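(* Let $d\ge 1$ be an integer and let $\mathbb V=(V_x)_{x\in\mathbb Z^d}$ be i.i.d. random variables with $\operatorname{ess\,inf}V_x=0$, $\mathbb E V_x^d<\infty$ and $\mathbb P[V_x=0]<1$. With the annealed partition function $Z^{\mathrm{an}}_{h,\beta,N}$, the annealed Lyapunov exponent $m^{\mathrm{an}}(h,\beta)$ and the critical parameter $\beta_{\mathrm c}^{\mathrm{an}}(h)$ defined in the context: (a) For any $h,\beta\ge 0$, $$Z^{\mathrm{an}}_{h,\beta,N}\le \exp(-m^{\mathrm{an}}(h,\beta)N)\qquad\text{for all } N\in\mathbb N,$$ and $m^{\mathrm{an}}$ is continuous on $[0,\infty)\times[0,\infty)$. Moreover, for any $h>0$ and $0\le \beta_0<\beta_{\mathrm c}^{\mathrm{an}}(h)$, there exists $K_{h,\beta_0}<\infty$ such that for all $0\le\beta\le\beta_0$, $$Z^{\mathrm{an}}_{h,\beta,N}\ge \frac{\exp(-m^{\mathrm{an}}(h,\beta)N)}{K_{h,\beta_0}}\qquad\text{for all } N\in\mathbb N.$$ (b) $m^{\mathrm{an}}$ is (real) analytic on the open set $\{(h,\beta)\in(0,\infty)^2:\beta\ne\beta_{\mathrm c}^{\mathrm{an}}(h)\}$.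
   Context: $\mathbb N=\{1,2,\dots\}$. For $h\ge0$, $P_h$ (expectation $E_h$) is the law of the nearest-neighbor random walk $S=(S(n))_{n\ge0}$ on $\mathbb Z^d$ with $S(0)=0$ and i.i.d. increments satisfying $P_h[S(1)=e]=e^{h e_1}/\sum_{e'}e^{he'_1}$ for each of the $2d$ unit vectors $e$ (sum over the same unit vectors; $e_1$ is the first coordinate of $e$). Equivalently, the density of the law of $(S(0),\dots,S(n))$ under $P_h$ with respect to $P_0$ (simple random walk) is $\exp(hS_1(n))/E_0[\exp(hS_1(n))]$, where $S_1$ is the first component. Local times: $\ell_x(N)=\sum_{n=1}^N 1_{\{S(n)=x\}}$. Annealed potential: $\varphi^{\mathrm{an}}_\beta(t)=-\log\mathbb E\exp(-t\beta V_x)$ for $t\ge0$, and $\Phi^{\mathrm{an}}_\beta(N)=\sum_{x\in\mathbb Z^d}\varphi^{\mathrm{an}}_\beta(\ell_x(N))$. Annealed partition function: $Z^{\mathrm{an}}_{h,\beta,N}=E_h[\exp(-\Phi^{\mathrm{an}}_\beta(N))]$. Annealed Lyapunov exponent: $m^{\mathrm{an}}(h,\beta)=-\lim_{N\to\infty}\frac1N\log Z^{\mathrm{an}}_{h,\beta,N}$ (the limit exists for all $h,\beta\ge0$). Point-to-hyperplane exponent: for $h>0$, $\overline Z^{\mathrm{an}}_{h,\beta,L}=\sum_{n=1}^\infty E_h[\exp(-\Phi^{\mathrm{an}}_\beta(n));\{S_1(n)=L\}]$ and $\overline m^{\mathrm{an}}(h,\beta)=-\lim_{L\to\infty}\frac1L\log\overline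 Z^{\mathrm{an}}_{h,\beta,L}$ (the limit exists); $\overline m^{\mathrm{an}}(\cdot,\beta)$ extends continuously to $[0,\infty)$, which defines $\overline m^{\mathrm{an}}(0,\beta)$. For $h>0$ the critical parameter $\beta_{\mathrm c}^{\mathrm{an}}(h)>0$ is the unique number with $\overline m^{\mathrm{an}}(0,\beta_{\mathrm c}^{\mathrm{an}}(h))=h$.
   Formalization: When P[V_x=0]>0, no critical parameter exists for large h, since the point-to-hyperplane exponent at drift 0 is bounded in β; the critical parameter is then taken to be +∞, and agrees with the stated definition wherever that number exists. *)

theory Defs
  imports "HOL-Probability.Probability"
begin

section \<open>Nearest-neighbour random walk with drift\<close>

text \<open>
  The lattice is \<^typ>\<open>int ^ 'd\<close>, of dimension \<open>d = CARD('d)\<close>. The index \<open>i0 :: 'd\<close> singles out the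
  direction of the drift, i.e. the coordinate called the first one.
\<close>

definition unit_vecs :: "(int ^ 'd) set" where
  "unit_vecs = (\<Union>i. {axis i 1, axis i (- 1)})"

definition step_prob :: "'d::finite \<Rightarrow> real \<Rightarrow> int ^ 'd \<Rightarrow> real" where
  "step_prob i0 h e =
     (if e \<in> unit_vecs
      then exp (h * of_int (e $ i0)) / (\<Sum>e'\<in>unit_vecs. exp (h * of_int (e' $ i0))) else 0)"

definition step_pmf :: "'d::finite \<Rightarrow> real \<Rightarrow> (int ^ 'd) pmf" where
  "step_pmf i0 h = embed_pmf (step_prob i0 h)"

lemma finite_unit_vecs: "finite (unit_vecs :: (int ^ 'd::finite) set)"
  by (auto simp: unit_vecs_def)

lemma card_unit_vecs: "card (unit_vecs :: (int ^ 'd::finite) set) = 2 * CARD('d)"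
proof -
  have "card (unit_vecs :: (int ^ 'd) set) = (\<Sum>i\<in>(UNIV :: 'd set). card {axis i (1::int), axis i (- 1)})"
    unfolding unit_vecs_def by (rule card_UN_disjoint) (auto simp: axis_eq_axis)
  also have "\<dots> = (\<Sum>i\<in>(UNIV :: 'd set). 2)"
    by (rule sum.cong) (auto simp: axis_eq_axis)
  finally show ?thesis
    by simp
qed

text \<open>The weights sum to one, so \<^const>\<open>step_pmf\<close> has the prescribed mass function.\<close>

lemma pmf_step_pmf: "pmf (step_pmf i0 h) e = step_prob i0 h e"
  unfolding step_pmf_def
proof (rule pmf_embed_pmf)
  let ?Z = "\<Sum>e'\<in>unit_vecs. exp (h * of_int (e' $ i0)) :: real"
  have ne: "(unit_vecs :: (int ^ 'a) set) \<noteq> {}"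
    by (auto simp: unit_vecs_def)
  have Z: "?Z > 0"
    by (rule sum_pos) (use ne finite_unit_vecs in auto)
  show nonneg: "0 \<le> step_prob i0 h x" for x
    using Z by (simp add: step_prob_def)
  have "(\<integral>\<^sup>+ x. ennreal (step_prob i0 h x) \<partial>count_space UNIV) =
        (\<Sum>x\<in>unit_vecs. ennreal (step_prob i0 h x))"
    by (rule nn_integral_count_space'[OF finite_unit_vecs]) (auto simp: step_prob_def)
  also have "\<dots> = ennreal (\<Sum>x\<in>unit_vecs. step_prob i0 h x)"
    using nonneg by (simp add: sum_ennreal)
  also have "(\<Sum>x\<in>unit_vecs. step_prob i0 h x) = ?Z / ?Z"
    unfolding sum_divide_distrib by (rule sum.cong) (auto simp: step_prob_def)
  finally show "(\<integral>\<^sup>+ x. ennreal (step_prob i0 h x) \<partial>count_space UNIV) = 1"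
    using Z by simp
qed

text \<open>
  A sample point \<open>\<xi>\<close> is the sequence of increments: \<open>\<xi> k\<close> is the increment from time \<open>k\<close> to \<open>k + 1\<close>.
\<close>

definition walk_measure :: "'d::finite \<Rightarrow> real \<Rightarrow> (nat \<Rightarrow> int ^ 'd) measure" where
  "walk_measure i0 h = PiM UNIV (\<lambda>_. measure_pmf (step_pmf i0 h))"

definition walk :: "(nat \<Rightarrow> int ^ 'd) \<Rightarrow> nat \<Rightarrow> int ^ 'd" where
  "walk \<xi> n = (\<Sum>k<n. \<xi> k)"

definition local_time :: "(nat \<Rightarrow> int ^ 'd) \<Rightarrow> int ^ 'd \<Rightarrow> nat \<Rightarrow> nat" where
  "local_time \<xi> x N = (\<Sum>n=1..N. of_bool (walk \<xi> n = x))"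


section \<open>Annealed quantities\<close>

definition essinf :: "'w measure \<Rightarrow> ('w \<Rightarrow> real) \<Rightarrow> ereal" where
  "essinf M f = - esssup M (\<lambda>\<omega>. - ereal (f \<omega>))"

text \<open>The \<open>V x\<close> are identically distributed, so the annealed potential is expressed through \<open>V 0\<close>.\<close>

definition phi_an :: "'w measure \<Rightarrow> (int ^ 'd \<Rightarrow> 'w \<Rightarrow> real) \<Rightarrow> real \<Rightarrow> real \<Rightarrow> real" where
  "phi_an M V \<beta> t = - ln (\<integral>\<omega>. exp (- t * \<beta> * V 0 \<omega>) \<partial>M)"

definition Phi_an ::
  "'w measure \<Rightarrow> (int ^ 'd \<Rightarrow> 'w \<Rightarrow> real) \<Rightarrow> real \<Rightarrow> nat \<Rightarrow> (nat \<Rightarrow> int ^ 'd) \<Rightarrow> real" where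
  "Phi_an M V \<beta> N \<xi> = (\<Sum>\<^sub>\<infinity>x. phi_an M V \<beta> (real (local_time \<xi> x N)))"

definition Z_an ::
  "'w measure \<Rightarrow> (int ^ 'd \<Rightarrow> 'w \<Rightarrow> real) \<Rightarrow> 'd::finite \<Rightarrow> real \<Rightarrow> real \<Rightarrow> nat \<Rightarrow> real" where
  "Z_an M V i0 h \<beta> N = (\<integral>\<xi>. exp (- Phi_an M V \<beta> N \<xi>) \<partial>walk_measure i0 h)"

definition m_an ::
  "'w measure \<Rightarrow> (int ^ 'd \<Rightarrow> 'w \<Rightarrow> real) \<Rightarrow> 'd::finite \<Rightarrow> real \<Rightarrow> real \<Rightarrow> real" where
  "m_an M V i0 h \<beta> = - lim (\<lambda>N. ln (Z_an M V i0 h \<beta> N) / real N)"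

text \<open>Point-to-hyperplane versions, to be used for \<open>h > 0\<close> only.\<close>

definition Zbar_an ::
  "'w measure \<Rightarrow> (int ^ 'd \<Rightarrow> 'w \<Rightarrow> real) \<Rightarrow> 'd::finite \<Rightarrow> real \<Rightarrow> real \<Rightarrow> nat \<Rightarrow> real" where
  "Zbar_an M V i0 h \<beta> L =
     (\<Sum>\<^sub>\<infinity>n\<in>{1..}. LINT \<xi>:{\<xi>. walk \<xi> n $ i0 = int L}|walk_measure i0 h. exp (- Phi_an M V \<beta> n \<xi>))"

definition mbar_an ::
  "'w measure \<Rightarrow> (int ^ 'd \<Rightarrow> 'w \<Rightarrow> real) \<Rightarrow> 'd::finite \<Rightarrow> real \<Rightarrow> real \<Rightarrow> real" where
  "mbar_an M V i0 h \<beta> = - lim (\<lambda>L. ln (Zbar_an M V i0 h \<beta> L) / real L)"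

text \<open>The value at \<open>h = 0\<close> of the continuous extension of \<open>\<lambda>h. mbar_an M V i0 h \<beta>\<close>.\<close>

definition mbar_an0 ::
  "'w measure \<Rightarrow> (int ^ 'd \<Rightarrow> 'w \<Rightarrow> real) \<Rightarrow> 'd::finite \<Rightarrow> real \<Rightarrow> real" where
  "mbar_an0 M V i0 \<beta> = Lim (at_right 0) (\<lambda>h. mbar_an M V i0 h \<beta>)"

text \<open>
  If \<open>V 0\<close> vanishes with positive probability, then \<open>mbar_an0 M V i0\<close> is bounded and does not attain
  large values of \<open>h\<close>; the critical parameter of such an \<open>h\<close> is infinite.
\<close>

definition beta_crit ::
  "'w measure \<Rightarrow> (int ^ 'd \<Rightarrow> 'w \<Rightarrow> real) \<Rightarrow> 'd::finite \<Rightarrow> real \<Rightarrow> ereal" where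
  "beta_crit M V i0 h =
     (if \<exists>\<beta>>0. mbar_an0 M V i0 \<beta> = h
      then ereal (THE \<beta>. \<beta> > 0 \<and> mbar_an0 M V i0 \<beta> = h) else \<infinity>)"


section \<open>Real analyticity in two variables\<close>

text \<open>Around every point of \<open>D\<close>, \<open>f\<close> is an absolutely convergent double power series.\<close>

definition real_analytic2_on :: "(real \<times> real \<Rightarrow> real) \<Rightarrow> (real \<times> real) set \<Rightarrow> bool" where
  "real_analytic2_on f D \<longleftrightarrow>
     (\<forall>(a, b)\<in>D. \<exists>r>0. \<exists>c :: nat \<Rightarrow> nat \<Rightarrow> real. \<forall>x y. \<bar>x - a\<bar> < r \<longrightarrow> \<bar>y - b\<bar> < r \<longrightarrow>
        ((\<lambda>(i, j). c i j * (x - a) ^ i * (y - b) ^ j) has_sum f (x, y)) UNIV)"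

end

theory Submission
  imports Defs "HOL-Complex_Analysis.Complex_Analysis"
begin

text \<open>
  Write \<open>\<psi> n = E (exp (- n \<beta> V))\<close>. By Jensen's inequality \<open>\<psi> (m + n) \<ge> \<psi> m * \<psi> n\<close>: the annealed
  potential is attractive, so that \<^emph>\<open>gluing\<close> paths costs nothing. Removing the normalization
  of the drifted step law turns the partition function into a sum over paths with weight
  \<open>(1 / 2 d) ^ N * exp (h * level) * potential\<close>. It is supermultiplicative in \<open>N\<close>, which gives the limit
  (the rate \<open>g (h, \<beta>)\<close>) and the upper bound, while Jensen's inequality for the paths gives
  \<open>g (t h, t \<beta>) \<le> t g (h, \<beta>)\<close> and continuity.

  Bridges, i.e. paths whose levels stay in \<open>{1..L}\<close> and that end at level \<open>L\<close>, factor uniquely into irreducible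
  ones. For a fugacity \<open>z \<le> 1\<close> let \<open>\<alpha> z\<close> be the decay rate of bridges in \<open>L\<close>. Splitting a bridge at a level, with
  the loops in between controlled by the Green function of a strip, shows that the mass of bridges is
  \<open>exp (- \<alpha> z L)\<close> up to a factor \<open>1 / L\<close>. Hence the generating function of bridges diverges at \<open>\<alpha> z\<close>, and by the
  renewal equation irreducible bridges have mass exactly one there. They also decay strictly faster (mass gap):
  if \<open>z < 1\<close>, then an irreducible bridge splits at every level into two irreducible pieces up to an
  exponentially small overlap, and the divergence makes the first of these pieces small.

  Since \<open>\<alpha> 1\<close> is the point-to-hyperplane exponent at \<open>h = 0\<close>, the condition \<open>\<beta> < \<beta>\<^sub>c h\<close> reads
  \<open>\<alpha> 1 < h\<close> and is equivalent to \<open>g (h, \<beta>) > 0\<close>. In this case \<open>z = exp (- g)\<close> is the solution of "irreducible bridges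
  with weight \<open>z ^ length * exp (h * level) * potential\<close> have mass one", and the mass gap makes this mass finite
  beyond \<open>z\<close>. The implicit function theorem yields analyticity, and the renewal theorem yields the lower bound. For
  \<open>\<beta> > \<beta>\<^sub>c h\<close> the rate \<open>g\<close> vanishes: it is never negative, because the path may stay in a large box.
\<close>

section \<open>Weighted counting and attractive potentials\<close>

text \<open>The lower bound asks for one constant for all \<beta> \<le> \<open>\<beta>0\<close>, and
  the implicit function theorem for a whole complex neighbourhood of (h, \<beta>), so the mass gap
  must be uniform. Bridges are therefore studied for an arbitrary weight \<open>\<psi>\<close>
  satisfying the axioms of \<open>attractive\<close>, with constants that depend only on the
  dimension and on a bound z0 < 1 for the fugacity. The source of uniformity is the lower bound exp
  (- \<alpha> L) / (2 d L) for bridges: the harmonic series it produces is the same for all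
  \<open>\<psi>\<close>, and it forces irreducible bridges of height K to have mass O (1 / log K).
  The condition z < 1 makes loops exponentially expensive; with z = exp (- g) it amounts to g > 0.
  The gap concerns the tilt h of the level, whereas analyticity needs room in z. The scaling g (t h,
  \<beta>) \<le> t g (h, \<beta>) converts one into the other: if g > 0, lowering h by \<delta>
  lowers g strictly, so that a fugacity slightly above exp (- g (h, \<beta>)) still satisfies h -
  \<delta> < \<alpha> z, which is where the gap applies.\<close>

definition mass :: "('x \<Rightarrow> real) \<Rightarrow> 'x set \<Rightarrow> ennreal" where
  "mass w A = (\<integral>\<^sup>+x. ennreal (w x) \<partial>count_space A)"

lemma mass_indicator: "mass w A = (\<integral>\<^sup>+x. ennreal (w x) * indicator A x \<partial>count_space UNIV)"
  unfolding mass_def by (subst nn_integral_count_space_indicator) auto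

lemma mass_mono:
  assumes "A \<subseteq> B" "\<And>x. x \<in> A \<Longrightarrow> w x \<le> v x"
  shows "mass w A \<le> mass v B"
  unfolding mass_indicator using assms
  by (intro nn_integral_mono) (auto split: split_indicator intro: ennreal_leI)

lemma mass_cong: "(\<And>x. x \<in> A \<Longrightarrow> w x = v x) \<Longrightarrow> mass w A = mass v A"
  unfolding mass_def by (intro nn_integral_cong) auto

lemma mass_empty [simp]: "mass w {} = 0"
  unfolding mass_def by (simp add: nn_integral_empty)

lemma mass_finite: "finite A \<Longrightarrow> (\<And>x. x \<in> A \<Longrightarrow> 0 \<le> w x) \<Longrightarrow> mass w A = ennreal (\<Sum>x\<in>A. w x)"
  unfolding mass_def by (simp add: nn_integral_count_space_finite sum_ennreal)

lemma mass_Un_disjoint: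
  assumes "A \<inter> B = {}"
  shows "mass w (A \<union> B) = mass w A + mass w B"
proof -
  have "mass w (A \<union> B) = (\<integral>\<^sup>+x. ennreal (w x) * indicator A x + ennreal (w x) * indicator B x \<partial>count_space UNIV)"
    unfolding mass_indicator using assms
    by (intro nn_integral_cong) (auto split: split_indicator)
  then show ?thesis
    by (simp add: nn_integral_add mass_indicator)
qed

lemma mass_insert: "x \<notin> A \<Longrightarrow> 0 \<le> w x \<Longrightarrow> mass w (insert x A) = ennreal (w x) + mass w A"
  using mass_Un_disjoint[of "{x}" A w] mass_finite[of "{x}" w] by simp

lemma mass_cmult: "0 \<le> c \<Longrightarrow> mass (\<lambda>x. c * w x) A = ennreal c * mass w A"
  unfolding mass_def by (simp add: ennreal_mult' nn_integral_cmult)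

lemma mass_Times:
  assumes "\<And>x. 0 \<le> f x"
  shows "mass (\<lambda>p. f (fst p) * g (snd p)) (A \<times> B) = mass f A * mass g B"
proof -
  have "mass (\<lambda>p. f (fst p) * g (snd p)) (A \<times> B) =
     (\<integral>\<^sup>+p. (\<lambda>(x,y). ennreal (f x) * indicator A x * (ennreal (g y) * indicator B y)) p \<partial>count_space UNIV)"
    unfolding mass_indicator using assms
    by (intro nn_integral_cong) (auto simp: ennreal_mult' indicator_def)
  also have "\<dots> = (\<integral>\<^sup>+x. \<integral>\<^sup>+y. ennreal (f x) * indicator A x * (ennreal (g y) * indicator B y)
       \<partial>count_space UNIV \<partial>count_space UNIV)"
    by (subst nn_integral_fst_count_space[symmetric]) simp
  also have "\<dots> = (\<integral>\<^sup>+x. ennreal (f x) * indicator A x * mass g B \<partial>count_space UNIV)"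
    unfolding mass_indicator by (intro nn_integral_cong nn_integral_cmult) simp
  also have "\<dots> = mass f A * mass g B"
    unfolding mass_indicator[of f] by (intro nn_integral_multc) simp
  finally show ?thesis .
qed

lemma mass_inj_image:
  assumes "inj_on g A"
  shows "mass w (g ` A) = mass (\<lambda>x. w (g x)) A"
  unfolding mass_def
  by (rule nn_integral_bij_count_space[symmetric]) (use assms in \<open>simp add: bij_betw_def\<close>)

text \<open>A choice of preimages under \<open>F\<close> is injective on \<open>A\<close>, so a
  decomposition that merely covers \<open>A\<close> gives an upper bound, even if a path can be cut
  in several ways.\<close>

lemma mass_cover:
  assumes "A \<subseteq> F ` B" "\<And>b. b \<in> B \<Longrightarrow> F b \<in> A \<Longrightarrow> w (F b) \<le> v b"
  shows "mass w A \<le> mass v B"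
proof -
  obtain g where g: "\<And>a. a \<in> A \<Longrightarrow> g a \<in> B \<and> F (g a) = a"
    using assms(1) by (metis (no_types, opaque_lifting) image_iff subsetD)
  have inj: "inj_on g A"
    by (metis g inj_onI)
  have "w a \<le> v (g a)" if "a \<in> A" for a
    using assms(2)[of "g a"] g[OF that] that by simp
  then have "mass w A \<le> mass (\<lambda>a. v (g a)) A"
    by (intro mass_mono) auto
  also have "\<dots> = mass v (g ` A)"
    by (rule mass_inj_image[OF inj, symmetric])
  also have "\<dots> \<le> mass v B"
    using g by (intro mass_mono) auto
  finally show ?thesis .
qed

lemma mass_cover3:
  assumes "\<And>x. x \<in> A \<Longrightarrow> \<exists>p\<in>B. \<exists>q\<in>C. \<exists>r\<in>D. x = p @ q @ r"
    and "\<And>p q r. p \<in> B \<Longrightarrow> q \<in> C \<Longrightarrow> r \<in> D \<Longrightarrow> p @ q @ r \<in> A \<Longrightarrow> w (p @ q @ r) \<le> f p * (g q * k r)"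
    and "\<And>x. 0 \<le> f x" "\<And>x. 0 \<le> g x"
  shows "mass w A \<le> mass f B * (mass g C * mass k D)"
proof -
  have "mass w A \<le> mass (\<lambda>p. f (fst p) * (g (fst (snd p)) * k (snd (snd p)))) (B \<times> C \<times> D)"
  proof (rule mass_cover[where F = "\<lambda>p. fst p @ fst (snd p) @ snd (snd p)"])
    show "A \<subseteq> (\<lambda>p. fst p @ fst (snd p) @ snd (snd p)) ` (B \<times> C \<times> D)"
    proof
      fix x assume "x \<in> A"
      then obtain p q r where "p \<in> B" "q \<in> C" "r \<in> D" "x = p @ q @ r"
        using assms(1) by blast
      then show "x \<in> (\<lambda>p. fst p @ fst (snd p) @ snd (snd p)) ` (B \<times> C \<times> D)"
        by (intro image_eqI[of _ _ "(p, q, r)"]) auto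
    qed
  qed (use assms(2) in auto)
  also have "\<dots> = mass f B * mass (\<lambda>p. g (fst p) * k (snd p)) (C \<times> D)"
    using mass_Times[of f "\<lambda>p. g (fst p) * k (snd p)" B "C \<times> D"] assms by simp
  finally show ?thesis
    by (simp add: mass_Times assms)
qed

lemma mass_split:
  fixes f :: "'x \<Rightarrow> nat"
  shows "mass w A = (\<Sum>n. mass w {x\<in>A. f x = n})"
proof -
  have eq: "(\<Sum>n. (ennreal (w x) * indicator {x\<in>A. f x = n} x)) = ennreal (w x) * indicator A x" for x
  proof -
    have "(\<Sum>n. (ennreal (w x) * indicator {x\<in>A. f x = n} x)) =
        (\<Sum>n\<in>{f x}. (ennreal (w x) * indicator {x\<in>A. f x = n} x))"
      by (rule suminf_finite) (auto simp: indicator_def)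
    also have "\<dots> = ennreal (w x) * indicator A x"
      by (simp add: indicator_def)
    finally show ?thesis .
  qed
  have "mass w A = (\<integral>\<^sup>+x. (\<Sum>n. (ennreal (w x) * indicator {x\<in>A. f x = n} x)) \<partial>count_space UNIV)"
    unfolding mass_indicator eq ..
  also have "\<dots> = (\<Sum>n. mass w {x\<in>A. f x = n})"
    unfolding mass_indicator by (rule nn_integral_suminf) simp
  finally show ?thesis .
qed

text \<open>Monotone convergence in the form in which a uniform bound passes to the limit of
  increasing tilts, fugacities or length cutoffs.\<close>

lemma mass_limit:
  assumes "\<And>k x. x \<in> A \<Longrightarrow> 0 \<le> w k x" "\<And>x. x \<in> A \<Longrightarrow> incseq (\<lambda>k. w k x)"
    and "\<And>x. x \<in> A \<Longrightarrow> (\<lambda>k. w k x) \<longlonglongrightarrow> v x" and "\<And>k. mass (w k) A \<le> B"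
  shows "mass v A \<le> B"
proof -
  have *: "mass v A = (\<integral>\<^sup>+x. (SUP k. ennreal (w k x)) \<partial>count_space A)"
    unfolding mass_def
  proof (intro nn_integral_cong)
    fix x assume "x \<in> space (count_space A)"
    then have x: "x \<in> A" by simp
    have "incseq (\<lambda>k. ennreal (w k x))"
      using assms(2)[OF x] by (auto simp: incseq_def intro: ennreal_leI)
    then have "(\<lambda>k. ennreal (w k x)) \<longlonglongrightarrow> (SUP k. ennreal (w k x))"
      by (rule LIMSEQ_SUP)
    moreover have "(\<lambda>k. ennreal (w k x)) \<longlonglongrightarrow> ennreal (v x)"
      using assms(3)[OF x] by (rule tendsto_ennrealI)
    ultimately show "ennreal (v x) = (SUP k. ennreal (w k x))"
      using LIMSEQ_unique by blast
  qed
  have "\<dots> = (SUP k. \<integral>\<^sup>+x. ennreal (w k x) \<partial>count_space A)"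
  proof (rule nn_integral_monotone_convergence_SUP_AE)
    show "AE x in count_space A. ennreal (w i x) \<le> ennreal (w (Suc i) x)" for i
      using assms(2) by (auto simp: AE_count_space incseq_Suc_iff intro!: ennreal_leI)
  qed simp
  then show ?thesis
    using * assms(4) by (auto simp: mass_def intro!: SUP_least)
qed

section \<open>Product weights of lists of visited sites\<close>

definition potl :: "(nat \<Rightarrow> 'a::comm_monoid_mult) \<Rightarrow> 'x list \<Rightarrow> 'a" where
  "potl \<psi> l = (\<Prod>y\<in>set l. \<psi> (count_list l y))"

lemma potl_superset:
  assumes "\<psi> 0 = 1" "finite S" "set l \<subseteq> S"
  shows "potl \<psi> l = (\<Prod>y\<in>S. \<psi> (count_list l y))"
  unfolding potl_def using assms by (intro prod.mono_neutral_left) (auto simp: count_list_0_iff)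

lemma count_list_map_inj: "inj f \<Longrightarrow> count_list (map f l) (f y) = count_list l y"
  by (induction l) (auto simp: inj_eq)

lemma potl_map: "inj f \<Longrightarrow> potl \<psi> (map f l) = potl \<psi> l"
  unfolding potl_def
  by (simp add: prod.reindex inj_on_subset count_list_map_inj)

locale attractive =
  fixes \<psi> :: "nat \<Rightarrow> real"
  assumes psi_0: "\<psi> 0 = 1" and psi_pos: "0 < \<psi> n"
    and psi_antimono: "m \<le> n \<Longrightarrow> \<psi> n \<le> \<psi> m"
    and psi_supermult: "\<psi> m * \<psi> n \<le> \<psi> (m + n)"
begin

lemma psi_le_1: "\<psi> n \<le> 1"
  using psi_antimono[of 0 n] psi_0 by simp

lemma potl_pos: "0 < potl \<psi> l"
  unfolding potl_def by (intro prod_pos) (simp add: psi_pos)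

lemma potl_append_ge: "potl \<psi> l1 * potl \<psi> l2 \<le> potl \<psi> (l1 @ l2)"
proof -
  have "potl \<psi> l1 * potl \<psi> l2 =
     (\<Prod>y\<in>set (l1 @ l2). \<psi> (count_list l1 y) * \<psi> (count_list l2 y))"
    unfolding prod.distrib
    by (intro arg_cong2[where f = "(*)"] potl_superset) (auto simp: psi_0)
  also have "\<dots> \<le> potl \<psi> (l1 @ l2)"
    unfolding potl_def
    by (intro prod_mono) (auto intro!: psi_supermult mult_nonneg_nonneg simp: psi_pos less_imp_le)
  finally show ?thesis .
qed

text \<open>A site occurring in \<open>l1\<close> does not occur in \<open>l3\<close>, so for each
  site one of the two factors on the right is \<open>\<psi> 0 = 1\<close>; the visits of
  \<open>l2\<close> only raise the count, and \<open>\<psi>\<close> is decreasing.\<close>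

lemma potl_append_le:
  assumes "set l1 \<inter> set l3 = {}"
  shows "potl \<psi> (l1 @ l2 @ l3) \<le> potl \<psi> l1 * potl \<psi> l3"
proof -
  let ?S = "set (l1 @ l2 @ l3)"
  have "potl \<psi> (l1 @ l2 @ l3) \<le> (\<Prod>y\<in>?S. \<psi> (count_list l1 y) * \<psi> (count_list l3 y))"
    unfolding potl_def
  proof (intro prod_mono conjI)
    fix y assume "y \<in> ?S"
    consider "count_list l1 y = 0" | "count_list l3 y = 0"
      using assms by (auto simp: count_list_0_iff)
    then show "\<psi> (count_list (l1 @ l2 @ l3) y) \<le> \<psi> (count_list l1 y) * \<psi> (count_list l3 y)"
      by cases (auto simp: psi_0 intro!: psi_antimono)
  qed (simp add: psi_pos less_imp_le)
  also have "\<dots> = potl \<psi> l1 * potl \<psi> l3"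
    unfolding prod.distrib
    by (intro arg_cong2[where f = "(*)"] potl_superset[symmetric]) (auto simp: psi_0)
  finally show ?thesis .
qed

lemma potl_le_1: "potl \<psi> l \<le> 1"
  unfolding potl_def by (intro prod_le_1) (simp add: psi_le_1 psi_pos less_imp_le)

lemma potl_ge_power: "\<psi> 1 ^ length l \<le> potl \<psi> l"
proof (induction l)
  case (Cons a l)
  have "potl \<psi> [a] = \<psi> 1"
    by (simp add: potl_def)
  then have "\<psi> 1 * potl \<psi> l \<le> potl \<psi> (a # l)"
    using potl_append_ge[of "[a]" l] by simp
  moreover have "\<psi> 1 * \<psi> 1 ^ length l \<le> \<psi> 1 * potl \<psi> l"
    using Cons psi_pos[of 1] by simp
  ultimately show ?case by simp
qed (simp add: potl_def)

end

lemma potl_mono: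
  fixes \<psi> :: "nat \<Rightarrow> real"
  assumes "\<And>n. n > 0 \<Longrightarrow> \<psi> n \<le> \<psi>' n" "\<And>n. n > 0 \<Longrightarrow> 0 \<le> \<psi> n"
  shows "potl \<psi> l \<le> potl \<psi>' l"
  unfolding potl_def
  by (intro prod_mono conjI assms) (auto simp: count_list_0_iff intro!: Nat.gr0I)

section \<open>Bridges and irreducible bridges\<close>

no_notation fps_nth (infixl "$" 75)

text \<open>The starting point is not listed, because local times count from time 1 on.
  \<open>levs\<close> follows the same convention.\<close>

primrec sites :: "int ^ 'd \<Rightarrow> (int ^ 'd) list \<Rightarrow> (int ^ 'd) list" where
  "sites x [] = []"
| "sites x (e # xs) = (x + e) # sites (x + e) xs"

primrec levs :: "'d \<Rightarrow> int \<Rightarrow> (int ^ 'd) list \<Rightarrow> int list" where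
  "levs i0 l [] = []"
| "levs i0 l (e # xs) = (l + e $ i0) # levs i0 (l + e $ i0) xs"

definition lev :: "'d \<Rightarrow> (int ^ 'd) list \<Rightarrow> int" where
  "lev i0 xs = (\<Sum>e\<leftarrow>xs. e $ i0)"

lemma lev_simps [simp]:
  "lev i0 [] = 0" "lev i0 (e # xs) = e $ i0 + lev i0 xs" "lev i0 (xs @ ys) = lev i0 xs + lev i0 ys"
  by (simp_all add: lev_def)

lemma sites_append: "sites x (a @ c) = sites x a @ sites (x + sum_list a) c"
  by (induction a arbitrary: x) (simp_all add: add.assoc)

lemma sites_shift: "sites (x + y) xs = map ((+) x) (sites y xs)"
  by (induction xs arbitrary: y) (simp_all add: add.assoc)

lemma length_sites [simp]: "length (sites x xs) = length xs"
  by (induction xs arbitrary: x) simp_all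

lemma levs_append: "levs i0 l (a @ c) = levs i0 l a @ levs i0 (l + lev i0 a) c"
  by (induction a arbitrary: l) (simp_all add: add.assoc)

lemma levs_shift: "levs i0 (k + l) xs = map ((+) k) (levs i0 l xs)"
  by (induction xs arbitrary: l) (simp_all add: add.assoc)

lemma levs_0: "set (levs i0 l xs) = (+) l ` set (levs i0 0 xs)"
  using levs_shift[of i0 l 0 xs] by simp

lemma levs_sites: "set (levs i0 (x $ i0) xs) = (\<lambda>y. y $ i0) ` set (sites x xs)"
proof (induction xs arbitrary: x)
  case (Cons e xs)
  show ?case
    using Cons.IH[of "x + e"] by simp
qed simp

lemma final_level: "xs \<noteq> [] \<Longrightarrow> l + lev i0 xs \<in> set (levs i0 l xs)"
proof (induction xs arbitrary: l)
  case (Cons e xs)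
  then show ?case
    using Cons.IH[of "l + e $ i0"] by (cases "xs = []") (auto simp: add.assoc)
qed simp

lemma unit_vec_level:
  assumes "e \<in> unit_vecs"
  shows "\<bar>e $ i0\<bar> \<le> 1"
  using assms by (auto simp: unit_vecs_def axis_def)

lemma lev_bound: "xs \<in> lists unit_vecs \<Longrightarrow> \<bar>lev i0 xs\<bar> \<le> int (length xs)"
proof (induction xs)
  case (Cons e xs)
  then show ?case
    using unit_vec_level[of e i0] by auto
qed simp

text \<open>Reaching level \<open>y\<close> and coming back to level 0 takes at least
  \<open>\<bar>y\<bar>\<close> steps each way.\<close>

lemma levs_loop:
  assumes "q \<in> lists unit_vecs" "lev i0 q = 0" "y \<in> set (levs i0 0 q)"
  shows "2 * \<bar>y\<bar> \<le> int (length q)"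
proof -
  have "\<exists>a c. q = a @ c \<and> l + lev i0 a = y" if "y \<in> set (levs i0 l q)" for l
    using that
  proof (induction q arbitrary: l)
    case (Cons e q)
    show ?case
    proof (cases "y = l + e $ i0")
      case True
      then show ?thesis
        by (intro exI[of _ "[e]"] exI[of _ q]) simp
    next
      case False
      then have "y \<in> set (levs i0 (l + e $ i0) q)"
        using Cons.prems by simp
      from Cons.IH[OF this] obtain a c where "q = a @ c" "l + e $ i0 + lev i0 a = y"
        by blast
      then show ?thesis
        by (intro exI[of _ "e # a"] exI[of _ c]) simp
    qed
  qed simp
  from this[OF assms(3)] obtain a c where ac: "q = a @ c" "lev i0 a = y"
    by auto
  have "\<bar>lev i0 a\<bar> \<le> int (length a)" "\<bar>lev i0 c\<bar> \<le> int (length c)"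
    using assms(1) ac by (auto intro!: lev_bound)
  then show ?thesis
    using ac assms(2) by simp
qed

text \<open>Steps change the level by at most one, so a path cannot jump over \<open>L\<close>;
  \<open>a\<close> ends with the first visit, which the clause on \<open>butlast a\<close> records.
  The last clause serves the induction: prepending a step to a nonempty \<open>a\<close> adds the
  level after that step to the levels of \<open>butlast\<close>.\<close>

lemma first_passage:
  assumes "xs \<in> lists unit_vecs" "l \<le> L" "\<exists>y\<in>set (l # levs i0 l xs). L \<le> y"
  shows "\<exists>a c. xs = a @ c \<and> l + lev i0 a = L \<and> (\<forall>y\<in>set (levs i0 l a). y \<le> L) \<and>
           (\<forall>y\<in>set (levs i0 l (butlast a)). y < L) \<and> (a \<noteq> [] \<longrightarrow> l < L)"
  using assms
proof (induction xs arbitrary: l rule: list.induct)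
  case Nil
  then show ?case by auto
next
  case (Cons e xs)
  show ?case
  proof (cases "l = L")
    case True
    then show ?thesis
      by (intro exI[of _ "[]"] exI[of _ "e # xs"]) simp
  next
    case False
    then have l: "l < L" using Cons.prems by simp
    have e: "\<bar>e $ i0\<bar> \<le> 1"
      using Cons.prems by (intro unit_vec_level) auto
    have "\<exists>a c. xs = a @ c \<and> l + e $ i0 + lev i0 a = L \<and> (\<forall>y\<in>set (levs i0 (l + e $ i0) a). y \<le> L) \<and>
           (\<forall>y\<in>set (levs i0 (l + e $ i0) (butlast a)). y < L) \<and> (a \<noteq> [] \<longrightarrow> l + e $ i0 < L)"
      using Cons.prems l e by (intro Cons.IH) auto
    then obtain a c where ac: "xs = a @ c" "l + e $ i0 + lev i0 a = L" "\<forall>y\<in>set (levs i0 (l + e $ i0) a). y \<le> L"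
        "\<forall>y\<in>set (levs i0 (l + e $ i0) (butlast a)). y < L" "a \<noteq> [] \<longrightarrow> l + e $ i0 < L"
      by blast
    show ?thesis
      using ac l e by (intro exI[of _ "e # a"] exI[of _ c]) auto
  qed
qed

text \<open>The dual cut: \<open>a\<close> ends with the last visit to \<open>L\<close>, after which
  the path remains strictly above.\<close>

lemma last_passage:
  assumes "xs \<in> lists unit_vecs" "\<exists>y\<in>set (l # levs i0 l xs). y \<le> L" "L \<le> l + lev i0 xs"
  shows "\<exists>a c. xs = a @ c \<and> l + lev i0 a = L \<and> (\<forall>y\<in>set (levs i0 L c). L < y)"
  using assms
proof (induction xs arbitrary: l rule: list.induct)
  case Nil
  then show ?case by auto
next
  case (Cons e xs)
  have e: "\<bar>e $ i0\<bar> \<le> 1"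
    using Cons.prems by (intro unit_vec_level) auto
  show ?case
  proof (cases "\<exists>y\<in>set ((l + e $ i0) # levs i0 (l + e $ i0) xs). y \<le> L")
    case True
    have "\<exists>a c. xs = a @ c \<and> l + e $ i0 + lev i0 a = L \<and> (\<forall>y\<in>set (levs i0 L c). L < y)"
      using Cons.prems True by (intro Cons.IH) auto
    then obtain a c where "xs = a @ c" "l + e $ i0 + lev i0 a = L" "\<forall>y\<in>set (levs i0 L c). L < y"
      by blast
    then show ?thesis
      by (intro exI[of _ "e # a"] exI[of _ c]) auto
  next
    case False
    then have "l = L"
      using Cons.prems(2) e by auto
    then show ?thesis
      using False by (intro exI[of _ "[]"] exI[of _ "e # xs"]) auto
  qed
qed

text \<open>Level 0 is left for good by the first step, while the final level may be visited
  repeatedly. With this half-open range of levels, concatenated bridges visit disjoint sets of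
  levels.\<close>

definition bridges :: "'d \<Rightarrow> (int ^ 'd) list set" where
  "bridges i0 = {xs \<in> lists unit_vecs. \<forall>y\<in>set (levs i0 0 xs). 0 < y \<and> y \<le> lev i0 xs}"

definition irreducible_bridges :: "'d \<Rightarrow> (int ^ 'd) list set" where
  "irreducible_bridges i0 = {xs \<in> bridges i0. xs \<noteq> [] \<and>
     (\<forall>a\<in>bridges i0. \<forall>c\<in>bridges i0. xs = a @ c \<longrightarrow> a = [] \<or> c = [])}"

lemma bridges_lists: "xs \<in> bridges i0 \<Longrightarrow> xs \<in> lists unit_vecs"
  by (simp add: bridges_def)

lemma Nil_in_bridges [simp]: "[] \<in> bridges i0"
  by (simp add: bridges_def)

lemma irreducible_bridgesD:
  assumes "xs \<in> irreducible_bridges i0"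
  shows "xs \<in> bridges i0" "xs \<noteq> []" "xs \<in> lists unit_vecs"
  using assms by (auto simp: irreducible_bridges_def bridges_def)

lemma irreducible_trivial:
  assumes "xs \<in> irreducible_bridges i0" "a \<in> bridges i0" "c \<in> bridges i0" "xs = a @ c"
  shows "a = [] \<or> c = []"
  using assms unfolding irreducible_bridges_def by blast

lemma bridge_lev_pos: "xs \<in> bridges i0 \<Longrightarrow> xs \<noteq> [] \<Longrightarrow> 0 < lev i0 xs"
  using final_level[of xs 0 i0] by (auto simp: bridges_def)

lemma bridge_lev_nonneg: "xs \<in> bridges i0 \<Longrightarrow> 0 \<le> lev i0 xs"
  using bridge_lev_pos[of xs i0] by (cases "xs = []") auto

lemma bridge_append:
  assumes "a \<in> bridges i0" "c \<in> bridges i0"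
  shows "a @ c \<in> bridges i0"
  unfolding bridges_def
proof (intro CollectI conjI ballI)
  show "a @ c \<in> lists unit_vecs"
    using assms bridges_lists by auto
  fix y assume "y \<in> set (levs i0 0 (a @ c))"
  then consider "y \<in> set (levs i0 0 a)" | y' where "y' \<in> set (levs i0 0 c)" "y = lev i0 a + y'"
    using levs_0[of i0 "lev i0 a" c] by (auto simp: levs_append)
  then have "0 < y \<and> y \<le> lev i0 a + lev i0 c"
  proof cases
    case 1
    then show ?thesis
      using assms(1) bridge_lev_nonneg[OF assms(2)] by (force simp: bridges_def)
  next
    case 2
    then show ?thesis
      using assms(2) bridge_lev_nonneg[OF assms(1)] by (force simp: bridges_def)
  qed
  then show "0 < y" "y \<le> lev i0 (a @ c)"
    by auto
qed

lemma irreducible_decomp: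
  assumes "xs \<in> bridges i0" "xs \<noteq> []"
  shows "\<exists>a\<in>irreducible_bridges i0. \<exists>c\<in>bridges i0. xs = a @ c"
  using assms
proof (induction xs rule: length_induct)
  case (1 xs)
  show ?case
  proof (cases "xs \<in> irreducible_bridges i0")
    case True
    then show ?thesis
      by (intro bexI[of _ xs] bexI[of _ "[]"]) auto
  next
    case False
    then obtain a c where ac: "a \<in> bridges i0" "c \<in> bridges i0" "xs = a @ c" "a \<noteq> []" "c \<noteq> []"
      using 1 by (auto simp: irreducible_bridges_def)
    then obtain a' c' where "a' \<in> irreducible_bridges i0" "c' \<in> bridges i0" "a = a' @ c'"
      using 1(1)[rule_format, of a] by auto
    then show ?thesis
      using ac by (intro bexI[of _ a'] bexI[of _ "c' @ c"]) (auto intro: bridge_append)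
  qed
qed

lemma irreducible_decomp_last:
  assumes "xs \<in> bridges i0" "xs \<noteq> []"
  shows "\<exists>c\<in>bridges i0. \<exists>a\<in>irreducible_bridges i0. xs = c @ a"
  using assms
proof (induction xs rule: length_induct)
  case (1 xs)
  show ?case
  proof (cases "xs \<in> irreducible_bridges i0")
    case True
    then show ?thesis
      by (intro bexI[of _ xs] bexI[of _ "[]"]) auto
  next
    case False
    then obtain a c where ac: "a \<in> bridges i0" "c \<in> bridges i0" "xs = a @ c" "a \<noteq> []" "c \<noteq> []"
      using 1 by (auto simp: irreducible_bridges_def)
    then obtain a' c' where "a' \<in> irreducible_bridges i0" "c' \<in> bridges i0" "c = c' @ a'"
      using 1(1)[rule_format, of c] by auto
    then show ?thesis
      using ac by (intro bexI[of _ "a @ c'"] bexI[of _ a']) (auto intro: bridge_append)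
  qed
qed

text \<open>Two bridge prefixes of one bridge differ by a bridge: the lower bound on the levels of
  \<open>d\<close> is inherited from \<open>c\<close>, the upper bound from \<open>a @ d\<close>.
  Unique factorization rests on this.\<close>

lemma bridge_prefix_cases:
  assumes "a \<in> bridges i0" "c \<in> bridges i0" "a @ d \<in> bridges i0" "c' \<in> bridges i0" "a @ c = (a @ d) @ c'"
  shows "d \<in> bridges i0"
proof -
  have "y \<le> lev i0 d" if "y \<in> set (levs i0 0 d)" for y
  proof -
    have "lev i0 a + y \<in> set (levs i0 0 (a @ d))"
      using that by (auto simp: levs_append levs_0[of i0 "lev i0 a" d])
    then show ?thesis
      using assms(3) by (auto simp: bridges_def)
  qed
  moreover have "c = d @ c'"
    using assms(5) by simp
  ultimately show ?thesis
    using assms(2) by (auto simp: bridges_def levs_append)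
qed

lemma irreducible_decomp_unique:
  assumes "a \<in> irreducible_bridges i0" "c \<in> bridges i0" "a' \<in> irreducible_bridges i0" "c' \<in> bridges i0"
    and "a @ c = a' @ c'"
  shows "a = a' \<and> c = c'"
proof -
  have *: "a = a'" if a: "a \<in> irreducible_bridges i0" "c \<in> bridges i0" "a' \<in> irreducible_bridges i0" "c' \<in> bridges i0"
    "a @ c = a' @ c'" "a' = a @ d" for a c a' c' d
  proof -
    have "d \<in> bridges i0"
      using a by (intro bridge_prefix_cases[of a i0 c d c']) (auto dest: irreducible_bridgesD)
    then have "d = []"
      using a irreducible_bridgesD[OF a(1)] by (auto simp: irreducible_bridges_def)
    then show ?thesis using a by simp
  qed
  obtain d where "a' = a @ d \<or> a = a' @ d"
    using assms(5) by (metis append_eq_append_conv2)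
  then have "a = a'"
    using *[of a c a' c' d] *[of a' c' a c d] assms by metis
  then show ?thesis
    using assms(5) by simp
qed

lemma bridges_eq:
  "bridges i0 = insert [] ((\<lambda>p. fst p @ snd p) ` (irreducible_bridges i0 \<times> bridges i0))"
proof (intro set_eqI iffI)
  fix xs assume "xs \<in> bridges i0"
  then show "xs \<in> insert [] ((\<lambda>p. fst p @ snd p) ` (irreducible_bridges i0 \<times> bridges i0))"
    using irreducible_decomp[of xs i0] by (cases "xs = []") force+
next
  fix xs assume "xs \<in> insert [] ((\<lambda>p. fst p @ snd p) ` (irreducible_bridges i0 \<times> bridges i0))"
  then show "xs \<in> bridges i0"
    using bridge_append irreducible_bridgesD(1) by fastforce
qed

lemma inj_on_irreducible_append:
  fixes i0 :: "'d::finite"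
  shows "inj_on (\<lambda>p. fst p @ snd p) (irreducible_bridges i0 \<times> bridges i0)"
proof (rule inj_onI)
  fix x y :: "(int ^ 'd) list \<times> (int ^ 'd) list"
  assume "x \<in> irreducible_bridges i0 \<times> bridges i0" "y \<in> irreducible_bridges i0 \<times> bridges i0"
    "fst x @ snd x = fst y @ snd y"
  then show "x = y"
    using irreducible_decomp_unique[of "fst x" i0 "snd x" "fst y" "snd y"] by (simp add: mem_Times_iff prod_eq_iff)
qed

text \<open>Cut at the first and at the last visit to level \<open>L\<close>. Between them lies a
  loop \<open>q\<close>, which may wander both below and above \<open>L\<close>.\<close>

lemma bridge_split:
  assumes "xs \<in> bridges i0" "lev i0 xs = L + M" "0 \<le> L" "0 \<le> M"
  shows "\<exists>p\<in>bridges i0. \<exists>q\<in>lists unit_vecs. \<exists>s\<in>bridges i0. xs = p @ q @ s \<and> lev i0 p = L \<and> lev i0 q = 0 \<and>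
     lev i0 s = M \<and> (\<forall>y\<in>set (levs i0 0 (butlast p)). y < L)"
proof -
  have xs: "xs \<in> lists unit_vecs" "\<forall>y\<in>set (levs i0 0 xs). 0 < y \<and> y \<le> L + M"
    using assms by (auto simp: bridges_def)
  have "\<exists>y\<in>set (0 # levs i0 0 xs). L \<le> y"
    using final_level[of xs 0 i0] assms(2,3,4) by (cases "xs = []") (force intro!: bexI[of _ "L + M"])+
  from first_passage[OF xs(1) assms(3) this] obtain p r where pr:
    "xs = p @ r" "lev i0 p = L" "\<forall>y\<in>set (levs i0 0 p). y \<le> L" "\<forall>y\<in>set (levs i0 0 (butlast p)). y < L"
    by auto
  have r: "r \<in> lists unit_vecs" "lev i0 r = M"
    using pr xs assms(2) by auto
  from last_passage[of r L i0 L] r assms(4) obtain q s where qs: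
    "r = q @ s" "lev i0 q = 0" "\<forall>y\<in>set (levs i0 L s). L < y"
    by auto
  have p: "p \<in> bridges i0"
    using xs pr by (auto simp: bridges_def levs_append)
  have "s \<in> bridges i0"
    unfolding bridges_def
  proof (intro CollectI conjI ballI)
    show "s \<in> lists unit_vecs" using r qs by auto
    fix y assume "y \<in> set (levs i0 0 s)"
    then have y: "L + y \<in> set (levs i0 L s)"
      by (subst levs_0) simp
    then show "0 < y" using qs by auto
    have "L + y \<in> set (levs i0 0 xs)"
      using y pr qs by (simp add: levs_append)
    then show "y \<le> lev i0 s"
      using xs(2) qs r by auto
  qed
  with p pr qs r show ?thesis
    by (intro bexI[of _ p] bexI[of _ q] bexI[of _ s] conjI) auto
qed

text \<open>Unless the loop \<open>q\<close> descends to the end of the first irreducible piece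
  \<open>a\<close>, the rest \<open>c @ q @ s\<close> is a bridge and \<open>xs\<close> factors
  after \<open>a\<close>; the same happens at the other end. Hence \<open>q\<close> has to run over
  all levels of \<open>c\<close> and of \<open>c'\<close>, so an overlap of the two pieces is paid
  for by the length of the loop.\<close>

lemma irreducible_split:
  assumes "xs \<in> irreducible_bridges i0" "lev i0 xs = L + M" "0 < L" "0 < M"
  shows "\<exists>a\<in>irreducible_bridges i0. \<exists>c\<in>bridges i0. \<exists>q\<in>lists unit_vecs. \<exists>c'\<in>bridges i0. \<exists>a'\<in>irreducible_bridges i0.
     xs = (a @ c) @ q @ (c' @ a') \<and> lev i0 (a @ c) = L \<and> lev i0 q = 0 \<and> lev i0 (c' @ a') = M \<and>
     lev i0 c + lev i0 c' \<le> int (length q)"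
proof -
  have xs: "xs \<in> bridges i0" using assms(1) by (rule irreducible_bridgesD)
  obtain p q s where pqs: "p \<in> bridges i0" "q \<in> lists unit_vecs" "s \<in> bridges i0" "xs = p @ q @ s"
    "lev i0 p = L" "lev i0 q = 0" "lev i0 s = M"
    using bridge_split[OF xs assms(2)] assms(3,4) by auto
  have "p \<noteq> []" "s \<noteq> []"
    using pqs assms by auto
  then obtain a c where ac: "a \<in> irreducible_bridges i0" "c \<in> bridges i0" "p = a @ c"
    using irreducible_decomp pqs by meson
  obtain a' c' where ac': "a' \<in> irreducible_bridges i0" "c' \<in> bridges i0" "s = c' @ a'"
    using irreducible_decomp_last[of s i0] pqs \<open>s \<noteq> []\<close> by blast
  have ne: "a \<noteq> []" "a' \<noteq> []" "a \<in> bridges i0" "a' \<in> bridges i0"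
    using ac ac' by (auto dest: irreducible_bridgesD)
  have c0: "0 \<le> lev i0 c" "0 \<le> lev i0 c'"
    using ac ac' by (auto intro: bridge_lev_nonneg)
  have lists: "a \<in> lists unit_vecs" "c \<in> lists unit_vecs" "c' \<in> lists unit_vecs" "a' \<in> lists unit_vecs"
    using ac ac' ne by (auto dest: bridges_lists)
  have q: "y + L > 0 \<and> y \<le> M" if "y \<in> set (levs i0 0 q)" for y
  proof -
    have "L + y \<in> set (levs i0 0 xs)"
      using that pqs by (auto simp: levs_append levs_0[of i0 L q])
    then show ?thesis using xs assms(2) by (auto simp: bridges_def)
  qed
  have sM: "0 < y \<and> y \<le> M" if "y \<in> set (levs i0 0 s)" for y
    using that pqs by (auto simp: bridges_def)
  have below: "\<exists>y\<in>set (levs i0 0 q). y \<le> - lev i0 c"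
  proof (rule ccontr)
    assume *: "\<not> ?thesis"
    have "c @ q @ s \<in> bridges i0"
      unfolding bridges_def
    proof (intro CollectI conjI ballI)
      show "c @ q @ s \<in> lists unit_vecs"
        using pqs lists bridges_lists by auto
      fix y assume y: "y \<in> set (levs i0 0 (c @ q @ s))"
      consider "y \<in> set (levs i0 0 c)" | y' where "y' \<in> set (levs i0 0 q)" "y = lev i0 c + y'"
        | y' where "y' \<in> set (levs i0 0 s)" "y = lev i0 c + y'"
        using y pqs(6) by (auto simp: levs_append levs_0[of i0 "lev i0 c"])
      then have "0 < y \<and> y \<le> lev i0 c + M"
      proof cases
        case 1
        then show ?thesis using ac assms(4) by (force simp: bridges_def)
      next
        case 2
        then show ?thesis using * q[of y'] by force
      next
        case 3
        then show ?thesis using sM[of y'] c0 by auto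
      qed
      then show "0 < y" "y \<le> lev i0 (c @ q @ s)" using pqs by auto
    qed
    then have "a = [] \<or> c @ q @ s = []"
      using irreducible_trivial[OF assms(1) ne(3), of "c @ q @ s"] pqs ac by simp
    then show False using ne \<open>s \<noteq> []\<close> by auto
  qed
  \<comment> \<open>Strict, unlike \<open>below\<close>: a bridge may revisit its final level but
    not its starting level.\<close>
  have above: "\<exists>y\<in>set (levs i0 0 q). y > lev i0 c'"
  proof (rule ccontr)
    assume *: "\<not> ?thesis"
    have "p @ q @ c' \<in> bridges i0"
      unfolding bridges_def
    proof (intro CollectI conjI ballI)
      show "p @ q @ c' \<in> lists unit_vecs"
        using pqs lists bridges_lists by auto
      fix y assume y: "y \<in> set (levs i0 0 (p @ q @ c'))"
      consider "y \<in> set (levs i0 0 p)" | y' where "y' \<in> set (levs i0 0 q)" "y = L + y'"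
        | y' where "y' \<in> set (levs i0 0 c')" "y = L + y'"
        using y pqs(5,6) by (auto simp: levs_append levs_0[of i0 L])
      then have "0 < y \<and> y \<le> L + lev i0 c'"
      proof cases
        case 1
        then show ?thesis using pqs c0 by (force simp: bridges_def)
      next
        case 2
        then show ?thesis using * q[of y'] by force
      next
        case 3
        then show ?thesis using ac' assms(3) by (auto simp: bridges_def)
      qed
      then show "0 < y" "y \<le> lev i0 (p @ q @ c')" using pqs by auto
    qed
    then have "p @ q @ c' = [] \<or> a' = []"
      using irreducible_trivial[OF assms(1) _ ne(4), of "p @ q @ c'"] pqs ac' by simp
    then show False using ne \<open>p \<noteq> []\<close> by auto
  qed
  obtain y1 y2 where "y1 \<in> set (levs i0 0 q)" "y1 \<le> - lev i0 c" "y2 \<in> set (levs i0 0 q)" "y2 > lev i0 c'"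
    using below above by blast
  \<comment> \<open>\<open>levs_loop\<close> charges twice the depth and twice the height; averaging
    the two bounds gives the sum.\<close>
  then have "lev i0 c + lev i0 c' \<le> int (length q)"
    using levs_loop[OF pqs(2,6), of y1] levs_loop[OF pqs(2,6), of y2] c0 by linarith
  moreover have "xs = (a @ c) @ q @ (c' @ a')" "lev i0 (a @ c) = L" "lev i0 (c' @ a') = M"
    using pqs ac(3) ac'(3) by simp_all
  ultimately show ?thesis
    using ac(1,2) ac'(1,2) pqs(2,6) by blast
qed

section \<open>Path weights and the Green function of a strip\<close>

declare finite_unit_vecs [simp]

text \<open>The value type stays generic: the same product is used with real site weights and with
  their complex continuation.\<close>

definition pot :: "(nat \<Rightarrow> 'a::comm_monoid_mult) \<Rightarrow> (int ^ 'd) list \<Rightarrow> 'a" where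
  "pot \<psi> xs = potl \<psi> (sites 0 xs)"

lemma sites_append_0: "sites 0 (a @ c) = sites 0 a @ map ((+) (sum_list a)) (sites 0 c)"
proof -
  have "sites (sum_list a + 0) c = map ((+) (sum_list a)) (sites 0 c)"
    by (rule sites_shift)
  then show ?thesis
    by (simp only: sites_append add_0_left add_0_right)
qed

lemma pot_Nil [simp]: "pot \<psi> [] = 1"
  by (simp add: pot_def potl_def)

lemma pot_single [simp]: "pot \<psi> [e] = \<psi> (Suc 0)"
  by (simp add: pot_def potl_def)

context attractive
begin

lemma pot_pos: "0 < pot \<psi> xs"
  unfolding pot_def by (rule potl_pos)

lemma pot_le_1: "pot \<psi> xs \<le> 1"
  unfolding pot_def by (rule potl_le_1)

lemma pot_ge_power: "\<psi> 1 ^ length xs \<le> pot \<psi> xs"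
  unfolding pot_def using potl_ge_power[of "sites 0 xs"] by simp

lemma pot_append_ge: "pot \<psi> a * pot \<psi> c \<le> pot \<psi> (a @ c)"
  unfolding pot_def sites_append_0
  using potl_append_ge[of "sites 0 a" "map ((+) (sum_list a)) (sites 0 c)"] by (simp add: potl_map)

text \<open>The sites of \<open>a\<close> and of \<open>c\<close> lie on different sides of the
  hyperplane at level \<open>L\<close>, so no site is shared; the visits of \<open>q\<close> can
  only lower the weight.\<close>

lemma pot_append3_le:
  assumes "\<And>y. y \<in> set (levs i0 0 a) \<Longrightarrow> y \<le> L" "\<And>y. y \<in> set (levs i0 (lev i0 (a @ q)) c) \<Longrightarrow> L < y"
  shows "pot \<psi> (a @ q @ c) \<le> pot \<psi> a * pot \<psi> c"
proof -
  let ?v = "sum_list a + sum_list q"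
  have lev: "sum_list xs $ i0 = lev i0 xs" for xs
    by (induction xs) auto
  have c: "map ((+) ?v) (sites 0 c) = sites ?v c"
    using sites_shift[of ?v 0 c] by simp
  have "set (sites 0 a) \<inter> set (map ((+) ?v) (sites 0 c)) = {}"
  proof -
    have "y $ i0 \<le> L" if "y \<in> set (sites 0 a)" for y
      using levs_sites[of i0 0 a] assms(1) that by auto
    moreover have "L < y $ i0" if "y \<in> set (sites ?v c)" for y
      using levs_sites[of i0 ?v c] assms(2) that by (auto simp: lev)
    ultimately show ?thesis unfolding c by fastforce
  qed
  then have "potl \<psi> (sites 0 a @ map ((+) (sum_list a)) (sites 0 q) @ map ((+) ?v) (sites 0 c)) \<le>
     potl \<psi> (sites 0 a) * potl \<psi> (map ((+) ?v) (sites 0 c))"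
    by (rule potl_append_le)
  moreover have "sites 0 (a @ q @ c) = sites 0 a @ map ((+) (sum_list a)) (sites 0 q) @ map ((+) ?v) (sites 0 c)"
    by (simp add: sites_append_0 comp_def add.assoc)
  ultimately show ?thesis
    by (simp add: pot_def potl_map)
qed

lemma pot_middle_le: "pot \<psi> (p @ s @ r) \<le> pot \<psi> s"
proof -
  let ?A = "sites 0 p" and ?B = "map ((+) (sum_list p)) (sites 0 s)"
    and ?C = "map ((+) (sum_list p)) (map ((+) (sum_list s)) (sites 0 r))"
  have "pot \<psi> (p @ s @ r) = potl \<psi> ([] @ ?A @ (?B @ ?C))"
    unfolding pot_def sites_append_0 by simp
  also have "\<dots> \<le> potl \<psi> (?B @ ?C)"
    using potl_append_le[of "[]" "?B @ ?C" ?A] by (simp add: potl_def)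
  also have "\<dots> \<le> potl \<psi> ?B"
    using potl_append_le[of ?B "[]" ?C] by (simp add: potl_def)
  also have "\<dots> = pot \<psi> s"
    by (simp add: potl_map pot_def)
  finally show ?thesis .
qed

end

section \<open>Free paths weighted by fugacity and tilt\<close>

lemma finite_paths: "finite {xs \<in> lists (unit_vecs :: (int ^ 'd::finite) set). length xs = n}"
proof -
  have eq: "{xs \<in> lists (unit_vecs :: (int ^ 'd) set). length xs = n} = {xs. set xs \<subseteq> unit_vecs \<and> length xs = n}"
    by auto
  show ?thesis
    unfolding eq by (rule finite_lists_length_eq[OF finite_unit_vecs])
qed


lemma sum_unit_vecs:
  fixes g :: "int ^ 'd::finite \<Rightarrow> 'a::comm_monoid_add"
  shows "(\<Sum>e\<in>unit_vecs. g e) = (\<Sum>i\<in>UNIV. g (axis i 1) + g (axis i (- 1)))"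
proof -
  have "(\<Sum>e\<in>unit_vecs. g e) = (\<Sum>i\<in>UNIV. \<Sum>e\<in>{axis i (1::int), axis i (- 1)}. g e)"
    unfolding unit_vecs_def by (rule sum.UNION_disjoint) (auto simp: axis_eq_axis)
  also have "\<dots> = (\<Sum>i\<in>UNIV. g (axis i 1) + g (axis i (- 1)))"
    by (intro sum.cong refl) (auto simp: axis_eq_axis)
  finally show ?thesis .
qed

lemma sum_unit_vecs_level:
  fixes f :: "int \<Rightarrow> real" and i0 :: "'d::finite"
  shows "(\<Sum>e\<in>unit_vecs. f (e $ i0)) = f 1 + f (- 1) + (2 * real CARD('d) - 2) * f 0"
proof -
  have "(\<Sum>e\<in>unit_vecs. f (e $ i0)) = (\<Sum>i\<in>UNIV. f (axis i 1 $ i0) + f (axis i (- 1) $ i0))"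
    by (rule sum_unit_vecs)
  also have "\<dots> = f 1 + f (- 1) + (\<Sum>i\<in>UNIV - {i0}. f (axis i 1 $ i0) + f (axis i (- 1) $ i0))"
    by (subst sum.remove[of _ i0]) auto
  also have "(\<Sum>i\<in>UNIV - {i0}. f (axis i 1 $ i0) + f (axis i (- 1) $ i0)) = (\<Sum>i\<in>UNIV - {i0}. 2 * f 0)"
    by (intro sum.cong) (auto simp: axis_def)
  also have "\<dots> = (2 * real CARD('d) - 2) * f 0"
    by (simp add: of_nat_diff algebra_simps)
  finally show ?thesis .
qed

text \<open>The probability of the path under simple random walk times \<open>z\<close> per step, so
  that the paths of length \<open>n\<close> have total mass \<open>z ^ n\<close>.\<close>

definition kap :: "real \<Rightarrow> (int ^ 'd::finite) list \<Rightarrow> real" where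
  "kap z xs = (z / (2 * real CARD('d))) ^ length xs"

definition wt :: "'d::finite \<Rightarrow> (nat \<Rightarrow> real) \<Rightarrow> real \<Rightarrow> real \<Rightarrow> (int ^ 'd) list \<Rightarrow> real" where
  "wt i0 \<psi> z h xs = kap z xs * exp (h * of_int (lev i0 xs)) * pot \<psi> xs"

lemma kap_nonneg: "0 \<le> z \<Longrightarrow> 0 \<le> kap z xs"
  by (simp add: kap_def)

lemma kap_append: "kap z (a @ c) = kap z a * kap z c"
  by (simp add: kap_def power_add)

lemma kap_Nil [simp]: "kap z [] = 1"
  by (simp add: kap_def)

lemma mass_kap:
  assumes "0 \<le> z"
  shows "mass (kap z) {xs \<in> lists (unit_vecs :: (int ^ 'd::finite) set). length xs = n} = ennreal (z ^ n)"
proof -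
  have "card {xs \<in> lists (unit_vecs :: (int ^ 'd) set). length xs = n} = (2 * CARD('d)) ^ n"
    using card_lists_length_eq[OF finite_unit_vecs[where 'd = 'd], of n] card_unit_vecs[where 'd = 'd]
    by (simp add: lists_eq_set)
  then have "(\<Sum>xs\<in>{xs \<in> lists (unit_vecs :: (int ^ 'd) set). length xs = n}. kap z xs) = z ^ n"
    by (simp add: kap_def power_divide power_mult_distrib)
  then show ?thesis
    using assms by (subst mass_finite) (auto simp: finite_paths kap_nonneg)
qed

lemma mass_kap_ge:
  assumes "0 \<le> z" "z < 1"
  shows "mass (kap z) {xs \<in> lists (unit_vecs :: (int ^ 'd::finite) set). m \<le> length xs} \<le> ennreal (z ^ m / (1 - z))"
proof -
  let ?A = "{xs \<in> lists (unit_vecs :: (int ^ 'd) set). m \<le> length xs}"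
  have "mass (kap z) ?A = (\<Sum>n. mass (kap z) {x \<in> ?A. length x - m = n})"
    by (rule mass_split)
  also have "\<dots> = (\<Sum>n. ennreal (z ^ (n + m)))"
  proof (intro suminf_cong)
    fix n
    have "{x \<in> ?A. length x - m = n} = {xs \<in> lists unit_vecs. length xs = n + m}"
      by auto
    then show "mass (kap z) {x \<in> ?A. length x - m = n} = ennreal (z ^ (n + m))"
      using mass_kap[OF assms(1)] by metis
  qed
  also have "\<dots> = ennreal (\<Sum>n. z ^ (n + m))"
    using assms by (intro suminf_ennreal2) (auto simp: power_add intro!: summable_mult2 summable_geometric)
  also have "(\<Sum>n. z ^ (n + m)) = z ^ m / (1 - z)"
    using assms by (simp add: power_add suminf_mult2[symmetric] suminf_geometric)
  finally show ?thesis by simp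
qed

lemma mass_le_lengths:
  assumes "\<And>x. x \<in> A \<Longrightarrow> 0 \<le> w x" "\<And>n. mass w {x \<in> A. length x \<le> n} \<le> B"
  shows "mass w A \<le> B"
proof (rule mass_limit)
  fix n
  have "mass (\<lambda>x. w x * of_bool (length x \<le> n)) A \<le> mass w {x \<in> A. length x \<le> n}"
    unfolding mass_indicator by (intro nn_integral_mono) (auto simp: indicator_def)
  then show "mass (\<lambda>x. w x * of_bool (length x \<le> n)) A \<le> B"
    using assms(2) order_trans by blast
next
  fix x assume "x \<in> A"
  have "\<forall>\<^sub>F n in sequentially. w x * of_bool (length x \<le> n) = w x"
    using eventually_ge_at_top[of "length x"] by eventually_elim simp
  then show "(\<lambda>n. w x * of_bool (length x \<le> n)) \<longlonglongrightarrow> w x"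
    by (rule tendsto_eventually)
  show "incseq (\<lambda>n. w x * of_bool (length x \<le> n))"
    using assms(1)[OF \<open>x \<in> A\<close>] by (auto simp: incseq_def)
qed (use assms(1) in auto)

text \<open>\<open>tent\<close> is the Green function of the first coordinate killed outside \<open>{1..<H}\<close>, with pole \<open>t\<close>.\<close>

definition tent :: "real \<Rightarrow> real \<Rightarrow> real \<Rightarrow> real \<Rightarrow> real" where
  "tent D t H x = D * min (x * (H - t)) (t * (H - x)) / H"

lemma tent_nonneg: "0 \<le> D \<Longrightarrow> 0 < H \<Longrightarrow> 0 \<le> t \<Longrightarrow> t \<le> H \<Longrightarrow> 0 \<le> x \<Longrightarrow> x \<le> H \<Longrightarrow> 0 \<le> tent D t H x"
  by (auto simp: tent_def intro!: mult_nonneg_nonneg divide_nonneg_nonneg)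

text \<open>Piecewise linear with a kink at \<open>t\<close>, where the slope drops from
  \<open>D * (H - t) / H\<close> to \<open>- D * t / H\<close>, that is, by
  \<open>D\<close>.\<close>

lemma tent_laplacian:
  fixes x t H :: int
  assumes "0 < x" "x < H" "0 < t" "t < H"
  shows "tent D t H (x + 1) + tent D t H (x - 1) - 2 * tent D t H x = - D * of_bool (x = t)"
proof -
  have H: "real_of_int H > 0" using assms by simp
  have *: "min (y * (real_of_int H - t)) (t * (H - y)) = (if y \<le> t then y * (real_of_int H - t) else t * (H - y))" for y :: real
  proof -
    have "y * (real_of_int H - t) - t * (H - y) = H * (y - t)"
      by (simp add: algebra_simps)
    then show ?thesis
      using H mult_le_0_iff[of "real_of_int H" "y - t"] by (auto simp: min_def)
  qed
  consider "x < t" | "x = t" | "x > t" by linarith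
  then show ?thesis
  proof cases
    case 1
    then have "real_of_int x + 1 \<le> t" "real_of_int x - 1 \<le> t" "real_of_int x \<le> t" by linarith+
    then show ?thesis using 1 H unfolding tent_def * by (simp add: field_simps)
  next
    case 2
    then have "\<not> real_of_int x + 1 \<le> t" "real_of_int x - 1 \<le> t" "real_of_int x \<le> t" by linarith+
    then show ?thesis using 2 H unfolding tent_def * by (simp add: field_simps)
  next
    case 3
    then have "\<not> real_of_int x + 1 \<le> t" "\<not> real_of_int x \<le> t" by linarith+
    moreover have "real_of_int x - 1 = t \<or> \<not> real_of_int x - 1 \<le> t" using 3 by linarith
    ultimately show ?thesis using 3 H unfolding tent_def * by (auto simp: field_simps)
  qed
qed

text \<open>A step goes up or down with weight \<open>1 / D\<close> each and otherwise keeps the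
  level, so the mean over one step differs from \<open>tent\<close> by the discrete Laplacian
  divided by \<open>D\<close>; this fixes the value \<open>2 d\<close> of \<open>D\<close>.\<close>

lemma tent_supersolution:
  fixes x t H :: int and i0 :: "'d::finite"
  assumes "0 < x" "x < H" "0 < t" "t < H"
  defines "D \<equiv> 2 * real CARD('d)"
  shows "of_bool (x = t) + (\<Sum>e\<in>(unit_vecs :: (int ^ 'd) set). tent D t H (real_of_int x + of_int (e $ i0)) / D) = tent D t H x"
proof -
  have D: "D > 0" by (simp add: D_def)
  have "(\<Sum>e\<in>(unit_vecs :: (int ^ 'd) set). tent D t H (real_of_int x + of_int (e $ i0)) / D) =
     tent D t H (x + 1) / D + tent D t H (x - 1) / D + (D - 2) * (tent D t H x / D)"
    using sum_unit_vecs_level[of "\<lambda>k. tent D t H (real_of_int x + of_int k) / D" i0] by (simp add: D_def)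
  also have "\<dots> = (tent D t H (x + 1) + tent D t H (x - 1) - 2 * tent D t H x) / D + tent D t H x"
    using D by (simp add: field_simps)
  also have "\<dots> = - of_bool (x = t) + tent D t H x"
    using D by (subst tent_laplacian[OF assms(1-4)]) simp
  finally show ?thesis by simp
qed

section \<open>Paths confined to a strip\<close>

definition strip_paths :: "'d::finite \<Rightarrow> int \<Rightarrow> int \<Rightarrow> int \<Rightarrow> (int ^ 'd) list set" where
  "strip_paths i0 H x t = {q \<in> lists unit_vecs. set (levs i0 x q) \<subseteq> {0<..<H} \<and> x + lev i0 q = t}"

lemma strip_paths_split:
  "{q \<in> strip_paths i0 H x t. length q \<le> Suc n} \<subseteq> (if x = t then {[]} else {}) \<union>
     (\<Union>e\<in>{e\<in>unit_vecs. x + e $ i0 \<in> {0<..<H}}. (#) e ` {q \<in> strip_paths i0 H (x + e $ i0) t. length q \<le> n})"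
proof
  fix q assume q: "q \<in> {q \<in> strip_paths i0 H x t. length q \<le> Suc n}"
  show "q \<in> (if x = t then {[]} else {}) \<union>
     (\<Union>e\<in>{e\<in>unit_vecs. x + e $ i0 \<in> {0<..<H}}. (#) e ` {q \<in> strip_paths i0 H (x + e $ i0) t. length q \<le> n})"
  proof (cases q)
    case Nil
    then show ?thesis using q by (auto simp: strip_paths_def)
  next
    case (Cons e r)
    then have "e \<in> {e\<in>unit_vecs. x + e $ i0 \<in> {0<..<H}}" "r \<in> {q \<in> strip_paths i0 H (x + e $ i0) t. length q \<le> n}"
      using q by (auto simp: strip_paths_def)
    then show ?thesis using Cons by blast
  qed
qed

lemma finite_strip_paths: "finite {q \<in> strip_paths i0 H x t. length q \<le> n}"
proof -
  have "{q \<in> strip_paths i0 H x t. length q \<le> n} \<subseteq> (\<Union>k\<le>n. {xs \<in> lists unit_vecs. length xs = k})"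
    by (auto simp: strip_paths_def)
  then show ?thesis
    by (rule finite_subset) (auto intro!: finite_UN_I finite_paths)
qed

lemma sum_Un_le:
  fixes f :: "'x \<Rightarrow> real"
  assumes "finite A" "finite B" "\<And>x. 0 \<le> f x"
  shows "sum f (A \<union> B) \<le> sum f A + sum f B"
  using assms by (simp add: sum_Un sum_nonneg)

text \<open>Comparison by first-step decomposition: the partial sums over lengths satisfy the
  equation of \<open>tent\<close> as an inequality. Steps that leave the strip carry no path on the
  left and a nonnegative value of \<open>tent\<close> on the right. Bounding the length avoids any
  question of convergence.\<close>

lemma strip_paths_sum:
  fixes i0 :: "'d::finite"
  assumes "0 < x" "x < H" "0 < t" "t < H"
  shows "(\<Sum>q\<in>{q \<in> strip_paths i0 H x t. length q \<le> n}. kap 1 q) \<le> tent (2 * real CARD('d)) t H x"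
  using assms(1,2)
proof (induction n arbitrary: x)
  case 0
  have "(\<Sum>q\<in>{q \<in> strip_paths i0 H x t. length q \<le> 0}. kap 1 q) \<le> (\<Sum>q\<in>(if x = t then {[] :: (int ^ 'd) list} else {}). kap 1 q)"
    by (rule sum_mono2) (auto simp: strip_paths_def kap_nonneg)
  also have "\<dots> = of_bool (x = t)" by simp
  also have "\<dots> \<le> tent (2 * real CARD('d)) t H x"
  proof -
    have "0 \<le> (\<Sum>e\<in>(unit_vecs :: (int ^ 'd) set). tent (2 * real CARD('d)) t H (real_of_int x + of_int (e $ i0)) / (2 * real CARD('d)))"
    proof (intro sum_nonneg divide_nonneg_nonneg tent_nonneg)
      fix e :: "int ^ 'd" assume "e \<in> unit_vecs"
      then have "\<bar>e $ i0\<bar> \<le> 1" by (rule unit_vec_level)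
      then show "0 \<le> real_of_int x + real_of_int (e $ i0)" "real_of_int x + real_of_int (e $ i0) \<le> real_of_int H"
        using 0 by linarith+
    qed (use assms in auto)
    then show ?thesis
      using tent_supersolution[OF 0 assms(3,4), of i0] by simp
  qed
  finally show ?case .
next
  case (Suc n)
  let ?D = "2 * real CARD('d)"
  let ?E = "{e\<in>unit_vecs. x + e $ i0 \<in> {0<..<H}}"
  define S where "S = (\<lambda>x. {q \<in> strip_paths i0 H x t. length q \<le> n})"
  define N :: "(int ^ 'd) list set" where "N = (if x = t then {[]} else {})"
  have fE: "finite ?E" by simp
  have fS: "finite (S y)" for y
    unfolding S_def by (rule finite_strip_paths)
  have fN: "finite N" "sum (kap 1) N = of_bool (x = t)"
    by (auto simp: N_def)
  have T0: "0 \<le> tent ?D t H (real_of_int x + of_int (e $ i0)) / ?D" if "e \<in> unit_vecs" for e :: "int ^ 'd"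
  proof (intro divide_nonneg_nonneg tent_nonneg)
    have "\<bar>e $ i0\<bar> \<le> 1" using that by (rule unit_vec_level)
    then show "0 \<le> real_of_int x + real_of_int (e $ i0)" "real_of_int x + real_of_int (e $ i0) \<le> real_of_int H"
      using Suc by linarith+
  qed (use assms in auto)
  have "(\<Sum>q\<in>{q \<in> strip_paths i0 H x t. length q \<le> Suc n}. kap 1 q) \<le>
      sum (kap 1) (N \<union> (\<Union>e\<in>?E. (#) e ` S (x + e $ i0)))"
  proof (rule sum_mono2)
    show "{q \<in> strip_paths i0 H x t. length q \<le> Suc n} \<subseteq> N \<union> (\<Union>e\<in>?E. (#) e ` S (x + e $ i0))"
      using strip_paths_split[of i0 H x t n] unfolding N_def S_def .
    show "finite (N \<union> (\<Union>e\<in>?E. (#) e ` S (x + e $ i0)))"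
      using fE fS fN by blast
  qed (simp add: kap_nonneg)
  also have "\<dots> \<le> sum (kap 1) N + sum (kap 1) (\<Union>e\<in>?E. (#) e ` S (x + e $ i0))"
    using fE fS fN by (intro sum_Un_le) (auto simp: kap_nonneg)
  also have "sum (kap 1) (\<Union>e\<in>?E. (#) e ` S (x + e $ i0)) = (\<Sum>e\<in>?E. sum (kap 1) ((#) e ` S (x + e $ i0)))"
    using fE fS by (intro sum.UNION_disjoint) blast+
  also have "\<dots> = (\<Sum>e\<in>?E. sum (kap 1) (S (x + e $ i0)) / ?D)"
  proof (intro sum.cong refl)
    fix e :: "int ^ 'd"
    have "sum (kap 1) ((#) e ` S (x + e $ i0)) = (\<Sum>q\<in>S (x + e $ i0). kap 1 (e # q))"
      by (subst sum.reindex) (auto intro!: inj_onI)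
    also have "\<dots> = (\<Sum>q\<in>S (x + e $ i0). kap 1 q / ?D)"
      by (intro sum.cong refl) (simp add: kap_def)
    finally show "sum (kap 1) ((#) e ` S (x + e $ i0)) = sum (kap 1) (S (x + e $ i0)) / ?D"
      by (simp add: sum_divide_distrib)
  qed
  also have "\<dots> \<le> (\<Sum>e\<in>?E. tent ?D t H (real_of_int x + of_int (e $ i0)) / ?D)"
  proof (rule sum_mono, rule divide_right_mono)
    fix e assume "e \<in> ?E"
    then show "sum (kap 1) (S (x + e $ i0)) \<le> tent ?D t H (real_of_int x + of_int (e $ i0))"
      using Suc.IH[of "x + e $ i0"] unfolding S_def by simp
  qed simp
  also have "\<dots> \<le> (\<Sum>e\<in>(unit_vecs :: (int ^ 'd) set). tent ?D t H (real_of_int x + of_int (e $ i0)) / ?D)"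
    by (rule sum_mono2) (use T0 in auto)
  also have "sum (kap 1) N + \<dots> = tent ?D t H x"
    using tent_supersolution[OF Suc.prems assms(3,4), of i0] fN by simp
  finally show ?case by simp
qed

lemma mass_strip_paths:
  fixes i0 :: "'d::finite"
  assumes "0 < x" "x < H" "0 < t" "t < H" "0 \<le> z" "z \<le> 1"
  shows "mass (kap z) (strip_paths i0 H x t) \<le> ennreal (tent (2 * real CARD('d)) t H x)"
proof -
  have "mass (kap z) (strip_paths i0 H x t) \<le> mass (kap 1) (strip_paths i0 H x t)"
    using assms by (intro mass_mono) (auto simp: kap_def intro!: power_mono divide_right_mono)
  also have "\<dots> \<le> ennreal (tent (2 * real CARD('d)) t H x)"
  proof (rule mass_le_lengths)
    fix n
    have "mass (kap 1) {q \<in> strip_paths i0 H x t. length q \<le> n} =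
        ennreal (\<Sum>q\<in>{q \<in> strip_paths i0 H x t. length q \<le> n}. kap 1 q)"
      by (rule mass_finite[OF finite_strip_paths]) (simp add: kap_nonneg)
    also have "\<dots> \<le> ennreal (tent (2 * real CARD('d)) t H x)"
      by (rule ennreal_leI, rule strip_paths_sum[OF assms(1-4)])
    finally show "mass (kap 1) {q \<in> strip_paths i0 H x t. length q \<le> n} \<le> ennreal (tent (2 * real CARD('d)) t H x)" .
  qed (simp add: kap_nonneg)
  finally show ?thesis .
qed

section \<open>Decay rate of bridges\<close>

lemma fekete_superadditive:
  fixes a :: "nat \<Rightarrow> real"
  assumes super: "\<And>m n. 1 \<le> m \<Longrightarrow> 1 \<le> n \<Longrightarrow> a m + a n \<le> a (m + n)"
    and bound: "\<And>n. 1 \<le> n \<Longrightarrow> a n \<le> C * real n"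
  obtains s where "(\<lambda>n. a n / real n) \<longlonglongrightarrow> s" "\<And>n. 1 \<le> n \<Longrightarrow> a n \<le> s * real n"
proof -
  define s where "s = (SUP n\<in>{1..}. a n / real n)"
  have bdd: "bdd_above ((\<lambda>n. a n / real n) ` {1..})"
    using bound by (intro bdd_aboveI[of _ C]) (auto simp: divide_le_eq)
  have le: "a n \<le> s * real n" if "1 \<le> n" for n
  proof -
    have "a n / real n \<le> s"
      unfolding s_def by (rule cSUP_upper) (use that bdd in auto)
    then show ?thesis using that by (simp add: divide_le_eq)
  qed
  have mult: "real q * a m \<le> a (q * m)" if "1 \<le> m" "1 \<le> q" for q m
    using that(2)
  proof (induction q rule: dec_induct)
    case (step q)
    then show ?case
      using super[of "q * m" m] that(1) by (simp add: algebra_simps)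
  qed simp
  have "(\<lambda>n. a n / real n) \<longlonglongrightarrow> s"
  proof (rule LIMSEQ_I)
    fix e :: real assume e: "0 < e"
    have "\<exists>m\<in>{1..}. s - e / 2 < a m / real m"
      using less_cSUP_iff[OF _ bdd, of "s - e / 2"] e unfolding s_def[symmetric] by auto
    then obtain m where m: "1 \<le> m" "s - e / 2 < a m / real m" by auto
    define c where "c = a m / real m"
    define B where "B = (\<Sum>r\<in>{1..m}. \<bar>a r\<bar>)"
    obtain N :: nat where N: "(real m * \<bar>c\<bar> + B) / (e / 2) < real N"
      using reals_Archimedean2 by blast
    show "\<exists>no. \<forall>n\<ge>no. norm (a n / real n - s) < e"
    proof (intro exI[of _ "Suc N + Suc m"] allI impI)
      fix n assume n: "Suc N + Suc m \<le> n"
      \<comment> \<open>The remainder lies in \<open>{1..m}\<close> instead of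
        \<open>{0..<m}\<close>, because superadditivity is available for positive indices
        only.\<close>
      define q r where "q = (n - 1) div m" and "r = Suc ((n - 1) mod m)"
      have n_eq: "n = q * m + r"
        using n unfolding q_def r_def by (metis One_nat_def Suc_pred add_Suc_right div_mult_mod_eq less_le_trans zero_less_Suc add_Suc)
      have r: "1 \<le> r" "r \<le> m"
        using m by (auto simp: r_def Suc_le_eq)
      have "1 \<le> q"
        unfolding q_def using n m by (simp add: Suc_le_eq div_greater_zero_iff)
      then have qm: "1 \<le> q * m" using m by simp
      have "\<bar>a r\<bar> \<le> B"
        unfolding B_def using r by (intro member_le_sum) auto
      have "a n \<ge> real q * a m + a r"
        using super[OF qm r(1)] mult[OF m(1) \<open>1 \<le> q\<close>] n_eq by simp
      also have "real q * a m = (real n - real r) * c"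
        using n_eq m by (simp add: c_def)
      also have "(real n - real r) * c + a r \<ge> real n * c - (real m * \<bar>c\<bar> + B)"
      proof -
        have "real r * c \<le> real r * \<bar>c\<bar>"
          by (intro mult_left_mono) auto
        also have "\<dots> \<le> real m * \<bar>c\<bar>"
          using r by (intro mult_right_mono) auto
        finally have "real r * c \<le> real m * \<bar>c\<bar>" .
        then show ?thesis
          using \<open>\<bar>a r\<bar> \<le> B\<close> by (simp add: algebra_simps)
      qed
      finally have "(real n * c - (real m * \<bar>c\<bar> + B)) / real n \<le> a n / real n"
        by (intro divide_right_mono) auto
      then have "a n / real n \<ge> c - (real m * \<bar>c\<bar> + B) / real n"
        using n by (simp add: diff_divide_distrib)
      moreover have "(real m * \<bar>c\<bar> + B) / real n < e / 2"
      proof -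
        have "real m * \<bar>c\<bar> + B < (e / 2) * real N"
          using N e by (simp add: divide_less_eq mult.commute)
        also have "\<dots> \<le> (e / 2) * real n"
          using n e by (intro mult_left_mono) auto
        finally show ?thesis
          using n by (simp add: divide_less_eq)
      qed
      moreover have "a n / real n \<le> s"
        using le[of n] n by (simp add: divide_le_eq)
      ultimately show "norm (a n / real n - s) < e"
        using m(2)[folded c_def] unfolding real_norm_def abs_less_iff by linarith
    qed
  qed
  with le that show ?thesis by blast
qed

section \<open>Bridges of a given height\<close>

lemma mass_add:
  assumes "\<And>x. x \<in> A \<Longrightarrow> 0 \<le> w x" "\<And>x. x \<in> A \<Longrightarrow> 0 \<le> v x"
  shows "mass (\<lambda>x. w x + v x) A = mass w A + mass v A"
proof -
  have "mass (\<lambda>x. w x + v x) A = (\<integral>\<^sup>+x. ennreal (w x) + ennreal (v x) \<partial>count_space A)"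
    unfolding mass_def using assms by (intro nn_integral_cong) (simp add: ennreal_plus)
  then show ?thesis
    unfolding mass_def by (simp add: nn_integral_add)
qed

lemma mass_restrict:
  "mass (\<lambda>x. w x * of_bool (P x)) A = mass w {x \<in> A. P x}"
  unfolding mass_indicator by (intro nn_integral_cong) (auto simp: indicator_def)

lemma mass_ge_single: "x \<in> A \<Longrightarrow> 0 \<le> w x \<Longrightarrow> ennreal (w x) \<le> mass w A"
  using mass_mono[of "{x}" A w w] mass_finite[of "{x}" w] by simp

definition bridges_at :: "'d::finite \<Rightarrow> nat \<Rightarrow> (int ^ 'd) list set" where
  "bridges_at i0 L = {xs \<in> bridges i0. lev i0 xs = int L}"

text \<open>The final level is reached by the last step only. When such a bridge is split at a
  level, the loop between the two pieces stays in an open strip, where its Green function is finite,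
  and both pieces are again of this kind.\<close>

definition strict_bridges_at :: "'d::finite \<Rightarrow> nat \<Rightarrow> (int ^ 'd) list set" where
  "strict_bridges_at i0 L = {xs \<in> bridges_at i0 L. \<forall>y\<in>set (levs i0 0 (butlast xs)). y < int L}"

definition brm :: "'d::finite \<Rightarrow> (nat \<Rightarrow> real) \<Rightarrow> real \<Rightarrow> nat \<Rightarrow> real" where
  "brm i0 \<psi> z L = enn2real (mass (wt i0 \<psi> z 0) (bridges_at i0 L))"

definition sbm :: "'d::finite \<Rightarrow> (nat \<Rightarrow> real) \<Rightarrow> real \<Rightarrow> nat \<Rightarrow> real" where
  "sbm i0 \<psi> z L = enn2real (mass (wt i0 \<psi> z 0) (strict_bridges_at i0 L))"

definition alpha :: "'d::finite \<Rightarrow> (nat \<Rightarrow> real) \<Rightarrow> real \<Rightarrow> real" where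
  "alpha i0 \<psi> z = - lim (\<lambda>L. ln (brm i0 \<psi> z L) / real L)"

locale weighted_walk = attractive \<psi> for \<psi> +
  fixes i0 :: "'d::finite" and z :: real
  assumes z_pos: "0 < z" and z_le_1: "z \<le> 1"
begin

lemma D_pos: "0 < (2 * real CARD('d))" and D_ge_2: "2 \<le> (2 * real CARD('d))"
  and D_ge_1: "1 \<le> (2 * real CARD('d))"
proof -
  have "1 \<le> CARD('d)" by (simp add: Suc_le_eq)
  then show "0 < (2 * real CARD('d))" "2 \<le> (2 * real CARD('d))" "1 \<le> (2 * real CARD('d))" by linarith+
qed

lemma wt_pos: "0 < wt i0 \<psi> z h xs"
  using z_pos D_pos by (simp add: wt_def kap_def pot_pos)

lemma wt_nonneg: "0 \<le> wt i0 \<psi> z h xs"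
  using wt_pos[of h xs] by simp

lemma wt_Nil [simp]: "wt i0 \<psi> z h [] = 1"
  by (simp add: wt_def)

lemma wt_le_kap: "lev i0 xs = 0 \<or> h = 0 \<Longrightarrow> wt i0 \<psi> z h xs \<le> kap z xs"
  using z_pos pot_le_1[of xs] mult_left_mono[OF pot_le_1 kap_nonneg, of z xs]
  by (auto simp: wt_def)

lemma wt_append_ge: "wt i0 \<psi> z h a * wt i0 \<psi> z h c \<le> wt i0 \<psi> z h (a @ c)"
proof -
  have "kap z a * exp (h * lev i0 a) * (kap z c * exp (h * lev i0 c)) * (pot \<psi> a * pot \<psi> c) \<le>
      kap z a * exp (h * lev i0 a) * (kap z c * exp (h * lev i0 c)) * pot \<psi> (a @ c)"
    using z_pos by (intro mult_left_mono pot_append_ge) (simp add: kap_nonneg)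
  then show ?thesis
    by (simp add: wt_def kap_append distrib_left exp_add mult_ac)
qed

lemma wt_append3_le:
  assumes "a \<in> bridges i0" "c \<in> bridges i0" "lev i0 q = 0"
  shows "wt i0 \<psi> z h (a @ q @ c) \<le> wt i0 \<psi> z h a * (kap z q * wt i0 \<psi> z h c)"
proof -
  have "pot \<psi> (a @ q @ c) \<le> pot \<psi> a * pot \<psi> c"
  proof (rule pot_append3_le[where L = "lev i0 a"])
    show "y \<le> lev i0 a" if "y \<in> set (levs i0 0 a)" for y
      using that assms(1) by (simp add: bridges_def)
    show "lev i0 a < y" if "y \<in> set (levs i0 (lev i0 (a @ q)) c)" for y
      using that assms(2,3) levs_0[of i0 "lev i0 a" c] by (auto simp: bridges_def)
  qed
  then have "kap z a * exp (h * lev i0 a) * (kap z c * exp (h * lev i0 c)) * kap z q * pot \<psi> (a @ q @ c) \<le>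
      kap z a * exp (h * lev i0 a) * (kap z c * exp (h * lev i0 c)) * kap z q * (pot \<psi> a * pot \<psi> c)"
    using z_pos by (intro mult_left_mono) (simp_all add: kap_nonneg)
  then show ?thesis
    using assms(3) by (simp add: wt_def kap_append distrib_left exp_add mult_ac)
qed

text \<open>Consecutive bridges visit disjoint levels, so the gluing inequality holds in both
  directions. This makes the renewal equation exact.\<close>

lemma wt_bridge_append:
  assumes "a \<in> bridges i0" "c \<in> bridges i0"
  shows "wt i0 \<psi> z h (a @ c) = wt i0 \<psi> z h a * wt i0 \<psi> z h c"
  using wt_append_ge[of h a c] wt_append3_le[OF assms, of "[]" h] by simp

lemma wt_shift: "lev i0 xs = int L \<Longrightarrow> wt i0 \<psi> z (h + k) xs = exp (h * real L) * wt i0 \<psi> z k xs"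
  by (simp add: wt_def distrib_right exp_add)

lemma wt_mono_h: "0 \<le> lev i0 xs \<Longrightarrow> h \<le> h' \<Longrightarrow> wt i0 \<psi> z h xs \<le> wt i0 \<psi> z h' xs"
  unfolding wt_def using z_pos
  by (intro mult_right_mono mult_left_mono) (simp_all add: kap_nonneg less_imp_le[OF pot_pos] mult_right_mono)

text \<open>Raised by one, a bridge of height \<open>L\<close> runs from 1 to \<open>L + 1\<close>
  inside the strip below \<open>L + 2\<close>. The Green function there is at most
  \<open>2 d\<close>, uniformly in \<open>L\<close> and even at \<open>z = 1\<close>.\<close>

lemma mass_bridges_at_le: "mass (wt i0 \<psi> z 0) (bridges_at i0 L) \<le> ennreal (2 * real CARD('d))"
proof -
  have "bridges_at i0 L \<subseteq> strip_paths i0 (int L + 2) 1 (int L + 1)"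
  proof
    fix xs assume "xs \<in> bridges_at i0 L"
    then show "xs \<in> strip_paths i0 (int L + 2) 1 (int L + 1)"
      using levs_0[of i0 1 xs] by (fastforce simp: bridges_at_def bridges_def strip_paths_def)
  qed
  then have "mass (wt i0 \<psi> z 0) (bridges_at i0 L) \<le> mass (kap z) (strip_paths i0 (int L + 2) 1 (int L + 1))"
    by (intro mass_mono) (auto intro: wt_le_kap)
  also have "\<dots> \<le> ennreal (tent (2 * real CARD('d)) (real_of_int (int L + 1)) (real_of_int (int L + 2)) (real_of_int 1))"
    using z_pos z_le_1 by (intro mass_strip_paths) auto
  also have "\<dots> \<le> ennreal (2 * real CARD('d))"
  proof (rule ennreal_leI)
    have "min (1 * (real L + 2 - (real L + 1))) ((real L + 1) * (real L + 2 - 1)) \<le> (1::real)"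
      by simp
    then have "(2 * real CARD('d)) * min (1 * (real L + 2 - (real L + 1))) ((real L + 1) * (real L + 2 - 1)) \<le> (2 * real CARD('d)) * (real L + 2)"
      using D_pos by (intro mult_left_mono) auto
    then show "tent (2 * real CARD('d)) (real_of_int (int L + 1)) (real_of_int (int L + 2)) (real_of_int 1) \<le> (2 * real CARD('d))"
      by (simp add: tent_def divide_le_eq)
  qed
  finally show ?thesis .
qed

lemma mass_bridges_at: "mass (wt i0 \<psi> z 0) (bridges_at i0 L) = ennreal (brm i0 \<psi> z L)"
  unfolding brm_def using mass_bridges_at_le[of L]
  by (intro ennreal_enn2real[symmetric]) (metis ennreal_less_top order.strict_trans1)

lemma mass_strict_bridges_at: "mass (wt i0 \<psi> z 0) (strict_bridges_at i0 L) = ennreal (sbm i0 \<psi> z L)"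
proof -
  have "mass (wt i0 \<psi> z 0) (strict_bridges_at i0 L) \<le> mass (wt i0 \<psi> z 0) (bridges_at i0 L)"
    by (intro mass_mono) (auto simp: strict_bridges_at_def)
  then show ?thesis
    unfolding sbm_def using mass_bridges_at_le[of L]
    by (intro ennreal_enn2real[symmetric]) (metis ennreal_less_top order.strict_trans1)
qed

lemma brm_nonneg: "0 \<le> brm i0 \<psi> z L" and sbm_nonneg: "0 \<le> sbm i0 \<psi> z L"
  by (simp_all add: brm_def sbm_def)

lemma sbm_le_brm: "sbm i0 \<psi> z L \<le> brm i0 \<psi> z L"
proof -
  have "mass (wt i0 \<psi> z 0) (strict_bridges_at i0 L) \<le> mass (wt i0 \<psi> z 0) (bridges_at i0 L)"
    by (intro mass_mono) (auto simp: strict_bridges_at_def)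
  then show ?thesis
    by (simp add: mass_bridges_at mass_strict_bridges_at brm_nonneg ennreal_le_iff)
qed

lemma brm_le_D: "brm i0 \<psi> z L \<le> (2 * real CARD('d))"
  using mass_bridges_at_le[of L] D_pos by (simp add: mass_bridges_at ennreal_le_iff)

lemma e1_unit: "axis i0 1 \<in> unit_vecs"
  by (auto simp: unit_vecs_def)

lemma straight_bridge: "replicate L (axis i0 1) \<in> bridges_at i0 L"
proof (induction L)
  case (Suc L)
  have "[axis i0 1] \<in> bridges i0"
    using e1_unit by (simp add: bridges_def)
  then show ?case
    using Suc bridge_append[of "[axis i0 1]" i0 "replicate L (axis i0 1)"] by (simp add: bridges_at_def)
qed (simp add: bridges_at_def)

lemma brm_pos: "0 < brm i0 \<psi> z L"
proof -
  have "ennreal (wt i0 \<psi> z 0 (replicate L (axis i0 1))) \<le> ennreal (brm i0 \<psi> z L)"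
    unfolding mass_bridges_at[symmetric] using straight_bridge wt_nonneg by (rule mass_ge_single)
  then have "wt i0 \<psi> z 0 (replicate L (axis i0 1)) \<le> brm i0 \<psi> z L"
    by (simp add: ennreal_le_iff brm_nonneg)
  then show ?thesis
    using wt_pos less_le_trans by blast
qed

text \<open>Two candidates for the first piece differ by a bridge of level 0, which is
  empty.\<close>

lemma bridges_at_append_inj: "inj_on (\<lambda>p. fst p @ snd p) (bridges_at i0 L \<times> bridges_at i0 M)"
proof (rule inj_onI)
  have *: "fst x = fst y" if "x \<in> bridges_at i0 L \<times> bridges_at i0 M" "y \<in> bridges_at i0 L \<times> bridges_at i0 M"
    "fst x @ snd x = fst y @ snd y" "fst y = fst x @ d" for x y d
  proof -
    have eq: "fst x @ snd x = (fst x @ d) @ snd y" using that by simp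
    have "d \<in> bridges i0"
      using that eq by (intro bridge_prefix_cases[of "fst x" i0 "snd x" d "snd y"]) (auto simp: bridges_at_def mem_Times_iff)
    moreover have "lev i0 d = 0"
      using that by (auto simp: bridges_at_def mem_Times_iff)
    ultimately have "d = []"
      using bridge_lev_pos by fastforce
    then show ?thesis using that by simp
  qed
  fix x y :: "(int ^ 'd) list \<times> (int ^ 'd) list"
  assume xy: "x \<in> bridges_at i0 L \<times> bridges_at i0 M" "y \<in> bridges_at i0 L \<times> bridges_at i0 M"
    "fst x @ snd x = fst y @ snd y"
  obtain d where "fst y = fst x @ d \<or> fst x = fst y @ d"
    using xy(3) by (metis append_eq_append_conv2)
  then have "fst x = fst y"
    using *[OF xy, of d] *[OF xy(2,1), of d] xy(3) by metis
  then show "x = y"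
    using xy(3) by (simp add: prod_eq_iff)
qed

lemma brm_supermult: "brm i0 \<psi> z L * brm i0 \<psi> z M \<le> brm i0 \<psi> z (L + M)"
proof -
  let ?w = "wt i0 \<psi> z 0"
  have "ennreal (brm i0 \<psi> z L) * ennreal (brm i0 \<psi> z M) =
      mass (\<lambda>p. ?w (fst p) * ?w (snd p)) (bridges_at i0 L \<times> bridges_at i0 M)"
    by (subst mass_Times) (simp_all add: wt_nonneg mass_bridges_at)
  also have "\<dots> \<le> mass (\<lambda>p. ?w (fst p @ snd p)) (bridges_at i0 L \<times> bridges_at i0 M)"
    by (intro mass_mono wt_append_ge) simp
  also have "\<dots> = mass ?w ((\<lambda>p. fst p @ snd p) ` (bridges_at i0 L \<times> bridges_at i0 M))"
    by (rule mass_inj_image[OF bridges_at_append_inj, symmetric])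
  also have "\<dots> \<le> mass ?w (bridges_at i0 (L + M))"
    by (intro mass_mono) (auto simp: bridges_at_def intro: bridge_append)
  finally show ?thesis
    by (simp add: mass_bridges_at ennreal_mult''[symmetric] brm_nonneg ennreal_le_iff)
qed

lemma strict_split:
  assumes "xs \<in> strict_bridges_at i0 (L + M)" "1 \<le> L" "1 \<le> M"
  shows "\<exists>p\<in>strict_bridges_at i0 L. \<exists>q\<in>strip_paths i0 (int (L + M)) (int L) (int L). \<exists>s\<in>strict_bridges_at i0 M. xs = p @ q @ s"
proof -
  have xs: "xs \<in> bridges i0" "lev i0 xs = int L + int M" "\<forall>y\<in>set (levs i0 0 (butlast xs)). y < int L + int M"
    using assms by (auto simp: strict_bridges_at_def bridges_at_def)
  from bridge_split[OF xs(1,2)] obtain p q s where pqs: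
    "p \<in> bridges i0" "q \<in> lists unit_vecs" "s \<in> bridges i0" "xs = p @ q @ s" "lev i0 p = int L" "lev i0 q = 0"
    "lev i0 s = int M" "\<forall>y\<in>set (levs i0 0 (butlast p)). y < int L"
    by auto
  have "s \<noteq> []" using pqs assms by auto
  then have bl: "butlast xs = p @ q @ butlast s"
    using pqs by (simp add: butlast_append)
  have "p \<in> strict_bridges_at i0 L"
    using pqs by (simp add: strict_bridges_at_def bridges_at_def)
  moreover have "q \<in> strip_paths i0 (int (L + M)) (int L) (int L)"
  proof -
    have "0 < y \<and> y < int L + int M" if "y \<in> set (levs i0 (int L) q)" for y
      using that xs(1,3) bl pqs by (auto simp: bridges_def levs_append)
    then show ?thesis
      using pqs by (auto simp: strip_paths_def)
  qed
  moreover have "s \<in> strict_bridges_at i0 M"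
  proof -
    have "y < int M" if "y \<in> set (levs i0 0 (butlast s))" for y
    proof -
      have "int L + y \<in> set (levs i0 0 (butlast xs))"
        using that bl pqs levs_0[of i0 "int L" "butlast s"] by (auto simp: levs_append)
      then show ?thesis using xs(3) by auto
    qed
    then show ?thesis
      using pqs by (simp add: strict_bridges_at_def bridges_at_def)
  qed
  ultimately show ?thesis
    using pqs(4) by blast
qed

text \<open>
  The piece between the first visit to level \<open>L\<close> and the last one is a loop in the strip, whose Green function at
  \<open>L\<close> is \<open>2 d L M / (L + M)\<close>; this factor is absorbed by the weights \<open>2 d L\<close>.
\<close>

lemma sbm_submult:
  assumes "1 \<le> L" "1 \<le> M"
  shows "(2 * real CARD('d)) * real (L + M) * sbm i0 \<psi> z (L + M) \<le> ((2 * real CARD('d)) * real L * sbm i0 \<psi> z L) * ((2 * real CARD('d)) * real M * sbm i0 \<psi> z M)"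
proof -
  let ?w = "wt i0 \<psi> z 0"
  let ?T = "tent (2 * real CARD('d)) (real_of_int (int L)) (real_of_int (int (L + M))) (real_of_int (int L))"
  have LM: "real L > 0" "real M > 0" using assms by auto
  have "mass ?w (strict_bridges_at i0 (L + M)) \<le>
     mass ?w (strict_bridges_at i0 L) * (mass (kap z) (strip_paths i0 (int (L + M)) (int L) (int L)) * mass ?w (strict_bridges_at i0 M))"
  proof (rule mass_cover3)
    fix xs assume "xs \<in> strict_bridges_at i0 (L + M)"
    then show "\<exists>p\<in>strict_bridges_at i0 L. \<exists>q\<in>strip_paths i0 (int (L + M)) (int L) (int L). \<exists>s\<in>strict_bridges_at i0 M. xs = p @ q @ s"
      using strict_split assms by blast
  next
    fix p q s assume "p \<in> strict_bridges_at i0 L" "q \<in> strip_paths i0 (int (L + M)) (int L) (int L)" "s \<in> strict_bridges_at i0 M"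
    then show "?w (p @ q @ s) \<le> ?w p * (kap z q * ?w s)"
      by (intro wt_append3_le) (auto simp: strict_bridges_at_def bridges_at_def strip_paths_def)
  qed (use z_pos in \<open>simp_all add: wt_nonneg kap_nonneg\<close>)
  also have "\<dots> \<le> ennreal (sbm i0 \<psi> z L) * (ennreal ?T * ennreal (sbm i0 \<psi> z M))"
    unfolding mass_strict_bridges_at
    using assms z_pos z_le_1 by (intro mult_left_mono mult_right_mono mass_strip_paths) auto
  also have "?T = (2 * real CARD('d)) * real L * real M / real (L + M)"
    by (simp add: tent_def min_def)
  finally have "sbm i0 \<psi> z (L + M) \<le> sbm i0 \<psi> z L * ((2 * real CARD('d)) * real L * real M / real (L + M) * sbm i0 \<psi> z M)"
    using D_pos
    by (simp add: mass_strict_bridges_at ennreal_mult''[symmetric] sbm_nonneg ennreal_le_iff del: of_nat_add)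
  then have "(2 * real CARD('d)) * real (L + M) * sbm i0 \<psi> z (L + M) \<le> (2 * real CARD('d)) * real (L + M) * (sbm i0 \<psi> z L * ((2 * real CARD('d)) * real L * real M / real (L + M) * sbm i0 \<psi> z M))"
    using D_pos by (intro mult_left_mono) auto
  also have "\<dots> = ((2 * real CARD('d)) * real L * sbm i0 \<psi> z L) * ((2 * real CARD('d)) * real M * sbm i0 \<psi> z M)"
    using LM by (simp add: field_simps)
  finally show ?thesis .
qed

text \<open>One upward step appended to a bridge ends on a level not visited before.\<close>

lemma sbm_ge: "brm i0 \<psi> z L * (z / (2 * real CARD('d)) * \<psi> 1) \<le> sbm i0 \<psi> z (Suc L)"
proof -
  let ?w = "wt i0 \<psi> z 0" and ?e = "axis i0 1 :: int ^ 'd"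
  have e: "[?e] \<in> bridges i0"
    using e1_unit by (simp add: bridges_def)
  have w: "?w [?e] = z / (2 * real CARD('d)) * \<psi> 1"
    by (simp add: wt_def kap_def)
  have "ennreal (z / (2 * real CARD('d)) * \<psi> 1) * ennreal (brm i0 \<psi> z L) = mass (\<lambda>xs. ?w [?e] * ?w xs) (bridges_at i0 L)"
    by (subst mass_cmult[OF wt_nonneg]) (simp only: w mass_bridges_at)
  also have "\<dots> \<le> mass (\<lambda>xs. ?w (xs @ [?e])) (bridges_at i0 L)"
    using wt_append_ge by (intro mass_mono) (auto simp: mult.commute)
  also have "\<dots> = mass ?w ((\<lambda>xs. xs @ [?e]) ` bridges_at i0 L)"
    by (rule mass_inj_image[symmetric]) (simp add: inj_on_def)
  also have "\<dots> \<le> mass ?w (strict_bridges_at i0 (Suc L))"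
  proof (intro mass_mono subsetI)
    fix xs assume "xs \<in> (\<lambda>xs. xs @ [?e]) ` bridges_at i0 L"
    then obtain ys where ys: "xs = ys @ [?e]" "ys \<in> bridges i0" "lev i0 ys = int L"
      by (auto simp: bridges_at_def)
    have "\<forall>y\<in>set (levs i0 0 ys). y < int (Suc L)"
      using ys by (force simp: bridges_def)
    then show "xs \<in> strict_bridges_at i0 (Suc L)"
      using ys bridge_append[OF ys(2) e] by (simp add: strict_bridges_at_def bridges_at_def)
  qed simp
  finally have "ennreal (z / (2 * real CARD('d)) * \<psi> 1 * brm i0 \<psi> z L) \<le> ennreal (sbm i0 \<psi> z (Suc L))"
    using z_pos D_pos psi_pos[of 1]
    by (simp add: mass_strict_bridges_at ennreal_mult''[symmetric] brm_nonneg)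
  then show ?thesis
    by (simp add: ennreal_le_iff sbm_nonneg mult.commute)
qed

lemma sbm_pos: "1 \<le> L \<Longrightarrow> 0 < sbm i0 \<psi> z L"
proof -
  assume "1 \<le> L"
  then obtain K where L: "L = Suc K" by (cases L) auto
  have "0 < brm i0 \<psi> z K * (z / (2 * real CARD('d)) * \<psi> 1)"
    using brm_pos[of K] z_pos D_pos psi_pos[of 1] by simp
  then show ?thesis
    using sbm_ge[of K] L by simp
qed

lemma alpha_limit: "(\<lambda>L. ln (brm i0 \<psi> z L) / real L) \<longlonglongrightarrow> - alpha i0 \<psi> z"
  and brm_le_alpha: "brm i0 \<psi> z L \<le> exp (- alpha i0 \<psi> z * real L)"
proof -
  obtain s where s: "(\<lambda>n. ln (brm i0 \<psi> z n) / real n) \<longlonglongrightarrow> s" "\<And>n. 1 \<le> n \<Longrightarrow> ln (brm i0 \<psi> z n) \<le> s * real n"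
  proof (rule fekete_superadditive[of "\<lambda>n. ln (brm i0 \<psi> z n)" "ln (2 * real CARD('d))"])
    fix m n :: nat
    show "ln (brm i0 \<psi> z m) + ln (brm i0 \<psi> z n) \<le> ln (brm i0 \<psi> z (m + n))"
      using brm_supermult[of m n] brm_pos by (simp add: ln_mult_pos[symmetric] mult_pos_pos)
  next
    fix n :: nat assume "1 \<le> n"
    have "ln (brm i0 \<psi> z n) \<le> ln (2 * real CARD('d))"
      using brm_le_D[of n] brm_pos[of n] D_pos by (subst ln_le_cancel_iff)
    also have "\<dots> \<le> ln (2 * real CARD('d)) * real n"
      using \<open>1 \<le> n\<close> D_ge_1 mult_left_mono[of 1 "real n" "ln (2 * real CARD('d))"] by simp
    finally show "ln (brm i0 \<psi> z n) \<le> ln (2 * real CARD('d)) * real n" .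
  qed blast
  have alpha: "alpha i0 \<psi> z = - s"
    unfolding alpha_def using s(1) by (simp add: limI)
  then show "(\<lambda>L. ln (brm i0 \<psi> z L) / real L) \<longlonglongrightarrow> - alpha i0 \<psi> z"
    using s(1) by simp
  \<comment> \<open>The Fekete bound starts at height 1; at height 0 there is only the empty
    bridge.\<close>
  have b0: "brm i0 \<psi> z 0 \<le> 1"
  proof -
    have "bridges_at i0 0 \<subseteq> {[]}"
      using bridge_lev_pos by (fastforce simp: bridges_at_def)
    then have "mass (wt i0 \<psi> z 0) (bridges_at i0 0) \<le> mass (wt i0 \<psi> z 0) {[]}"
      by (intro mass_mono) auto
    also have "mass (wt i0 \<psi> z 0) {[]} = 1"
      using mass_finite[of "{[]}" "wt i0 \<psi> z 0"] wt_nonneg by simp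
    finally show ?thesis
      by (simp add: mass_bridges_at ennreal_le_1)
  qed
  show "brm i0 \<psi> z L \<le> exp (- alpha i0 \<psi> z * real L)"
  proof (cases "L = 0")
    case False
    then have "exp (ln (brm i0 \<psi> z L)) \<le> exp (s * real L)"
      using s(2)[of L] by simp
    then show ?thesis
      using brm_pos[of L] by (simp add: alpha)
  qed (use b0 in simp)
qed

text \<open>The converse of \<open>brm_le_alpha\<close> up to the factor \<open>2 d L\<close>. By
  \<open>sbm_submult\<close> the sequence \<open>v\<close> is submultiplicative, so
  \<open>v (n L) \<le> v L ^ n\<close>; along the multiples of \<open>L\<close> it decays no faster
  than bridges do, at rate \<open>alpha\<close>, and the n-th root gives the claim for the single
  height \<open>L\<close>.\<close>

lemma sbm_ge_alpha:
  assumes "1 \<le> L"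
  shows "exp (- alpha i0 \<psi> z * real L) / ((2 * real CARD('d)) * real L) \<le> sbm i0 \<psi> z L"
proof -
  define v where "v = (\<lambda>L. (2 * real CARD('d)) * real L * sbm i0 \<psi> z L)"
  define c where "c = z / (2 * real CARD('d)) * \<psi> 1"
  have c: "0 < c" using z_pos D_pos psi_pos[of 1] by (simp add: c_def)
  have v_pos: "0 < v n" if "1 \<le> n" for n
    using sbm_pos[OF that] that D_pos by (simp add: v_def)
  have pow: "v (Suc n * L) \<le> v L ^ Suc n" for n
  proof (induction n)
    case (Suc n)
    have "v (Suc n * L + L) \<le> v (Suc n * L) * v L"
      unfolding v_def using assms by (intro sbm_submult) auto
    also have "\<dots> \<le> v L ^ Suc n * v L"
      using Suc v_pos[OF assms] by (intro mult_right_mono) auto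
    finally show ?case by (simp add: algebra_simps)
  qed simp
  \<comment> \<open>\<open>sbm_ge\<close> turns bridges one level lower into strict bridges of
    height \<open>Suc n * L\<close>, at the price of the constant \<open>c\<close>.\<close>
  have lower: "ln c + ln (brm i0 \<psi> z (Suc n * L - 1)) \<le> real (Suc n) * ln (v L)" for n
  proof -
    have nL: "1 \<le> Suc n * L" using assms by simp
    have "c * brm i0 \<psi> z (Suc n * L - 1) \<le> sbm i0 \<psi> z (Suc n * L)"
    proof -
      have "Suc (Suc n * L - 1) = Suc n * L" using nL by simp
      then show ?thesis
        using sbm_ge[of "Suc n * L - 1"] unfolding c_def by (simp only: mult.commute[of "z / (2 * real CARD('d)) * \<psi> 1"])
    qed
    also have "\<dots> \<le> v (Suc n * L)"
    proof -
      have "1 * 1 \<le> (2 * real CARD('d)) * real (Suc n * L)"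
        using D_ge_1 nL by (intro mult_mono) (auto simp del: mult_Suc of_nat_mult)
      then show ?thesis
        using mult_right_mono[of 1 "(2 * real CARD('d)) * real (Suc n * L)" "sbm i0 \<psi> z (Suc n * L)"] sbm_nonneg
        by (simp add: v_def del: mult_Suc of_nat_mult)
    qed
    also have "\<dots> \<le> v L ^ Suc n" by (rule pow)
    finally have "ln (c * brm i0 \<psi> z (Suc n * L - 1)) \<le> ln (v L ^ Suc n)"
      using c brm_pos v_pos[OF assms] by (subst ln_le_cancel_iff) auto
    then show ?thesis
      using c brm_pos v_pos[OF assms] by (simp add: ln_mult_pos ln_realpow del: power_Suc)
  qed
  have sub: "filterlim (\<lambda>n. Suc n * L - 1) at_top sequentially"
  proof (rule filterlim_at_top_mono[OF filterlim_ident], rule always_eventually, rule allI)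
    fix n
    have "Suc n * 1 \<le> Suc n * L"
      using assms by (intro mult_le_mono) auto
    moreover have "n \<le> k - 1" if "Suc n * 1 \<le> k" for k
      using that by simp
    ultimately show "n \<le> Suc n * L - 1" by blast
  qed
  have "(\<lambda>n. ln (brm i0 \<psi> z (Suc n * L - 1)) / real (Suc n * L - 1)) \<longlonglongrightarrow> - alpha i0 \<psi> z"
    using filterlim_compose[OF alpha_limit sub] .
  moreover have "(\<lambda>n. real (Suc n * L - 1) / real (Suc n)) \<longlonglongrightarrow> real L"
  proof -
    have "(\<lambda>n. real L - 1 / real (Suc n)) \<longlonglongrightarrow> real L - 0"
      by (intro tendsto_intros LIMSEQ_Suc lim_1_over_n)
    moreover have "real (Suc n * L - 1) / real (Suc n) = real L - 1 / real (Suc n)" for n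
    proof -
      have "real (Suc n * L - 1) = real (Suc n) * real L - 1"
        using assms by (subst of_nat_diff) (auto simp: algebra_simps)
      then show ?thesis by (simp add: diff_divide_distrib)
    qed
    ultimately show ?thesis by simp
  qed
  moreover have "(\<lambda>n. ln c / real (Suc n)) \<longlonglongrightarrow> 0"
    by (intro LIMSEQ_Suc lim_const_over_n)
  ultimately have "(\<lambda>n. ln c / real (Suc n) + ln (brm i0 \<psi> z (Suc n * L - 1)) / real (Suc n * L - 1) * (real (Suc n * L - 1) / real (Suc n))) \<longlonglongrightarrow> 0 + - alpha i0 \<psi> z * real L"
    by (intro tendsto_intros)
  moreover have "\<forall>\<^sub>F n in sequentially. ln c / real (Suc n) + ln (brm i0 \<psi> z (Suc n * L - 1)) / real (Suc n * L - 1) * (real (Suc n * L - 1) / real (Suc n)) \<le> ln (v L)"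
    using eventually_ge_at_top[of 1]
  proof eventually_elim
    case (elim n)
    have "2 * 1 \<le> Suc n * L"
      using elim assms by (intro mult_le_mono) auto
    moreover have "real (k - 1) \<noteq> 0" if "2 * 1 \<le> k" for k :: nat
      using that by simp
    ultimately have ne: "real (Suc n * L - 1) \<noteq> 0" by blast
    have "(ln c + ln (brm i0 \<psi> z (Suc n * L - 1))) / real (Suc n) \<le> ln (v L)"
      using lower[of n] by (simp add: divide_le_eq mult.commute del: of_nat_Suc)
    then show ?case
      using ne by (simp add: add_divide_distrib del: of_nat_Suc mult_Suc)
  qed
  ultimately have "0 + - alpha i0 \<psi> z * real L \<le> ln (v L)"
    by (rule tendsto_upperbound) simp
  then have "exp (- alpha i0 \<psi> z * real L) \<le> v L"
    using v_pos[OF assms] by (simp add: ln_ge_iff)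
  then show ?thesis
    using D_pos assms by (simp add: v_def divide_le_eq mult_ac)
qed

end

section \<open>Renewal structure of bridges\<close>

text \<open>The convolution satisfies \<open>T (Suc n) = q * T n + a (Suc n)\<close>; summing this
  recursion replaces an exchange of double sums.\<close>

lemma geometric_convolution_sum:
  fixes a :: "nat \<Rightarrow> real"
  assumes "\<And>k. 1 \<le> k \<Longrightarrow> 0 \<le> a k" "0 \<le> q" "q < 1"
  shows "(\<Sum>n=1..N. \<Sum>k=1..n. a k * q ^ (n - k)) \<le> (\<Sum>k=1..N. a k) / (1 - q)"
proof -
  define T where "T = (\<lambda>n. \<Sum>k=1..n. a k * q ^ (n - k))"
  have T_Suc: "T (Suc n) = q * T n + a (Suc n)" for n
  proof -
    have "(\<Sum>k=1..n. a k * q ^ (Suc n - k)) = (\<Sum>k=1..n. q * (a k * q ^ (n - k)))"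
      by (intro sum.cong) (auto simp: Suc_diff_le)
    then show ?thesis
      by (simp add: T_def sum_distrib_left)
  qed
  have "(1 - q) * (\<Sum>n=1..N. T n) + q * T N = (\<Sum>k=1..N. a k)"
  proof (induction N)
    case 0
    then show ?case by (simp add: T_def)
  next
    case (Suc N)
    have "(1 - q) * (\<Sum>n=1..Suc N. T n) + q * T (Suc N) = (1 - q) * (\<Sum>n=1..N. T n) + T (Suc N)"
      by (simp add: algebra_simps)
    then show ?case using Suc T_Suc[of N] by simp
  qed
  moreover have "0 \<le> q * T N"
    unfolding T_def using assms by (intro mult_nonneg_nonneg sum_nonneg) auto
  ultimately have "(1 - q) * (\<Sum>n=1..N. T n) \<le> (\<Sum>k=1..N. a k)"
    by linarith
  then show ?thesis
    using assms by (simp add: T_def pos_le_divide_eq mult.commute)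
qed

text \<open>The same recursion, now as a contraction with vanishing forcing.\<close>

lemma geometric_convolution_null:
  fixes g :: "nat \<Rightarrow> real"
  assumes g: "g \<longlonglongrightarrow> 0" "\<And>k. 0 \<le> g k" and r: "0 \<le> r" "r < 1"
  shows "(\<lambda>n. \<Sum>k=1..n. g k * r ^ (n - k)) \<longlonglongrightarrow> 0"
proof -
  define x where "x = (\<lambda>n. \<Sum>k=1..n. g k * r ^ (n - k))"
  have x_Suc: "x (Suc n) = r * x n + g (Suc n)" for n
  proof -
    have "(\<Sum>k=1..n. g k * r ^ (Suc n - k)) = (\<Sum>k=1..n. r * (g k * r ^ (n - k)))"
      by (intro sum.cong) (auto simp: Suc_diff_le)
    then show ?thesis
      by (simp add: x_def sum_distrib_left)
  qed
  have x0: "0 \<le> x n" for n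
    unfolding x_def using g r by (intro sum_nonneg) auto
  have "x \<longlonglongrightarrow> 0"
  proof (rule LIMSEQ_I)
    fix e :: real assume e: "0 < e"
    have "0 < e * (1 - r) / 2" using e r by simp
    then obtain N where "\<forall>n\<ge>N. norm (g n - 0) < e * (1 - r) / 2"
      using LIMSEQ_D[OF g(1)] by blast
    then have N: "g n < e * (1 - r) / 2" if "N \<le> n" for n
      using that g(2)[of n] by auto
    have bound: "x (N + j) \<le> r ^ j * x N + e / 2" for j
    proof (induction j)
      case (Suc j)
      have "x (N + Suc j) = r * x (N + j) + g (Suc (N + j))"
        using x_Suc[of "N + j"] by simp
      also have "\<dots> \<le> r * (r ^ j * x N + e / 2) + e * (1 - r) / 2"
        using Suc r N[of "Suc (N + j)"] by (intro add_mono mult_left_mono) auto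
      also have "\<dots> = r ^ Suc j * x N + e / 2"
        by (simp add: field_simps)
      finally show ?case .
    qed (use e in simp)
    have "(\<lambda>j. r ^ j * x N) \<longlonglongrightarrow> 0"
      using r by (intro tendsto_mult_left_zero LIMSEQ_power_zero) auto
    then obtain J where J: "\<And>j. J \<le> j \<Longrightarrow> norm (r ^ j * x N - 0) < e / 2"
      using LIMSEQ_D[of _ _ "e / 2"] e by (metis half_gt_zero)
    show "\<exists>no. \<forall>n\<ge>no. norm (x n - 0) < e"
    proof (intro exI[of _ "N + J"] allI impI)
      fix n assume n: "N + J \<le> n"
      then obtain j where j: "n = N + j" "J \<le> j"
        by (metis add.assoc le_Suc_ex le_add1)
      have "r ^ j * x N < e / 2"
        using J[OF j(2)] x0[of N] r by simp
      then show "norm (x n - 0) < e"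
        using bound[of j] x0[of n] j by simp
    qed
  qed
  then show ?thesis by (simp add: x_def)
qed

text \<open>
  The hypothesis says that a long irreducible piece splits, at any height, into two shorter ones up to an
  exponentially small overlap. Once the convolution is small at one height \<open>K\<close>, this bootstraps to an
  exponential bound; \<open>\<delta>\<close> and \<open>A\<close> depend on \<open>g\<close>, \<open>r\<close>, \<open>C\<close> only.
\<close>

lemma exponential_bootstrap:
  fixes g :: "nat \<Rightarrow> real"
  assumes g: "g \<longlonglongrightarrow> 0" "\<And>k. 0 \<le> g k" and r: "0 < r" "r < 1" and C: "0 \<le> C"
  obtains \<delta> A where "0 < \<delta>" "0 < A"
    "\<And>f N. \<lbrakk>\<And>k. 1 \<le> k \<Longrightarrow> 0 \<le> f k \<and> f k \<le> g k;
       \<And>L M. 1 \<le> L \<Longrightarrow> 1 \<le> M \<Longrightarrow>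
         f (L + M) \<le> C * (\<Sum>k=1..L. f k * r ^ (L - k)) * (\<Sum>k=1..M. f k * r ^ (M - k))\<rbrakk> \<Longrightarrow>
       (\<Sum>m=1..N. f m * exp (\<delta> * real m)) \<le> A"
proof -
  have "(\<lambda>n. C * (\<Sum>k=1..n. g k * r ^ (n - k))) \<longlonglongrightarrow> 0"
    using geometric_convolution_null[OF g] r by (intro tendsto_mult_right_zero) auto
  then have "\<forall>\<^sub>F n in sequentially. C * (\<Sum>k=1..n. g k * r ^ (n - k)) < (1 - r) / 8"
    using r by (intro order_tendstoD(2)) auto
  then have "\<forall>\<^sub>F n in sequentially. C * (\<Sum>k=1..n. g k * r ^ (n - k)) < (1 - r) / 8 \<and> 1 \<le> n"
    using eventually_ge_at_top[of 1] by eventually_elim simp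
  \<comment> \<open>The threshold (1 - r) / 8 is such that the factor 2 from \<open>exp_K\<close>
    and the factor 2 / (1 - r) from \<open>conv\<close> leave 1 / 2 in the final estimate.\<close>
  then obtain K where K: "C * (\<Sum>k=1..K. g k * r ^ (K - k)) < (1 - r) / 8" "1 \<le> K"
    by (auto simp: eventually_sequentially)
  \<comment> \<open>The first bound yields \<open>exp (\<delta> * K) \<le> 2\<close>, the second
    keeps the tilted ratio \<open>q = r * exp \<delta>\<close> below one.\<close>
  define \<delta> where "\<delta> = min (ln 2 / real K) (ln ((1 + r) / (2 * r)))"
  have "1 < (1 + r) / (2 * r)" using r by (simp add: less_divide_eq)
  then have \<delta>: "0 < \<delta>" using K by (simp add: \<delta>_def)
  have exp_K: "exp (\<delta> * real K) \<le> 2"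
  proof -
    have "\<delta> * real K \<le> ln 2"
      using K by (simp add: \<delta>_def min_def field_simps)
    then have "exp (\<delta> * real K) \<le> exp (ln 2)" by (subst exp_le_cancel_iff)
    then show ?thesis by simp
  qed
  have exp_r: "r * exp \<delta> \<le> (1 + r) / 2"
  proof -
    have "exp \<delta> \<le> exp (ln ((1 + r) / (2 * r)))"
      unfolding exp_le_cancel_iff by (simp add: \<delta>_def)
    also have "\<dots> = (1 + r) / (2 * r)" using r by simp
    finally have "r * exp \<delta> \<le> r * ((1 + r) / (2 * r))" using r by (intro mult_left_mono) auto
    then show ?thesis using r by simp
  qed
  define q where "q = r * exp \<delta>"
  have q: "0 \<le> q" "q < 1" using r exp_r by (simp_all add: q_def)
  define A0 where "A0 = (\<Sum>m=1..K. g m * exp (\<delta> * real m))"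
  have A0: "0 \<le> A0" unfolding A0_def using g by (intro sum_nonneg) auto
  have main: "(\<Sum>m=1..N. f m * exp (\<delta> * real m)) \<le> 2 * A0 + 1"
    if f: "\<And>k. 1 \<le> k \<Longrightarrow> 0 \<le> f k \<and> f k \<le> g k"
    and split: "\<And>L M. 1 \<le> L \<Longrightarrow> 1 \<le> M \<Longrightarrow>
         f (L + M) \<le> C * (\<Sum>k=1..L. f k * r ^ (L - k)) * (\<Sum>k=1..M. f k * r ^ (M - k))" for f N
  proof -
    define S where "S = (\<lambda>N. \<Sum>m=1..N. f m * exp (\<delta> * real m))"
    define Y where "Y = (\<lambda>L. \<Sum>k=1..L. f k * r ^ (L - k))"
    have Y0: "0 \<le> Y L" for L
      unfolding Y_def using f r by (intro sum_nonneg) auto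
    have YK: "C * Y K \<le> (1 - r) / 8"
    proof -
      have "C * Y K \<le> C * (\<Sum>k=1..K. g k * r ^ (K - k))"
        unfolding Y_def using f r C by (intro mult_left_mono sum_mono mult_right_mono) auto
      then show ?thesis using K by linarith
    qed
    have S_small: "S N \<le> A0" if "N \<le> K" for N
    proof -
      have "S N \<le> (\<Sum>m=1..N. g m * exp (\<delta> * real m))"
        unfolding S_def using f by (intro sum_mono mult_right_mono) auto
      also have "\<dots> \<le> A0"
        unfolding A0_def using that g by (intro sum_mono2) auto
      finally show ?thesis .
    qed
    have S_mono: "S M \<le> S N" if "M \<le> N" for M N
      unfolding S_def using that f by (intro sum_mono2) auto
    have step: "f (n + K) * exp (\<delta> * real (n + K)) \<le> (1 - r) / 4 * (Y n * exp (\<delta> * real n))" if "1 \<le> n" for n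
    proof -
      have "f (n + K) \<le> (1 - r) / 8 * Y n"
      proof -
        have "f (n + K) \<le> (C * Y K) * Y n"
          using split[OF that K(2)] by (simp add: Y_def mult_ac)
        also have "\<dots> \<le> (1 - r) / 8 * Y n"
          using YK Y0 by (intro mult_right_mono) auto
        finally show ?thesis .
      qed
      then have "f (n + K) * (exp (\<delta> * real n) * exp (\<delta> * real K)) \<le> ((1 - r) / 8 * Y n) * (exp (\<delta> * real n) * 2)"
        using exp_K r Y0 by (intro mult_mono) auto
      then show ?thesis
        by (simp add: distrib_left exp_add mult_ac)
    qed
    have conv: "(\<Sum>n=1..M. Y n * exp (\<delta> * real n)) \<le> S M * (2 / (1 - r))" for M
    proof -
      have "(\<Sum>n=1..M. Y n * exp (\<delta> * real n)) = (\<Sum>n=1..M. \<Sum>k=1..n. (f k * exp (\<delta> * real k)) * q ^ (n - k))"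
      proof (intro sum.cong refl)
        fix n
        have "r ^ (n - k) * exp (\<delta> * real n) = exp (\<delta> * real k) * q ^ (n - k)" if "k \<le> n" for k
        proof -
          have "exp (\<delta> * real n) = exp (\<delta> * real k) * exp \<delta> ^ (n - k)"
            using that by (simp add: exp_of_nat_mult[symmetric] exp_add[symmetric] of_nat_diff algebra_simps)
          then show ?thesis by (simp add: q_def power_mult_distrib)
        qed
        then show "Y n * exp (\<delta> * real n) = (\<Sum>k=1..n. (f k * exp (\<delta> * real k)) * q ^ (n - k))"
          unfolding Y_def sum_distrib_right by (intro sum.cong refl) (simp add: mult.assoc)
      qed
      also have "\<dots> \<le> S M / (1 - q)"
        unfolding S_def using f q by (intro geometric_convolution_sum) auto
      also have "\<dots> \<le> S M * (2 / (1 - r))"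
      proof -
        have "0 \<le> S M" using S_mono[of 0 M] by (simp add: S_def)
        moreover have "1 / (1 - q) \<le> 2 / (1 - r)"
          using exp_r q r by (simp add: q_def[symmetric] field_simps)
        ultimately have "S M * (1 / (1 - q)) \<le> S M * (2 / (1 - r))"
          by (intro mult_left_mono)
        then show ?thesis by simp
      qed
      finally show ?thesis .
    qed
    \<comment> \<open>The part beyond \<open>K\<close> is at most half of \<open>S N\<close> itself;
      as a finite sum, \<open>S N\<close> can be absorbed on the left.\<close>
    have "S N \<le> 2 * A0"
    proof (cases "N \<le> K")
      case True
      then show ?thesis using S_small[OF True] A0 by linarith
    next
      case False
      then obtain M where N: "N = M + K" by (metis add.commute le_Suc_ex nat_le_linear)
      have "S N = S K + (\<Sum>m=K+1..N. f m * exp (\<delta> * real m))"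
        unfolding S_def N using sum.ub_add_nat[of 1 K "\<lambda>m. f m * exp (\<delta> * real m)" M] by (simp add: add.commute)
      also have "(\<Sum>m=K+1..N. f m * exp (\<delta> * real m)) = (\<Sum>n=1..M. f (n + K) * exp (\<delta> * real (n + K)))"
        unfolding N using sum.shift_bounds_cl_nat_ivl[of "\<lambda>m. f m * exp (\<delta> * real m)" 1 K M] by (simp add: add.commute)
      also have "\<dots> \<le> (\<Sum>n=1..M. (1 - r) / 4 * (Y n * exp (\<delta> * real n)))"
        by (intro sum_mono step) auto
      also have "\<dots> = (1 - r) / 4 * (\<Sum>n=1..M. Y n * exp (\<delta> * real n))"
        by (simp add: sum_distrib_left)
      also have "\<dots> \<le> (1 - r) / 4 * (S N * (2 / (1 - r)))"
      proof (intro mult_left_mono order_trans[OF conv])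
        show "S M * (2 / (1 - r)) \<le> S N * (2 / (1 - r))"
          using r N by (intro mult_right_mono S_mono) auto
      qed (use r in auto)
      also have "\<dots> = S N / 2" using r by (simp add: field_simps)
      finally have "S N \<le> S K + S N / 2" by simp
      then show ?thesis using S_small[of K] by simp
    qed
    then show ?thesis by (simp add: S_def)
  qed
  show ?thesis
    \<comment> \<open>The summand 1 makes the constant strictly positive.\<close>
    by (rule that[OF \<delta>, of "2 * A0 + 1"]) (use A0 main in auto)
qed

section \<open>The renewal equation in the level and its critical point\<close>

definition bridge_mass :: "'d::finite \<Rightarrow> (nat \<Rightarrow> real) \<Rightarrow> real \<Rightarrow> real \<Rightarrow> ennreal" where
  "bridge_mass i0 \<psi> z h = mass (wt i0 \<psi> z h) (bridges i0)"

definition irr_mass :: "'d::finite \<Rightarrow> (nat \<Rightarrow> real) \<Rightarrow> real \<Rightarrow> real \<Rightarrow> ennreal" where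
  "irr_mass i0 \<psi> z h = mass (wt i0 \<psi> z h) (irreducible_bridges i0)"

definition irr_at :: "'d::finite \<Rightarrow> nat \<Rightarrow> (int ^ 'd) list set" where
  "irr_at i0 L = {xs \<in> irreducible_bridges i0. lev i0 xs = int L}"

lemma mass_UN_le:
  "finite I \<Longrightarrow> mass w (\<Union>i\<in>I. A i) \<le> (\<Sum>i\<in>I. mass w (A i))"
proof (induction I rule: finite_induct)
  case (insert i I)
  have "mass w (\<Union>j\<in>insert i I. A j) = mass w (A i \<union> ((\<Union>j\<in>I. A j) - A i))"
    by (rule arg_cong[of _ _ "mass w"]) auto
  also have "\<dots> = mass w (A i) + mass w ((\<Union>j\<in>I. A j) - A i)"
    by (rule mass_Un_disjoint) auto
  also have "\<dots> \<le> mass w (A i) + mass w (\<Union>j\<in>I. A j)"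
    by (intro add_mono mass_mono) auto
  also have "\<dots> \<le> mass w (A i) + (\<Sum>j\<in>I. mass w (A j))"
    using insert.IH by (intro add_mono) auto
  finally show ?case
    using insert.hyps by simp
qed simp

text \<open>The reciprocal of the sum of \<open>exp (- 1) / (D * L)\<close> over \<open>L\<close> in
  \<open>{1..K}\<close>, which bounds the bridge mass at distance \<open>1 / K\<close> below the
  critical tilt from below. It tends to 0 because the harmonic series diverges.\<close>

definition eta :: "real \<Rightarrow> nat \<Rightarrow> real" where
  "eta D K = D * exp 1 / harm K"

lemma eta_nonneg: "0 \<le> D \<Longrightarrow> 0 \<le> eta D K"
  by (simp add: eta_def harm_nonneg)

lemma eta_tendsto: "eta D \<longlonglongrightarrow> 0"
proof -
  have "(\<lambda>K. D * exp 1 / (harm K :: real)) \<longlonglongrightarrow> 0"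
    by (rule tendsto_divide_0[OF tendsto_const filterlim_at_top_imp_at_infinity[OF harm_at_top]])
  then show ?thesis
    by (simp add: eta_def[abs_def])
qed

context weighted_walk
begin

lemma renewal: "bridge_mass i0 \<psi> z h = 1 + irr_mass i0 \<psi> z h * bridge_mass i0 \<psi> z h"
proof -
  let ?w = "wt i0 \<psi> z h" and ?P = "irreducible_bridges i0 \<times> bridges i0"
  have "bridge_mass i0 \<psi> z h = mass ?w (insert [] ((\<lambda>p. fst p @ snd p) ` ?P))"
    unfolding bridge_mass_def by (rule arg_cong[OF bridges_eq])
  also have "\<dots> = ennreal (?w []) + mass ?w ((\<lambda>p. fst p @ snd p) ` ?P)"
    by (rule mass_insert) (auto dest: irreducible_bridgesD(2))
  also have "mass ?w ((\<lambda>p. fst p @ snd p) ` ?P) = mass (\<lambda>p. ?w (fst p @ snd p)) ?P"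
    by (rule mass_inj_image[OF inj_on_irreducible_append])
  also have "\<dots> = mass (\<lambda>p. ?w (fst p) * ?w (snd p)) ?P"
    by (intro mass_cong wt_bridge_append) (auto dest: irreducible_bridgesD(1))
  also have "\<dots> = irr_mass i0 \<psi> z h * bridge_mass i0 \<psi> z h"
    unfolding irr_mass_def bridge_mass_def by (rule mass_Times) (simp add: wt_nonneg)
  finally show ?thesis
    unfolding wt_Nil ennreal_1 .
qed

lemma mass_wt_bridges_at: "mass (wt i0 \<psi> z h) (bridges_at i0 L) = ennreal (exp (h * real L) * brm i0 \<psi> z L)"
proof -
  have "mass (wt i0 \<psi> z h) (bridges_at i0 L) = mass (\<lambda>xs. exp (h * real L) * wt i0 \<psi> z 0 xs) (bridges_at i0 L)"
  proof (rule mass_cong)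
    fix xs assume "xs \<in> bridges_at i0 L"
    then have "lev i0 xs = int L" by (simp add: bridges_at_def)
    from wt_shift[OF this, of h 0] show "wt i0 \<psi> z h xs = exp (h * real L) * wt i0 \<psi> z 0 xs"
      by (simp only: add_0_right)
  qed
  also have "\<dots> = ennreal (exp (h * real L)) * ennreal (brm i0 \<psi> z L)"
    by (subst mass_cmult) (simp_all add: mass_bridges_at)
  finally show ?thesis by (simp add: ennreal_mult brm_nonneg)
qed

lemma bridge_mass_series: "bridge_mass i0 \<psi> z h = (\<Sum>L. ennreal (exp (h * real L) * brm i0 \<psi> z L))"
proof -
  have "bridge_mass i0 \<psi> z h = (\<Sum>L. mass (wt i0 \<psi> z h) {xs \<in> bridges i0. nat (lev i0 xs) = L})"
    unfolding bridge_mass_def by (rule mass_split)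
  also have "\<dots> = (\<Sum>L. mass (wt i0 \<psi> z h) (bridges_at i0 L))"
  proof (intro suminf_cong arg_cong[of _ _ "mass (wt i0 \<psi> z h)"])
    fix L
    show "{xs \<in> bridges i0. nat (lev i0 xs) = L} = bridges_at i0 L"
      using bridge_lev_nonneg by (force simp: bridges_at_def)
  qed
  finally show ?thesis by (simp add: mass_wt_bridges_at)
qed

lemma bridge_mass_finite:
  assumes "h < alpha i0 \<psi> z"
  shows "bridge_mass i0 \<psi> z h < \<infinity>"
proof -
  let ?q = "exp (h - alpha i0 \<psi> z)"
  have q: "0 < ?q" "?q < 1" using assms by auto
  have "bridge_mass i0 \<psi> z h \<le> (\<Sum>L. ennreal (?q ^ L))"
    unfolding bridge_mass_series
  proof (intro suminf_le ennreal_leI)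
    fix L
    have "exp (h * real L) * brm i0 \<psi> z L \<le> exp (h * real L) * exp (- alpha i0 \<psi> z * real L)"
      by (intro mult_left_mono brm_le_alpha) simp
    also have "\<dots> = ?q ^ L"
      by (simp add: exp_of_nat_mult[symmetric] exp_add[symmetric] algebra_simps)
    finally show "exp (h * real L) * brm i0 \<psi> z L \<le> ?q ^ L" .
  qed auto
  also have "\<dots> = ennreal (\<Sum>L. ?q ^ L)"
    using q by (intro suminf_ennreal2 summable_geometric) auto
  finally have le: "bridge_mass i0 \<psi> z h \<le> ennreal (\<Sum>L. ?q ^ L)" .
  show ?thesis
    by (rule le_less_trans[OF le]) simp
qed

text \<open>At tilt \<open>alpha - 1 / K\<close> the factor lost on the heights up to
  \<open>K\<close> is at least \<open>exp (- 1)\<close>, and at \<open>alpha\<close> itself the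
  height \<open>L\<close> contributes at least \<open>1 / (2 d L)\<close> by
  \<open>sbm_ge_alpha\<close>.\<close>

lemma bridge_mass_lower:
  assumes "1 \<le> K"
  shows "ennreal (1 / eta (2 * real CARD('d)) K) \<le> bridge_mass i0 \<psi> z (alpha i0 \<psi> z - 1 / real K)"
proof -
  let ?h = "alpha i0 \<psi> z - 1 / real K" and ?D = "2 * real CARD('d)"
  have "1 / eta ?D K = (\<Sum>L=1..K. exp (- 1) / (?D * real L))"
    by (simp add: eta_def harm_def exp_minus sum_divide_distrib[symmetric] sum_distrib_left inverse_eq_divide sum_distrib_right field_simps)
  also have "\<dots> \<le> (\<Sum>L=1..K. exp (?h * real L) * brm i0 \<psi> z L)"
  proof (rule sum_mono)
    fix L assume L: "L \<in> {1..K}"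
    have "exp (- 1) \<le> exp (- (1 / real K) * real L)"
      using L by (simp add: field_simps)
    then have "exp (- 1) / (?D * real L) \<le> exp (- (1 / real K) * real L) / (?D * real L)"
      using L by (intro divide_right_mono) auto
    also have "\<dots> = exp (?h * real L) * (exp (- alpha i0 \<psi> z * real L) / (?D * real L))"
      by (simp add: exp_add[symmetric] algebra_simps)
    also have "\<dots> \<le> exp (?h * real L) * brm i0 \<psi> z L"
      using sbm_ge_alpha[of L] sbm_le_brm[of L] L by (intro mult_left_mono) auto
    finally show "exp (- 1) / (?D * real L) \<le> exp (?h * real L) * brm i0 \<psi> z L" .
  qed
  finally have "ennreal (1 / eta ?D K) \<le> ennreal (\<Sum>L=1..K. exp (?h * real L) * brm i0 \<psi> z L)"
    by (rule ennreal_leI)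
  also have "\<dots> = (\<Sum>L=1..K. ennreal (exp (?h * real L) * brm i0 \<psi> z L))"
    by (rule sum_ennreal[symmetric]) (simp add: brm_nonneg)
  also have "\<dots> \<le> bridge_mass i0 \<psi> z ?h"
    unfolding bridge_mass_series by (rule sum_le_suminf) auto
  finally show ?thesis .
qed

text \<open>The renewal equation solved for the irreducible mass, after ruling out infinite
  values.\<close>

lemma irr_mass_real:
  assumes "bridge_mass i0 \<psi> z h < \<infinity>"
  obtains u where "1 \<le> u" "bridge_mass i0 \<psi> z h = ennreal u" "irr_mass i0 \<psi> z h = ennreal (1 - 1 / u)"
proof -
  obtain u where u: "bridge_mass i0 \<psi> z h = ennreal u" "0 \<le> u"
    using assms by (cases "bridge_mass i0 \<psi> z h") auto
  have u1: "1 \<le> u"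
  proof -
    have "(1::ennreal) \<le> 1 + irr_mass i0 \<psi> z h * bridge_mass i0 \<psi> z h" by simp
    then have "1 \<le> bridge_mass i0 \<psi> z h"
      using renewal[of h] by metis
    then show ?thesis using u by (simp add: ennreal_ge_1)
  qed
  have eq: "ennreal u = 1 + irr_mass i0 \<psi> z h * ennreal u"
    using renewal[of h] unfolding u(1) .
  have "irr_mass i0 \<psi> z h \<noteq> top"
  proof
    assume "irr_mass i0 \<psi> z h = top"
    then have "ennreal u = top"
      using eq u1 by (simp add: ennreal_top_mult)
    then show False by simp
  qed
  then obtain f where f: "irr_mass i0 \<psi> z h = ennreal f" "0 \<le> f"
    by (cases "irr_mass i0 \<psi> z h") auto
  have "ennreal u = ennreal (1 + f * u)"
    using eq u f by (simp add: ennreal_mult'' ennreal_plus)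
  then have "u = 1 + f * u"
    using u f by (subst (asm) ennreal_inj) auto
  then have fu: "f * u = u - 1"
    by linarith
  have "f = f * u / u"
    using u1 by simp
  also have "\<dots> = 1 - 1 / u"
    unfolding fu using u1 by (simp add: diff_divide_distrib)
  finally have "f = 1 - 1 / u" .
  then show ?thesis
    using that u u1 f by blast
qed

lemma irr_mass_ge:
  assumes "1 \<le> K"
  shows "ennreal (1 - eta (2 * real CARD('d)) K) \<le> irr_mass i0 \<psi> z (alpha i0 \<psi> z - 1 / real K)"
proof -
  let ?h = "alpha i0 \<psi> z - 1 / real K" and ?e = "eta (2 * real CARD('d)) K"
  have "bridge_mass i0 \<psi> z ?h < \<infinity>"
    using assms by (intro bridge_mass_finite) auto
  then obtain u where u: "1 \<le> u" "bridge_mass i0 \<psi> z ?h = ennreal u" "irr_mass i0 \<psi> z ?h = ennreal (1 - 1 / u)"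
    by (rule irr_mass_real)
  have "1 / ?e \<le> u"
    using bridge_mass_lower[OF assms] u by (simp add: ennreal_le_iff)
  moreover have "0 < ?e"
    using D_pos harm_pos[of K] assms by (simp add: eta_def)
  ultimately have "1 / u \<le> ?e"
    using u by (simp add: field_simps)
  then show ?thesis
    unfolding u(3) by (intro ennreal_leI) simp
qed

lemma wt_mono_irr: "xs \<in> irreducible_bridges i0 \<Longrightarrow> h \<le> h' \<Longrightarrow> wt i0 \<psi> z h xs \<le> wt i0 \<psi> z h' xs"
  by (rule wt_mono_h[OF bridge_lev_nonneg[OF irreducible_bridgesD(1)]])

lemma irr_mass_mono: "h \<le> h' \<Longrightarrow> irr_mass i0 \<psi> z h \<le> irr_mass i0 \<psi> z h'"
  unfolding irr_mass_def by (intro mass_mono wt_mono_irr) auto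

text \<open>Below \<open>alpha\<close> the irreducible mass is 1 - 1 / u with u the bridge mass,
  hence less than one, and monotone convergence keeps the bound at \<open>alpha\<close>. It is not
  smaller, since u is at least \<open>1 / eta\<close>, which is unbounded.\<close>

lemma irr_mass_alpha: "irr_mass i0 \<psi> z (alpha i0 \<psi> z) = 1"
proof (rule antisym)
  let ?a = "alpha i0 \<psi> z"
  show le: "irr_mass i0 \<psi> z ?a \<le> 1"
    unfolding irr_mass_def
  proof (rule mass_limit[where w = "\<lambda>k. wt i0 \<psi> z (?a - 1 / real (Suc k))"])
    fix xs assume xs: "xs \<in> irreducible_bridges i0"
    show "incseq (\<lambda>k. wt i0 \<psi> z (?a - 1 / real (Suc k)) xs)"
      using xs by (auto simp: incseq_def intro!: wt_mono_irr frac_le)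
    have "(\<lambda>k. ?a - 1 / real (Suc k)) \<longlonglongrightarrow> ?a - 0"
      by (intro tendsto_intros LIMSEQ_Suc lim_1_over_n)
    then show "(\<lambda>k. wt i0 \<psi> z (?a - 1 / real (Suc k)) xs) \<longlonglongrightarrow> wt i0 \<psi> z ?a xs"
      unfolding wt_def by (auto intro!: tendsto_intros)
  next
    fix k
    have "bridge_mass i0 \<psi> z (?a - 1 / real (Suc k)) < \<infinity>"
      by (intro bridge_mass_finite) auto
    then obtain u where "1 \<le> u" "irr_mass i0 \<psi> z (?a - 1 / real (Suc k)) = ennreal (1 - 1 / u)"
      by (rule irr_mass_real)
    then show "mass (wt i0 \<psi> z (?a - 1 / real (Suc k))) (irreducible_bridges i0) \<le> 1"
      unfolding irr_mass_def[symmetric] by simp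
  qed (simp add: wt_nonneg)
  show "1 \<le> irr_mass i0 \<psi> z ?a"
  proof (rule tendsto_upperbound)
    have "(\<lambda>K. ennreal (1 - eta (2 * real CARD('d)) K)) \<longlonglongrightarrow> ennreal (1 - 0)"
      by (intro tendsto_ennrealI tendsto_intros eta_tendsto)
    then show "(\<lambda>K. ennreal (1 - eta (2 * real CARD('d)) K)) \<longlonglongrightarrow> 1" by simp
    show "\<forall>\<^sub>F K in sequentially. ennreal (1 - eta (2 * real CARD('d)) K) \<le> irr_mass i0 \<psi> z ?a"
      using eventually_ge_at_top[of 1]
    proof eventually_elim
      case (elim K)
      have "ennreal (1 - eta (2 * real CARD('d)) K) \<le> irr_mass i0 \<psi> z (?a - 1 / real K)"
        using elim by (rule irr_mass_ge)
      also have "\<dots> \<le> irr_mass i0 \<psi> z ?a"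
        using elim by (intro irr_mass_mono) auto
      finally show ?case .
    qed
  qed simp
qed

end

section \<open>The mass gap\<close>

text \<open>Tilted by the critical value \<open>alpha\<close>, where by
  \<open>irr_mass_alpha\<close> these masses form a probability distribution of the height of an
  irreducible bridge.\<close>

definition irm :: "'d::finite \<Rightarrow> (nat \<Rightarrow> real) \<Rightarrow> real \<Rightarrow> nat \<Rightarrow> real" where
  "irm i0 \<psi> z L = enn2real (mass (wt i0 \<psi> z (alpha i0 \<psi> z)) (irr_at i0 L))"

definition split_pairs :: "'d::finite \<Rightarrow> nat \<Rightarrow> ((int ^ 'd) list \<times> (int ^ 'd) list) set" where
  "split_pairs i0 L = {(a, c). a \<in> irreducible_bridges i0 \<and> c \<in> bridges i0 \<and> lev i0 a + lev i0 c = int L}"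

context weighted_walk
begin

abbreviation "al \<equiv> alpha i0 \<psi> z"

lemma mass_irr_at: "mass (wt i0 \<psi> z al) (irr_at i0 L) = ennreal (irm i0 \<psi> z L)"
  and irm_nonneg: "0 \<le> irm i0 \<psi> z L" and irm_le_1: "irm i0 \<psi> z L \<le> 1"
proof -
  have "mass (wt i0 \<psi> z al) (irr_at i0 L) \<le> irr_mass i0 \<psi> z al"
    unfolding irr_mass_def by (intro mass_mono) (auto simp: irr_at_def)
  then have le: "mass (wt i0 \<psi> z al) (irr_at i0 L) \<le> 1"
    by (simp add: irr_mass_alpha)
  then have "mass (wt i0 \<psi> z al) (irr_at i0 L) < top"
    by (rule le_less_trans) simp
  then show eq: "mass (wt i0 \<psi> z al) (irr_at i0 L) = ennreal (irm i0 \<psi> z L)"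
    unfolding irm_def by (rule ennreal_enn2real[symmetric])
  show "0 \<le> irm i0 \<psi> z L" by (simp add: irm_def)
  show "irm i0 \<psi> z L \<le> 1" using le unfolding eq by simp
qed

text \<open>Lowering the tilt from \<open>alpha\<close> by \<open>1 / K\<close> loses at most
  \<open>eta\<close> of the total mass one, by \<open>irr_mass_ge\<close>, while the bridges of
  height \<open>K\<close> alone lose the fraction \<open>1 - exp (- 1)\<close> of their
  mass.\<close>

lemma irm_le_eta:
  assumes "1 \<le> K"
  shows "irm i0 \<psi> z K \<le> eta (2 * real CARD('d)) K / (1 - exp (- 1))"
proof -
  let ?e = "eta (2 * real CARD('d)) K" and ?c = "1 - exp (- 1) :: real" and ?I = "irreducible_bridges i0"
  have c: "0 < ?c" "?c \<le> 1" by simp_all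
  have "irm i0 \<psi> z K * ?c \<le> ?e"
  proof (cases "?e \<le> 1")
    case True
    have "ennreal (1 - ?e + ?c * irm i0 \<psi> z K) = ennreal (1 - ?e) + ennreal ?c * mass (wt i0 \<psi> z al) {xs \<in> ?I. lev i0 xs = int K}"
      using True c irm_nonneg[of K] mass_irr_at[of K] by (simp add: ennreal_mult ennreal_plus irr_at_def)
    also have "\<dots> \<le> irr_mass i0 \<psi> z (al - 1 / real K) + ennreal ?c * mass (wt i0 \<psi> z al) {xs \<in> ?I. lev i0 xs = int K}"
      by (intro add_right_mono irr_mass_ge assms)
    also have "\<dots> = mass (\<lambda>xs. wt i0 \<psi> z (al - 1 / real K) xs + ?c * (wt i0 \<psi> z al xs * of_bool (lev i0 xs = int K))) ?I"
    proof -
      have "mass (\<lambda>xs. ?c * (wt i0 \<psi> z al xs * of_bool (lev i0 xs = int K))) ?I =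
          ennreal ?c * mass (wt i0 \<psi> z al) {xs \<in> ?I. lev i0 xs = int K}"
        using c by (subst mass_cmult) (simp_all add: mass_restrict)
      then show ?thesis
        unfolding irr_mass_def using c by (subst mass_add) (simp_all add: wt_nonneg)
    qed
    also have "\<dots> \<le> mass (wt i0 \<psi> z al) ?I"
    proof (rule mass_mono)
      fix xs assume xs: "xs \<in> ?I"
      show "wt i0 \<psi> z (al - 1 / real K) xs + ?c * (wt i0 \<psi> z al xs * of_bool (lev i0 xs = int K)) \<le> wt i0 \<psi> z al xs"
      proof (cases "lev i0 xs = int K")
        case True
        have "wt i0 \<psi> z (- (1 / real K) + al) xs = exp (- (1 / real K) * real K) * wt i0 \<psi> z al xs"
          by (rule wt_shift[OF True])
        then have "wt i0 \<psi> z (al - 1 / real K) xs = exp (- 1) * wt i0 \<psi> z al xs"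
          using assms by simp
        then show ?thesis using True by (simp add: algebra_simps)
      next
        case False
        have "wt i0 \<psi> z (al - 1 / real K) xs \<le> wt i0 \<psi> z al xs"
          by (rule wt_mono_irr[OF xs]) simp
        then show ?thesis using False by simp
      qed
    qed simp
    also have "\<dots> = ennreal 1"
      using irr_mass_alpha by (simp add: irr_mass_def)
    finally have "1 - ?e + ?c * irm i0 \<psi> z K \<le> 1"
      by (subst (asm) ennreal_le_iff) auto
    then show ?thesis by (simp add: mult.commute)
  next
    case False
    have "irm i0 \<psi> z K * ?c \<le> 1 * 1"
      using irm_le_1 irm_nonneg c by (intro mult_mono) auto
    then show ?thesis using False by simp
  qed
  then show ?thesis using c by (simp add: pos_le_divide_eq)
qed

text \<open>The power of \<open>r\<close> is the share of this pair in the cost of the loop, which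
  is at least as long as the overlapping bridges are high.\<close>

definition pair_wt :: "real \<Rightarrow> (int ^ 'd) list \<times> (int ^ 'd) list \<Rightarrow> real" where
  "pair_wt r p = wt i0 \<psi> z al (fst p) * (wt i0 \<psi> z al (snd p) * r ^ nat (lev i0 (snd p)))"

lemma pair_wt_nonneg: "0 \<le> r \<Longrightarrow> 0 \<le> pair_wt r p"
  by (simp add: pair_wt_def wt_nonneg)

text \<open>Tilted by \<open>alpha\<close>, the bridges of one height have mass at most one by
  \<open>brm_le_alpha\<close>, so only the geometric factor remains of the second component.\<close>

lemma mass_split_pairs:
  assumes "0 \<le> r"
  shows "mass (pair_wt r) (split_pairs i0 L) \<le> ennreal (\<Sum>k=1..L. irm i0 \<psi> z k * r ^ (L - k))"
proof -
  have sub: "split_pairs i0 L \<subseteq> (\<Union>k\<in>{1..L}. irr_at i0 k \<times> bridges_at i0 (L - k))"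
  proof
    fix p assume "p \<in> split_pairs i0 L"
    then obtain a c where p: "p = (a, c)" "a \<in> irreducible_bridges i0" "c \<in> bridges i0" "lev i0 a + lev i0 c = int L"
      by (auto simp: split_pairs_def)
    have "0 < lev i0 a" "0 \<le> lev i0 c"
      using p irreducible_bridgesD bridge_lev_pos bridge_lev_nonneg by blast+
    then show "p \<in> (\<Union>k\<in>{1..L}. irr_at i0 k \<times> bridges_at i0 (L - k))"
      using p by (intro UN_I[of "nat (lev i0 a)"]) (auto simp: irr_at_def bridges_at_def)
  qed
  have each: "mass (pair_wt r) (irr_at i0 k \<times> bridges_at i0 M) \<le> ennreal (irm i0 \<psi> z k * r ^ M)" for k M
  proof -
    have "mass (pair_wt r) (irr_at i0 k \<times> bridges_at i0 M) =
        mass (\<lambda>p. wt i0 \<psi> z al (fst p) * (r ^ M * wt i0 \<psi> z al (snd p))) (irr_at i0 k \<times> bridges_at i0 M)"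
      by (rule mass_cong) (auto simp: pair_wt_def bridges_at_def)
    also have "\<dots> = ennreal (irm i0 \<psi> z k) * (ennreal (r ^ M) * ennreal (exp (al * real M) * brm i0 \<psi> z M))"
      using mass_Times[of "wt i0 \<psi> z al" "\<lambda>c. r ^ M * wt i0 \<psi> z al c" "irr_at i0 k" "bridges_at i0 M"] assms
      by (simp add: wt_nonneg mass_irr_at mass_cmult mass_wt_bridges_at)
    also have "\<dots> \<le> ennreal (irm i0 \<psi> z k) * (ennreal (r ^ M) * ennreal 1)"
    proof (intro mult_left_mono ennreal_leI)
      have "exp (al * real M) * brm i0 \<psi> z M \<le> exp (al * real M) * exp (- al * real M)"
        by (intro mult_left_mono brm_le_alpha) simp
      then show "exp (al * real M) * brm i0 \<psi> z M \<le> 1"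
        by (simp add: exp_add[symmetric])
    qed auto
    also have "\<dots> = ennreal (irm i0 \<psi> z k * r ^ M)"
      using assms irm_nonneg by (simp add: ennreal_mult)
    finally show ?thesis .
  qed
  have "mass (pair_wt r) (split_pairs i0 L) \<le> mass (pair_wt r) (\<Union>k\<in>{1..L}. irr_at i0 k \<times> bridges_at i0 (L - k))"
    by (rule mass_mono[OF sub]) simp
  also have "\<dots> \<le> (\<Sum>k=1..L. mass (pair_wt r) (irr_at i0 k \<times> bridges_at i0 (L - k)))"
    by (rule mass_UN_le) simp
  also have "\<dots> \<le> (\<Sum>k=1..L. ennreal (irm i0 \<psi> z k * r ^ (L - k)))"
    by (intro sum_mono each)
  also have "\<dots> = ennreal (\<Sum>k=1..L. irm i0 \<psi> z k * r ^ (L - k))"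
    using assms irm_nonneg by (intro sum_ennreal) simp
  finally show ?thesis .
qed

text \<open>Under \<open>z \<le> r * r\<close> every step of the loop supplies two factors
  \<open>r\<close>. One pays for the heights of the two overlapping bridges, through the length
  bound of \<open>irreducible_split\<close>; the other makes the sum over all loops converge to at
  most \<open>1 / (1 - r)\<close>.\<close>

lemma irm_split:
  assumes "z \<le> r * r" "0 < r" "r < 1" "1 \<le> L" "1 \<le> M"
  shows "irm i0 \<psi> z (L + M) \<le> 1 / (1 - r) * (\<Sum>k=1..L. irm i0 \<psi> z k * r ^ (L - k)) * (\<Sum>k=1..M. irm i0 \<psi> z k * r ^ (M - k))"
proof -
  let ?Q = "{q \<in> lists (unit_vecs :: (int ^ 'd) set). 0 \<le> length q}"
  let ?B = "{(p, q, s) \<in> split_pairs i0 L \<times> ?Q \<times> split_pairs i0 M. lev i0 (snd p) + lev i0 (snd s) \<le> int (length q)}"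
  let ?F = "\<lambda>(p, q, s). (fst p @ snd p) @ q @ (snd s @ fst s)"
  let ?G = "\<lambda>t. pair_wt r (fst t) * (kap r (fst (snd t)) * pair_wt r (snd (snd t)))"
  have "mass (wt i0 \<psi> z al) (irr_at i0 (L + M)) \<le> mass ?G ({t \<in> split_pairs i0 L \<times> ?Q \<times> split_pairs i0 M. t \<in> ?B \<and> lev i0 (fst (snd t)) = 0})"
  proof (rule mass_cover[where F = ?F], rule subsetI)
    fix xs assume "xs \<in> irr_at i0 (L + M)"
    then have "xs \<in> irreducible_bridges i0" "lev i0 xs = int L + int M" "0 < int L" "0 < int M"
      using assms by (auto simp: irr_at_def)
    from irreducible_split[OF this] obtain a c q c' a' where
      *: "a \<in> irreducible_bridges i0" "c \<in> bridges i0" "q \<in> lists unit_vecs" "c' \<in> bridges i0" "a' \<in> irreducible_bridges i0"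
        "xs = (a @ c) @ q @ (c' @ a')" "lev i0 (a @ c) = int L" "lev i0 q = 0" "lev i0 (c' @ a') = int M"
        "lev i0 c + lev i0 c' \<le> int (length q)"
      by blast
    show "xs \<in> ?F ` {t \<in> split_pairs i0 L \<times> ?Q \<times> split_pairs i0 M. t \<in> ?B \<and> lev i0 (fst (snd t)) = 0}"
      by (rule image_eqI[of _ _ "((a, c), q, (a', c'))"]) (use * in \<open>auto simp: split_pairs_def\<close>)
  next
    fix t assume "t \<in> {t \<in> split_pairs i0 L \<times> ?Q \<times> split_pairs i0 M. t \<in> ?B \<and> lev i0 (fst (snd t)) = 0}"
    then obtain a c q a' c' where t: "t = ((a, c), q, (a', c'))"
      "a \<in> irreducible_bridges i0" "c \<in> bridges i0" "a' \<in> irreducible_bridges i0" "c' \<in> bridges i0" "lev i0 q = 0"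
      "lev i0 c + lev i0 c' \<le> int (length q)"
      by (auto simp: split_pairs_def)
    have c0: "0 \<le> lev i0 c" "0 \<le> lev i0 c'" using t bridge_lev_nonneg by blast+
    have br: "a \<in> bridges i0" "a' \<in> bridges i0" using t irreducible_bridgesD by blast+
    have len: "nat (lev i0 c) + nat (lev i0 c') \<le> length q" using t(7) c0 by linarith
    have "kap z q = (z / (2 * real CARD('d))) ^ length q" by (simp add: kap_def)
    also have "\<dots> \<le> (r * (r / (2 * real CARD('d)))) ^ length q"
      using assms z_pos by (intro power_mono) (auto simp: divide_right_mono)
    also have "\<dots> = r ^ length q * kap r q" by (simp only: kap_def power_mult_distrib)
    also have "\<dots> \<le> r ^ (nat (lev i0 c) + nat (lev i0 c')) * kap r q"
      using assms len by (intro mult_right_mono power_decreasing kap_nonneg) auto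
    finally have k: "kap z q \<le> r ^ nat (lev i0 c) * r ^ nat (lev i0 c') * kap r q"
      by (simp add: power_add)
    have "wt i0 \<psi> z al ((a @ c) @ q @ (c' @ a')) \<le> wt i0 \<psi> z al (a @ c) * (kap z q * wt i0 \<psi> z al (c' @ a'))"
      using t br by (intro wt_append3_le bridge_append) auto
    also have "\<dots> \<le> wt i0 \<psi> z al (a @ c) * ((r ^ nat (lev i0 c) * r ^ nat (lev i0 c') * kap r q) * wt i0 \<psi> z al (c' @ a'))"
      by (intro mult_left_mono mult_right_mono k wt_nonneg)
    also have "\<dots> = ?G t"
      unfolding wt_bridge_append[OF br(1) t(3)] wt_bridge_append[OF t(5) br(2)]
      by (simp add: pair_wt_def t(1) mult_ac)
    finally show "wt i0 \<psi> z al (?F t) \<le> ?G t" by (simp add: t(1))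
  qed
  also have "\<dots> \<le> mass ?G (split_pairs i0 L \<times> ?Q \<times> split_pairs i0 M)"
    by (rule mass_mono) auto
  also have "\<dots> = mass (pair_wt r) (split_pairs i0 L) * (mass (kap r) ?Q * mass (pair_wt r) (split_pairs i0 M))"
    using mass_Times[of "pair_wt r" "\<lambda>p. kap r (fst p) * pair_wt r (snd p)" "split_pairs i0 L" "?Q \<times> split_pairs i0 M"]
      mass_Times[of "kap r" "pair_wt r" ?Q "split_pairs i0 M"] assms
    by (simp add: pair_wt_nonneg kap_nonneg)
  also have "\<dots> \<le> ennreal (\<Sum>k=1..L. irm i0 \<psi> z k * r ^ (L - k)) * (ennreal (r ^ 0 / (1 - r)) * ennreal (\<Sum>k=1..M. irm i0 \<psi> z k * r ^ (M - k)))"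
    using assms by (intro mult_mono mass_split_pairs mass_kap_ge) auto
  also have "\<dots> = ennreal (1 / (1 - r) * (\<Sum>k=1..L. irm i0 \<psi> z k * r ^ (L - k)) * (\<Sum>k=1..M. irm i0 \<psi> z k * r ^ (M - k)))"
  proof -
    have "0 \<le> (\<Sum>k=1..L. irm i0 \<psi> z k * r ^ (L - k))" for L
      using assms irm_nonneg by (intro sum_nonneg) auto
    then show ?thesis
      using assms by (simp add: ennreal_mult[symmetric] mult_ac)
  qed
  finally show ?thesis
    unfolding mass_irr_at
    using assms irm_nonneg by (subst (asm) ennreal_le_iff) (auto intro!: mult_nonneg_nonneg divide_nonneg_nonneg sum_nonneg)
qed

lemma irr_mass_le_sum:
  assumes "\<And>N. (\<Sum>m=1..N. irm i0 \<psi> z m * exp (\<delta> * real m)) \<le> A"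
  shows "irr_mass i0 \<psi> z (al + \<delta>) \<le> ennreal A"
proof -
  have "irr_mass i0 \<psi> z (al + \<delta>) = (\<Sum>L. mass (wt i0 \<psi> z (al + \<delta>)) {xs \<in> irreducible_bridges i0. nat (lev i0 xs) = L})"
    unfolding irr_mass_def by (rule mass_split)
  also have "\<dots> = (\<Sum>L. ennreal (irm i0 \<psi> z L * exp (\<delta> * real L)))"
  proof (rule suminf_cong)
    fix L
    have eq: "{xs \<in> irreducible_bridges i0. nat (lev i0 xs) = L} = irr_at i0 L"
      using bridge_lev_nonneg irreducible_bridgesD by (force simp: irr_at_def)
    have "mass (wt i0 \<psi> z (al + \<delta>)) (irr_at i0 L) = mass (\<lambda>xs. exp (\<delta> * real L) * wt i0 \<psi> z al xs) (irr_at i0 L)"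
    proof (rule mass_cong)
      fix xs assume "xs \<in> irr_at i0 L"
      then have "lev i0 xs = int L" by (simp add: irr_at_def)
      from wt_shift[OF this, of \<delta> al] show "wt i0 \<psi> z (al + \<delta>) xs = exp (\<delta> * real L) * wt i0 \<psi> z al xs"
        by (simp only: add.commute)
    qed
    also have "\<dots> = ennreal (irm i0 \<psi> z L * exp (\<delta> * real L))"
      by (simp add: mass_cmult mass_irr_at ennreal_mult irm_nonneg mult.commute)
    finally show "mass (wt i0 \<psi> z (al + \<delta>)) {xs \<in> irreducible_bridges i0. nat (lev i0 xs) = L} = ennreal (irm i0 \<psi> z L * exp (\<delta> * real L))"
      unfolding eq .
  qed
  also have "\<dots> = (SUP N. \<Sum>L<N. ennreal (irm i0 \<psi> z L * exp (\<delta> * real L)))"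
    by (rule suminf_eq_SUP)
  also have "\<dots> \<le> ennreal A"
  proof (rule SUP_least)
    fix N
    have "irr_at i0 0 = {}"
      using irreducible_bridgesD bridge_lev_pos by (fastforce simp: irr_at_def)
    then have "irm i0 \<psi> z 0 = 0" by (simp add: irm_def)
    have "(\<Sum>L<N. irm i0 \<psi> z L * exp (\<delta> * real L)) \<le> (\<Sum>L\<in>insert 0 {1..N}. irm i0 \<psi> z L * exp (\<delta> * real L))"
      using irm_nonneg by (intro sum_mono2) auto
    also have "\<dots> = (\<Sum>L=1..N. irm i0 \<psi> z L * exp (\<delta> * real L))"
      using \<open>irm i0 \<psi> z 0 = 0\<close> by simp
    also have "\<dots> \<le> A" by (rule assms)
    finally show "(\<Sum>L<N. ennreal (irm i0 \<psi> z L * exp (\<delta> * real L))) \<le> ennreal A"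
      by (subst sum_ennreal) (auto simp: irm_nonneg intro!: ennreal_leI)
  qed
  finally show ?thesis .
qed

end

text \<open>Irreducible bridges decay strictly faster than bridges, whose rate is \<open>alpha\<close>.\<close>

lemma mass_gap:
  fixes i0 :: "'d::finite"
  assumes "0 < z0" "z0 < 1"
  obtains \<delta> A where "0 < \<delta>" "0 < A"
    "\<And>\<psi> z. attractive \<psi> \<Longrightarrow> 0 < z \<Longrightarrow> z \<le> z0 \<Longrightarrow> irr_mass i0 \<psi> z (alpha i0 \<psi> z + \<delta>) \<le> ennreal A"
proof -
  \<comment> \<open>The square root, since \<open>irm_split\<close> uses two factors
    \<open>r\<close> per unit of fugacity.\<close>
  define r where "r = sqrt z0"
  have r: "0 < r" "r < 1" "r * r = z0" using assms by (auto simp: r_def)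
  \<comment> \<open>This envelope depends on the dimension only, which makes \<open>\<delta>\<close>
    and \<open>A\<close> uniform in \<open>\<psi>\<close> and \<open>z\<close>.\<close>
  let ?g = "\<lambda>k. eta (2 * real CARD('d)) k / (1 - exp (- 1))"
  have g: "?g \<longlonglongrightarrow> 0"
    using tendsto_divide[OF eta_tendsto tendsto_const, of "1 - exp (- 1)" "2 * real CARD('d)"] by simp
  have g0: "0 \<le> ?g k" for k
    by (intro divide_nonneg_nonneg eta_nonneg) auto
  have C: "0 \<le> 1 / (1 - r)" using r by simp
  show thesis
  proof (rule exponential_bootstrap[OF g g0 r(1,2) C])
    fix \<delta> A :: real
    assume dA: "0 < \<delta>" "0 < A"
      and bound: "\<And>f N. \<lbrakk>\<And>k. 1 \<le> k \<Longrightarrow> 0 \<le> f k \<and> f k \<le> ?g k;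
       \<And>L M. 1 \<le> L \<Longrightarrow> 1 \<le> M \<Longrightarrow>
         f (L + M) \<le> 1 / (1 - r) * (\<Sum>k=1..L. f k * r ^ (L - k)) * (\<Sum>k=1..M. f k * r ^ (M - k))\<rbrakk> \<Longrightarrow>
       (\<Sum>m=1..N. f m * exp (\<delta> * real m)) \<le> A"
  have "irr_mass i0 \<psi> z (alpha i0 \<psi> z + \<delta>) \<le> ennreal A" if "attractive \<psi>" "0 < z" "z \<le> z0" for \<psi> z
  proof -
    interpret weighted_walk \<psi> i0 z
      using that assms by (simp add: weighted_walk_def weighted_walk_axioms_def)
    have zr: "z \<le> r * r" using that r by simp
    show ?thesis
    proof (rule irr_mass_le_sum, rule bound)
      fix k :: nat assume "1 \<le> k"
      then show "0 \<le> irm i0 \<psi> z k \<and> irm i0 \<psi> z k \<le> ?g k"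
        using irm_nonneg irm_le_eta by blast
    next
      fix L M :: nat assume "1 \<le> L" "1 \<le> M"
      then show "irm i0 \<psi> z (L + M) \<le> 1 / (1 - r) * (\<Sum>k=1..L. irm i0 \<psi> z k * r ^ (L - k)) * (\<Sum>k=1..M. irm i0 \<psi> z k * r ^ (M - k))"
        by (rule irm_split[OF zr r(1,2)])
    qed
  qed
    with dA show thesis by (rule that)
  qed
qed

section \<open>The rate of the partition function\<close>

lemma ln_le_iff: "0 < x \<Longrightarrow> ln x \<le> y \<longleftrightarrow> x \<le> exp y" for x y :: real
  by (metis exp_le_cancel_iff exp_ln)

section \<open>Partition functions over all paths\<close>

definition upaths :: "nat \<Rightarrow> (int ^ 'd) list set" where
  "upaths n = {xs \<in> lists unit_vecs. length xs = n}"

definition zhat :: "'d::finite \<Rightarrow> (nat \<Rightarrow> real) \<Rightarrow> nat \<Rightarrow> real \<Rightarrow> real" where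
  "zhat i0 \<psi> N h = (\<Sum>xs\<in>upaths N. wt i0 \<psi> 1 h xs)"

definition zrate :: "'d::finite \<Rightarrow> (nat \<Rightarrow> real) \<Rightarrow> real \<Rightarrow> real" where
  "zrate i0 \<psi> h = lim (\<lambda>N. ln (zhat i0 \<psi> N h) / real N)"

lemma finite_upaths [simp]: "finite (upaths n :: (int ^ 'd::finite) list set)"
  unfolding upaths_def by (rule finite_paths)

lemma upaths_nonempty: "(upaths n :: (int ^ 'd::finite) list set) \<noteq> {}"
proof -
  have "replicate n (axis undefined 1) \<in> (upaths n :: (int ^ 'd) list set)"
    by (auto simp: upaths_def unit_vecs_def)
  then show ?thesis by blast
qed

lemma sum_kap: "(\<Sum>xs\<in>upaths n. kap 1 (xs :: (int ^ 'd::finite) list)) = 1"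
proof -
  have "ennreal (\<Sum>xs\<in>upaths n. kap 1 (xs :: (int ^ 'd) list)) = ennreal 1"
    using mass_kap[of 1 n, where 'd = 'd] mass_finite[of "upaths n" "kap 1 :: (int ^ 'd) list \<Rightarrow> real"]
    by (simp add: upaths_def finite_paths kap_nonneg)
  then show ?thesis
    by (subst (asm) ennreal_inj) (auto intro!: sum_nonneg kap_nonneg)
qed

lemma weighted_walkI: "attractive \<psi> \<Longrightarrow> 0 < z \<Longrightarrow> z \<le> 1 \<Longrightarrow> weighted_walk \<psi> z"
  by (simp add: weighted_walk_def weighted_walk_axioms_def)

context weighted_walk
begin

lemma wt_scale: "wt i0 \<psi> z h xs = z ^ length xs * wt i0 \<psi> 1 h xs"
  by (simp add: wt_def kap_def power_divide)

lemma ww1: "weighted_walk \<psi> 1"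
  by (rule weighted_walkI[OF attractive_axioms]) auto

lemma zhat_pos: "0 < zhat i0 \<psi> N h"
  unfolding zhat_def
  by (rule sum_pos) (auto simp: upaths_nonempty intro!: weighted_walk.wt_pos[OF ww1])

lemma mass_upaths: "mass (wt i0 \<psi> z h) (upaths N) = ennreal (z ^ N * zhat i0 \<psi> N h)"
proof -
  have "mass (wt i0 \<psi> z h) (upaths N) = ennreal (\<Sum>xs\<in>upaths N. wt i0 \<psi> z h xs)"
    by (rule mass_finite) (simp_all add: wt_nonneg)
  also have "(\<Sum>xs\<in>upaths N. wt i0 \<psi> z h xs) = (\<Sum>xs\<in>upaths N. z ^ N * wt i0 \<psi> 1 h xs)"
    by (rule sum.cong[OF refl]) (subst wt_scale, simp add: upaths_def)
  finally show ?thesis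
    by (simp add: zhat_def sum_distrib_left)
qed

lemma zhat_supermult: "zhat i0 \<psi> m h * zhat i0 \<psi> n h \<le> zhat i0 \<psi> (m + n) h"
proof -
  interpret W: weighted_walk \<psi> i0 1 by (rule ww1)
  let ?w = "wt i0 \<psi> 1 h"
  have "zhat i0 \<psi> m h * zhat i0 \<psi> n h = (\<Sum>p\<in>upaths m \<times> upaths n. ?w (fst p) * ?w (snd p))"
    unfolding zhat_def sum_product sum.cartesian_product by (simp add: case_prod_beta)
  also have "\<dots> \<le> (\<Sum>p\<in>upaths m \<times> upaths n. ?w (fst p @ snd p))"
    by (intro sum_mono W.wt_append_ge)
  also have "\<dots> = (\<Sum>xs\<in>(\<lambda>p. fst p @ snd p) ` (upaths m \<times> upaths n). ?w xs)"
    by (subst sum.reindex) (auto simp: inj_on_def upaths_def)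
  also have "\<dots> \<le> (\<Sum>xs\<in>upaths (m + n). ?w xs)"
    by (rule sum_mono2) (auto simp: upaths_def finite_paths W.wt_nonneg)
  finally show ?thesis by (simp add: zhat_def)
qed

lemma zhat_le_exp: "zhat i0 \<psi> N h \<le> exp (\<bar>h\<bar> * real N)"
proof -
  have "zhat i0 \<psi> N h \<le> (\<Sum>xs\<in>upaths N. kap 1 (xs :: (int ^ 'd) list) * exp (\<bar>h\<bar> * real N))"
    unfolding zhat_def
  proof (rule sum_mono)
    fix xs :: "(int ^ 'd) list" assume xs: "xs \<in> upaths N"
    have "\<bar>real_of_int (lev i0 xs)\<bar> \<le> real N"
      using lev_bound[of xs i0] xs by (simp add: upaths_def flip: of_int_abs)
    then have "\<bar>h * of_int (lev i0 xs)\<bar> \<le> \<bar>h\<bar> * real N"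
      unfolding abs_mult by (intro mult_left_mono) auto
    then have "exp (h * of_int (lev i0 xs)) \<le> exp (\<bar>h\<bar> * real N)" by simp
    then have "kap 1 xs * exp (h * of_int (lev i0 xs)) * pot \<psi> xs \<le> kap 1 xs * exp (\<bar>h\<bar> * real N) * 1"
      by (intro mult_mono mult_left_mono pot_le_1) (auto simp: kap_nonneg less_imp_le[OF pot_pos])
    then show "wt i0 \<psi> 1 h xs \<le> kap 1 xs * exp (\<bar>h\<bar> * real N)"
      by (simp add: wt_def)
  qed
  also have "\<dots> = exp (\<bar>h\<bar> * real N)"
    by (simp add: sum_kap flip: sum_distrib_right)
  finally show ?thesis .
qed

lemma zrate_limit: "(\<lambda>N. ln (zhat i0 \<psi> N h) / real N) \<longlonglongrightarrow> zrate i0 \<psi> h"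
  and zhat_le_zrate: "1 \<le> N \<Longrightarrow> zhat i0 \<psi> N h \<le> exp (zrate i0 \<psi> h * real N)"
proof -
  obtain s where s: "(\<lambda>n. ln (zhat i0 \<psi> n h) / real n) \<longlonglongrightarrow> s" "\<And>n. 1 \<le> n \<Longrightarrow> ln (zhat i0 \<psi> n h) \<le> s * real n"
  proof (rule fekete_superadditive[of "\<lambda>n. ln (zhat i0 \<psi> n h)" "\<bar>h\<bar>"])
    fix m n :: nat
    show "ln (zhat i0 \<psi> m h) + ln (zhat i0 \<psi> n h) \<le> ln (zhat i0 \<psi> (m + n) h)"
      using zhat_supermult[of m h n] zhat_pos by (simp add: ln_mult_pos[symmetric] mult_pos_pos)
  next
    fix n :: nat
    show "ln (zhat i0 \<psi> n h) \<le> \<bar>h\<bar> * real n"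
      using zhat_le_exp[of n h] zhat_pos[of n h] by (simp add: ln_le_iff)
  qed blast
  have rate: "zrate i0 \<psi> h = s"
    unfolding zrate_def by (rule limI[OF s(1)])
  then show "(\<lambda>N. ln (zhat i0 \<psi> N h) / real N) \<longlonglongrightarrow> zrate i0 \<psi> h" using s by simp
  show "zhat i0 \<psi> N h \<le> exp (zrate i0 \<psi> h * real N)" if "1 \<le> N"
    using s(2)[OF that] zhat_pos[of N h] rate by (simp add: ln_le_iff)
qed

text \<open>A finite bridge mass u would give irreducible mass 1 - 1 / u, below the value one
  reached at \<open>alpha\<close>.\<close>

lemma bridge_mass_infinite:
  assumes "alpha i0 \<psi> z \<le> h"
  shows "bridge_mass i0 \<psi> z h = \<infinity>"
proof (rule ccontr)
  assume "bridge_mass i0 \<psi> z h \<noteq> \<infinity>"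
  then have "bridge_mass i0 \<psi> z h < \<infinity>" by (simp add: less_top)
  then obtain u where u: "1 \<le> u" "irr_mass i0 \<psi> z h = ennreal (1 - 1 / u)"
    by (rule irr_mass_real)
  have "1 \<le> irr_mass i0 \<psi> z h"
    using irr_mass_mono[OF assms] by (simp add: irr_mass_alpha)
  then show False
    unfolding u(2) using u(1) by (simp add: ennreal_ge_1)
qed

lemma mass_lists_series: "mass (wt i0 \<psi> z h) (lists unit_vecs) = (\<Sum>N. ennreal (z ^ N * zhat i0 \<psi> N h))"
proof -
  have "mass (wt i0 \<psi> z h) (lists unit_vecs) = (\<Sum>N. mass (wt i0 \<psi> z h) {xs \<in> lists unit_vecs. length xs = N})"
    by (rule mass_split)
  then show ?thesis
    by (simp only: mass_upaths upaths_def[symmetric])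
qed

text \<open>Bridges are paths: if \<open>z * exp (zrate i0 \<psi> h) < 1\<close>, the mass of all
  paths is dominated by a convergent geometric series, contrary to
  \<open>bridge_mass_infinite\<close>.\<close>

lemma zrate_ge:
  assumes "alpha i0 \<psi> z \<le> h"
  shows "- ln z \<le> zrate i0 \<psi> h"
proof (rule ccontr)
  assume "\<not> ?thesis"
  then have lt: "zrate i0 \<psi> h < - ln z" by simp
  define q where "q = z * exp (zrate i0 \<psi> h)"
  have "exp (zrate i0 \<psi> h) < exp (- ln z)" using lt by simp
  then have "z * exp (zrate i0 \<psi> h) < z * exp (- ln z)" using z_pos by simp
  then have q: "0 \<le> q" "q < 1" using z_pos by (simp_all add: q_def exp_minus)
  have "bridge_mass i0 \<psi> z h \<le> mass (wt i0 \<psi> z h) (lists unit_vecs)"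
    unfolding bridge_mass_def by (rule mass_mono) (auto dest: bridges_lists)
  also have "\<dots> \<le> (\<Sum>N. ennreal (q ^ N))"
    unfolding mass_lists_series
  proof (intro suminf_le ennreal_leI)
    fix N
    show "z ^ N * zhat i0 \<psi> N h \<le> q ^ N"
    proof (cases "N = 0")
      case True
      have "upaths 0 = {[] :: (int ^ 'd) list}" by (auto simp: upaths_def)
      then show ?thesis using True by (simp add: zhat_def weighted_walk.wt_Nil[OF ww1])
    next
      case False
      then have "z ^ N * zhat i0 \<psi> N h \<le> z ^ N * exp (zrate i0 \<psi> h * real N)"
        using z_pos by (intro mult_left_mono zhat_le_zrate) auto
      also have "\<dots> = q ^ N"
        by (simp add: q_def power_mult_distrib exp_of_nat_mult[symmetric] mult.commute)
      finally show ?thesis .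
    qed
  qed auto
  also have "\<dots> = ennreal (\<Sum>N. q ^ N)"
    using q by (intro suminf_ennreal2 summable_geometric) auto
  finally show False
    unfolding bridge_mass_infinite[OF assms] by (simp add: top_unique)
qed

text \<open>Cut at the first visit to the final level, and before it at the last visit to level 0.
  What lies between is a bridge, and both ends return to their starting level.\<close>

lemma up_cover:
  assumes "xs \<in> lists unit_vecs" "0 \<le> lev i0 xs"
  shows "\<exists>p\<in>lists unit_vecs. \<exists>s\<in>bridges i0. \<exists>r\<in>lists unit_vecs. xs = p @ s @ r \<and> lev i0 p = 0 \<and> lev i0 r = 0 \<and> lev i0 s = lev i0 xs"
proof -
  have "\<exists>y\<in>set (0 # levs i0 0 xs). lev i0 xs \<le> y"
    using final_level[of xs 0 i0] by (cases "xs = []") auto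
  from first_passage[OF assms this] obtain a r where
    "xs = a @ r" "0 + lev i0 a = lev i0 xs" "\<forall>y\<in>set (levs i0 0 a). y \<le> lev i0 xs"
    by blast
  then have ar: "xs = a @ r" "lev i0 a = lev i0 xs" "\<forall>y\<in>set (levs i0 0 a). y \<le> lev i0 xs"
    by simp_all
  have a: "a \<in> lists unit_vecs" "r \<in> lists unit_vecs" "0 \<le> 0 + lev i0 a" "\<exists>y\<in>set (0 # levs i0 0 a). y \<le> 0"
    using ar(1,2) assms by auto
  from last_passage[OF a(1,4,3)] obtain p s where ps0:
    "a = p @ s" "0 + lev i0 p = 0" "\<forall>y\<in>set (levs i0 0 s). 0 < y"
    by blast
  then have ps: "a = p @ s" "lev i0 p = 0" "\<forall>y\<in>set (levs i0 0 s). 0 < y"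
    by simp_all
  have lev_s: "lev i0 s = lev i0 xs"
    using ps(1,2) ar(2) by simp
  have s_list: "s \<in> lists unit_vecs" "p \<in> lists unit_vecs"
    using a(1) ps(1) by auto
  have s: "s \<in> bridges i0"
  proof -
    have "y \<le> lev i0 s" if "y \<in> set (levs i0 0 s)" for y
      using that ar(3) unfolding lev_s ps(1) by (simp add: levs_append ps(2))
    then show ?thesis
      using ps(3) s_list by (auto simp: bridges_def)
  qed
  have "lev i0 r = 0"
    using arg_cong[OF ar(1), of "lev i0"] ar(2) by simp
  moreover have "xs = p @ s @ r"
    using ar(1) ps(1) by simp
  ultimately show ?thesis
    using s s_list a(2) ps(2) lev_s by blast
qed

lemma wt_middle_le:
  assumes "lev i0 p = 0" "lev i0 r = 0"
  shows "wt i0 \<psi> z h (p @ s @ r) \<le> kap z p * (wt i0 \<psi> z h s * kap z r)"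
proof -
  have "kap z p * kap z s * kap z r * exp (h * of_int (lev i0 s)) * pot \<psi> (p @ s @ r) \<le>
      kap z p * kap z s * kap z r * exp (h * of_int (lev i0 s)) * pot \<psi> s"
    using z_pos by (intro mult_left_mono pot_middle_le mult_nonneg_nonneg kap_nonneg) auto
  then show ?thesis
    using assms by (simp add: wt_def kap_append mult_ac)
qed

text \<open>The potential of the two ends is dropped, so they cost a factor
  \<open>1 / (1 - z)\<close> each. The predicate \<open>P\<close> allows for all heights at once as
  well as for a single one.\<close>

lemma mass_up_le:
  assumes "z < 1" "\<And>xs. xs \<in> A \<Longrightarrow> xs \<in> lists unit_vecs \<and> 0 \<le> lev i0 xs \<and> P (lev i0 xs)"
  shows "mass (wt i0 \<psi> z h) A \<le> ennreal (1 / (1 - z)) * (mass (wt i0 \<psi> z h) {s \<in> bridges i0. P (lev i0 s)} * ennreal (1 / (1 - z)))"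
proof -
  let ?Q = "{q \<in> lists (unit_vecs :: (int ^ 'd) set). 0 \<le> length q}"
  let ?R = "{q \<in> ?Q. lev i0 q = 0}"
  have "mass (wt i0 \<psi> z h) A \<le> mass (kap z) ?R * (mass (wt i0 \<psi> z h) {s \<in> bridges i0. P (lev i0 s)} * mass (kap z) ?R)"
  proof (rule mass_cover3)
    fix xs assume "xs \<in> A"
    then have "xs \<in> lists unit_vecs" "0 \<le> lev i0 xs" "P (lev i0 xs)" using assms(2) by blast+
    from up_cover[OF this(1,2)] this(3)
    show "\<exists>p\<in>?R. \<exists>q\<in>{s \<in> bridges i0. P (lev i0 s)}. \<exists>r\<in>?R. xs = p @ q @ r"
      by (metis (mono_tags, lifting) mem_Collect_eq zero_le)
  next
    fix p q r assume "p \<in> ?R" "r \<in> ?R"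
    then show "wt i0 \<psi> z h (p @ q @ r) \<le> kap z p * (wt i0 \<psi> z h q * kap z r)"
      by (intro wt_middle_le) auto
  qed (use z_pos in \<open>simp_all add: wt_nonneg kap_nonneg\<close>)
  also have "\<dots> \<le> ennreal (1 / (1 - z)) * (mass (wt i0 \<psi> z h) {s \<in> bridges i0. P (lev i0 s)} * ennreal (1 / (1 - z)))"
  proof -
    have "mass (kap z) ?R \<le> mass (kap z) ?Q" by (rule mass_mono) auto
    also have "\<dots> \<le> ennreal (1 / (1 - z))"
      using mass_kap_ge[of z 0, where 'd = 'd] z_pos assms(1) by simp
    finally show ?thesis by (intro mult_mono) auto
  qed
  finally show ?thesis .
qed

text \<open>The converse of \<open>zrate_ge\<close>: below \<open>alpha\<close> the mass of all
  paths is finite, so \<open>z ^ N * zhat i0 \<psi> N h\<close> stays bounded. Paths that end at a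
  negative level have tilt at most one because \<open>0 \<le> h\<close>, and are controlled by
  \<open>z < 1\<close> alone.\<close>

lemma zrate_le:
  assumes "z < 1" "0 \<le> h" "h < alpha i0 \<psi> z"
  shows "zrate i0 \<psi> h \<le> - ln z"
proof -
  let ?w = "wt i0 \<psi> z h" and ?P = "lists (unit_vecs :: (int ^ 'd) set)"
  have "mass ?w ?P = mass ?w ({xs \<in> ?P. 0 \<le> lev i0 xs} \<union> {xs \<in> ?P. lev i0 xs < 0})"
    by (rule arg_cong[of _ _ "mass ?w"]) auto
  also have "\<dots> = mass ?w {xs \<in> ?P. 0 \<le> lev i0 xs} + mass ?w {xs \<in> ?P. lev i0 xs < 0}"
    by (rule mass_Un_disjoint) auto
  also have "\<dots> \<le> ennreal (1 / (1 - z)) * (bridge_mass i0 \<psi> z h * ennreal (1 / (1 - z))) + ennreal (1 / (1 - z))"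
  proof (rule add_mono)
    show "mass ?w {xs \<in> ?P. 0 \<le> lev i0 xs} \<le> ennreal (1 / (1 - z)) * (bridge_mass i0 \<psi> z h * ennreal (1 / (1 - z)))"
      using mass_up_le[OF assms(1), of "{xs \<in> ?P. 0 \<le> lev i0 xs}" "\<lambda>_. True" h] by (simp add: bridge_mass_def)
    have "mass ?w {xs \<in> ?P. lev i0 xs < 0} \<le> mass (kap z) {q \<in> ?P. 0 \<le> length q}"
    proof (rule mass_mono)
      fix xs assume "xs \<in> {xs \<in> ?P. lev i0 xs < 0}"
      then have "h * of_int (lev i0 xs) \<le> 0"
        using assms by (simp add: mult_nonneg_nonpos)
      then have "kap z xs * exp (h * of_int (lev i0 xs)) * pot \<psi> xs \<le> kap z xs * 1 * 1"
        using z_pos by (intro mult_mono mult_left_mono pot_le_1) (auto simp: kap_nonneg less_imp_le[OF pot_pos])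
      then show "?w xs \<le> kap z xs" by (simp add: wt_def)
    qed auto
    also have "\<dots> \<le> ennreal (1 / (1 - z))"
      using mass_kap_ge[of z 0, where 'd = 'd] z_pos assms(1) by simp
    finally show "mass ?w {xs \<in> ?P. lev i0 xs < 0} \<le> ennreal (1 / (1 - z))" .
  qed
  also have "\<dots> < \<infinity>"
    using bridge_mass_finite[OF assms(3)] by (simp add: ennreal_mult_less_top)
  finally obtain T where T: "mass ?w ?P = ennreal T" "0 \<le> T"
    by (cases "mass ?w ?P") auto
  have bound: "z ^ N * zhat i0 \<psi> N h \<le> T" for N
  proof -
    have "ennreal (z ^ N * zhat i0 \<psi> N h) \<le> mass ?w ?P"
      unfolding mass_upaths[symmetric] by (rule mass_mono) (auto simp: upaths_def)
    then show ?thesis using T by (simp add: ennreal_le_iff)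
  qed
  have T0: "0 < T"
    using bound[of 0] zhat_pos[of 0 h] by simp
  have "\<forall>\<^sub>F N in sequentially. ln (zhat i0 \<psi> N h) / real N \<le> ln T / real N - ln z"
    using eventually_ge_at_top[of 1]
  proof eventually_elim
    case (elim N)
    have "ln (z ^ N * zhat i0 \<psi> N h) \<le> ln T"
      using bound[of N] z_pos zhat_pos[of N h] T0 by (subst ln_le_cancel_iff) auto
    then have "real N * ln z + ln (zhat i0 \<psi> N h) \<le> ln T"
      using z_pos zhat_pos[of N h] by (simp add: ln_mult_pos ln_realpow)
    then have "(real N * ln z + ln (zhat i0 \<psi> N h)) / real N \<le> ln T / real N"
      by (intro divide_right_mono) auto
    then show ?case using elim by (simp add: add_divide_distrib)
  qed
  moreover have "(\<lambda>N. ln T / real N - ln z) \<longlonglongrightarrow> 0 - ln z"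
    by (intro tendsto_intros lim_const_over_n)
  ultimately show ?thesis
    using tendsto_le[OF trivial_limit_sequentially _ zrate_limit] by fastforce
qed

end

section \<open>Dependence on the site weight and on the fugacity\<close>

lemma wt_mono:
  fixes i0 :: "'d::finite"
  assumes "attractive \<psi>" "attractive \<psi>'" "\<And>n. n > 0 \<Longrightarrow> \<psi> n \<le> \<psi>' n" "0 \<le> z" "z \<le> z'"
  shows "wt i0 \<psi> z h xs \<le> wt i0 \<psi>' z' h xs"
proof -
  have "pot \<psi> xs \<le> pot \<psi>' xs"
    unfolding pot_def using assms(3) attractive.psi_pos[OF assms(1)] by (intro potl_mono) (auto simp: less_imp_le)
  moreover have "kap z xs \<le> kap z' xs"
    unfolding kap_def using assms by (intro power_mono divide_right_mono) auto
  ultimately show ?thesis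
    unfolding wt_def using attractive.pot_pos[OF assms(1), THEN less_imp_le] assms
    by (intro mult_mono mult_right_mono) (auto simp: kap_nonneg)
qed

lemma alpha_antimono:
  fixes i0 :: "'d::finite"
  assumes "attractive \<psi>" "attractive \<psi>'" "\<And>n. n > 0 \<Longrightarrow> \<psi> n \<le> \<psi>' n" "0 < z" "z \<le> z'" "z' \<le> 1"
  shows "alpha i0 \<psi>' z' \<le> alpha i0 \<psi> z"
proof -
  interpret A: weighted_walk \<psi> i0 z using assms by (intro weighted_walkI) auto
  interpret B: weighted_walk \<psi>' i0 z' using assms by (intro weighted_walkI) auto
  have "brm i0 \<psi> z L \<le> brm i0 \<psi>' z' L" for L
  proof -
    have "ennreal (brm i0 \<psi> z L) \<le> ennreal (brm i0 \<psi>' z' L)"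
      unfolding A.mass_bridges_at[symmetric] B.mass_bridges_at[symmetric]
      by (intro mass_mono wt_mono) (use assms in auto)
    then show ?thesis by (simp add: ennreal_le_iff B.brm_nonneg)
  qed
  then have "ln (brm i0 \<psi> z L) / real L \<le> ln (brm i0 \<psi>' z' L) / real L" for L
    using A.brm_pos[of L] B.brm_pos[of L] by (intro divide_right_mono) auto
  then have "- alpha i0 \<psi> z \<le> - alpha i0 \<psi>' z'"
    by (intro LIMSEQ_le[OF A.alpha_limit B.alpha_limit]) auto
  then show ?thesis by simp
qed

text \<open>The bound of \<open>brm_le_alpha\<close> has no prefactor. If the rate stayed above
  \<open>b\<close> for all smaller fugacities, then \<open>exp (- b * L)\<close> would bound the
  bridges of each fixed height, and this survives the monotone limit in the fugacity.\<close>

lemma alpha_left_cont: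
  fixes i0 :: "'d::finite"
  assumes "attractive \<psi>" "0 < z" "z \<le> 1" "alpha i0 \<psi> z < b"
  shows "\<exists>z'. 0 < z' \<and> z' < z \<and> alpha i0 \<psi> z' < b"
proof (rule ccontr)
  assume *: "\<not> ?thesis"
  interpret A: weighted_walk \<psi> i0 z using assms by (intro weighted_walkI) auto
  \<comment> \<open>The shift by two keeps the first term positive.\<close>
  define y where "y = (\<lambda>k. z * (1 - 1 / real (Suc (Suc k))))"
  have y: "0 < y k" "y k < z" for k
  proof -
    have "0 < 1 - 1 / real (Suc (Suc k))" "1 - 1 / real (Suc (Suc k)) < 1"
      by (auto simp: divide_less_eq)
    then show "0 < y k" "y k < z"
      unfolding y_def using assms(2) mult_strict_left_mono[of "1 - 1 / real (Suc (Suc k))" 1 z] by auto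
  qed
  have "brm i0 \<psi> z L \<le> exp (- b * real L)" for L
  proof -
    have "mass (wt i0 \<psi> z 0) (bridges_at i0 L) \<le> ennreal (exp (- b * real L))"
    proof (rule mass_limit[where w = "\<lambda>k. wt i0 \<psi> (y k) 0"])
      fix k xs
      interpret B: weighted_walk \<psi> i0 "y k" using assms y[of k] by (intro weighted_walkI) auto
      show "0 \<le> wt i0 \<psi> (y k) 0 xs" by (rule B.wt_nonneg)
      have "brm i0 \<psi> (y k) L \<le> exp (- alpha i0 \<psi> (y k) * real L)" by (rule B.brm_le_alpha)
      also have "\<dots> \<le> exp (- b * real L)"
      proof -
        have "b \<le> alpha i0 \<psi> (y k)" using * y[of k] by (metis not_less)
        then show ?thesis by (simp add: mult_right_mono)
      qed
      finally show "mass (wt i0 \<psi> (y k) 0) (bridges_at i0 L) \<le> ennreal (exp (- b * real L))"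
        unfolding B.mass_bridges_at by (rule ennreal_leI)
    next
      fix xs
      show "incseq (\<lambda>k. wt i0 \<psi> (y k) 0 xs)"
      proof (rule incseq_SucI, rule wt_mono)
        show "y k \<le> y (Suc k)" for k
          unfolding y_def using assms by (intro mult_left_mono) (auto simp: field_simps)
      qed (use assms y in \<open>auto intro: less_imp_le\<close>)
      have "y \<longlonglongrightarrow> z * (1 - 0)"
        unfolding y_def by (intro tendsto_intros LIMSEQ_Suc lim_1_over_n)
      then show "(\<lambda>k. wt i0 \<psi> (y k) 0 xs) \<longlonglongrightarrow> wt i0 \<psi> z 0 xs"
        unfolding wt_def kap_def by (intro tendsto_intros) auto
    qed
    then show ?thesis
      unfolding A.mass_bridges_at by (simp add: ennreal_le_iff)
  qed
  then have bound: "ln (brm i0 \<psi> z L) \<le> - b * real L" for L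
    using A.brm_pos[of L] by (simp add: ln_le_iff)
  have "ln (brm i0 \<psi> z L) / real L \<le> - b" if "1 \<le> L" for L
    using divide_right_mono[OF bound[of L], of "real L"] that by simp
  then have "\<forall>\<^sub>F L in sequentially. ln (brm i0 \<psi> z L) / real L \<le> - b"
    using eventually_ge_at_top[of 1] by (rule eventually_mono[rotated])
  then have "- alpha i0 \<psi> z \<le> - b"
    using A.alpha_limit by (intro tendsto_upperbound) auto
  then show False using assms by simp
qed

text \<open>By left continuity some fugacity below one still has decay rate below \<open>h\<close>,
  and \<open>zrate_ge\<close> turns it into a positive lower bound.\<close>

lemma zrate_pos:
  assumes "attractive \<psi>" "alpha i0 \<psi> 1 < h"
  shows "0 < zrate i0 \<psi> h"
proof -
  obtain z where z: "0 < z" "z < 1" "alpha i0 \<psi> z < h"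
    using alpha_left_cont[OF assms(1), of 1 i0 h] assms(2) by auto
  interpret weighted_walk \<psi> i0 z using assms z by (intro weighted_walkI) auto
  have "- ln z \<le> zrate i0 \<psi> h" using z by (intro zrate_ge) auto
  then show ?thesis using z ln_less_zero[of z] by linarith
qed

lemma zrate_nonpos:
  assumes "attractive \<psi>" "0 \<le> h" "h < alpha i0 \<psi> 1"
  shows "zrate i0 \<psi> h \<le> 0"
proof (rule ccontr)
  assume "\<not> ?thesis"
  then have pos: "0 < zrate i0 \<psi> h" by simp
  \<comment> \<open>Here \<open>- ln z\<close> is half the rate, so \<open>zrate_le\<close> would
    bound a positive rate by half of itself.\<close>
  define z where "z = exp (- zrate i0 \<psi> h / 2)"
  have z: "0 < z" "z < 1" using pos by (auto simp: z_def)
  interpret weighted_walk \<psi> i0 z using assms z by (intro weighted_walkI) auto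
  have "alpha i0 \<psi> 1 \<le> alpha i0 \<psi> z"
    by (rule alpha_antimono) (use assms z in auto)
  then have "zrate i0 \<psi> h \<le> - ln z"
    using assms z by (intro zrate_le) auto
  then show False using pos by (simp add: z_def)
qed

text \<open>The mass gap without reference to \<open>alpha\<close>: by \<open>zrate_ge\<close>, the
  condition on the rate at \<open>h - \<delta>\<close> places \<open>h - \<delta>\<close> below
  \<open>alpha i0 \<psi> z\<close>.\<close>

lemma irr_mass_gap:
  fixes i0 :: "'d::finite"
  assumes "0 < z0" "z0 < 1"
  obtains \<delta> A where "0 < \<delta>" "0 < A"
    "\<And>\<psi> z h. attractive \<psi> \<Longrightarrow> 0 < z \<Longrightarrow> z \<le> z0 \<Longrightarrow> zrate i0 \<psi> (h - \<delta>) < - ln z \<Longrightarrow> irr_mass i0 \<psi> z h \<le> ennreal A"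
proof (rule mass_gap[OF assms])
  fix \<delta> A :: real
  assume dA: "0 < \<delta>" "0 < A"
    and gap: "\<And>\<psi> z. attractive \<psi> \<Longrightarrow> 0 < z \<Longrightarrow> z \<le> z0 \<Longrightarrow> irr_mass i0 \<psi> z (alpha i0 \<psi> z + \<delta>) \<le> ennreal A"
  have "irr_mass i0 \<psi> z h \<le> ennreal A" if *: "attractive \<psi>" "0 < z" "z \<le> z0" "zrate i0 \<psi> (h - \<delta>) < - ln z" for \<psi> z h
  proof -
    interpret weighted_walk \<psi> i0 z using assms * by (intro weighted_walkI) auto
    have "h - \<delta> < alpha i0 \<psi> z"
      using zrate_ge[of "h - \<delta>"] *(4) by linarith
    then have "irr_mass i0 \<psi> z h \<le> irr_mass i0 \<psi> z (alpha i0 \<psi> z + \<delta>)"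
      by (intro irr_mass_mono) simp
    also have "\<dots> \<le> ennreal A" using * by (intro gap)
    finally show ?thesis .
  qed
  with dA show thesis by (rule that)
qed

section \<open>Confinement and point-to-plane sums\<close>

definition lattice_box :: "nat \<Rightarrow> (int ^ 'd) set" where
  "lattice_box R = {y. \<forall>i. \<bar>y $ i\<bar> < int R}"

lemma finite_lattice_box: "finite (lattice_box R :: (int ^ 'd::finite) set)"
proof -
  have "(lattice_box R :: (int ^ 'd) set) \<subseteq> vec_lambda ` (PiE UNIV (\<lambda>_. {- int R..int R}))"
  proof
    fix y :: "int ^ 'd" assume y: "y \<in> lattice_box R"
    show "y \<in> vec_lambda ` (PiE UNIV (\<lambda>_. {- int R..int R}))"
    proof (rule image_eqI[of _ _ "vec_nth y"])
      have "- int R \<le> y $ i \<and> y $ i \<le> int R" for i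
        using y by (auto simp: lattice_box_def abs_less_iff intro: less_imp_le) (smt (verit))+
      then show "vec_nth y \<in> (PiE UNIV (\<lambda>_. {- int R..int R}))" by auto
    qed simp
  qed
  then show ?thesis
    by (rule finite_subset) (auto intro!: finite_PiE)
qed

text \<open>The positive eigenfunction of the simple random walk killed outside the box.\<close>

definition coswave :: "nat \<Rightarrow> int ^ 'd::finite \<Rightarrow> real" where
  "coswave R x = (\<Prod>i\<in>UNIV. cos (pi * of_int (x $ i) / (2 * real R)))"

lemma coswave_bounds:
  assumes "x \<in> lattice_box R"
  shows "0 \<le> coswave R x" "coswave R x \<le> 1"
proof -
  have "0 \<le> cos (pi * of_int (x $ i) / (2 * real R))" for i
  proof -
    have x: "\<bar>x $ i\<bar> < int R" using assms by (simp add: lattice_box_def)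
    then have R: "0 < real R" by linarith
    have "\<bar>real_of_int (x $ i)\<bar> \<le> real R" using x by linarith
    then have "\<bar>pi * of_int (x $ i) / (2 * real R)\<bar> \<le> pi / 2"
      using R by (simp add: abs_mult divide_le_eq)
    then show ?thesis unfolding abs_le_iff by (intro cos_ge_zero) linarith+
  qed
  then show "0 \<le> coswave R x" "coswave R x \<le> 1"
    unfolding coswave_def by (auto intro!: prod_nonneg prod_le_1)
qed

text \<open>A single step leaves the box only onto one of its faces, where the argument of one
  cosine is \<open>pi / 2\<close> up to sign.\<close>

lemma coswave_outside:
  assumes "x \<in> lattice_box R" "e \<in> unit_vecs" "x + e \<notin> lattice_box R"
  shows "coswave R (x + e) = 0"
proof -
  obtain i where i: "\<not> \<bar>(x + e) $ i\<bar> < int R" using assms(3) by (auto simp: lattice_box_def)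
  have x: "\<bar>x $ i\<bar> < int R" using assms(1) by (simp add: lattice_box_def)
  have "\<bar>e $ i\<bar> \<le> 1" using assms(2) by (rule unit_vec_level)
  then have "\<bar>(x + e) $ i\<bar> = int R" using i x by simp
  then have "(x + e) $ i = int R \<or> (x + e) $ i = - int R" by linarith
  moreover have "real R \<noteq> 0" using x by linarith
  ultimately have "cos (pi * of_int ((x + e) $ i) / (2 * real R)) = 0"
    by (auto simp del: vector_add_component)
  then show ?thesis
    unfolding coswave_def by (intro prod_zero) auto
qed

lemma coswave_eigen:
  fixes x :: "int ^ 'd::finite"
  shows "(\<Sum>e\<in>unit_vecs. coswave R (x + e)) = 2 * real CARD('d) * cos (pi / (2 * real R)) * coswave R x"
proof -
  let ?c = "\<lambda>k::int. cos (pi * of_int k / (2 * real R))"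
  have split: "coswave R (x + axis i k) = ?c (x $ i + k) * (\<Prod>j\<in>UNIV - {i}. ?c (x $ j))" for i k
  proof -
    have "coswave R (x + axis i k) = ?c ((x + axis i k) $ i) * (\<Prod>j\<in>UNIV - {i}. ?c ((x + axis i k) $ j))"
      unfolding coswave_def by (rule prod.remove) auto
    also have "(\<Prod>j\<in>UNIV - {i}. ?c ((x + axis i k) $ j)) = (\<Prod>j\<in>UNIV - {i}. ?c (x $ j))"
      by (rule prod.cong) (auto simp: axis_def)
    finally show ?thesis by (simp add: axis_def)
  qed
  have "coswave R (x + axis i 1) + coswave R (x + axis i (- 1)) = 2 * cos (pi / (2 * real R)) * coswave R x" for i
  proof -
    have "?c (x $ i + 1) + ?c (x $ i + - 1) = 2 * cos (pi / (2 * real R)) * ?c (x $ i)"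
      by (simp add: distrib_left diff_divide_distrib add_divide_distrib right_diff_distrib cos_add cos_diff)
    moreover have "coswave R x = ?c (x $ i) * (\<Prod>j\<in>UNIV - {i}. ?c (x $ j))"
      unfolding coswave_def by (rule prod.remove) auto
    ultimately show ?thesis
      unfolding split by (simp add: distrib_right[symmetric] mult.assoc)
  qed
  then show ?thesis
    unfolding sum_unit_vecs by simp
qed

definition confined :: "nat \<Rightarrow> nat \<Rightarrow> int ^ 'd::finite \<Rightarrow> (int ^ 'd) list set" where
  "confined R n x = {xs \<in> upaths n. set (sites x xs) \<subseteq> lattice_box R}"

text \<open>The eigenfunction is at most one inside the box and vanishes one step outside, so the
  eigenvalue equation yields a lower bound for the survival probability by induction.\<close>

lemma confined_sum:
  fixes x :: "int ^ 'd::finite"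
  assumes "x \<in> lattice_box R" "0 \<le> cos (pi / (2 * real R))"
  shows "cos (pi / (2 * real R)) ^ n * coswave R x \<le> (\<Sum>xs\<in>confined R n x. kap 1 xs)"
  using assms(1)
proof (induction n arbitrary: x)
  case 0
  have "confined R 0 x = {[]}" by (auto simp: confined_def upaths_def)
  then show ?case using coswave_bounds[OF 0] by simp
next
  case (Suc n)
  let ?\<rho> = "cos (pi / (2 * real R))" and ?D = "2 * real CARD('d)"
  let ?E = "{e \<in> unit_vecs. x + e \<in> lattice_box R}"
  have eq: "confined R (Suc n) x = (\<lambda>(e, xs). e # xs) ` (SIGMA e:?E. confined R n (x + e))"
  proof (intro set_eqI iffI)
    fix xs assume xs: "xs \<in> confined R (Suc n) x"
    then obtain e ys where "xs = e # ys" by (cases xs) (auto simp: confined_def upaths_def)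
    then show "xs \<in> (\<lambda>(e, xs). e # xs) ` (SIGMA e:?E. confined R n (x + e))"
      using xs by (intro image_eqI[of _ _ "(e, ys)"]) (auto simp: confined_def upaths_def)
  qed (auto simp: confined_def upaths_def)
  have fin: "finite (confined R n y)" for y :: "int ^ 'd"
    by (simp add: confined_def)
  have "?\<rho> ^ Suc n * coswave R x = ?\<rho> ^ n / ?D * (\<Sum>e\<in>unit_vecs. coswave R (x + e))"
    by (simp add: coswave_eigen)
  also have "(\<Sum>e\<in>unit_vecs. coswave R (x + e)) = (\<Sum>e\<in>?E. coswave R (x + e))"
    using coswave_outside[OF Suc.prems] by (intro sum.mono_neutral_right) auto
  also have "?\<rho> ^ n / ?D * (\<Sum>e\<in>?E. coswave R (x + e)) = (\<Sum>e\<in>?E. (?\<rho> ^ n * coswave R (x + e)) / ?D)"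
    by (simp add: sum_distrib_left)
  also have "\<dots> \<le> (\<Sum>e\<in>?E. (\<Sum>xs\<in>confined R n (x + e). kap 1 xs) / ?D)"
    by (intro sum_mono divide_right_mono Suc.IH) auto
  also have "\<dots> = (\<Sum>e\<in>?E. \<Sum>xs\<in>confined R n (x + e). kap 1 (e # xs))"
    by (simp add: kap_def sum_divide_distrib)
  also have "\<dots> = (\<Sum>p\<in>(SIGMA e:?E. confined R n (x + e)). kap 1 (fst p # snd p))"
    by (subst sum.Sigma) (auto simp: fin case_prod_beta)
  also have "\<dots> = (\<Sum>xs\<in>confined R (Suc n) x. kap 1 xs)"
    unfolding eq by (subst sum.reindex) (auto simp: inj_on_def case_prod_beta)
  finally show ?case .
qed

text \<open>A path that stays in the box visits at most as many sites as the box contains, each at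
  most \<open>n\<close> times, and its final level is below \<open>R\<close> in absolute
  value.\<close>

lemma zhat_confined:
  fixes i0 :: "'d::finite"
  assumes "attractive \<psi>" "2 \<le> R" "1 \<le> n"
  shows "cos (pi / (2 * real R)) ^ n * exp (- \<bar>h\<bar> * real R) * \<psi> n ^ card (lattice_box R :: (int ^ 'd) set) \<le> zhat i0 \<psi> n h"
proof -
  interpret weighted_walk \<psi> i0 1 using assms by (intro weighted_walkI) auto
  let ?\<rho> = "cos (pi / (2 * real R))" and ?B = "card (lattice_box R :: (int ^ 'd) set)"
  have \<rho>: "0 \<le> ?\<rho>"
  proof (rule cos_ge_zero)
    have "0 \<le> pi / (2 * real R)" by simp
    then show "- (pi / 2) \<le> pi / (2 * real R)" using pi_gt_zero by linarith
    show "pi / (2 * real R) \<le> pi / 2" using assms(2) by (simp add: divide_le_eq)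
  qed
  have "coswave R (0 :: int ^ 'd) = 1" by (simp add: coswave_def)
  moreover have "(0 :: int ^ 'd) \<in> lattice_box R" using assms(2) by (simp add: lattice_box_def)
  ultimately have "?\<rho> ^ n \<le> (\<Sum>xs\<in>confined R n (0 :: int ^ 'd). kap 1 xs)"
    using confined_sum[of "0 :: int ^ 'd" R n] \<rho> by simp
  then have "?\<rho> ^ n * (exp (- \<bar>h\<bar> * real R) * \<psi> n ^ ?B) \<le> (\<Sum>xs\<in>confined R n (0 :: int ^ 'd). kap 1 xs) * (exp (- \<bar>h\<bar> * real R) * \<psi> n ^ ?B)"
    using psi_pos[of n] by (intro mult_right_mono) auto
  also have "\<dots> = (\<Sum>xs\<in>confined R n (0 :: int ^ 'd). kap 1 xs * exp (- \<bar>h\<bar> * real R) * \<psi> n ^ ?B)"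
    by (simp add: sum_distrib_right mult.assoc)
  also have "\<dots> \<le> (\<Sum>xs\<in>confined R n (0 :: int ^ 'd). wt i0 \<psi> 1 h xs)"
    unfolding wt_def
  proof (rule sum_mono)
    fix xs :: "(int ^ 'd) list" assume xs: "xs \<in> confined R n 0"
    have len: "length xs = n" and sub: "set (sites 0 xs) \<subseteq> lattice_box R"
      using xs by (auto simp: confined_def upaths_def)
    have "0 + lev i0 xs \<in> set (levs i0 0 xs)"
      using assms(3) len by (intro final_level) auto
    then obtain y where "y \<in> set (sites 0 xs)" "lev i0 xs = y $ i0"
      using levs_sites[of i0 0 xs] by auto
    then have "\<bar>lev i0 xs\<bar> < int R" using sub by (auto simp: lattice_box_def)
    then have "\<bar>real_of_int (lev i0 xs)\<bar> \<le> real R" by linarith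
    then have "\<bar>h * of_int (lev i0 xs)\<bar> \<le> \<bar>h\<bar> * real R"
      unfolding abs_mult by (intro mult_left_mono) auto
    then have e: "exp (- \<bar>h\<bar> * real R) \<le> exp (h * of_int (lev i0 xs))" by simp
    have p: "\<psi> n ^ ?B \<le> pot \<psi> xs"
    proof -
      have "\<psi> n ^ ?B \<le> \<psi> n ^ card (set (sites 0 xs))"
        using psi_pos[of n] psi_le_1 sub finite_lattice_box by (intro power_decreasing card_mono) (auto intro: less_imp_le)
      also have "\<dots> = (\<Prod>y\<in>set (sites 0 xs). \<psi> n)" by simp
      also have "\<dots> \<le> pot \<psi> xs"
        unfolding pot_def potl_def using psi_pos[of n] count_le_length[of "sites 0 xs"] len
        by (intro prod_mono) (auto intro!: psi_antimono intro: less_imp_le)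
      finally show ?thesis .
    qed
    show "kap 1 xs * exp (- \<bar>h\<bar> * real R) * \<psi> n ^ ?B \<le> kap 1 xs * exp (h * of_int (lev i0 xs)) * pot \<psi> xs"
      using psi_pos[of n] by (intro mult_mono mult_left_mono e p) (auto simp: kap_nonneg)
  qed
  also have "\<dots> \<le> zhat i0 \<psi> n h"
    unfolding zhat_def by (rule sum_mono2) (auto simp: confined_def wt_nonneg)
  finally show ?thesis by (simp add: mult.assoc)
qed

text \<open>In a fixed box potential and tilt are subexponential in the time, by the hypothesis on
  \<open>ln (\<psi> n)\<close>. Only the survival rate \<open>ln (cos (pi / (2 * R)))\<close>
  remains, and it tends to 0 as the box grows.\<close>

lemma zrate_nonneg:
  fixes i0 :: "'d::finite"
  assumes "attractive \<psi>" "(\<lambda>n. ln (\<psi> n) / real n) \<longlonglongrightarrow> 0"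
  shows "0 \<le> zrate i0 \<psi> h"
proof -
  interpret weighted_walk \<psi> i0 1 using assms by (intro weighted_walkI) auto
  have le: "ln (cos (pi / (2 * real R))) \<le> zrate i0 \<psi> h" if R: "2 \<le> R" for R :: nat
  proof -
    let ?\<rho> = "cos (pi / (2 * real R))" and ?B = "card (lattice_box R :: (int ^ 'd) set)"
    have \<rho>: "0 < ?\<rho>"
    proof (rule cos_gt_zero_pi)
      have "0 \<le> pi / (2 * real R)" by simp
      then show "- (pi / 2) < pi / (2 * real R)" using pi_gt_zero by linarith
      show "pi / (2 * real R) < pi / 2" using R by (simp add: divide_less_eq)
    qed
    have "\<forall>\<^sub>F n in sequentially. ln ?\<rho> + (- \<bar>h\<bar> * real R) / real n + real ?B * (ln (\<psi> n) / real n) \<le> ln (zhat i0 \<psi> n h) / real n"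
      using eventually_ge_at_top[of 1]
    proof eventually_elim
      case (elim n)
      have "ln (?\<rho> ^ n * exp (- \<bar>h\<bar> * real R) * \<psi> n ^ ?B) \<le> ln (zhat i0 \<psi> n h)"
        using zhat_confined[OF assms(1) R elim, of h i0] \<rho> psi_pos[of n] zhat_pos[of n h]
        by (subst ln_le_cancel_iff) auto
      then have "real n * ln ?\<rho> + (- \<bar>h\<bar> * real R) + real ?B * ln (\<psi> n) \<le> ln (zhat i0 \<psi> n h)"
        using \<rho> psi_pos[of n] by (simp add: ln_mult_pos ln_realpow)
      then have "(real n * ln ?\<rho> + (- \<bar>h\<bar> * real R) + real ?B * ln (\<psi> n)) / real n \<le> ln (zhat i0 \<psi> n h) / real n"
        by (intro divide_right_mono) auto
      moreover have "(real n * ln ?\<rho> + (- \<bar>h\<bar> * real R) + real ?B * ln (\<psi> n)) / real n =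
          ln ?\<rho> + (- \<bar>h\<bar> * real R) / real n + real ?B * (ln (\<psi> n) / real n)"
        using elim unfolding add_divide_distrib by simp
      ultimately show ?case by simp
    qed
    moreover have "(\<lambda>n. ln ?\<rho> + (- \<bar>h\<bar> * real R) / real n + real ?B * (ln (\<psi> n) / real n)) \<longlonglongrightarrow> ln ?\<rho> + 0 + real ?B * 0"
      by (intro tendsto_intros lim_const_over_n assms(2))
    ultimately show ?thesis
      using tendsto_le[OF trivial_limit_sequentially zrate_limit] by fastforce
  qed
  have "(\<lambda>R. ln (cos (pi / (2 * real R)))) \<longlonglongrightarrow> ln (cos 0)"
  proof (intro tendsto_ln tendsto_cos)
    have "(\<lambda>R. pi / 2 / real R) \<longlonglongrightarrow> 0" by (rule lim_const_over_n)
    then show "(\<lambda>R. pi / (2 * real R)) \<longlonglongrightarrow> 0" by simp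
  qed auto
  then have "(\<lambda>R. ln (cos (pi / (2 * real R)))) \<longlonglongrightarrow> 0" by simp
  then show ?thesis
    by (rule tendsto_upperbound) (auto intro!: eventually_mono[OF eventually_ge_at_top[of 2]] le)
qed

section \<open>Paths that end in a hyperplane\<close>

definition plane_mass :: "'d::finite \<Rightarrow> (nat \<Rightarrow> real) \<Rightarrow> real \<Rightarrow> nat \<Rightarrow> ennreal" where
  "plane_mass i0 \<psi> z L = mass (wt i0 \<psi> z 0) {xs \<in> lists unit_vecs. lev i0 xs = int L}"

text \<open>Sandwiched between bridges and, by \<open>mass_up_le\<close>, the same bridges times the
  square of \<open>1 / (1 - z)\<close>; a constant factor does not change the rate.\<close>

lemma plane_mass_limit:
  fixes i0 :: "'d::finite"
  assumes "attractive \<psi>" "0 < z" "z < 1"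
  shows "plane_mass i0 \<psi> z L < \<infinity>"
    and "(\<lambda>L. ln (enn2real (plane_mass i0 \<psi> z L)) / real L) \<longlonglongrightarrow> - alpha i0 \<psi> z"
proof -
  interpret weighted_walk \<psi> i0 z using assms by (intro weighted_walkI) auto
  define C where "C = 1 / (1 - z)"
  have C: "0 < C" using assms by (simp add: C_def)
  have upper: "plane_mass i0 \<psi> z L \<le> ennreal (C * (brm i0 \<psi> z L * C))" for L
  proof -
    have "plane_mass i0 \<psi> z L \<le> ennreal C * (ennreal (brm i0 \<psi> z L) * ennreal C)"
      using mass_up_le[OF assms(3), of "{xs \<in> lists unit_vecs. lev i0 xs = int L}" "\<lambda>k. k = int L" 0]
      by (simp add: plane_mass_def bridges_at_def[symmetric] mass_bridges_at C_def)
    also have "\<dots> = ennreal (C * (brm i0 \<psi> z L * C))"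
      using C brm_nonneg[of L] by (simp add: ennreal_mult)
    finally show ?thesis .
  qed
  have fin: "plane_mass i0 \<psi> z L < \<infinity>" for L
    using le_less_trans[OF upper ennreal_less_top] by (simp add: infinity_ennreal_def)
  then show "plane_mass i0 \<psi> z L < \<infinity>" .
  define G where "G = (\<lambda>L. enn2real (plane_mass i0 \<psi> z L))"
  have G: "plane_mass i0 \<psi> z L = ennreal (G L)" for L
    unfolding G_def using fin[of L] by (intro ennreal_enn2real[symmetric]) (simp add: infinity_ennreal_def)
  have G_eq: "enn2real (plane_mass i0 \<psi> z L) = G L" for L by (simp add: G_def)
  have G0: "0 \<le> G L" for L by (simp add: G_def)
  have lower: "brm i0 \<psi> z L \<le> G L" for L
  proof -
    have "ennreal (brm i0 \<psi> z L) \<le> plane_mass i0 \<psi> z L"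
      unfolding mass_bridges_at[symmetric] plane_mass_def
      by (rule mass_mono) (auto simp: bridges_at_def dest: bridges_lists)
    then show ?thesis unfolding G using G0 by (simp add: ennreal_le_iff)
  qed
  have upper': "G L \<le> C * (brm i0 \<psi> z L * C)" for L
    using upper[of L] C brm_nonneg[of L] unfolding G by (subst (asm) ennreal_le_iff) auto
  have Gpos: "0 < G L" for L using lower[of L] brm_pos[of L] by simp
  show "(\<lambda>L. ln (enn2real (plane_mass i0 \<psi> z L)) / real L) \<longlonglongrightarrow> - alpha i0 \<psi> z"
    unfolding G_eq
  proof (rule tendsto_sandwich)
    show "\<forall>\<^sub>F L in sequentially. ln (brm i0 \<psi> z L) / real L \<le> ln (G L) / real L"
      using lower brm_pos Gpos by (intro always_eventually allI divide_right_mono) auto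
    show "\<forall>\<^sub>F L in sequentially. ln (G L) / real L \<le> 2 * ln C / real L + ln (brm i0 \<psi> z L) / real L"
    proof (intro always_eventually allI)
      fix L
      have "ln (G L) \<le> ln (C * (brm i0 \<psi> z L * C))"
        using upper'[of L] Gpos[of L] brm_pos[of L] C by (subst ln_le_cancel_iff) auto
      also have "\<dots> = 2 * ln C + ln (brm i0 \<psi> z L)"
        using brm_pos[of L] C by (simp add: ln_mult_pos)
      finally have "ln (G L) / real L \<le> (2 * ln C + ln (brm i0 \<psi> z L)) / real L"
        by (rule divide_right_mono) simp
      then show "ln (G L) / real L \<le> 2 * ln C / real L + ln (brm i0 \<psi> z L) / real L"
        by (simp add: add_divide_distrib)
    qed
    have "(\<lambda>L. 2 * ln C / real L + ln (brm i0 \<psi> z L) / real L) \<longlonglongrightarrow> 0 + - alpha i0 \<psi> z"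
      by (intro tendsto_add alpha_limit lim_const_over_n)
    then show "(\<lambda>L. 2 * ln C / real L + ln (brm i0 \<psi> z L) / real L) \<longlonglongrightarrow> - alpha i0 \<psi> z" by simp
  qed (rule alpha_limit)
qed

section \<open>Double power series, a renewal estimate and an implicit function theorem\<close>

lemma taylor_coeff_bound:
  assumes "f holomorphic_on ball a R" "\<And>x. x \<in> ball a R \<Longrightarrow> norm (f x) \<le> M" "0 < r" "r < R"
  shows "norm ((deriv ^^ n) f a / fact n) \<le> M / r ^ n"
proof -
  have sub: "cball a r \<subseteq> ball a R" using assms by (auto simp: dist_norm)
  have "norm ((deriv ^^ n) f a) \<le> fact n * M / r ^ n"
  proof (rule Cauchy_inequality)
    show "f holomorphic_on ball a r"
      using assms(1) sub ball_subset_cball by (meson holomorphic_on_subset subset_trans)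
    show "continuous_on (cball a r) f"
      using assms(1) sub by (meson holomorphic_on_imp_continuous_on holomorphic_on_subset)
    show "norm (f x) \<le> M" if "norm (a - x) = r" for x
      using that assms by (intro assms(2)) (simp add: dist_norm)
  qed (use assms in auto)
  then show ?thesis
    by (simp add: norm_divide divide_le_eq mult.commute)
qed

text \<open>
  The \<open>k\<close>-th Taylor coefficient in the first variable is a locally uniform limit of the functions
  obtained by removing the lower coefficients and dividing by the \<open>k\<close>-th power.
\<close>

lemma taylor_coeff_holomorphic:
  fixes H :: "complex \<Rightarrow> complex \<Rightarrow> complex"
  assumes R: "0 < R"
    and hx: "\<And>y. y \<in> ball b R \<Longrightarrow> (\<lambda>x. H x y) holomorphic_on ball a R"
    and hy: "\<And>x. x \<in> ball a R \<Longrightarrow> H x holomorphic_on ball b R"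
    and bound: "\<And>x y. x \<in> ball a R \<Longrightarrow> y \<in> ball b R \<Longrightarrow> norm (H x y) \<le> M"
  shows "(\<lambda>y. (deriv ^^ k) (\<lambda>x. H x y) a / fact k) holomorphic_on ball b R"
proof (induction k rule: less_induct)
  case (less k)
  define A where "A = (\<lambda>i y. (deriv ^^ i) (\<lambda>x. H x y) a / fact i)"
  define r where "r = R / 2"
  have r: "0 < r" "r < R" using R by (auto simp: r_def)
  have M: "0 \<le> M" using bound[of a b] R norm_ge_zero order_trans by (metis centre_in_ball)
  have A_bound: "norm (A i y) \<le> M / r ^ i" if "y \<in> ball b R" for i y
    unfolding A_def using hx[OF that] bound that r by (intro taylor_coeff_bound) auto
  have A_sums: "(\<lambda>i. A i y * (x - a) ^ i) sums H x y" if "x \<in> ball a R" "y \<in> ball b R" for x y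
    unfolding A_def using holomorphic_power_series[OF hx[OF that(2)] that(1)] .
  \<comment> \<open>Nonzero points tending to 0 with norm at most \<open>r / 2\<close>, so the tails
    of the Taylor series are geometric with ratio 1 / 2.\<close>
  define t where "t = (\<lambda>n::nat. complex_of_real (r / (real n + 2)))"
  have t: "t n \<noteq> 0" "norm (t n) = r / (real n + 2)" "norm (t n) \<le> r / 2" "a + t n \<in> ball a R" for n
  proof -
    have "r / (real n + 2) \<noteq> 0" using r by simp
    then show "t n \<noteq> 0" by (simp only: t_def of_real_eq_0_iff not_False_eq_True)
    have "r / (real n + 2) > 0" using r by simp
    then show nt: "norm (t n) = r / (real n + 2)" unfolding t_def norm_of_real by linarith
    have "r / (real n + 2) \<le> r / 2" using r by (intro divide_left_mono) auto
    then show "norm (t n) \<le> r / 2" using nt by simp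
    then show "a + t n \<in> ball a R" using r by (simp add: dist_norm)
  qed
  define g where "g = (\<lambda>n y. (H (a + t n) y - (\<Sum>i<k. A i y * t n ^ i)) / t n ^ k)"
  have est: "norm (g n y - A k y) \<le> 2 * M / r ^ Suc k * norm (t n)" if y: "y \<in> ball b R" for n y
  proof -
    have s1: "(\<lambda>i. A (i + Suc k) y * t n ^ (i + Suc k)) sums (H (a + t n) y - (\<Sum>i<Suc k. A i y * t n ^ i))"
      using sums_split_initial_segment[OF A_sums[OF t(4) y], of "Suc k" n] by simp
    have "norm (A (i + Suc k) y * t n ^ (i + Suc k)) \<le> M * (norm (t n) / r) ^ Suc k * (1 / 2) ^ i" for i
    proof -
      have "norm (A (i + Suc k) y * t n ^ (i + Suc k)) \<le> M / r ^ (i + Suc k) * norm (t n) ^ (i + Suc k)"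
        unfolding norm_mult norm_power by (rule mult_right_mono[OF A_bound[OF y]]) simp
      also have "\<dots> = M * (norm (t n) / r) ^ Suc k * (norm (t n) / r) ^ i"
        by (simp add: power_add power_divide field_simps)
      also have "\<dots> \<le> M * (norm (t n) / r) ^ Suc k * (1 / 2) ^ i"
        using t(3)[of n] r M by (intro mult_left_mono power_mono mult_nonneg_nonneg) (auto simp: divide_le_eq)
      finally show ?thesis .
    qed
    moreover have geo: "(\<lambda>i. M * (norm (t n) / r) ^ Suc k * (1 / 2) ^ i) sums (M * (norm (t n) / r) ^ Suc k * 2)"
      using sums_mult[OF geometric_sums[of "1 / 2 :: real"], of "M * (norm (t n) / r) ^ Suc k"] by simp
    ultimately have "norm (H (a + t n) y - (\<Sum>i<Suc k. A i y * t n ^ i)) \<le> M * (norm (t n) / r) ^ Suc k * 2"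
      unfolding sums_unique[OF s1] sums_unique[OF geo]
      by (intro norm_suminf_le) (use geo in \<open>auto simp: sums_iff\<close>)
    then have "norm (H (a + t n) y - (\<Sum>i<Suc k. A i y * t n ^ i)) / norm (t n) ^ k \<le> M * (norm (t n) / r) ^ Suc k * 2 / norm (t n) ^ k"
      by (intro divide_right_mono) auto
    also have "\<dots> = 2 * M / r ^ Suc k * norm (t n)"
      using t(1)[of n] by (simp add: power_divide field_simps)
    also have "norm (H (a + t n) y - (\<Sum>i<Suc k. A i y * t n ^ i)) / norm (t n) ^ k = norm (g n y - A k y)"
      using t(1)[of n] by (simp add: g_def norm_divide[symmetric] norm_power[symmetric] field_simps)
    finally show ?thesis .
  qed
  have "A k holomorphic_on ball b R"
  proof (rule holomorphic_uniform_sequence)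
    show "g n holomorphic_on ball b R" for n
    proof -
      have "A i holomorphic_on ball b R" if "i < k" for i
        unfolding A_def by (rule less.IH[OF that])
      then show ?thesis
        unfolding g_def using t[of n] by (intro holomorphic_intros hy) auto
    qed
    fix y assume "y \<in> ball b R"
    then obtain d where d: "0 < d" "cball y d \<subseteq> ball b R"
      using open_contains_cball open_ball by metis
    have "uniform_limit (cball y d) g (A k) sequentially"
    proof (rule uniform_limitI)
      fix e :: real assume e: "0 < e"
      have "(\<lambda>n. 2 * M / r ^ Suc k * (r / real (n + 2))) \<longlonglongrightarrow> 2 * M / r ^ Suc k * 0"
        by (intro tendsto_mult tendsto_const LIMSEQ_ignore_initial_segment lim_const_over_n)
      then have "\<forall>\<^sub>F n in sequentially. 2 * M / r ^ Suc k * (r / real (n + 2)) < e"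
        using e by (intro order_tendstoD(2)) auto
      then show "\<forall>\<^sub>F n in sequentially. \<forall>x\<in>cball y d. dist (g n x) (A k x) < e"
      proof eventually_elim
        case (elim n)
        have nt: "norm (t n) = r / real (n + 2)" using t(2)[of n] by simp
        show ?case
        proof
          fix x assume "x \<in> cball y d"
          then have "norm (g n x - A k x) \<le> 2 * M / r ^ Suc k * norm (t n)" using d by (intro est) auto
          then show "dist (g n x) (A k x) < e" using elim unfolding nt dist_norm by linarith
        qed
      qed
    qed
    then show "\<exists>d>0. cball y d \<subseteq> ball b R \<and> uniform_limit (cball y d) g (A k) sequentially"
      using d by blast
  qed simp
  then show ?case by (simp add: A_def)
qed

lemma abs_summable_geometric_product:
  fixes q :: real
  assumes "0 \<le> q" "q < 1"
  shows "(\<lambda>p. norm (case p of (i, j) \<Rightarrow> M * q ^ i * q ^ j)) summable_on (UNIV :: (nat \<times> nat) set)"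
proof -
  have geo: "((\<lambda>i. c * q ^ i) has_sum c * (1 / (1 - q))) UNIV" for c
  proof (rule norm_summable_imp_has_sum)
    show "summable (\<lambda>n. norm (c * q ^ n))"
      using assms by (simp add: abs_mult summable_mult summable_geometric)
    show "(\<lambda>n. c * q ^ n) sums (c * (1 / (1 - q)))"
      using assms by (intro sums_mult geometric_sums) auto
  qed
  have inner: "(\<Sum>\<^sub>\<infinity>j. norm (M * q ^ i * q ^ j)) = \<bar>M\<bar> * (1 / (1 - q)) * q ^ i" for i
    using infsumI[OF geo[of "\<bar>M\<bar> * q ^ i"]] assms by (simp add: abs_mult mult_ac)
  have "(\<lambda>p. norm (M * q ^ fst p * q ^ snd p)) summable_on ((UNIV :: nat set) \<times> (UNIV :: nat set))"
  proof (subst Infinite_Sum.abs_summable_on_Sigma_iff, intro conjI ballI)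
    fix i :: nat
    show "(\<lambda>y. norm (M * q ^ fst (i, y) * q ^ snd (i, y :: nat))) summable_on UNIV"
      using geo[of "\<bar>M\<bar> * q ^ i"] assms by (auto simp: abs_mult summable_on_def)
    show "(\<lambda>x. norm (\<Sum>\<^sub>\<infinity>y. norm (M * q ^ fst (x :: nat, y) * q ^ snd (x, y :: nat)))) summable_on UNIV"
    proof -
      have "norm (\<Sum>\<^sub>\<infinity>y. norm (M * q ^ fst (x, y) * q ^ snd (x, y))) = \<bar>M\<bar> * (1 / (1 - q)) * q ^ x" for x :: nat
        unfolding fst_conv snd_conv inner using assms by simp
      then show ?thesis
        using geo[of "\<bar>M\<bar> * (1 / (1 - q))"] by (simp only:) (auto simp only: summable_on_def)
    qed
  qed
  then show ?thesis by (simp only: case_prod_unfold UNIV_Times_UNIV)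
qed

text \<open>Expand in the first variable, then the coefficients, which are holomorphic by
  \<open>taylor_coeff_holomorphic\<close>, in the second. Cauchy's estimates at radius
  \<open>R / 2\<close> bound the coefficients; on the quarter radius both ratios are at most 1 / 2,
  and absolute convergence permits rearrangement.\<close>

lemma double_power_series:
  fixes H :: "complex \<Rightarrow> complex \<Rightarrow> complex"
  assumes R: "0 < R"
    and hx: "\<And>y. y \<in> ball b R \<Longrightarrow> (\<lambda>x. H x y) holomorphic_on ball a R"
    and hy: "\<And>x. x \<in> ball a R \<Longrightarrow> H x holomorphic_on ball b R"
    and bound: "\<And>x y. x \<in> ball a R \<Longrightarrow> y \<in> ball b R \<Longrightarrow> norm (H x y) \<le> M"
  obtains c where "\<And>x y. x \<in> ball a (R / 4) \<Longrightarrow> y \<in> ball b (R / 4) \<Longrightarrow>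
     ((\<lambda>(i, j). c i j * (x - a) ^ i * (y - b) ^ j) has_sum H x y) UNIV"
proof -
  define A where "A = (\<lambda>i y. (deriv ^^ i) (\<lambda>x. H x y) a / fact i)"
  define c where "c = (\<lambda>i j. (deriv ^^ j) (A i) b / fact j)"
  define r where "r = R / 2"
  have r: "0 < r" "r < R" using R by (auto simp: r_def)
  have M: "0 \<le> M" using bound[of a b] R norm_ge_zero order_trans by (metis centre_in_ball)
  have A_hol: "A i holomorphic_on ball b R" for i
    unfolding A_def by (rule taylor_coeff_holomorphic[OF R hx hy bound])
  have A_bound: "norm (A i y) \<le> M / r ^ i" if "y \<in> ball b R" for i y
    unfolding A_def using hx[OF that] bound that r by (intro taylor_coeff_bound) auto
  have c_bound: "norm (c i j) \<le> M / r ^ i / r ^ j" for i j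
    unfolding c_def using A_hol A_bound r by (intro taylor_coeff_bound) auto
  have "((\<lambda>(i, j). c i j * (x - a) ^ i * (y - b) ^ j) has_sum H x y) UNIV"
    if x: "x \<in> ball a (R / 4)" and y: "y \<in> ball b (R / 4)" for x y
  proof -
    have xy: "x \<in> ball a R" "y \<in> ball b R" using x y R by auto
    have small: "norm (x - a) / r \<le> 1 / 2" "norm (y - b) / r \<le> 1 / 2"
      using x y R by (auto simp: r_def dist_norm norm_minus_commute)
    let ?f = "\<lambda>p. c (fst p) (snd p) * (x - a) ^ fst p * (y - b) ^ snd p"
    have le: "norm (?f p) \<le> norm (M * (1 / 2) ^ fst p * (1 / 2) ^ snd p)" for p
    proof -
      have "norm (?f p) = norm (c (fst p) (snd p)) * norm (x - a) ^ fst p * norm (y - b) ^ snd p"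
        by (simp add: norm_mult norm_power)
      also have "\<dots> \<le> M / r ^ fst p / r ^ snd p * norm (x - a) ^ fst p * norm (y - b) ^ snd p"
        by (intro mult_right_mono c_bound) auto
      also have "\<dots> = M * (norm (x - a) / r) ^ fst p * (norm (y - b) / r) ^ snd p"
        by (simp add: power_divide)
      also have "\<dots> \<le> M * (1 / 2) ^ fst p * (1 / 2) ^ snd p"
        using small M r by (intro mult_mono power_mono mult_nonneg_nonneg) auto
      finally show ?thesis using M by simp
    qed
    have abs: "(\<lambda>p. norm (?f p)) summable_on UNIV"
    proof (rule Infinite_Sum.abs_summable_on_comparison_test)
      show "(\<lambda>p. norm (case p of (i, j) \<Rightarrow> M * (1 / 2) ^ i * (1 / 2) ^ j)) summable_on (UNIV :: (nat \<times> nat) set)"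
        by (rule abs_summable_geometric_product) auto
      show "norm (?f p) \<le> norm (case p of (i, j) \<Rightarrow> M * (1 / 2) ^ i * (1 / 2) ^ j)" for p
        using le[of p] by (cases p) simp
    qed
    then have summ: "?f summable_on UNIV \<times> UNIV" by (simp add: Infinite_Sum.abs_summable_summable)
    have inner: "(\<Sum>\<^sub>\<infinity>j. ?f (i, j)) = A i y * (x - a) ^ i" for i
    proof -
      have "(\<lambda>j. c i j * (y - b) ^ j) sums A i y"
        unfolding c_def by (rule holomorphic_power_series[OF A_hol xy(2)])
      then have "(\<lambda>j. (x - a) ^ i * (c i j * (y - b) ^ j)) sums ((x - a) ^ i * A i y)"
        by (rule sums_mult)
      then have s: "(\<lambda>j. ?f (i, j)) sums (A i y * (x - a) ^ i)" by (simp add: mult_ac)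
      have "(\<lambda>j. norm (?f (i, j))) summable_on UNIV"
        using abs Infinite_Sum.abs_summable_on_Sigma_iff[of ?f UNIV "\<lambda>_. UNIV"] by simp
      then have "summable (\<lambda>j. norm (?f (i, j)))"
        using summable_on_imp_summable by blast
      then show ?thesis using norm_summable_imp_has_sum[OF _ s] by (simp add: infsumI)
    qed
    have "(\<Sum>\<^sub>\<infinity>i. A i y * (x - a) ^ i) = infsum ?f (UNIV \<times> UNIV)"
      using infsum_Sigma_banach[OF summ] by (simp only: inner)
    moreover have "(\<Sum>\<^sub>\<infinity>i. A i y * (x - a) ^ i) = H x y"
    proof -
      have s: "(\<lambda>i. A i y * (x - a) ^ i) sums H x y"
        unfolding A_def by (rule holomorphic_power_series[OF hx[OF xy(2)] xy(1)])
      have "summable (\<lambda>i. norm (A i y * (x - a) ^ i))"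
      proof (rule summable_comparison_test')
        show "summable (\<lambda>i. M * (1 / 2 :: real) ^ i)" by (intro summable_mult summable_geometric) simp
        show "norm (norm (A i y * (x - a) ^ i)) \<le> M * (1 / 2) ^ i" if "0 \<le> i" for i
        proof -
          have "norm (A i y * (x - a) ^ i) \<le> M / r ^ i * norm (x - a) ^ i"
            unfolding norm_mult norm_power by (intro mult_right_mono A_bound xy) auto
          also have "\<dots> = M * (norm (x - a) / r) ^ i" by (simp add: power_divide)
          also have "\<dots> \<le> M * (1 / 2) ^ i" using small M r by (intro mult_left_mono power_mono) auto
          finally show ?thesis by simp
        qed
      qed
      then show ?thesis using norm_summable_imp_has_sum[OF _ s] by (simp add: infsumI)
    qed
    ultimately have "infsum ?f UNIV = H x y" by simp
    then have "(?f has_sum H x y) UNIV"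
      using summ has_sum_infsum by fastforce
    then show ?thesis by (simp only: case_prod_unfold)
  qed
  then show ?thesis by (rule that)
qed

lemma real_double_power_series:
  fixes H :: "complex \<Rightarrow> complex \<Rightarrow> complex" and f :: "real \<times> real \<Rightarrow> real"
  assumes R: "0 < R"
    and hx: "\<And>y. y \<in> ball (of_real b) R \<Longrightarrow> (\<lambda>x. H x y) holomorphic_on ball (of_real a) R"
    and hy: "\<And>x. x \<in> ball (of_real a) R \<Longrightarrow> H x holomorphic_on ball (of_real b) R"
    and bound: "\<And>x y. x \<in> ball (of_real a) R \<Longrightarrow> y \<in> ball (of_real b) R \<Longrightarrow> norm (H x y) \<le> M"
    and real: "\<And>x y. \<bar>x - a\<bar> < R \<Longrightarrow> \<bar>y - b\<bar> < R \<Longrightarrow> Re (H (of_real x) (of_real y)) = f (x, y)"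
  shows "\<exists>r>0. \<exists>c :: nat \<Rightarrow> nat \<Rightarrow> real. \<forall>x y. \<bar>x - a\<bar> < r \<longrightarrow> \<bar>y - b\<bar> < r \<longrightarrow>
        ((\<lambda>(i, j). c i j * (x - a) ^ i * (y - b) ^ j) has_sum f (x, y)) UNIV"
proof (rule double_power_series[OF R hx hy bound])
  fix c :: "nat \<Rightarrow> nat \<Rightarrow> complex"
  assume c: "\<And>x y. x \<in> ball (of_real a) (R / 4) \<Longrightarrow> y \<in> ball (of_real b) (R / 4) \<Longrightarrow>
     ((\<lambda>(i, j). c i j * (x - of_real a) ^ i * (y - of_real b) ^ j) has_sum H x y) UNIV"
  show ?thesis
  proof (intro exI[of _ "R / 4"] exI[of _ "\<lambda>i j. Re (c i j)"] conjI allI impI)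
    show "0 < R / 4" using R by simp
    fix x y :: real assume xy: "\<bar>x - a\<bar> < R / 4" "\<bar>y - b\<bar> < R / 4"
    have "complex_of_real x \<in> ball (of_real a) (R / 4)" "complex_of_real y \<in> ball (of_real b) (R / 4)"
      using xy by (simp_all add: dist_norm abs_minus_commute flip: of_real_diff)
    from has_sum_Re[OF c[OF this]]
    have "((\<lambda>p. Re (case p of (i, j) \<Rightarrow> c i j * (of_real x - of_real a) ^ i * (of_real y - of_real b) ^ j)) has_sum f (x, y)) UNIV"
      using real[of x y] xy R by simp
    moreover have "Re (case p of (i, j) \<Rightarrow> c i j * (of_real x - of_real a) ^ i * (of_real y - of_real b) ^ j) =
        (case p of (i, j) \<Rightarrow> Re (c i j) * (x - a) ^ i * (y - b) ^ j)" for p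
      by (cases p) (simp flip: of_real_diff of_real_power)
    ultimately show "((\<lambda>(i, j). Re (c i j) * (x - a) ^ i * (y - b) ^ j) has_sum f (x, y)) UNIV" by simp
  qed
qed

text \<open>The constant is obtained before the sequences, because it has to serve all \<beta> in an
  interval. Exponential tails force a recent value of \<open>u\<close> to be bounded below; the mass
  \<open>c\<close> of a renewal step of length one then carries this value to time \<open>n\<close>
  in at most \<open>J\<close> steps.\<close>

lemma renewal_lower_bound:
  fixes c q A :: real
  assumes "0 < c" "c \<le> 1" "1 < q" "0 < A"
  obtains \<kappa> where "0 < \<kappa>"
    "\<And>u f n. \<lbrakk>u 0 = 1; \<And>n. 1 \<le> n \<Longrightarrow> u n = (\<Sum>k=1..n. f k * u (n - k)); \<And>n. 0 \<le> u n \<and> u n \<le> (1::real);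
       \<And>n. 0 \<le> f n; c \<le> f 1; f 0 = 0; f sums 1; \<And>N. (\<Sum>k\<le>N. f k * q ^ k) \<le> A\<rbrakk> \<Longrightarrow> \<kappa> \<le> u n"
proof -
  have "(\<lambda>J. A / (q - 1) * (1 / q) ^ J) \<longlonglongrightarrow> A / (q - 1) * 0"
    using assms by (intro tendsto_mult tendsto_const LIMSEQ_power_zero) auto
  then have "\<forall>\<^sub>F J in sequentially. A / (q - 1) * (1 / q) ^ J < 1 / 2"
    by (intro order_tendstoD(2)) auto
  \<comment> \<open>Beyond \<open>J\<close> the summed tail bounds of the step distribution
    contribute less than one half of the identity \<open>ident\<close>.\<close>
  then obtain J where J: "A / (q - 1) * (1 / q) ^ J < 1 / 2"
    by (auto simp: eventually_sequentially)
  define \<kappa> where "\<kappa> = c ^ J / (2 * real (Suc J))"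
  have "0 < \<kappa>" using assms by (simp add: \<kappa>_def)
  moreover have "\<kappa> \<le> u n"
    if u0: "u 0 = 1" and ren: "\<And>n. 1 \<le> n \<Longrightarrow> u n = (\<Sum>k=1..n. f k * u (n - k))" and u: "\<And>n. 0 \<le> u n \<and> u n \<le> 1"
    and f: "\<And>n. 0 \<le> f n" and f1: "c \<le> f 1" and f0: "f 0 = 0" and f_sums: "f sums 1"
    and A: "\<And>N. (\<Sum>k\<le>N. f k * q ^ k) \<le> A" for u f :: "nat \<Rightarrow> real" and n
  proof -
    define r where "r = (\<lambda>j. 1 - (\<Sum>i\<le>j. f i))"
    have r_le: "r j \<le> A * (1 / q) ^ Suc j" for j
    proof -
      have "(\<lambda>N. \<Sum>i\<le>N. f i) \<longlonglongrightarrow> 1" using f_sums by (simp add: sums_def_le)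
      moreover have "(\<Sum>i\<le>N. f i) \<le> (\<Sum>i\<le>j. f i) + A * (1 / q) ^ Suc j" for N
      proof -
        have "(\<Sum>i\<le>N. f i) \<le> (\<Sum>i\<in>{..j} \<union> {Suc j..N}. f i)"
          using f by (intro sum_mono2) auto
        also have "\<dots> = (\<Sum>i\<le>j. f i) + (\<Sum>i=Suc j..N. f i)"
          by (rule sum.union_disjoint) auto
        also have "(\<Sum>i=Suc j..N. f i) \<le> (\<Sum>i=Suc j..N. f i * q ^ i * (1 / q) ^ Suc j)"
        proof (rule sum_mono)
          fix i assume i: "i \<in> {Suc j..N}"
          have "q ^ Suc j \<le> q ^ i" using i assms by (intro power_increasing) auto
          then have "1 \<le> q ^ i * (1 / q) ^ Suc j" using assms by (simp add: power_divide le_divide_eq)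
          then have "f i * 1 \<le> f i * (q ^ i * (1 / q) ^ Suc j)"
            by (rule mult_left_mono[OF _ f])
          then show "f i \<le> f i * q ^ i * (1 / q) ^ Suc j"
            by (simp only: mult.assoc mult_1_right)
        qed
        also have "\<dots> = (\<Sum>i=Suc j..N. f i * q ^ i) * (1 / q) ^ Suc j" by (simp only: sum_distrib_right)
        also have "\<dots> \<le> (\<Sum>i\<le>N. f i * q ^ i) * (1 / q) ^ Suc j"
          using f assms by (intro mult_right_mono sum_mono2) auto
        also have "\<dots> \<le> A * (1 / q) ^ Suc j" using A assms by (intro mult_right_mono) auto
        finally show ?thesis by simp
      qed
      ultimately have "1 \<le> (\<Sum>i\<le>j. f i) + A * (1 / q) ^ Suc j"
        by (intro LIMSEQ_le_const2) auto
      then show ?thesis by (simp add: r_def)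
    qed
    have r_le_1: "r j \<le> 1" for j using f by (simp add: r_def sum_nonneg)
    \<comment> \<open>The last renewal up to time \<open>m\<close> occurs at some \<open>k\<close>,
      and the following step is longer than \<open>m - k\<close>.\<close>
    have ident: "(\<Sum>k\<le>m. u k * r (m - k)) = 1" for m
    proof (induction m)
      case 0
      then show ?case by (simp add: u0 r_def f0)
    next
      case (Suc m)
      have "(\<Sum>k\<le>Suc m. u k * r (Suc m - k)) = (\<Sum>k\<le>m. u k * r (Suc m - k)) + u (Suc m) * r 0" by simp
      also have "(\<Sum>k\<le>m. u k * r (Suc m - k)) = (\<Sum>k\<le>m. u k * r (m - k) - u k * f (Suc m - k))"
        by (intro sum.cong refl) (simp add: r_def Suc_diff_le algebra_simps)
      also have "\<dots> = 1 - (\<Sum>k\<le>m. u k * f (Suc m - k))" by (simp add: sum_subtractf Suc)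
      also have "(\<Sum>k\<le>m. u k * f (Suc m - k)) = (\<Sum>k=1..Suc m. f k * u (Suc m - k))"
        by (rule sum.reindex_bij_witness[of _ "\<lambda>k. Suc m - k" "\<lambda>k. Suc m - k"]) auto
      also have "\<dots> = u (Suc m)" using ren[of "Suc m"] by simp
      finally show ?case by (simp add: r_def f0)
    qed
    have u_step: "c ^ j * u m \<le> u (m + j)" for m j
    proof (induction j)
      case (Suc j)
      have "c * (c ^ j * u m) \<le> f 1 * u (m + j)"
        using Suc f1 assms u f by (intro mult_mono) (auto intro!: mult_nonneg_nonneg)
      also have "\<dots> \<le> (\<Sum>k=1..Suc (m + j). f k * u (Suc (m + j) - k))"
        using member_le_sum[of 1 "{1..Suc (m + j)}" "\<lambda>k. f k * u (Suc (m + j) - k)"] f u by auto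
      also have "\<dots> = u (Suc (m + j))" using ren[of "Suc (m + j)"] by simp
      finally show ?case by (simp add: mult.assoc)
    qed simp
    \<comment> \<open>Otherwise the \<open>Suc J\<close> most recent terms of \<open>ident\<close>
      contribute at most 1 / 2 and the older ones less than 1 / 2.\<close>
    have "\<exists>j\<le>min J n. 1 / (2 * real (Suc J)) \<le> u (n - j)"
    proof (rule ccontr)
      assume "\<not> ?thesis"
      then have small: "u (n - j) < 1 / (2 * real (Suc J))" if "j \<le> J" "j \<le> n" for j
      proof -
        have "j \<le> min J n" using that by simp
        then show ?thesis using \<open>\<not> (\<exists>j\<le>min J n. 1 / (2 * real (Suc J)) \<le> u (n - j))\<close> not_le by blast
      qed
      have "1 = (\<Sum>k\<le>n. u k * r (n - k))" using ident by simp
      also have "\<dots> = (\<Sum>j\<le>n. u (n - j) * r j)"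
        by (rule sum.reindex_bij_witness[of _ "\<lambda>k. n - k" "\<lambda>k. n - k"]) auto
      also have "\<dots> \<le> (\<Sum>j\<le>n. (if j \<le> J then 1 / (2 * real (Suc J)) else 0) + (if J < j then A * (1 / q) ^ Suc j else 0))"
      proof (rule sum_mono)
        fix j assume j: "j \<in> {..n}"
        show "u (n - j) * r j \<le> (if j \<le> J then 1 / (2 * real (Suc J)) else 0) + (if J < j then A * (1 / q) ^ Suc j else 0)"
        proof (cases "j \<le> J")
          case True
          have "u (n - j) * r j \<le> u (n - j) * 1" using u r_le_1 by (intro mult_left_mono) auto
          then show ?thesis using small[OF True] j True by auto
        next
          case False
          have "u (n - j) * r j \<le> u (n - j) * (A * (1 / q) ^ Suc j)" using u r_le by (intro mult_left_mono) auto
          also have "\<dots> \<le> 1 * (A * (1 / q) ^ Suc j)" using u assms by (intro mult_right_mono) auto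
          finally show ?thesis using False by simp
        qed
      qed
      also have "\<dots> = (\<Sum>j\<le>n. if j \<le> J then 1 / (2 * real (Suc J)) else 0) + (\<Sum>j\<le>n. if J < j then A * (1 / q) ^ Suc j else 0)"
        by (rule sum.distrib)
      also have "(\<Sum>j\<le>n. if j \<le> J then 1 / (2 * real (Suc J)) else 0) \<le> (\<Sum>j\<le>J. 1 / (2 * real (Suc J)))"
      proof -
        have "(\<Sum>j\<le>n. if j \<le> J then 1 / (2 * real (Suc J)) else 0) = (\<Sum>j\<in>{..n} \<inter> {..J}. 1 / (2 * real (Suc J)))"
          using sum.inter_restrict[OF finite_atMost, of "\<lambda>_. 1 / (2 * real (Suc J))" n "{..J}"] by (simp only: atMost_iff)
        also have "\<dots> \<le> (\<Sum>j\<le>J. 1 / (2 * real (Suc J)))"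
          by (rule sum_mono2) auto
        finally show ?thesis .
      qed
      also have "(\<Sum>j\<le>J. 1 / (2 * real (Suc J))) = 1 / 2" by (simp add: field_simps)
      also have "(\<Sum>j\<le>n. if J < j then A * (1 / q) ^ Suc j else 0) \<le> A / (q - 1) * (1 / q) ^ J - A / (q - 1) * (1 / q) ^ (max J n)"
      proof -
        \<comment> \<open>The subtracted term makes the claim inductive in \<open>n\<close>;
          \<open>max J n\<close> covers \<open>n \<le> J\<close>, where both sides vanish.\<close>
        have "(\<Sum>j\<le>n. if J < j then A * (1 / q) ^ Suc j else 0) \<le> A / (q - 1) * (1 / q) ^ J - A / (q - 1) * (1 / q) ^ (max J n)" for n
        proof (induction n)
          case (Suc n)
          have step: "A / (q - 1) * (1 / q) ^ n - A / (q - 1) * (1 / q) ^ Suc n = A * (1 / q) ^ Suc n"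
          proof -
            define p where "p = (1 / q) ^ n"
            have "A / (q - 1) * p - A / (q - 1) * (p / q) = A * (p / q)"
              using assms by (simp add: divide_simps) (simp add: algebra_simps)
            then show ?thesis by (simp add: p_def)
          qed
          have "A * (1 / q) ^ Suc (Suc n) \<le> A * (1 / q) ^ Suc n"
            using assms by (intro mult_left_mono power_decreasing) auto
          then show ?case using Suc step by (cases "J \<le> n") (auto simp: max_def not_le le_Suc_eq)
        qed simp
        then show ?thesis .
      qed
      also have "\<dots> \<le> A / (q - 1) * (1 / q) ^ J" using assms by simp
      finally have "1 \<le> 1 / 2 + A / (q - 1) * (1 / q) ^ J" by simp
      then show False using J by linarith
    qed
    then obtain j where j: "j \<le> J" "j \<le> n" "1 / (2 * real (Suc J)) \<le> u (n - j)" by auto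
    have "\<kappa> = c ^ J * (1 / (2 * real (Suc J)))" by (simp add: \<kappa>_def)
    also have "\<dots> \<le> c ^ j * u (n - j)"
      using j assms u by (intro mult_mono power_decreasing) auto
    also have "\<dots> \<le> u n" using u_step[of j "n - j"] j by simp
    finally show ?thesis .
  qed
  ultimately show ?thesis by (rule that) 
qed


text \<open>\<open>Q\<close> is the divided difference of \<open>F\<close> in its first argument.
  The equation for \<open>\<zeta>\<close> becomes a formula for the difference quotient of
  \<open>\<zeta>\<close>, whose denominator \<open>Q\<close> is bounded away from 0; the same
  formula gives continuity first.\<close>

lemma implicit_slice:
  fixes F :: "complex \<Rightarrow> complex \<Rightarrow> complex"
  assumes X: "open X" and F: "\<And>w. w \<in> B \<Longrightarrow> F w holomorphic_on X"
    and FQ: "\<And>w w' x. w \<in> B \<Longrightarrow> w' \<in> B \<Longrightarrow> x \<in> X \<Longrightarrow> F w x - F w' x = (w - w') * Q w w' x"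
    and Q: "\<And>w w' x. w \<in> B \<Longrightarrow> w' \<in> B \<Longrightarrow> x \<in> X \<Longrightarrow> m \<le> norm (Q w w' x)" and m: "0 < m"
    and cont: "continuous_on (B \<times> B \<times> X) (\<lambda>p. Q (fst p) (fst (snd p)) (snd (snd p)))"
    and \<zeta>: "\<And>x. x \<in> X \<Longrightarrow> \<zeta> x \<in> B \<and> F (\<zeta> x) x = 1"
  shows "\<zeta> holomorphic_on X"
  unfolding holomorphic_on_open[OF X]
proof
  fix x0 assume x0: "x0 \<in> X"
  define w0 where "w0 = \<zeta> x0"
  have w0: "w0 \<in> B" "F w0 x0 = 1" using \<zeta>[OF x0] by (auto simp: w0_def)
  have nX: "\<forall>\<^sub>F x in at x0. x \<in> X" using X x0 by (rule eventually_at_in_open')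
  have eq: "(\<zeta> x - w0) * Q (\<zeta> x) w0 x = - (F w0 x - F w0 x0)" if "x \<in> X" for x
    using FQ[of "\<zeta> x" w0 x] \<zeta>[OF that] w0 that by (simp add: algebra_simps)
  obtain F' where F': "(F w0 has_field_derivative F') (at x0)"
    using F[OF w0(1)] X x0 by (metis holomorphic_on_open)
  then have quot: "((\<lambda>x. (F w0 x - F w0 x0) / (x - x0)) \<longlongrightarrow> F') (at x0)"
    by (simp add: has_field_derivative_iff)
  have Fc: "(F w0 \<longlongrightarrow> F w0 x0) (at x0)"
    using DERIV_isCont[OF F'] by (simp add: isCont_def)
  have \<zeta>_lim: "(\<zeta> \<longlongrightarrow> w0) (at x0)"
  proof (rule LIM_zero_cancel)
    show "((\<lambda>x. \<zeta> x - w0) \<longlongrightarrow> 0) (at x0)"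
    proof (rule Lim_null_comparison)
      show "\<forall>\<^sub>F x in at x0. norm (\<zeta> x - w0) \<le> norm (F w0 x - F w0 x0) / m"
        using nX
      proof eventually_elim
        case (elim x)
        have "norm (\<zeta> x - w0) * m \<le> norm (\<zeta> x - w0) * norm (Q (\<zeta> x) w0 x)"
          using Q[of "\<zeta> x" w0 x] \<zeta>[OF elim] w0 elim by (intro mult_left_mono) auto
        also have "\<dots> = norm (F w0 x - F w0 x0)"
          unfolding norm_mult[symmetric] eq[OF elim] by (rule norm_minus_cancel)
        finally show ?case using m by (simp add: le_divide_eq)
      qed
      have "((\<lambda>x. norm (F w0 x - F w0 x0) / m) \<longlongrightarrow> norm (F w0 x0 - F w0 x0) / m) (at x0)"
        using m by (intro tendsto_intros Fc) auto
      then show "((\<lambda>x. norm (F w0 x - F w0 x0) / m) \<longlongrightarrow> 0) (at x0)" by simp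
    qed
  qed
  have Q_lim: "((\<lambda>x. Q (\<zeta> x) w0 x) \<longlongrightarrow> Q w0 w0 x0) (at x0)"
  proof -
    have "((\<lambda>x. (\<zeta> x, w0, x)) \<longlongrightarrow> (w0, w0, x0)) (at x0)"
      by (intro tendsto_Pair \<zeta>_lim tendsto_const tendsto_ident_at)
    moreover have "\<forall>\<^sub>F x in at x0. (\<zeta> x, w0, x) \<in> B \<times> B \<times> X"
      using nX by eventually_elim (use \<zeta> w0 in auto)
    ultimately show ?thesis
      using continuous_on_tendsto_compose[OF cont, of "\<lambda>x. (\<zeta> x, w0, x)" "(w0, w0, x0)" "at x0"] w0 x0 by simp
  qed
  have Q0: "Q w0 w0 x0 \<noteq> 0" using Q[OF w0(1) w0(1) x0] m by auto
  have "((\<lambda>x. - ((F w0 x - F w0 x0) / (x - x0)) / Q (\<zeta> x) w0 x) \<longlongrightarrow> - F' / Q w0 w0 x0) (at x0)"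
    by (intro tendsto_divide tendsto_minus quot Q_lim Q0)
  moreover have "\<forall>\<^sub>F x in at x0. - ((F w0 x - F w0 x0) / (x - x0)) / Q (\<zeta> x) w0 x = (\<zeta> x - \<zeta> x0) / (x - x0)"
    using nX
  proof eventually_elim
    case (elim x)
    have "Q (\<zeta> x) w0 x \<noteq> 0" using Q[of "\<zeta> x" w0 x] \<zeta>[OF elim] w0 elim m by auto
    moreover have dF: "F w0 x - F w0 x0 = - ((\<zeta> x - w0) * Q (\<zeta> x) w0 x)"
      using eq[OF elim] by (simp only: minus_minus)
    ultimately show ?case
      unfolding dF w0_def[symmetric] by simp
  qed
  ultimately have "((\<lambda>x. (\<zeta> x - \<zeta> x0) / (x - x0)) \<longlongrightarrow> - F' / Q w0 w0 x0) (at x0)"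
    by (rule Lim_transform_eventually)
  then show "\<exists>f'. (\<zeta> has_field_derivative f') (at x0)"
    by (auto simp: has_field_derivative_iff)
qed

lemma continuous_on_suminf_M:
  fixes f :: "nat \<Rightarrow> 'x::topological_space \<Rightarrow> complex"
  assumes "\<And>n. continuous_on S (f n)" "\<And>n x. x \<in> S \<Longrightarrow> norm (f n x) \<le> M n" "summable M"
  shows "continuous_on S (\<lambda>x. \<Sum>n. f n x)"
proof (rule uniform_limit_theorem)
  show "uniform_limit S (\<lambda>n x. \<Sum>i<n. f i x) (\<lambda>x. \<Sum>n. f n x) sequentially"
    by (rule Weierstrass_m_test) (use assms in auto)
  show "\<forall>\<^sub>F n in sequentially. continuous_on S (\<lambda>x. \<Sum>i<n. f i x)"
    by (intro always_eventually allI continuous_on_sum assms)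
qed simp

lemma holomorphic_on_suminf_M:
  fixes f :: "nat \<Rightarrow> complex \<Rightarrow> complex"
  assumes "open S" "\<And>n. f n holomorphic_on S" "\<And>n x. x \<in> S \<Longrightarrow> norm (f n x) \<le> M n" "summable M"
  shows "(\<lambda>x. \<Sum>n. f n x) holomorphic_on S"
proof (rule holomorphic_uniform_sequence[OF assms(1), of "\<lambda>n x. \<Sum>i<n. f i x"])
  show "(\<lambda>x. \<Sum>i<n. f i x) holomorphic_on S" for n
    by (intro holomorphic_on_sum assms)
  fix x assume "x \<in> S"
  then obtain d where d: "0 < d" "cball x d \<subseteq> S"
    using assms(1) open_contains_cball by metis
  have "uniform_limit (cball x d) (\<lambda>n x. \<Sum>i<n. f i x) (\<lambda>x. \<Sum>n. f n x) sequentially"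
    by (rule Weierstrass_m_test) (use assms d in auto)
  then show "\<exists>d>0. cball x d \<subseteq> S \<and> uniform_limit (cball x d) (\<lambda>n x. \<Sum>i<n. f i x) (\<lambda>x. \<Sum>n. f n x) sequentially"
    using d by blast
qed


text \<open>The implicit function theorem for a power series in \<open>w\<close> whose coefficients
  depend on two parameters. The majorant \<open>C\<close>, summable at a radius \<open>z1\<close>
  beyond the root, makes the series and its divided difference \<open>Q\<close> jointly continuous;
  \<open>D\<close> says that \<open>Q\<close> does not vanish at the base point. Holomorphy is
  obtained in each parameter separately, which suffices for
  \<open>double_power_series\<close>.\<close>

lemma power_series_implicit:
  fixes c :: "nat \<Rightarrow> complex \<Rightarrow> complex \<Rightarrow> complex" and C :: "nat \<Rightarrow> real"
  assumes R: "0 < R"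
    and c_bound: "\<And>n x y. x \<in> ball a R \<Longrightarrow> y \<in> ball b R \<Longrightarrow> norm (c n x y) \<le> C n"
    and summ: "summable (\<lambda>n. C n * z1 ^ n)"
    and cont: "\<And>n. continuous_on (ball a R \<times> ball b R) (\<lambda>p. c n (fst p) (snd p))"
    and hx: "\<And>n y. y \<in> ball b R \<Longrightarrow> (\<lambda>x. c n x y) holomorphic_on ball a R"
    and hy: "\<And>n x. x \<in> ball a R \<Longrightarrow> c n x holomorphic_on ball b R"
    and z0: "norm z0 < z1" and root: "(\<Sum>n. c n a b * z0 ^ n) = 1"
    and D: "(\<Sum>n. c n a b * (of_nat n * z0 ^ (n - 1))) \<noteq> 0" and \<rho>0: "0 < \<rho>0"
  obtains r \<rho> \<zeta> where "0 < r" "r \<le> R" "0 < \<rho>" "\<rho> \<le> \<rho>0"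
    "\<And>x y. x \<in> ball a r \<Longrightarrow> y \<in> ball b r \<Longrightarrow> \<zeta> x y \<in> ball z0 \<rho>"
    "\<And>x y w. x \<in> ball a r \<Longrightarrow> y \<in> ball b r \<Longrightarrow> w \<in> ball z0 \<rho> \<Longrightarrow> (\<Sum>n. c n x y * w ^ n) = 1 \<Longrightarrow> w = \<zeta> x y"
    "\<And>y. y \<in> ball b r \<Longrightarrow> (\<lambda>x. \<zeta> x y) holomorphic_on ball a r"
    "\<And>x. x \<in> ball a r \<Longrightarrow> \<zeta> x holomorphic_on ball b r"
proof -
  define \<Omega> where "\<Omega> = ball a R \<times> ball b R"
  \<comment> \<open>A radius strictly between the root and \<open>z1\<close>, where the termwise
    derivative of the majorant still converges.\<close>
  define r1 where "r1 = (norm z0 + z1) / 2"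
  have r1: "norm z0 < r1" "r1 < z1" "0 < r1" using z0 norm_ge_zero[of z0] by (auto simp: r1_def simp del: norm_ge_zero)
  have z1: "0 < z1" using r1 by simp
  have C0: "0 \<le> C n" for n
    using c_bound[of a b n] R norm_ge_zero order_trans by (metis centre_in_ball)
  define F where "F = (\<lambda>w x y. \<Sum>n. c n x y * w ^ n)"
  define S where "S = (\<lambda>n w w'. \<Sum>i<n. w' ^ (n - Suc i) * w ^ i :: complex)"
  define Q where "Q = (\<lambda>w w' x y. \<Sum>n. c n x y * S n w w')"
  define M where "M = (\<lambda>n. C n * (real n * r1 ^ (n - 1)))"
  define B1 where "B1 = cball (0::complex) r1"
  have summ_x: "summable (\<lambda>n. C n * x ^ n)" if "norm x < z1" for x :: real
  proof (rule summable_comparison_test'[OF summ])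
    fix n :: nat
    show "norm (C n * x ^ n) \<le> C n * z1 ^ n"
      using that C0 by (auto simp: abs_mult power_abs intro!: mult_left_mono power_mono)
  qed
  have summ_M: "summable M"
  proof -
    have "summable (\<lambda>n. diffs C n * r1 ^ n)"
      using termdiff_converges[of r1 z1 C] summ_x r1 by simp
    then have "summable (\<lambda>n. M (Suc n))"
      by (simp add: M_def diffs_def mult_ac)
    then show ?thesis by (simp add: summable_Suc_iff)
  qed
  have summ_r1: "summable (\<lambda>n. C n * r1 ^ n)" using summ_x[of r1] r1 by simp
  have S_bound: "norm (S n w w') \<le> real n * r1 ^ (n - 1)" if "w \<in> B1" "w' \<in> B1" for n w w'
  proof -
    have "norm (S n w w') \<le> (\<Sum>i<n. r1 ^ (n - 1))"
      unfolding S_def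
    proof (rule sum_norm_le)
      fix i assume i: "i \<in> {..<n}"
      have "norm (w' ^ (n - Suc i) * w ^ i) \<le> r1 ^ (n - Suc i) * r1 ^ i"
        using that r1 unfolding norm_mult norm_power B1_def by (intro mult_mono power_mono) auto
      also have "\<dots> = r1 ^ (n - 1)" using i by (simp flip: power_add)
      finally show "norm (w' ^ (n - Suc i) * w ^ i) \<le> r1 ^ (n - 1)" .
    qed
    then show ?thesis by simp
  qed
  have Qn: "norm (c n x y * S n w w') \<le> M n" if "x \<in> ball a R" "y \<in> ball b R" "w \<in> B1" "w' \<in> B1" for n x y w w'
    unfolding norm_mult M_def using that C0 by (intro mult_mono c_bound S_bound) auto
  have Fn: "norm (c n x y * w ^ n) \<le> C n * r1 ^ n" if "x \<in> ball a R" "y \<in> ball b R" "w \<in> B1" for n x y w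
    unfolding norm_mult norm_power using that C0 by (intro mult_mono c_bound power_mono) (auto simp: B1_def)
  have FQ: "F w x y - F w' x y = (w - w') * Q w w' x y" if "x \<in> ball a R" "y \<in> ball b R" "w \<in> B1" "w' \<in> B1" for x y w w'
  proof -
    have sF: "summable (\<lambda>n. c n x y * u ^ n)" if "u \<in> B1" for u
      by (rule summable_comparison_test'[OF summ_r1]) (use Fn that \<open>x \<in> ball a R\<close> \<open>y \<in> ball b R\<close> in auto)
    have sQ: "summable (\<lambda>n. c n x y * S n w w')"
      by (rule summable_comparison_test'[OF summ_M]) (use Qn that in auto)
    have "F w x y - F w' x y = (\<Sum>n. c n x y * w ^ n - c n x y * w' ^ n)"
      unfolding F_def by (rule suminf_diff) (use sF that in auto)
    also have "\<dots> = (\<Sum>n. (w - w') * (c n x y * S n w w'))"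
    proof (rule suminf_cong)
      fix n
      have "c n x y * w ^ n - c n x y * w' ^ n = c n x y * (w ^ n - w' ^ n)" by (simp add: right_diff_distrib)
      also have "w ^ n - w' ^ n = (w - w') * S n w w'" unfolding S_def by (rule power_diff_sumr2)
      finally show "c n x y * w ^ n - c n x y * w' ^ n = (w - w') * (c n x y * S n w w')" by (simp add: mult_ac)
    qed
    also have "\<dots> = (w - w') * Q w w' x y" unfolding Q_def by (rule suminf_mult[OF sQ])
    finally show ?thesis .
  qed
  have c_cont: "continuous_on T (\<lambda>p. c n (g p) (h p))"
    if "continuous_on T g" "continuous_on T h" "\<And>p. p \<in> T \<Longrightarrow> g p \<in> ball a R \<and> h p \<in> ball b R"
    for n and T :: "'t::topological_space set" and g h
  proof -
    have "(\<lambda>x. (g x, h x)) ` T \<subseteq> ball a R \<times> ball b R" using that(3) by blast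
    from continuous_on_compose2[OF cont[of n] continuous_on_Pair[OF that(1,2)] this] show ?thesis
      by (simp only: fst_conv snd_conv)
  qed
  define T where "T = B1 \<times> B1 \<times> \<Omega>"
  have Q_cont: "continuous_on T (\<lambda>p. Q (fst p) (fst (snd p)) (fst (snd (snd p))) (snd (snd (snd p))))"
    unfolding Q_def
  proof (rule continuous_on_suminf_M[OF _ _ summ_M])
    show "continuous_on T (\<lambda>p. c n (fst (snd (snd p))) (snd (snd (snd p))) * S n (fst p) (fst (snd p)))" for n
      unfolding S_def by (intro continuous_intros c_cont) (auto simp: T_def \<Omega>_def)
  qed (use Qn in \<open>auto simp: T_def \<Omega>_def\<close>)
  have F_cont: "continuous_on \<Omega> (\<lambda>p. F z0 (fst p) (snd p))"
    unfolding F_def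
  proof (rule continuous_on_suminf_M[OF _ _ summ_r1])
    show "continuous_on \<Omega> (\<lambda>p. c n (fst p) (snd p) * z0 ^ n)" for n
      by (intro continuous_intros c_cont) (auto simp: \<Omega>_def)
  qed (use Fn r1 in \<open>auto simp: B1_def \<Omega>_def\<close>)
  define Dv where "Dv = (\<Sum>n. c n a b * (of_nat n * z0 ^ (n - 1)))"
  have Dv: "Dv \<noteq> 0" using D by (simp add: Dv_def)
  have QD: "Q z0 z0 a b = Dv"
    unfolding Q_def Dv_def
  proof (intro suminf_cong arg_cong2[where f = "(*)"] refl)
    fix n
    have "S n z0 z0 = (\<Sum>i<n. z0 ^ (n - 1))"
      unfolding S_def by (intro sum.cong refl) (simp flip: power_add)
    then show "S n z0 z0 = of_nat n * z0 ^ (n - 1)" by simp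
  qed
  have p0: "(z0, z0, a, b) \<in> T" using r1 R by (auto simp: T_def B1_def \<Omega>_def)
  obtain d1 where d1: "0 < d1" "\<And>p. p \<in> T \<Longrightarrow> dist p (z0, z0, a, b) < d1 \<Longrightarrow>
      dist (Q (fst p) (fst (snd p)) (fst (snd (snd p))) (snd (snd (snd p)))) (Q z0 z0 a b) < norm Dv / 2"
    using Q_cont[unfolded continuous_on_iff, rule_format, OF p0, of "norm Dv / 2"] Dv by auto
  \<comment> \<open>Two arguments within \<open>\<rho>\<close> and two within \<open>r\<close>, each
    at most \<open>d1 / 8\<close>, stay within \<open>d1\<close> altogether; the last bound keeps
    the ball inside \<open>B1\<close>.\<close>
  define \<rho> where "\<rho> = min \<rho>0 (min (d1 / 8) (r1 - norm z0))"
  have \<rho>: "0 < \<rho>" "\<rho> \<le> \<rho>0" "\<rho> \<le> d1 / 8" "\<rho> \<le> r1 - norm z0" using \<rho>0 d1(1) r1 unfolding \<rho>_def by linarith+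
  have subB: "cball z0 \<rho> \<subseteq> B1"
  proof
    fix w assume "w \<in> cball z0 \<rho>"
    then have "norm (w - z0) \<le> \<rho>" by (simp add: dist_norm norm_minus_commute)
    then show "w \<in> B1" using \<rho>(4) norm_triangle_sub[of w z0] by (simp add: B1_def)
  qed
  have "(a, b) \<in> \<Omega>" using R by (simp add: \<Omega>_def)
  then obtain d2 where d2: "0 < d2" "\<And>p. p \<in> \<Omega> \<Longrightarrow> dist p (a, b) < d2 \<Longrightarrow> dist (F z0 (fst p) (snd p)) (F z0 a b) < norm Dv * (\<rho> / 4)"
    using F_cont[unfolded continuous_on_iff, rule_format, of "(a, b)" "norm Dv * (\<rho> / 4)"] Dv \<rho> by auto
  define r where "r = min R (min (d1 / 8) (d2 / 4))"
  have r: "0 < r" "r \<le> R" "r \<le> d1 / 8" "r \<le> d2 / 4" using R d1(1) d2(1) unfolding r_def by linarith+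
  have sub_r: "x \<in> ball a R" if "x \<in> ball a r" for x using that r by auto
  have sub_r': "y \<in> ball b R" if "y \<in> ball b r" for y using that r by auto
  have inB1: "w \<in> B1" if "w \<in> cball z0 \<rho>" for w using that subB by blast
  have dist_Pair: "dist (u, v) (u', v') \<le> dist u u' + dist v v'" for u u' :: "'p::metric_space" and v v' :: "'q::metric_space"
    unfolding dist_Pair_Pair by (rule sqrt_sum_squares_le_sum) auto
  have Q_near: "norm (Q w w' x y - Dv) < norm Dv / 2"
    if "w \<in> cball z0 \<rho>" "w' \<in> cball z0 \<rho>" "x \<in> ball a r" "y \<in> ball b r" for w w' x y
  proof -
    have "(w, w', x, y) \<in> T" using that subB r by (auto simp: T_def \<Omega>_def)
    moreover have "dist (w, w', x, y) (z0, z0, a, b) < d1"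
    proof -
      have "dist (w, w', x, y) (z0, z0, a, b) \<le> dist w z0 + (dist w' z0 + (dist x a + dist y b))"
        using dist_Pair[of w "(w', x, y)" z0 "(z0, a, b)"] dist_Pair[of w' "(x, y)" z0 "(a, b)"] dist_Pair[of x y a b]
        by linarith
      also have "\<dots> < d1"
        using that \<rho> r d1(1) by (simp add: dist_commute)
      finally show ?thesis .
    qed
    ultimately show ?thesis using d1(2)[of "(w, w', x, y)"] by (simp add: QD dist_norm)
  qed
  have Q_lower: "norm Dv / 2 \<le> norm (Q w w' x y)"
    if "w \<in> cball z0 \<rho>" "w' \<in> cball z0 \<rho>" "x \<in> ball a r" "y \<in> ball b r" for w w' x y
    using Q_near[OF that] norm_triangle_ineq2[of Dv "Dv - Q w w' x y"] by (simp add: norm_minus_commute)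
  have unique: "w = w'" if "w \<in> cball z0 \<rho>" "w' \<in> cball z0 \<rho>" "x \<in> ball a r" "y \<in> ball b r" "F w x y = 1" "F w' x y = 1" for w w' x y
  proof -
    have "(w - w') * Q w w' x y = 0"
      using FQ[OF sub_r[OF that(3)] sub_r'[OF that(4)] inB1[OF that(1)] inB1[OF that(2)]] that(5,6) by simp
    moreover have "Q w w' x y \<noteq> 0" using Q_lower[OF that(1-4)] Dv by auto
    ultimately show ?thesis by simp
  qed
  have exists: "\<exists>w\<in>cball z0 (\<rho> / 2). F w x y = 1" if xy: "x \<in> ball a r" "y \<in> ball b r" for x y
  proof -
    \<comment> \<open>Newton's map with the derivative frozen at the base point. By
      \<open>Q_near\<close> it contracts by 1 / 2, and it moves \<open>z0\<close> by at most
      \<open>\<rho> / 4\<close>, so it preserves the ball of radius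
      \<open>\<rho> / 2\<close>.\<close>
    let ?\<Phi> = "\<lambda>w. w - (F w x y - 1) / Dv"
    have sub: "cball z0 (\<rho> / 2) \<subseteq> cball z0 \<rho>" using \<rho> by auto
    have lip: "dist (?\<Phi> w) (?\<Phi> w') \<le> 1 / 2 * dist w w'" if "w \<in> cball z0 (\<rho> / 2)" "w' \<in> cball z0 (\<rho> / 2)" for w w'
    proof -
      have w: "w \<in> cball z0 \<rho>" "w' \<in> cball z0 \<rho>" using that sub by auto
      have "?\<Phi> w - ?\<Phi> w' = (w - w') - (F w x y - F w' x y) / Dv" by (simp add: diff_divide_distrib)
      also have "\<dots> = (w - w') * ((Dv - Q w w' x y) / Dv)"
        unfolding FQ[OF sub_r[OF xy(1)] sub_r'[OF xy(2)] inB1[OF w(1)] inB1[OF w(2)]]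
        using Dv by (simp add: field_simps)
      finally have "norm (?\<Phi> w - ?\<Phi> w') = norm (w - w') * (norm (Dv - Q w w' x y) / norm Dv)"
        by (simp add: norm_mult norm_divide)
      also have "\<dots> \<le> norm (w - w') * (1 / 2)"
        using Q_near[OF w xy] Dv by (intro mult_left_mono) (auto simp: divide_le_eq norm_minus_commute)
      finally show ?thesis by (simp add: dist_norm)
    qed
    have F0: "norm (F z0 x y - 1) < norm Dv * (\<rho> / 4)"
    proof -
      have "dist (x, y) (a, b) \<le> dist x a + dist y b" by (rule dist_Pair)
      also have "\<dots> < d2" using xy r d2 by (simp add: dist_commute)
      finally show ?thesis
        using d2(2)[of "(x, y)"] xy r root by (auto simp: \<Omega>_def dist_norm F_def)
    qed
    have "\<exists>!w. w \<in> cball z0 (\<rho> / 2) \<and> ?\<Phi> w = w"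
    proof (rule Banach_fix[OF complete_eq_closed[THEN iffD2, OF closed_cball], where c = "1 / 2"])
      show "cball z0 (\<rho> / 2) \<noteq> {}" using \<rho> by simp
      show "?\<Phi> ` cball z0 (\<rho> / 2) \<subseteq> cball z0 (\<rho> / 2)"
      proof
        fix v assume "v \<in> ?\<Phi> ` cball z0 (\<rho> / 2)"
        then obtain w where w: "w \<in> cball z0 (\<rho> / 2)" "v = ?\<Phi> w" by auto
        have "dist (?\<Phi> w) (?\<Phi> z0) \<le> 1 / 2 * dist w z0" using w \<rho> by (intro lip) auto
        moreover have "dist (?\<Phi> z0) z0 \<le> \<rho> / 4"
          using F0 Dv by (simp add: dist_norm norm_divide divide_le_eq mult.commute)
        moreover have "dist (?\<Phi> w) z0 \<le> dist (?\<Phi> w) (?\<Phi> z0) + dist (?\<Phi> z0) z0" by (rule dist_triangle)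
        ultimately show "v \<in> cball z0 (\<rho> / 2)" using w by (simp add: dist_commute)
      qed
    qed (use lip in auto)
    then obtain w where "w \<in> cball z0 (\<rho> / 2)" "?\<Phi> w = w" by blast
    then show ?thesis using Dv by (intro bexI[of _ w]) auto
  qed
  define \<zeta> where "\<zeta> = (\<lambda>x y. SOME w. w \<in> cball z0 (\<rho> / 2) \<and> F w x y = 1)"
  have \<zeta>: "\<zeta> x y \<in> cball z0 (\<rho> / 2) \<and> F (\<zeta> x y) x y = 1" if "x \<in> ball a r" "y \<in> ball b r" for x y
  proof -
    have "\<exists>w. w \<in> cball z0 (\<rho> / 2) \<and> F w x y = 1" using exists[OF that] by blast
    from someI_ex[OF this] show ?thesis unfolding \<zeta>_def .
  qed
  have half: "cball z0 (\<rho> / 2) \<subseteq> cball z0 \<rho>" "cball z0 (\<rho> / 2) \<subseteq> B1" using \<rho> subB by auto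
  have half_in: "w \<in> cball z0 \<rho>" "w \<in> B1" if "w \<in> cball z0 (\<rho> / 2)" for w using half that by blast+
  have hol_x: "(\<lambda>x. \<zeta> x y) holomorphic_on ball a r" if y: "y \<in> ball b r" for y
  proof (rule implicit_slice[where B = "cball z0 (\<rho> / 2)" and F = "\<lambda>w x. F w x y" and Q = "\<lambda>w w' x. Q w w' x y" and m = "norm Dv / 2"])
    show "(\<lambda>x. F w x y) holomorphic_on ball a r" if "w \<in> cball z0 (\<rho> / 2)" for w
      unfolding F_def
    proof (rule holomorphic_on_suminf_M[OF open_ball _ _ summ_r1])
      show "(\<lambda>x. c n x y * w ^ n) holomorphic_on ball a r" for n
        by (intro holomorphic_on_mult holomorphic_on_const holomorphic_on_subset[OF hx[OF sub_r'[OF y]] subset_ball[OF r(2)]])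
      show "norm (c n x y * w ^ n) \<le> C n * r1 ^ n" if "x \<in> ball a r" for n x
        by (rule Fn[OF sub_r[OF that] sub_r'[OF y] half_in(2)[OF \<open>w \<in> cball z0 (\<rho> / 2)\<close>]])
    qed
    show "continuous_on (cball z0 (\<rho> / 2) \<times> cball z0 (\<rho> / 2) \<times> ball a r) (\<lambda>p. Q (fst p) (fst (snd p)) (snd (snd p)) y)"
    proof -
      let ?T = "cball z0 (\<rho> / 2) \<times> cball z0 (\<rho> / 2) \<times> ball a r" and ?g = "\<lambda>p. (fst p, fst (snd p), snd (snd p), y)"
      have "continuous_on ?T ?g" by (intro continuous_intros)
      moreover have "?g ` ?T \<subseteq> T"
      proof (rule image_subsetI)
        fix p assume "p \<in> ?T"
        then have "fst p \<in> B1" "fst (snd p) \<in> B1" "snd (snd p) \<in> ball a R"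
          by (auto simp del: mem_ball mem_cball intro: half_in(2) sub_r)
        then show "?g p \<in> T"
          unfolding T_def \<Omega>_def by (intro SigmaI sub_r'[OF y])
      qed
      ultimately show ?thesis
        using continuous_on_compose2[OF Q_cont, of ?T ?g] by (simp only: fst_conv snd_conv)
    qed
    show "F w x y - F w' x y = (w - w') * Q w w' x y" if "w \<in> cball z0 (\<rho> / 2)" "w' \<in> cball z0 (\<rho> / 2)" "x \<in> ball a r" for w w' x
      by (rule FQ[OF sub_r[OF that(3)] sub_r'[OF y] half_in(2)[OF that(1)] half_in(2)[OF that(2)]])
    show "norm Dv / 2 \<le> norm (Q w w' x y)" if "w \<in> cball z0 (\<rho> / 2)" "w' \<in> cball z0 (\<rho> / 2)" "x \<in> ball a r" for w w' x
      by (rule Q_lower[OF half_in(1)[OF that(1)] half_in(1)[OF that(2)] that(3) y])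
    show "\<zeta> x y \<in> cball z0 (\<rho> / 2) \<and> F (\<zeta> x y) x y = 1" if "x \<in> ball a r" for x
      by (rule \<zeta>[OF that y])
  qed (use Dv in auto)
  have hol_y: "\<zeta> x holomorphic_on ball b r" if x: "x \<in> ball a r" for x
  proof (rule implicit_slice[where B = "cball z0 (\<rho> / 2)" and F = "\<lambda>w y. F w x y" and Q = "\<lambda>w w' y. Q w w' x y" and m = "norm Dv / 2"])
    show "(\<lambda>y. F w x y) holomorphic_on ball b r" if "w \<in> cball z0 (\<rho> / 2)" for w
      unfolding F_def
    proof (rule holomorphic_on_suminf_M[OF open_ball _ _ summ_r1])
      show "(\<lambda>y. c n x y * w ^ n) holomorphic_on ball b r" for n
        by (intro holomorphic_on_mult holomorphic_on_const holomorphic_on_subset[OF hy[OF sub_r[OF x]] subset_ball[OF r(2)]])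
      show "norm (c n x y * w ^ n) \<le> C n * r1 ^ n" if "y \<in> ball b r" for n y
        by (rule Fn[OF sub_r[OF x] sub_r'[OF that] half_in(2)[OF \<open>w \<in> cball z0 (\<rho> / 2)\<close>]])
    qed
    show "continuous_on (cball z0 (\<rho> / 2) \<times> cball z0 (\<rho> / 2) \<times> ball b r) (\<lambda>p. Q (fst p) (fst (snd p)) x (snd (snd p)))"
    proof -
      let ?T = "cball z0 (\<rho> / 2) \<times> cball z0 (\<rho> / 2) \<times> ball b r" and ?g = "\<lambda>p. (fst p, fst (snd p), x, snd (snd p))"
      have "continuous_on ?T ?g" by (intro continuous_intros)
      moreover have "?g ` ?T \<subseteq> T"
      proof (rule image_subsetI)
        fix p assume "p \<in> ?T"
        then have "fst p \<in> B1" "fst (snd p) \<in> B1" "snd (snd p) \<in> ball b R"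
          by (auto simp del: mem_ball mem_cball intro: half_in(2) sub_r')
        then show "?g p \<in> T"
          unfolding T_def \<Omega>_def by (intro SigmaI sub_r[OF x])
      qed
      ultimately show ?thesis
        using continuous_on_compose2[OF Q_cont, of ?T ?g] by (simp only: fst_conv snd_conv)
    qed
    show "F w x y - F w' x y = (w - w') * Q w w' x y" if "w \<in> cball z0 (\<rho> / 2)" "w' \<in> cball z0 (\<rho> / 2)" "y \<in> ball b r" for w w' y
      by (rule FQ[OF sub_r[OF x] sub_r'[OF that(3)] half_in(2)[OF that(1)] half_in(2)[OF that(2)]])
    show "norm Dv / 2 \<le> norm (Q w w' x y)" if "w \<in> cball z0 (\<rho> / 2)" "w' \<in> cball z0 (\<rho> / 2)" "y \<in> ball b r" for w w' y
      by (rule Q_lower[OF half_in(1)[OF that(1)] half_in(1)[OF that(2)] x that(3)])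
    show "\<zeta> x y \<in> cball z0 (\<rho> / 2) \<and> F (\<zeta> x y) x y = 1" if "y \<in> ball b r" for y
      by (rule \<zeta>[OF x that])
  qed (use Dv in auto)
  show ?thesis
  proof (rule that[of r \<rho> \<zeta>])
    show "\<zeta> x y \<in> ball z0 \<rho>" if "x \<in> ball a r" "y \<in> ball b r" for x y
      using \<zeta>[OF that] \<rho> by auto
    show "w = \<zeta> x y" if "x \<in> ball a r" "y \<in> ball b r" "w \<in> ball z0 \<rho>" "(\<Sum>n. c n x y * w ^ n) = 1" for x y w
    proof (rule unique[OF _ half_in(1) that(1,2)])
      show "w \<in> cball z0 \<rho>" using that(3) by auto
      show "F w x y = 1" unfolding F_def by (rule that(4))
    qed (use \<zeta>[OF that(1,2)] in auto)
  qed (use r \<rho> hol_x hol_y in auto)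
qed

section \<open>Random walk expectations as path sums\<close>

lemma countable_int_vec: "countable (UNIV :: (int ^ 'd::finite) set)"
proof -
  have "(UNIV :: (int ^ 'd) set) \<subseteq> vec_lambda ` (PiE UNIV (\<lambda>_. UNIV))"
  proof
    fix y :: "int ^ 'd"
    show "y \<in> vec_lambda ` (PiE UNIV (\<lambda>_. UNIV))"
      by (rule image_eqI[of _ _ "vec_nth y"]) auto
  qed
  moreover have "countable (PiE (UNIV :: 'd set) (\<lambda>_. UNIV :: int set))"
    by (rule countable_PiE) auto
  ultimately show ?thesis
    by (meson countable_image countable_subset)
qed

definition cylinder :: "(int ^ 'd) list \<Rightarrow> (nat \<Rightarrow> int ^ 'd) set" where
  "cylinder xs = {\<xi>. \<forall>k<length xs. \<xi> k = xs ! k}"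

lemma mem_cylinder: "\<xi> \<in> cylinder xs \<longleftrightarrow> map \<xi> [0..<length xs] = xs"
proof
  assume "\<xi> \<in> cylinder xs"
  then show "map \<xi> [0..<length xs] = xs"
    by (intro nth_equalityI) (simp_all add: cylinder_def)
next
  assume *: "map \<xi> [0..<length xs] = xs"
  have "\<xi> k = xs ! k" if "k < length xs" for k
    using arg_cong[OF *, of "\<lambda>l. l ! k"] that by simp
  then show "\<xi> \<in> cylinder xs"
    by (simp add: cylinder_def)
qed

lemma prob_space_walk: "prob_space (walk_measure i0 h)"
  unfolding walk_measure_def by (intro prob_space_PiM) (rule prob_space_measure_pmf)

lemma cylinder_emb:
  fixes xs :: "(int ^ 'd) list"
  shows "cylinder xs = prod_emb UNIV (\<lambda>_. measure_pmf p) {..<length xs} (PiE {..<length xs} (\<lambda>k. {xs ! k}))"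
proof (rule set_eqI)
  fix \<xi> :: "nat \<Rightarrow> int ^ 'd"
  have "\<xi> \<in> prod_emb UNIV (\<lambda>_. measure_pmf p) {..<length xs} (PiE {..<length xs} (\<lambda>k. {xs ! k}))
      \<longleftrightarrow> (\<forall>k<length xs. \<xi> k = xs ! k)"
    unfolding prod_emb_def PiE_iff space_measure_pmf by (simp add: PiE_def Pi_iff Ball_def)
  then show "\<xi> \<in> cylinder xs \<longleftrightarrow> \<xi> \<in> prod_emb UNIV (\<lambda>_. measure_pmf p) {..<length xs} (PiE {..<length xs} (\<lambda>k. {xs ! k}))"
    by (simp only: cylinder_def mem_Collect_eq)
qed

lemma cylinder_sets: "cylinder xs \<in> sets (walk_measure i0 h)"
  unfolding walk_measure_def cylinder_emb[where p = "step_pmf i0 h"]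
  by (rule sets_PiM_I) auto

lemma measure_cylinder:
  "measure (walk_measure i0 h) (cylinder xs) = (\<Prod>k<length xs. step_prob i0 h (xs ! k))"
proof -
  have "emeasure (walk_measure i0 h) (cylinder xs) = (\<Prod>k<length xs. emeasure (measure_pmf (step_pmf i0 h)) {xs ! k})"
    unfolding walk_measure_def cylinder_emb[where p = "step_pmf i0 h"]
    by (rule emeasure_PiM_emb) (auto intro: prob_space_measure_pmf)
  also have "\<dots> = ennreal (\<Prod>k<length xs. step_prob i0 h (xs ! k))"
    by (simp add: emeasure_pmf_single prod_ennreal flip: pmf_step_pmf)
  finally show ?thesis
    by (simp add: measure_def prod_nonneg pmf_step_pmf[symmetric])
qed

lemma walk_increments_AE: "AE \<xi> in walk_measure i0 h. \<forall>k. \<xi> k \<in> unit_vecs"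
proof -
  interpret P: product_prob_space "\<lambda>_::nat. measure_pmf (step_pmf i0 h)" UNIV
    by unfold_locales
  have "AE \<xi> in walk_measure i0 h. \<xi> k \<in> unit_vecs" for k
    unfolding walk_measure_def
  proof (rule P.AE_component)
    show "AE x in measure_pmf (step_pmf i0 h). x \<in> unit_vecs"
      by (rule AE_pmfI) (auto simp: set_pmf_iff pmf_step_pmf step_prob_def split: if_splits)
  qed simp
  then show ?thesis by (simp add: AE_all_countable)
qed

text \<open>Preimages are unions of cylinders, of which there are countably many.\<close>

lemma walk_functional_measurable:
  fixes F :: "(int ^ 'd::finite) list \<Rightarrow> real"
  shows "(\<lambda>\<xi>. F (map \<xi> [0..<n])) \<in> borel_measurable (walk_measure i0 h)"
proof (rule measurableI)
  fix A :: "real set" assume "A \<in> sets borel"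
  have sp: "space (walk_measure i0 h) = UNIV" by (simp add: walk_measure_def space_PiM PiE_UNIV_domain)
  have "(\<lambda>\<xi>. F (map \<xi> [0..<n])) -` A \<inter> space (walk_measure i0 h) = (\<Union>xs\<in>{xs. length xs = n \<and> F xs \<in> A}. cylinder xs)"
    unfolding sp by (auto simp: mem_cylinder)
  moreover have "(\<Union>xs\<in>{xs. length xs = n \<and> F xs \<in> A}. cylinder xs) \<in> sets (walk_measure i0 h)"
  proof (rule sets.countable_UN')
    have "countable (lists (UNIV :: (int ^ 'd) set))"
      by (rule countable_lists[OF countable_int_vec])
    then show "countable {xs :: (int ^ 'd) list. length xs = n \<and> F xs \<in> A}"
      by (rule countable_subset[rotated]) auto
  qed (auto intro: cylinder_sets)
  ultimately show "(\<lambda>\<xi>. F (map \<xi> [0..<n])) -` A \<inter> space (walk_measure i0 h) \<in> sets (walk_measure i0 h)"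
    by simp
qed simp

text \<open>The drifted walk makes a step \<open>e\<close> with probability \<open>fug h / (2 d) * exp (h * e $ i0)\<close>.\<close>

definition fug :: "'d::finite itself \<Rightarrow> real \<Rightarrow> real" where
  "fug _ h = real CARD('d) / (cosh h + real CARD('d) - 1)"

lemma fug_pos: "0 < fug TYPE('d::finite) h" and fug_le_1: "fug TYPE('d) h \<le> 1"
  and fug_less_1: "h \<noteq> 0 \<Longrightarrow> fug TYPE('d) h < 1" and fug_0: "fug TYPE('d) 0 = 1"
proof -
  have c: "1 \<le> real CARD('d)" by (simp add: Suc_le_eq)
  have h: "1 \<le> cosh h" by (rule cosh_real_ge_1)
  have pos: "0 < cosh h + real CARD('d) - 1" using c h by linarith
  then show "0 < fug TYPE('d) h"
    using c unfolding fug_def by (intro divide_pos_pos) linarith+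
  show "fug TYPE('d) h \<le> 1"
    using pos h by (simp add: fug_def divide_le_eq)
  show "h \<noteq> 0 \<Longrightarrow> fug TYPE('d) h < 1"
  proof -
    assume "h \<noteq> 0"
    then have "1 < cosh h"
      using h cosh_real_one_iff[of h] by linarith
    then show ?thesis
      using pos by (simp add: fug_def divide_less_eq)
  qed
  show "fug TYPE('d) 0 = 1" by (simp add: fug_def)
qed

lemma step_normalization:
  fixes i0 :: "'d::finite"
  shows "(\<Sum>e\<in>(unit_vecs :: (int ^ 'd) set). exp (h * of_int (e $ i0))) = 2 * real CARD('d) / fug TYPE('d) h"
proof -
  have "(\<Sum>e\<in>(unit_vecs :: (int ^ 'd) set). exp (h * of_int (e $ i0))) = exp h + exp (- h) + (2 * real CARD('d) - 2)"
    using sum_unit_vecs_level[of "\<lambda>k. exp (h * of_int k)" i0] by simp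
  also have "exp h + exp (- h) = 2 * cosh h" by (simp add: cosh_def)
  also have "2 * cosh h + (2 * real CARD('d) - 2) = 2 * real CARD('d) / fug TYPE('d) h" by (simp add: fug_def)
  finally show ?thesis .
qed

lemma measure_cylinder_upaths:
  fixes i0 :: "'d::finite"
  assumes "xs \<in> upaths n"
  shows "measure (walk_measure i0 h) (cylinder xs) = kap (fug TYPE('d) h) xs * exp (h * of_int (lev i0 xs))"
proof -
  have xs: "length xs = n" "\<And>k. k < n \<Longrightarrow> xs ! k \<in> unit_vecs"
    using assms by (auto simp: upaths_def)
  have "(\<Prod>k<n. step_prob i0 h (xs ! k)) = (\<Prod>k<n. exp (h * of_int (xs ! k $ i0)) * (fug TYPE('d) h / (2 * real CARD('d))))"
    by (intro prod.cong refl) (simp add: step_prob_def xs step_normalization)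
  also have "\<dots> = (\<Prod>k<n. exp (h * of_int (xs ! k $ i0))) * (fug TYPE('d) h / (2 * real CARD('d))) ^ n"
    by (simp only: prod.distrib prod_constant card_lessThan)
  also have "(\<Prod>k<n. exp (h * of_int (xs ! k $ i0))) = exp (h * of_int (lev i0 xs))"
    using xs(1) by (simp add: lev_def sum_list_sum_nth exp_sum[symmetric] sum_distrib_left atLeast0LessThan)
  finally show ?thesis
    unfolding measure_cylinder xs(1) by (simp add: kap_def xs(1) mult.commute)
qed

text \<open>Almost surely all increments are unit vectors, so a functional of the first
  \<open>n\<close> increments is a finite combination of indicators of cylinders.\<close>

lemma walk_expectation:
  fixes F :: "(int ^ 'd::finite) list \<Rightarrow> real"
  shows "(\<integral>\<xi>. F (map \<xi> [0..<n]) \<partial>walk_measure i0 h) =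
     (\<Sum>xs\<in>upaths n. kap (fug TYPE('d) h) xs * exp (h * of_int (lev i0 xs)) * F xs)"
proof -
  interpret prob_space "walk_measure i0 h" by (rule prob_space_walk)
  have cyl: "integrable (walk_measure i0 h) (\<lambda>\<xi>. F xs * indicator (cylinder xs) \<xi>)" for xs
    using cylinder_sets[of xs i0 h] by (intro integrable_mult_right integrable_real_indicator) (auto simp: emeasure_eq_measure)
  have "(\<integral>\<xi>. F (map \<xi> [0..<n]) \<partial>walk_measure i0 h) = (\<integral>\<xi>. (\<Sum>xs\<in>upaths n. F xs * indicator (cylinder xs) \<xi>) \<partial>walk_measure i0 h)"
  proof (rule integral_cong_AE)
    show "(\<lambda>\<xi>. F (map \<xi> [0..<n])) \<in> borel_measurable (walk_measure i0 h)"
      by (rule walk_functional_measurable)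
    show "(\<lambda>\<xi>. (\<Sum>xs\<in>upaths n. F xs * indicator (cylinder xs) \<xi>)) \<in> borel_measurable (walk_measure i0 h)"
      by (intro borel_measurable_sum borel_measurable_integrable cyl)
    show "AE \<xi> in walk_measure i0 h. F (map \<xi> [0..<n]) = (\<Sum>xs\<in>upaths n. F xs * indicator (cylinder xs) \<xi>)"
      using walk_increments_AE
    proof eventually_elim
      case (elim \<xi>)
      have in_up: "map \<xi> [0..<n] \<in> upaths n" using elim by (auto simp: upaths_def)
      have "(\<Sum>xs\<in>upaths n. F xs * indicator (cylinder xs) \<xi>) = (\<Sum>xs\<in>upaths n. if xs = map \<xi> [0..<n] then F xs else 0)"
        by (intro sum.cong refl) (auto simp: indicator_def mem_cylinder upaths_def)
      also have "\<dots> = F (map \<xi> [0..<n])"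
        using in_up by (simp add: sum.delta)
      finally show ?case by simp
    qed
  qed
  also have "\<dots> = (\<Sum>xs\<in>upaths n. \<integral>\<xi>. F xs * indicator (cylinder xs) \<xi> \<partial>walk_measure i0 h)"
    by (rule Bochner_Integration.integral_sum) (rule cyl)
  also have "\<dots> = (\<Sum>xs\<in>upaths n. F xs * measure (walk_measure i0 h) (cylinder xs))"
  proof (intro sum.cong refl)
    fix xs :: "(int ^ 'd) list"
    have "space (walk_measure i0 h) = UNIV" by (simp add: walk_measure_def space_PiM PiE_UNIV_domain)
    then show "(\<integral>\<xi>. F xs * indicator (cylinder xs) \<xi> \<partial>walk_measure i0 h) = F xs * measure (walk_measure i0 h) (cylinder xs)"
      by simp
  qed
  also have "\<dots> = (\<Sum>xs\<in>upaths n. kap (fug TYPE('d) h) xs * exp (h * of_int (lev i0 xs)) * F xs)"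
    by (intro sum.cong refl) (simp add: measure_cylinder_upaths mult.commute)
  finally show ?thesis .
qed

lemma sum_list_walk: "sum_list (map \<xi> [0..<n]) = walk \<xi> n"
  by (induction n) (simp_all add: walk_def)

lemma sites_walk: "sites 0 (map \<xi> [0..<n]) = map (walk \<xi>) [1..<Suc n]"
proof (induction n)
  case (Suc n)
  have "sites 0 (map \<xi> [0..<Suc n]) = sites 0 (map \<xi> [0..<n]) @ [sum_list (map \<xi> [0..<n]) + \<xi> n]"
    by (simp add: sites_append)
  also have "sum_list (map \<xi> [0..<n]) + \<xi> n = walk \<xi> (Suc n)"
    unfolding sum_list_walk by (simp add: walk_def)
  finally have "sites 0 (map \<xi> [0..<Suc n]) = map (walk \<xi>) [1..<Suc n] @ [walk \<xi> (Suc n)]"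
    unfolding Suc .
  moreover have "[1..<Suc (Suc n)] = [1..<Suc n] @ [Suc n]"
    by simp
  ultimately show ?case by (simp only: map_append list.map)
qed simp

lemma local_time_count: "local_time \<xi> x n = count_list (sites 0 (map \<xi> [0..<n])) x"
proof (induction n)
  case (Suc n)
  have "sites 0 (map \<xi> [0..<Suc n]) = sites 0 (map \<xi> [0..<n]) @ [walk \<xi> (Suc n)]"
  proof -
    have "[1..<Suc (Suc n)] = [1..<Suc n] @ [Suc n]" by simp
    then show ?thesis by (simp only: sites_walk map_append list.map)
  qed
  then have "count_list (sites 0 (map \<xi> [0..<Suc n])) x = local_time \<xi> x n + of_bool (walk \<xi> (Suc n) = x)"
    by (simp only: Suc count_list_append) simp
  then show ?case
    by (simp only: local_time_def sum.cl_ivl_Suc) simp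
qed (simp add: local_time_def)

lemma walk_level:
  fixes i0 :: "'d::finite"
  shows "walk \<xi> n $ i0 = lev i0 (map \<xi> [0..<n])"
proof -
  have "sum_list xs $ i0 = lev i0 xs" for xs :: "(int ^ 'd) list"
    by (induction xs) auto
  then show ?thesis by (metis sum_list_walk)
qed

section \<open>Annealed quantities as path sums\<close>

definition laplace :: "'w measure \<Rightarrow> (int ^ 'd \<Rightarrow> 'w \<Rightarrow> real) \<Rightarrow> real \<Rightarrow> real" where
  "laplace M V s = (\<integral>\<omega>. exp (- s * V 0 \<omega>) \<partial>M)"

definition claplace :: "'w measure \<Rightarrow> (int ^ 'd \<Rightarrow> 'w \<Rightarrow> real) \<Rightarrow> complex \<Rightarrow> complex" where
  "claplace M V s = (\<integral>\<omega>. exp (- s * of_real (V 0 \<omega>)) \<partial>M)"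

definition site_weight :: "'w measure \<Rightarrow> (int ^ 'd \<Rightarrow> 'w \<Rightarrow> real) \<Rightarrow> real \<Rightarrow> nat \<Rightarrow> real" where
  "site_weight M V \<beta> n = laplace M V (real n * \<beta>)"

text \<open>The potential vanishes at local time 0, so the sum over the lattice reduces to the
  finitely many visited sites.\<close>

lemma exp_Phi_an:
  assumes "attractive (site_weight M V \<beta>)"
  shows "exp (- Phi_an M V \<beta> n \<xi>) = pot (site_weight M V \<beta>) (map \<xi> [0..<n])"
proof -
  interpret attractive "site_weight M V \<beta>" by (rule assms)
  let ?l = "sites 0 (map \<xi> [0..<n])"
  have phi: "phi_an M V \<beta> (real k) = - ln (site_weight M V \<beta> k)" for k
    by (simp add: phi_an_def site_weight_def laplace_def)
  have "Phi_an M V \<beta> n \<xi> = (\<Sum>\<^sub>\<infinity>x\<in>set ?l. - ln (site_weight M V \<beta> (count_list ?l x)))"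
    unfolding Phi_an_def local_time_count phi
    by (rule infsum_cong_neutral) (auto simp: count_list_0_iff psi_0)
  also have "\<dots> = - (\<Sum>x\<in>set ?l. ln (site_weight M V \<beta> (count_list ?l x)))"
    by (simp add: sum_negf)
  finally show ?thesis
    using psi_pos by (simp add: pot_def potl_def exp_sum)
qed

lemma Z_an_eq:
  fixes i0 :: "'d::finite"
  assumes "attractive (site_weight M V \<beta>)"
  shows "Z_an M V i0 h \<beta> N = fug TYPE('d) h ^ N * zhat i0 (site_weight M V \<beta>) N h"
proof -
  have "Z_an M V i0 h \<beta> N = (\<Sum>xs\<in>upaths N. kap (fug TYPE('d) h) xs * exp (h * of_int (lev i0 xs)) * pot (site_weight M V \<beta>) xs)"
    unfolding Z_an_def exp_Phi_an[OF assms] by (rule walk_expectation)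
  also have "\<dots> = (\<Sum>xs\<in>upaths N. fug TYPE('d) h ^ N * wt i0 (site_weight M V \<beta>) 1 h xs)"
    by (intro sum.cong refl) (simp add: wt_def kap_def upaths_def power_divide)
  finally show ?thesis by (simp add: zhat_def sum_distrib_left)
qed

text \<open>On the hyperplane the tilt is the constant \<open>exp (h * L)\<close>. What remains is a
  simple random walk whose fugacity \<open>fug h\<close> is below one for \<open>h > 0\<close>, so
  \<open>plane_mass_limit\<close> applies.\<close>

lemma Zbar_an_eq:
  fixes i0 :: "'d::finite"
  assumes att: "attractive (site_weight M V \<beta>)" and h: "0 < h" and L: "1 \<le> L"
  shows "Zbar_an M V i0 h \<beta> L = exp (h * real L) * enn2real (plane_mass i0 (site_weight M V \<beta>) (fug TYPE('d) h) L)"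
proof -
  let ?\<psi> = "site_weight M V \<beta>" and ?z = "fug TYPE('d) h"
  have z: "0 < ?z" "?z < 1"
    using h by (simp_all add: fug_pos fug_less_1)
  interpret weighted_walk ?\<psi> i0 ?z by (rule weighted_walkI[OF att z(1) less_imp_le[OF z(2)]])
  define s where "s = (\<lambda>n. \<Sum>xs\<in>{xs \<in> upaths n. lev i0 xs = int L}. wt i0 ?\<psi> ?z 0 xs)"
  have s0: "0 \<le> s n" for n unfolding s_def by (intro sum_nonneg wt_nonneg)
  have hterm: "(LINT \<xi>:{\<xi>. walk \<xi> n $ i0 = int L}|walk_measure i0 h. exp (- Phi_an M V \<beta> n \<xi>)) = exp (h * real L) * s n" for n
  proof -
    let ?F = "\<lambda>xs. of_bool (lev i0 xs = int L) * pot ?\<psi> xs"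
    have "(LINT \<xi>:{\<xi>. walk \<xi> n $ i0 = int L}|walk_measure i0 h. exp (- Phi_an M V \<beta> n \<xi>)) =
        (\<integral>\<xi>. ?F (map \<xi> [0..<n]) \<partial>walk_measure i0 h)"
      unfolding set_lebesgue_integral_def exp_Phi_an[OF att] walk_level
      by (intro Bochner_Integration.integral_cong) (auto simp: indicator_def)
    also have "\<dots> = (\<Sum>xs\<in>upaths n. kap ?z xs * exp (h * of_int (lev i0 xs)) * ?F xs)"
      by (rule walk_expectation)
    also have "\<dots> = (\<Sum>xs\<in>upaths n. if lev i0 xs = int L then exp (h * real L) * wt i0 ?\<psi> ?z 0 xs else 0)"
      by (intro sum.cong refl) (simp add: wt_def)
    also have "\<dots> = (\<Sum>xs\<in>{xs \<in> upaths n. lev i0 xs = int L}. exp (h * real L) * wt i0 ?\<psi> ?z 0 xs)"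
      by (rule sum.inter_filter[symmetric]) simp
    finally show ?thesis by (simp add: s_def sum_distrib_left)
  qed
  have "plane_mass i0 ?\<psi> ?z L = (\<Sum>n. mass (wt i0 ?\<psi> ?z 0) {xs \<in> {xs \<in> lists unit_vecs. lev i0 xs = int L}. length xs = n})"
    unfolding plane_mass_def by (rule mass_split)
  also have "\<dots> = (\<Sum>n. ennreal (s n))"
  proof (rule suminf_cong)
    fix n
    have eq: "{xs \<in> {xs \<in> lists unit_vecs. lev i0 xs = int L}. length xs = n} = {xs \<in> upaths n. lev i0 xs = int L}"
      by (auto simp: upaths_def)
    show "mass (wt i0 ?\<psi> ?z 0) {xs \<in> {xs \<in> lists unit_vecs. lev i0 xs = int L}. length xs = n} = ennreal (s n)"
      unfolding eq s_def by (rule mass_finite) (simp_all add: wt_nonneg)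
  qed
  finally have series: "plane_mass i0 ?\<psi> ?z L = (\<Sum>n. ennreal (s n))" .
  have fin: "(\<Sum>n. ennreal (s n)) \<noteq> top"
    using plane_mass_limit(1)[OF att z, of i0 L] unfolding series by (simp add: less_top)
  have summ: "summable s"
    using fin s0 by (intro summable_suminf_not_top) auto
  have "plane_mass i0 ?\<psi> ?z L = ennreal (\<Sum>n. s n)"
    unfolding series using summ s0 by (intro suminf_ennreal2) auto
  then have pm: "enn2real (plane_mass i0 ?\<psi> ?z L) = (\<Sum>n. s n)"
    using summ s0 by (simp add: suminf_nonneg)
  have hs: "(s has_sum (\<Sum>n. s n)) UNIV"
    using summ s0 by (intro sums_nonneg_imp_has_sum summable_sums) auto
  \<comment> \<open>The sum over times in \<open>Zbar_an\<close> starts at 1, whereas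
    \<open>plane_mass\<close> also counts the empty path; that path is at level 0, not
    \<open>L\<close>.\<close>
  have "s 0 = 0"
    using L by (auto simp: s_def upaths_def)
  then have "(s has_sum (\<Sum>n. s n)) {1..}"
    using hs by (subst has_sum_cong_neutral[where g = s and T = UNIV]) (auto simp: not_le)
  then have "((\<lambda>n. exp (h * real L) * s n) has_sum exp (h * real L) * (\<Sum>n. s n)) {1..}"
    by (rule has_sum_cmult_right)
  then show ?thesis
    unfolding Zbar_an_def hterm pm by (rule infsumI)
qed

lemma mbar_an_eq:
  fixes i0 :: "'d::finite"
  assumes att: "attractive (site_weight M V \<beta>)" and h: "0 < h"
  shows "mbar_an M V i0 h \<beta> = alpha i0 (site_weight M V \<beta>) (fug TYPE('d) h) - h"
proof -
  let ?\<psi> = "site_weight M V \<beta>" and ?z = "fug TYPE('d) h"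
  have z: "0 < ?z" "?z < 1"
    using h by (simp_all add: fug_pos fug_less_1)
  interpret weighted_walk ?\<psi> i0 ?z by (rule weighted_walkI[OF att z(1) less_imp_le[OF z(2)]])
  let ?G = "\<lambda>L. enn2real (plane_mass i0 ?\<psi> ?z L)"
  have G_pos: "0 < ?G L" for L
  proof -
    have "ennreal (brm i0 ?\<psi> ?z L) \<le> plane_mass i0 ?\<psi> ?z L"
      unfolding mass_bridges_at[symmetric] plane_mass_def
      by (rule mass_mono) (auto simp: bridges_at_def dest: bridges_lists)
    then have "0 < plane_mass i0 ?\<psi> ?z L"
      using brm_pos[of L] by (metis ennreal_less_zero_iff order_less_le_trans)
    then show ?thesis
      using plane_mass_limit(1)[OF att z, of i0 L] by (simp add: enn2real_positive_iff)
  qed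
  have "(\<lambda>L. ln (Zbar_an M V i0 h \<beta> L) / real L) \<longlonglongrightarrow> h + - alpha i0 ?\<psi> ?z"
  proof (rule Lim_transform_eventually)
    show "(\<lambda>L. h + ln (?G L) / real L) \<longlonglongrightarrow> h + - alpha i0 ?\<psi> ?z"
      by (intro tendsto_intros plane_mass_limit(2)[OF att z])
    show "\<forall>\<^sub>F L in sequentially. h + ln (?G L) / real L = ln (Zbar_an M V i0 h \<beta> L) / real L"
      using eventually_ge_at_top[of 1]
    proof eventually_elim
      case (elim L)
      have "ln (Zbar_an M V i0 h \<beta> L) = h * real L + ln (?G L)"
        unfolding Zbar_an_eq[OF att h elim] using G_pos[of L] by (simp add: ln_mult_pos)
      then show ?case using elim by (simp add: add_divide_distrib)
    qed
  qed
  then show ?thesis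
    unfolding mbar_an_def by (simp add: limI)
qed

text \<open>The fugacity tends to 1 from below as \<open>h\<close> tends to 0 from above, so left
  continuity and monotonicity of \<open>alpha\<close> in the fugacity identify the limit.\<close>

lemma mbar_an0_eq:
  fixes i0 :: "'d::finite"
  assumes att: "attractive (site_weight M V \<beta>)"
  shows "mbar_an0 M V i0 \<beta> = alpha i0 (site_weight M V \<beta>) 1"
proof -
  let ?\<psi> = "site_weight M V \<beta>"
  let ?a = "\<lambda>h. alpha i0 ?\<psi> (fug TYPE('d) h)"
  have "continuous (at_right 0) (\<lambda>h. fug TYPE('d) h)"
  proof -
    have "cosh (0::real) + real CARD('d) - 1 \<noteq> 0" by simp
    then show ?thesis unfolding fug_def by (intro continuous_intros) auto
  qed
  then have fug_lim: "((\<lambda>h. fug TYPE('d) h) \<longlongrightarrow> 1) (at_right 0)"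
    by (simp add: continuous_within fug_0)
  have "(?a \<longlongrightarrow> alpha i0 ?\<psi> 1) (at_right 0)"
  proof (rule order_tendstoI)
    fix b assume "b < alpha i0 ?\<psi> 1"
    moreover have "alpha i0 ?\<psi> 1 \<le> ?a h" for h
      by (rule alpha_antimono[OF att att]) (use fug_pos[where 'd = 'd] fug_le_1[where 'd = 'd] in auto)
    ultimately show "\<forall>\<^sub>F h in at_right 0. b < ?a h"
      by (intro always_eventually) (auto intro: less_le_trans)
  next
    fix b assume "alpha i0 ?\<psi> 1 < b"
    then obtain z where z: "0 < z" "z < 1" "alpha i0 ?\<psi> z < b"
      using alpha_left_cont[OF att, of 1 i0 b] by auto
    have "\<forall>\<^sub>F h in at_right 0. z < fug TYPE('d) h"
      using z by (intro order_tendstoD(1)[OF fug_lim])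
    then show "\<forall>\<^sub>F h in at_right 0. ?a h < b"
    proof eventually_elim
      case (elim h)
      have "?a h \<le> alpha i0 ?\<psi> z"
        by (rule alpha_antimono[OF att att]) (use fug_le_1[where 'd = 'd] z elim in auto)
      then show ?case using z by simp
    qed
  qed
  then have "((\<lambda>h. ?a h - h) \<longlongrightarrow> alpha i0 ?\<psi> 1 - 0) (at_right 0)"
    by (intro tendsto_diff tendsto_ident_at)
  then have "((\<lambda>h. mbar_an M V i0 h \<beta>) \<longlongrightarrow> alpha i0 ?\<psi> 1 - 0) (at_right 0)"
    by (rule Lim_transform_eventually) (auto simp: mbar_an_eq[OF att] eventually_at_right_less intro!: eventually_at_rightI[of 0 1])
  then show ?thesis
    unfolding mbar_an0_def by (intro tendsto_Lim) auto
qed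

lemma m_an_eq:
  fixes i0 :: "'d::finite"
  assumes att: "attractive (site_weight M V \<beta>)"
  shows "m_an M V i0 h \<beta> = - ln (fug TYPE('d) h) - zrate i0 (site_weight M V \<beta>) h"
proof -
  let ?\<psi> = "site_weight M V \<beta>" and ?z = "fug TYPE('d) h"
  interpret weighted_walk ?\<psi> i0 1 by (rule weighted_walkI[OF att]) auto
  have "(\<lambda>N. ln (Z_an M V i0 h \<beta> N) / real N) \<longlonglongrightarrow> ln ?z + zrate i0 ?\<psi> h"
  proof (rule Lim_transform_eventually)
    show "(\<lambda>N. ln ?z + ln (zhat i0 ?\<psi> N h) / real N) \<longlonglongrightarrow> ln ?z + zrate i0 ?\<psi> h"
      by (intro tendsto_intros zrate_limit)
    show "\<forall>\<^sub>F N in sequentially. ln ?z + ln (zhat i0 ?\<psi> N h) / real N = ln (Z_an M V i0 h \<beta> N) / real N"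
      using eventually_ge_at_top[of 1]
    proof eventually_elim
      case (elim N)
      have "ln (Z_an M V i0 h \<beta> N) = real N * ln ?z + ln (zhat i0 ?\<psi> N h)"
        unfolding Z_an_eq[OF att] using fug_pos[where 'd = 'd, of h] zhat_pos[of N h] by (simp add: ln_mult_pos ln_realpow)
      then show ?case using elim by (simp add: add_divide_distrib)
    qed
  qed
  then show ?thesis
    unfolding m_an_def by (simp add: limI)
qed

section \<open>The Laplace transform of the potential\<close>

text \<open>\<open>nonneg\<close> and \<open>near_0\<close> together express that the essential
  infimum is 0.\<close>

locale potential_law = prob_space M for M :: "'w measure" +
  fixes V :: "int ^ 'd::finite \<Rightarrow> 'w \<Rightarrow> real"
  assumes meas [measurable]: "V 0 \<in> borel_measurable M"
    and nonneg: "AE \<omega> in M. 0 \<le> V 0 \<omega>"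
    and near_0: "0 < \<epsilon> \<Longrightarrow> 0 < measure M {\<omega> \<in> space M. V 0 \<omega> < \<epsilon>}"
    and not_AE_0: "measure M {\<omega> \<in> space M. V 0 \<omega> = 0} < 1"
begin

lemma laplace_integrable: "0 \<le> s \<Longrightarrow> integrable M (\<lambda>\<omega>. exp (- s * V 0 \<omega>))"
proof (rule integrable_const_bound[where B = 1])
  assume "0 \<le> s"
  show "AE \<omega> in M. norm (exp (- s * V 0 \<omega>)) \<le> 1"
    using nonneg by eventually_elim (use \<open>0 \<le> s\<close> in simp)
qed measurable

lemma laplace_0: "laplace M V 0 = 1"
  by (simp add: laplace_def prob_space)

lemma laplace_ge:
  assumes "0 \<le> s"
  shows "measure M {\<omega> \<in> space M. V 0 \<omega> < \<epsilon>} * exp (- s * \<epsilon>) \<le> laplace M V s"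
proof -
  let ?A = "{\<omega> \<in> space M. V 0 \<omega> < \<epsilon>}"
  have A: "?A \<in> sets M" by measurable
  have "measure M ?A * exp (- s * \<epsilon>) = (\<integral>\<omega>. exp (- s * \<epsilon>) * indicator ?A \<omega> \<partial>M)"
    using A by simp
  also have "\<dots> \<le> laplace M V s"
    unfolding laplace_def
  proof (rule integral_mono)
    show "integrable M (\<lambda>\<omega>. exp (- s * \<epsilon>) * indicator ?A \<omega>)"
      using A by (intro integrable_mult_right integrable_real_indicator) (auto simp: emeasure_eq_measure)
    show "exp (- s * \<epsilon>) * indicator ?A \<omega> \<le> exp (- s * V 0 \<omega>)" for \<omega>
      using assms by (auto simp: indicator_def intro: mult_left_mono)
  qed (rule laplace_integrable[OF assms])
  finally show ?thesis .
qed

lemma laplace_pos: "0 \<le> s \<Longrightarrow> 0 < laplace M V s"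
  using laplace_ge[of s 1] near_0[of 1] by (meson exp_gt_zero less_le_trans mult_pos_pos zero_less_one)

lemma laplace_antimono:
  assumes "0 \<le> s" "s \<le> t" shows "laplace M V t \<le> laplace M V s"
  unfolding laplace_def
proof (rule integral_mono_AE)
  show "AE \<omega> in M. exp (- t * V 0 \<omega>) \<le> exp (- s * V 0 \<omega>)"
    using nonneg by eventually_elim (use assms in \<open>simp add: mult_right_mono\<close>)
qed (rule laplace_integrable; use assms in simp)+

lemma laplace_le_1: "0 \<le> s \<Longrightarrow> laplace M V s \<le> 1"
  using laplace_antimono[of 0 s] by (simp add: laplace_0)

lemma laplace_strict_antimono:
  assumes "0 \<le> s" "s < t" shows "laplace M V t < laplace M V s"
proof (rule ccontr)
  assume "\<not> laplace M V t < laplace M V s"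
  then have eq: "laplace M V s - laplace M V t = 0"
    using laplace_antimono[of s t] assms by simp
  let ?D = "\<lambda>\<omega>. exp (- s * V 0 \<omega>) - exp (- t * V 0 \<omega>)"
  have int: "integrable M ?D" using assms by (intro Bochner_Integration.integrable_diff laplace_integrable) auto
  have "(\<integral>\<omega>. ?D \<omega> \<partial>M) = 0"
    using eq assms laplace_integrable[of s] laplace_integrable[of t] by (simp add: laplace_def)
  moreover have "AE \<omega> in M. 0 \<le> ?D \<omega>"
    using nonneg by eventually_elim (use assms in \<open>simp add: mult_right_mono\<close>)
  ultimately have "AE \<omega> in M. ?D \<omega> = 0"
    using integral_nonneg_eq_0_iff_AE[OF int] by simp
  then have "AE \<omega> in M. V 0 \<omega> = 0"
    by eventually_elim (use assms in simp)
  then have "measure M {\<omega> \<in> space M. V 0 \<omega> = 0} = 1"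
    by (intro prob_eq_1[THEN iffD2]) auto
  then show False using not_AE_0 by simp
qed

text \<open>Jensen's inequality for the power \<open>t\<close>, obtained by integrating Young's
  inequality \<open>x powr t * L powr (1 - t) \<le> t * x + (1 - t) * L\<close> with
  \<open>L\<close> the mean of \<open>x\<close>.\<close>

lemma laplace_jensen:
  assumes s: "0 \<le> s" and t: "0 \<le> t" "t \<le> 1"
  shows "laplace M V (t * s) \<le> laplace M V s powr t"
proof -
  let ?L = "laplace M V s"
  have L: "0 < ?L" by (rule laplace_pos[OF s])
  have "laplace M V (t * s) * ?L powr (1 - t) = (\<integral>\<omega>. exp (- (t * s) * V 0 \<omega>) * ?L powr (1 - t) \<partial>M)"
    by (simp add: laplace_def)
  also have "\<dots> \<le> (\<integral>\<omega>. t * exp (- s * V 0 \<omega>) + (1 - t) * ?L \<partial>M)"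
  proof (rule integral_mono)
    show "integrable M (\<lambda>\<omega>. exp (- (t * s) * V 0 \<omega>) * ?L powr (1 - t))"
      using s t by (intro integrable_mult_left laplace_integrable) auto
    show "integrable M (\<lambda>\<omega>. t * exp (- s * V 0 \<omega>) + (1 - t) * ?L)"
      by (intro Bochner_Integration.integrable_add integrable_mult_right laplace_integrable s) simp
    show "exp (- (t * s) * V 0 \<omega>) * ?L powr (1 - t) \<le> t * exp (- s * V 0 \<omega>) + (1 - t) * ?L" for \<omega>
      using Youngs_inequality_0[of t "1 - t" "exp (- s * V 0 \<omega>)" ?L] t L
      by (simp add: exp_powr_real mult_ac)
  qed
  also have "\<dots> = ?L"
    using laplace_integrable[OF s] by (simp add: prob_space laplace_def algebra_simps)
  finally have "laplace M V (t * s) \<le> ?L / ?L powr (1 - t)"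
    using L by (simp add: pos_le_divide_eq)
  also have "\<dots> = ?L powr t"
    using L powr_diff[of ?L 1 "1 - t"] by simp
  finally show ?thesis .
qed

lemma laplace_tendsto_1:
  assumes "0 < \<epsilon>" obtains \<delta> where "0 < \<delta>" "\<And>s. 0 \<le> s \<Longrightarrow> s \<le> \<delta> \<Longrightarrow> 1 - \<epsilon> < laplace M V s"
proof -
  have "(\<lambda>n. \<integral>\<omega>. exp (- inverse (real (Suc n)) * V 0 \<omega>) \<partial>M) \<longlonglongrightarrow> (\<integral>\<omega>. exp (- 0 * V 0 \<omega>) \<partial>M)"
  proof (rule integral_dominated_convergence[where w = "\<lambda>_. 1"])
    show "AE \<omega> in M. (\<lambda>n. exp (- inverse (real (Suc n)) * V 0 \<omega>)) \<longlonglongrightarrow> exp (- 0 * V 0 \<omega>)"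
      by (intro AE_I2 tendsto_intros LIMSEQ_inverse_real_of_nat)
    show "AE \<omega> in M. norm (exp (- inverse (real (Suc n)) * V 0 \<omega>)) \<le> 1" for n
      using nonneg by eventually_elim simp
  qed auto
  then have "(\<lambda>n. laplace M V (inverse (real (Suc n)))) \<longlonglongrightarrow> 1"
    by (simp add: laplace_def prob_space)
  then have "\<forall>\<^sub>F n in sequentially. 1 - \<epsilon> < laplace M V (inverse (real (Suc n)))"
    using assms by (intro order_tendstoD) auto
  then obtain n where n: "1 - \<epsilon> < laplace M V (inverse (real (Suc n)))"
    by (auto simp: eventually_sequentially)
  show thesis
  proof (rule that)
    show "0 < inverse (real (Suc n))" by simp
    show "1 - \<epsilon> < laplace M V s" if "0 \<le> s" "s \<le> inverse (real (Suc n))" for s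
      using n laplace_antimono[OF that] by linarith
  qed
qed

lemma site_weight_0: "site_weight M V 0 n = 1"
  by (simp add: site_weight_def laplace_0)

text \<open>Both \<open>m\<close> and \<open>n\<close> are fractions of \<open>m + n\<close> that
  add up to one, so \<open>laplace_jensen\<close> bounds the two factors by complementary powers of
  the weight at \<open>m + n\<close>.\<close>

lemma attractive_site_weight:
  assumes "0 \<le> \<beta>" shows "attractive (site_weight M V \<beta>)"
proof
  show "site_weight M V \<beta> 0 = 1" by (simp add: site_weight_def laplace_0)
  show "0 < site_weight M V \<beta> n" for n
    using assms by (simp add: site_weight_def laplace_pos)
  show "site_weight M V \<beta> n \<le> site_weight M V \<beta> m" if "m \<le> n" for m n
    unfolding site_weight_def using that assms by (intro laplace_antimono) (auto intro: mult_right_mono)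
  show "site_weight M V \<beta> m * site_weight M V \<beta> n \<le> site_weight M V \<beta> (m + n)" for m n
  proof (cases "m + n = 0")
    case False
    let ?L = "site_weight M V \<beta> (m + n)" and ?t = "real m / real (m + n)"
    have L: "0 < ?L" using assms by (simp add: site_weight_def laplace_pos)
    have mn: "real m + real n \<noteq> 0" using False by linarith
    then have n: "1 - ?t = real n / real (m + n)"
      by (simp add: field_simps)
    have m_eq: "?t * (real (m + n) * \<beta>) = real m * \<beta>" and n_eq: "(1 - ?t) * (real (m + n) * \<beta>) = real n * \<beta>"
      unfolding n using mn by simp_all
    have "site_weight M V \<beta> m \<le> ?L powr ?t"
      using laplace_jensen[of "real (m + n) * \<beta>" ?t] assms False unfolding m_eq by (simp add: site_weight_def)
    moreover have "site_weight M V \<beta> n \<le> ?L powr (1 - ?t)"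
      using laplace_jensen[of "real (m + n) * \<beta>" "1 - ?t"] assms False unfolding n_eq by (simp add: site_weight_def)
    ultimately have "site_weight M V \<beta> m * site_weight M V \<beta> n \<le> ?L powr ?t * ?L powr (1 - ?t)"
      using assms by (intro mult_mono) (auto simp: site_weight_def less_imp_le[OF laplace_pos])
    also have "\<dots> = ?L" using L by (simp add: powr_add[symmetric])
    finally show ?thesis .
  qed (simp add: site_weight_def laplace_0)
qed

lemma site_weight_power:
  assumes "0 \<le> \<beta>" "0 \<le> t" "t \<le> 1"
  shows "site_weight M V (t * \<beta>) n \<le> site_weight M V \<beta> n powr t"
  using laplace_jensen[of "real n * \<beta>" t] assms by (simp add: site_weight_def mult_ac)

lemma site_weight_antimono:
  assumes "0 \<le> \<beta>" "\<beta> \<le> \<beta>'" shows "site_weight M V \<beta>' n \<le> site_weight M V \<beta> n"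
  unfolding site_weight_def using assms by (intro laplace_antimono) (auto intro: mult_left_mono)

text \<open>Here the vanishing essential infimum enters: with positive probability
  \<open>V 0\<close> is below \<open>\<epsilon>\<close>, hence the weight decays at rate at most
  \<open>\<epsilon> * \<beta>\<close>, for every \<open>\<epsilon>\<close>.\<close>

lemma ln_site_weight_limit:
  assumes "0 \<le> \<beta>" shows "(\<lambda>n. ln (site_weight M V \<beta> n) / real n) \<longlonglongrightarrow> 0"
proof (rule order_tendstoI)
  fix a :: real assume "0 < a"
  have "ln (site_weight M V \<beta> n) / real n \<le> 0" for n
    using assms by (intro divide_nonpos_nonneg) (auto simp: site_weight_def laplace_le_1 laplace_pos)
  then show "\<forall>\<^sub>F n in sequentially. ln (site_weight M V \<beta> n) / real n < a"
    using \<open>0 < a\<close> by (intro always_eventually) (auto intro: le_less_trans)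
next
  fix a :: real assume a: "a < 0"
  \<comment> \<open>The \<open>\<beta> + 1\<close> in the denominator makes the choice valid for
    \<open>\<beta> = 0\<close> too.\<close>
  define \<epsilon> where "\<epsilon> = - a / (2 * (\<beta> + 1))"
  have \<epsilon>: "0 < \<epsilon>" "\<epsilon> * \<beta> < - a"
  proof -
    show "0 < \<epsilon>" unfolding \<epsilon>_def using a assms by (intro divide_pos_pos) auto
    have "(- a) * \<beta> < (- a) * (2 * (\<beta> + 1))" using a assms by (intro mult_strict_left_mono) auto
    then have "((- a) * \<beta>) / (2 * (\<beta> + 1)) < - a"
      using assms by (subst pos_divide_less_eq) auto
    then show "\<epsilon> * \<beta> < - a" by (simp add: \<epsilon>_def)
  qed
  define p where "p = measure M {\<omega> \<in> space M. V 0 \<omega> < \<epsilon>}"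
  have p: "0 < p" unfolding p_def by (rule near_0[OF \<epsilon>(1)])
  have "(\<lambda>n. ln p / real n - \<epsilon> * \<beta>) \<longlonglongrightarrow> 0 - \<epsilon> * \<beta>"
    by (intro tendsto_intros lim_const_over_n)
  then have "\<forall>\<^sub>F n in sequentially. a < ln p / real n - \<epsilon> * \<beta>"
    using \<epsilon> by (intro order_tendstoD) auto
  then show "\<forall>\<^sub>F n in sequentially. a < ln (site_weight M V \<beta> n) / real n"
    using eventually_gt_at_top[of 0]
  proof eventually_elim
    case (elim n)
    have "p * exp (- (real n * \<beta>) * \<epsilon>) \<le> site_weight M V \<beta> n"
      unfolding site_weight_def p_def by (rule laplace_ge) (use assms in simp)
    then have "ln (p * exp (- (real n * \<beta>) * \<epsilon>)) \<le> ln (site_weight M V \<beta> n)"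
      using p by (intro ln_mono) auto
    then have "ln p - real n * \<beta> * \<epsilon> \<le> ln (site_weight M V \<beta> n)"
      using p by (simp add: ln_mult_pos)
    then have "(ln p - real n * \<beta> * \<epsilon>) / real n \<le> ln (site_weight M V \<beta> n) / real n"
      by (rule divide_right_mono) simp
    then show ?case using elim by (simp add: diff_divide_distrib mult.commute)
  qed
qed

section \<open>The complex Laplace transform\<close>

lemma claplace_of_real: "claplace M V (of_real s) = of_real (laplace M V s)"
proof -
  have "exp (- complex_of_real s * of_real (V 0 \<omega>)) = of_real (exp (- s * V 0 \<omega>))" for \<omega>
    by (simp add: exp_of_real[symmetric])
  then show ?thesis by (simp add: claplace_def laplace_def)
qed

lemma norm_claplace_le: "0 \<le> Re s \<Longrightarrow> norm (claplace M V s) \<le> laplace M V (Re s)"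
proof -
  have "norm (claplace M V s) \<le> (\<integral>\<omega>. norm (exp (- s * of_real (V 0 \<omega>))) \<partial>M)"
    unfolding claplace_def by (rule integral_norm_bound)
  also have "\<dots> = laplace M V (Re s)"
    by (simp add: laplace_def norm_exp_eq_Re)
  finally show ?thesis .
qed

text \<open>Expand about \<open>c\<close> in the disc of radius \<open>Re c\<close>. At distance
  \<open>\<rho> < Re c\<close> the sum of the absolute values of all terms is at most
  \<open>exp (- ((Re c - \<rho>) * V 0 \<omega>)) \<le> 1\<close>, which allows integration term by
  term.\<close>

lemma claplace_holomorphic: "claplace M V holomorphic_on {s. 0 < Re s}"
proof -
  have "claplace M V holomorphic_on ball c (Re c)" if c: "0 < Re c" for c
  proof (rule power_series_holomorphic)
    define a where "a = (\<lambda>k. \<integral>\<omega>. exp (- c * of_real (V 0 \<omega>)) * (- of_real (V 0 \<omega>)) ^ k / fact k \<partial>M)"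
    show "(\<lambda>k. a k * (w - c) ^ k) sums claplace M V w" if w: "w \<in> ball c (Re c)" for w
    proof -
      define \<rho> where "\<rho> = norm (w - c)"
      have \<rho>: "0 \<le> \<rho>" "\<rho> < Re c" using w by (auto simp: \<rho>_def dist_norm norm_minus_commute)
      define f where "f = (\<lambda>k \<omega>. exp (- c * of_real (V 0 \<omega>)) * ((- of_real (V 0 \<omega>)) ^ k / fact k * (w - c) ^ k))"
      have f_meas [measurable]: "f k \<in> borel_measurable M" for k unfolding f_def by measurable
      have f_sums: "(\<lambda>k. f k \<omega>) sums exp (- w * of_real (V 0 \<omega>))" for \<omega>
      proof -
        have "(\<lambda>k. exp (- c * of_real (V 0 \<omega>)) * ((- of_real (V 0 \<omega>) * (w - c)) ^ k /\<^sub>R fact k))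
            sums (exp (- c * of_real (V 0 \<omega>)) * exp (- of_real (V 0 \<omega>) * (w - c)))"
          by (intro sums_mult exp_converges)
        moreover have "exp (- c * of_real (V 0 \<omega>)) * exp (- of_real (V 0 \<omega>) * (w - c)) = exp (- w * of_real (V 0 \<omega>))"
          by (simp add: exp_add[symmetric] algebra_simps)
        moreover have "exp (- c * of_real (V 0 \<omega>)) * ((- of_real (V 0 \<omega>) * (w - c)) ^ k /\<^sub>R fact k) = f k \<omega>" for k
          unfolding f_def power_mult_distrib by (simp add: scaleR_conv_of_real divide_inverse mult_ac)
        ultimately show ?thesis by simp
      qed
      have nf: "norm (f k \<omega>) = exp (- Re c * V 0 \<omega>) * ((\<rho> * V 0 \<omega>) ^ k / fact k)" if "0 \<le> V 0 \<omega>" for k \<omega>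
        using that by (simp add: f_def \<rho>_def norm_mult norm_divide norm_power norm_exp_eq_Re power_mult_distrib)
      have nf_sum: "(\<Sum>k<n. norm (f k \<omega>)) \<le> 1" if "0 \<le> V 0 \<omega>" for n \<omega>
      proof -
        have "(\<Sum>k<n. (\<rho> * V 0 \<omega>) ^ k / fact k) \<le> exp (\<rho> * V 0 \<omega>)"
          using exp_converges[of "\<rho> * V 0 \<omega>"] \<rho> that
          by (intro sum_le_suminf[THEN order_trans]) (auto simp: sums_iff divide_inverse mult.commute)
        then have "(\<Sum>k<n. norm (f k \<omega>)) \<le> exp (- Re c * V 0 \<omega>) * exp (\<rho> * V 0 \<omega>)"
          unfolding nf[OF that] sum_distrib_left[symmetric] by (rule mult_left_mono) simp
        also have "\<dots> = exp (- ((Re c - \<rho>) * V 0 \<omega>))"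
          by (simp add: exp_add[symmetric] algebra_simps)
        also have "\<dots> \<le> 1" using \<rho> that by simp
        finally show ?thesis .
      qed
      have nf_1: "norm (f k \<omega>) \<le> 1" if "0 \<le> V 0 \<omega>" for k \<omega>
        using nf_sum[OF that, of "Suc k"] sum_nonneg[of "{..<k}" "\<lambda>k. norm (f k \<omega>)"] by simp
      have f_int: "integrable M (f k)" for k
      proof (rule integrable_const_bound[where B = 1])
        show "AE \<omega> in M. norm (f k \<omega>) \<le> 1"
          using nonneg by eventually_elim (rule nf_1)
      qed measurable
      have "(\<lambda>k. \<integral>\<omega>. f k \<omega> \<partial>M) sums (\<integral>\<omega>. (\<Sum>k. f k \<omega>) \<partial>M)"
      proof (rule sums_integral[OF f_int])
        show "AE \<omega> in M. summable (\<lambda>k. norm (f k \<omega>))"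
          using nonneg
        proof eventually_elim
          case (elim \<omega>)
          show ?case by (rule summableI_nonneg_bounded[OF _ nf_sum[OF elim]]) simp
        qed
        show "summable (\<lambda>k. \<integral>\<omega>. norm (f k \<omega>) \<partial>M)"
        proof (rule summableI_nonneg_bounded)
          fix n
          have "(\<Sum>k<n. \<integral>\<omega>. norm (f k \<omega>) \<partial>M) = (\<integral>\<omega>. (\<Sum>k<n. norm (f k \<omega>)) \<partial>M)"
            using f_int by (simp add: Bochner_Integration.integral_sum)
          also have "\<dots> \<le> (\<integral>\<omega>. 1 \<partial>M)"
          proof (rule integral_mono_AE)
            show "AE \<omega> in M. (\<Sum>k<n. norm (f k \<omega>)) \<le> 1"
              using nonneg by eventually_elim (rule nf_sum)
          qed (use f_int in auto)
          finally show "(\<Sum>k<n. \<integral>\<omega>. norm (f k \<omega>) \<partial>M) \<le> 1" by (simp add: prob_space)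
        qed simp
      qed
      moreover have "(\<integral>\<omega>. (\<Sum>k. f k \<omega>) \<partial>M) = claplace M V w"
        unfolding claplace_def using f_sums by (simp add: sums_iff)
      moreover have "(\<integral>\<omega>. f k \<omega> \<partial>M) = a k * (w - c) ^ k" for k
      proof -
        have "f k = (\<lambda>\<omega>. (exp (- c * of_real (V 0 \<omega>)) * (- of_real (V 0 \<omega>)) ^ k / fact k) * (w - c) ^ k)"
          by (simp add: f_def fun_eq_iff)
        then show ?thesis unfolding a_def by simp
      qed
      ultimately show ?thesis by simp
    qed
  qed
  then have "claplace M V field_differentiable at c" if "0 < Re c" for c
    using that holomorphic_on_imp_differentiable_at[of "claplace M V" "ball c (Re c)" c] by simp
  then show ?thesis
    by (auto simp: holomorphic_on_def intro: field_differentiable_at_within)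
qed

end

lemma potential_lawI:
  fixes V :: "int ^ 'd::finite \<Rightarrow> 'w \<Rightarrow> real"
  assumes "prob_space M" and [measurable]: "V 0 \<in> borel_measurable M" and ess: "essinf M (V 0) = 0"
    and "measure M {\<omega> \<in> space M. V 0 \<omega> = 0} < 1"
  shows "potential_law M V"
proof -
  interpret prob_space M by (rule assms)
  have sup: "esssup M (\<lambda>\<omega>. - ereal (V 0 \<omega>)) = 0"
    using ess by (simp add: essinf_def ereal_uminus_eq_reorder)
  show ?thesis
  proof
    show "AE \<omega> in M. 0 \<le> V 0 \<omega>"
      using esssup_AE[of "\<lambda>\<omega>. - ereal (V 0 \<omega>)" M] unfolding sup by eventually_elim (simp add: uminus_ereal.simps flip: zero_ereal_def)
    show "0 < measure M {\<omega> \<in> space M. V 0 \<omega> < \<epsilon>}" if "0 < \<epsilon>" for \<epsilon>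
    proof (rule ccontr)
      assume "\<not> 0 < measure M {\<omega> \<in> space M. V 0 \<omega> < \<epsilon>}"
      then have "prob {\<omega> \<in> space M. V 0 \<omega> < \<epsilon>} = 0" using measure_nonneg by (simp add: not_less antisym)
      then have "AE \<omega> in M. \<not> V 0 \<omega> < \<epsilon>"
        by (subst (asm) prob_eq_0) (auto elim: AE_mp)
      then have "AE \<omega> in M. - ereal (V 0 \<omega>) \<le> ereal (- \<epsilon>)"
        by eventually_elim simp
      then have "esssup M (\<lambda>\<omega>. - ereal (V 0 \<omega>)) \<le> ereal (- \<epsilon>)"
        by (intro esssup_I) measurable
      then show False using sup that by simp
    qed
  qed (use assms in auto)
qed

section \<open>Regularity of the rate and the critical line\<close>

text \<open>One comparison principle for several uses: \<open>t = 1\<close> for pathwise comparison,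
  \<open>c = 0\<close> for scaling, and \<open>t = 0\<close> for the crude bound.\<close>

lemma zrate_leI:
  fixes i0 :: "'d::finite"
  assumes att: "attractive \<psi>" "attractive \<psi>'" and t: "0 \<le> t"
    and le: "\<And>N. 1 \<le> N \<Longrightarrow> zhat i0 \<psi> N h \<le> exp (c * real N) * zhat i0 \<psi>' N h' powr t"
  shows "zrate i0 \<psi> h \<le> c + t * zrate i0 \<psi>' h'"
proof -
  interpret A: weighted_walk \<psi> i0 1 by (rule weighted_walkI[OF att(1)]) auto
  interpret B: weighted_walk \<psi>' i0 1 by (rule weighted_walkI[OF att(2)]) auto
  show ?thesis
  proof (rule LIMSEQ_le_const2[OF A.zrate_limit], intro exI[of _ 1] allI impI)
    fix N :: nat assume N: "1 \<le> N"
    have "zhat i0 \<psi>' N h' powr t \<le> exp (zrate i0 \<psi>' h' * real N) powr t"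
      by (rule powr_mono2[OF t less_imp_le[OF B.zhat_pos] B.zhat_le_zrate[OF N]])
    then have "zhat i0 \<psi> N h \<le> exp (c * real N) * exp (zrate i0 \<psi>' h' * real N) powr t"
      by (intro order_trans[OF le[OF N]] mult_left_mono) auto
    also have "\<dots> = exp ((c + t * zrate i0 \<psi>' h') * real N)"
      by (simp add: exp_powr_real exp_add[symmetric] algebra_simps)
    finally have "ln (zhat i0 \<psi> N h) \<le> (c + t * zrate i0 \<psi>' h') * real N"
      using A.zhat_pos ln_le_iff by blast
    then show "ln (zhat i0 \<psi> N h) / real N \<le> c + t * zrate i0 \<psi>' h'"
      using N by (simp add: divide_le_eq)
  qed
qed

lemma zrate_leI1:
  fixes i0 :: "'d::finite"
  assumes att: "attractive \<psi>" "attractive \<psi>'"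
    and le: "\<And>N xs. xs \<in> upaths N \<Longrightarrow> wt i0 \<psi> 1 h xs \<le> exp (c * real N) * wt i0 \<psi>' 1 h' xs"
  shows "zrate i0 \<psi> h \<le> c + zrate i0 \<psi>' h'"
proof -
  interpret B: weighted_walk \<psi>' i0 1 by (rule weighted_walkI[OF att(2)]) auto
  have "zrate i0 \<psi> h \<le> c + 1 * zrate i0 \<psi>' h'"
  proof (rule zrate_leI[OF att])
    show "zhat i0 \<psi> N h \<le> exp (c * real N) * zhat i0 \<psi>' N h' powr 1" for N
    proof -
      have "zhat i0 \<psi> N h \<le> (\<Sum>xs\<in>upaths N. exp (c * real N) * wt i0 \<psi>' 1 h' xs)"
        unfolding zhat_def by (rule sum_mono) (rule le)
      also have "\<dots> = exp (c * real N) * zhat i0 \<psi>' N h' powr 1"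
        using B.zhat_pos[of N h'] by (simp add: zhat_def sum_distrib_left)
      finally show ?thesis .
    qed
  qed simp
  then show ?thesis by simp
qed

lemma zrate_lipschitz:
  fixes i0 :: "'d::finite"
  assumes att: "attractive \<psi>"
  shows "zrate i0 \<psi> h \<le> \<bar>h - h'\<bar> + zrate i0 \<psi> h'"
proof (rule zrate_leI1[OF att att])
  fix N and xs :: "(int ^ 'd) list"
  assume "xs \<in> upaths N"
  then have "\<bar>lev i0 xs\<bar> \<le> int N" using lev_bound by (auto simp: upaths_def)
  then have l: "\<bar>real_of_int (lev i0 xs)\<bar> \<le> real N" by linarith
  have "(h - h') * real_of_int (lev i0 xs) \<le> \<bar>h - h'\<bar> * \<bar>real_of_int (lev i0 xs)\<bar>"
    by (simp add: abs_mult[symmetric])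
  also have "\<dots> \<le> \<bar>h - h'\<bar> * real N" by (rule mult_left_mono[OF l]) simp
  finally have "h * real_of_int (lev i0 xs) \<le> \<bar>h - h'\<bar> * real N + h' * real_of_int (lev i0 xs)"
    by (simp add: algebra_simps)
  then have "exp (h * of_int (lev i0 xs)) \<le> exp (\<bar>h - h'\<bar> * real N) * exp (h' * of_int (lev i0 xs))"
    by (simp add: exp_add[symmetric])
  then have "kap 1 xs * exp (h * of_int (lev i0 xs)) * pot \<psi> xs
      \<le> kap 1 xs * (exp (\<bar>h - h'\<bar> * real N) * exp (h' * of_int (lev i0 xs))) * pot \<psi> xs"
    using less_imp_le[OF attractive.pot_pos[OF att]] by (intro mult_right_mono mult_left_mono kap_nonneg) auto
  then show "wt i0 \<psi> 1 h xs \<le> exp (\<bar>h - h'\<bar> * real N) * wt i0 \<psi> 1 h' xs"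
    by (simp add: wt_def mult_ac)
qed

lemma zrate_le_abs:
  fixes i0 :: "'d::finite"
  assumes "attractive \<psi>" shows "zrate i0 \<psi> h \<le> \<bar>h\<bar>"
proof -
  interpret weighted_walk \<psi> i0 1 by (rule weighted_walkI[OF assms]) auto
  have "zrate i0 \<psi> h \<le> \<bar>h\<bar> + 0 * zrate i0 \<psi> h"
    by (rule zrate_leI[OF assms assms]) (use zhat_le_exp[of _ h] zhat_pos in \<open>simp_all add: less_imp_neq[symmetric]\<close>)
  then show ?thesis by simp
qed

lemma axis_irreducible:
  fixes i0 :: "'d::finite"
  shows "[axis i0 1] \<in> irreducible_bridges i0"
  by (auto simp: irreducible_bridges_def bridges_def unit_vecs_def append_eq_Cons_conv Cons_eq_append_conv)

lemma weighted_jensen: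
  fixes w y :: "'x \<Rightarrow> real"
  assumes "finite A" "\<And>x. x \<in> A \<Longrightarrow> 0 \<le> w x" "(\<Sum>x\<in>A. w x) = 1" "\<And>x. x \<in> A \<Longrightarrow> 0 < y x" "0 \<le> t" "t \<le> 1"
    and Y: "0 < (\<Sum>x\<in>A. w x * y x)"
  shows "(\<Sum>x\<in>A. w x * y x powr t) \<le> (\<Sum>x\<in>A. w x * y x) powr t"
proof -
  let ?Y = "\<Sum>x\<in>A. w x * y x"
  have "(\<Sum>x\<in>A. w x * y x powr t) * ?Y powr (1 - t) = (\<Sum>x\<in>A. w x * (y x powr t * ?Y powr (1 - t)))"
    by (simp add: sum_distrib_right mult_ac)
  also have "\<dots> \<le> (\<Sum>x\<in>A. w x * (t * y x + (1 - t) * ?Y))"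
    using assms by (intro sum_mono mult_left_mono Youngs_inequality_0) auto
  also have "\<dots> = (\<Sum>x\<in>A. t * (w x * y x) + (1 - t) * ?Y * w x)"
    by (intro sum.cong) (simp_all add: algebra_simps)
  also have "\<dots> = t * ?Y + (1 - t) * ?Y * (\<Sum>x\<in>A. w x)"
    unfolding sum.distrib sum_distrib_left[symmetric] by (rule refl)
  also have "\<dots> = ?Y" unfolding assms(3) by (simp add: algebra_simps)
  finally have "(\<Sum>x\<in>A. w x * y x powr t) \<le> ?Y / ?Y powr (1 - t)"
    using Y by (simp add: pos_le_divide_eq)
  also have "\<dots> = ?Y powr t" using Y powr_diff[of ?Y 1 "1 - t"] by simp
  finally show ?thesis .
qed

section \<open>The rate as a function of (h, \<beta>)\<close>

locale drifted_potential = potential_law M V for M :: "'w measure" and V :: "int ^ 'd::finite \<Rightarrow> 'w \<Rightarrow> real" +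
  fixes i0 :: 'd
begin

abbreviation "W \<equiv> site_weight M V"
abbreviation "g h \<beta> \<equiv> zrate i0 (W \<beta>) h"
abbreviation "a \<beta> \<equiv> alpha i0 (W \<beta>) 1"

lemma W_nonneg: "0 \<le> \<beta> \<Longrightarrow> 0 \<le> W \<beta> n"
  by (simp add: site_weight_def less_imp_le[OF laplace_pos])

lemma pot_antimono: "0 \<le> \<beta> \<Longrightarrow> \<beta> \<le> \<beta>' \<Longrightarrow> pot (W \<beta>') xs \<le> pot (W \<beta>) xs"
  unfolding pot_def by (rule potl_mono) (simp_all add: site_weight_antimono W_nonneg)

lemma wt_antimono: "0 \<le> \<beta> \<Longrightarrow> \<beta> \<le> \<beta>' \<Longrightarrow> 0 \<le> z \<Longrightarrow> wt i0 (W \<beta>') z h xs \<le> wt i0 (W \<beta>) z h xs"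
  unfolding wt_def by (intro mult_left_mono pot_antimono mult_nonneg_nonneg kap_nonneg) auto

lemma pot_power:
  assumes "0 \<le> \<beta>" "0 \<le> t" "t \<le> 1"
  shows "pot (W (t * \<beta>)) xs \<le> pot (W \<beta>) xs powr t"
proof -
  let ?l = "sites 0 xs"
  have "pot (W (t * \<beta>)) xs \<le> (\<Prod>y\<in>set ?l. W \<beta> (count_list ?l y) powr t)"
    unfolding pot_def potl_def
    using assms by (intro prod_mono) (auto intro!: site_weight_power W_nonneg)
  also have "\<dots> = pot (W \<beta>) xs powr t"
    unfolding pot_def potl_def
    by (rule prod_powr_distrib[symmetric])
  finally show ?thesis .
qed

lemma g_nonneg: "0 \<le> \<beta> \<Longrightarrow> 0 \<le> g h \<beta>"
  by (rule zrate_nonneg[OF attractive_site_weight ln_site_weight_limit])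

lemma g_le: "0 \<le> \<beta> \<Longrightarrow> g h \<beta> \<le> \<bar>h\<bar>"
  by (rule zrate_le_abs[OF attractive_site_weight])

lemma g_lipschitz: "0 \<le> \<beta> \<Longrightarrow> \<bar>g h \<beta> - g h' \<beta>\<bar> \<le> \<bar>h - h'\<bar>"
  using zrate_lipschitz[OF attractive_site_weight, of \<beta> i0 h h'] zrate_lipschitz[OF attractive_site_weight, of \<beta> i0 h' h]
  by linarith

lemma g_antimono:
  assumes "0 \<le> \<beta>" "\<beta> \<le> \<beta>'" shows "g h \<beta>' \<le> g h \<beta>"
proof -
  have "g h \<beta>' \<le> 0 + g h \<beta>"
    using assms by (intro zrate_leI1 attractive_site_weight) (auto intro: wt_antimono)
  then show ?thesis by simp
qed

text \<open>Jensen twice: for the potential, which gives the power \<open>t\<close> path by path,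
  and for the average over simple random walk paths.\<close>

lemma g_scale:
  assumes "0 \<le> \<beta>" "0 \<le> t" "t \<le> 1" shows "g (t * h) (t * \<beta>) \<le> t * g h \<beta>"
proof -
  have att: "attractive (W \<beta>)" "attractive (W (t * \<beta>))" using assms by (auto intro: attractive_site_weight)
  interpret B: weighted_walk "W \<beta>" i0 1 by (rule weighted_walkI[OF att(1)]) auto
  have "g (t * h) (t * \<beta>) \<le> 0 + t * g h \<beta>"
  proof (rule zrate_leI[OF att(2,1) assms(2)])
    fix N :: nat
    let ?y = "\<lambda>xs. exp (h * of_int (lev i0 xs)) * pot (W \<beta>) xs"
    have zy: "zhat i0 (W \<beta>) N h = (\<Sum>xs\<in>upaths N. kap 1 xs * ?y xs)"
      by (simp add: zhat_def wt_def mult.assoc)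
    have "zhat i0 (W (t * \<beta>)) N (t * h) \<le> (\<Sum>xs\<in>upaths N. kap 1 xs * ?y xs powr t)"
      unfolding zhat_def
    proof (rule sum_mono)
      fix xs :: "(int ^ 'd) list"
      have "?y xs powr t = exp (t * h * of_int (lev i0 xs)) * pot (W \<beta>) xs powr t"
        using B.pot_pos by (subst powr_mult) (auto simp: exp_powr_real less_imp_le mult_ac)
      then show "wt i0 (W (t * \<beta>)) 1 (t * h) xs \<le> kap 1 xs * ?y xs powr t"
        unfolding wt_def mult.assoc using pot_power[OF assms, of xs] by (simp add: mult_left_mono kap_nonneg)
    qed
    also have "\<dots> \<le> (\<Sum>xs\<in>upaths N. kap 1 xs * ?y xs) powr t"
      by (rule weighted_jensen)
        (use assms B.pot_pos B.zhat_pos[of N h] in \<open>auto simp: sum_kap kap_nonneg zy intro!: mult_pos_pos\<close>)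
    finally show "zhat i0 (W (t * \<beta>)) N (t * h) \<le> exp (0 * real N) * zhat i0 (W \<beta>) N h powr t"
      by (simp add: zy)
  qed
  then show ?thesis by simp
qed

lemma g_scale_h: "0 \<le> \<beta> \<Longrightarrow> 0 \<le> t \<Longrightarrow> t \<le> 1 \<Longrightarrow> g (t * h) \<beta> \<le> t * g h \<beta>"
  using g_scale[of \<beta> t h] g_antimono[of "t * \<beta>" \<beta> "t * h"] mult_left_le_one_le[of \<beta> t] by simp

text \<open>By \<open>pot_power\<close> the potential at \<open>\<beta>'\<close> is at least the one
  at \<open>\<beta>\<close> raised to the power \<open>\<beta>' / \<beta>\<close>. The surplus
  exponent costs little, since the potential of a path of length \<open>N\<close> is at least
  \<open>laplace M V \<beta> ^ N\<close>.\<close>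

lemma g_beta_diff:
  assumes "0 < \<beta>" "\<beta> \<le> \<beta>'"
  shows "g h \<beta> \<le> (\<beta>' / \<beta> - 1) * (- ln (laplace M V \<beta>)) + g h \<beta>'"
proof (rule zrate_leI1)
  show att: "attractive (W \<beta>)" "attractive (W \<beta>')" using assms by (auto intro: attractive_site_weight)
  fix N and xs :: "(int ^ 'd) list" assume xs: "xs \<in> upaths N"
  let ?p = "pot (W \<beta>) xs" and ?t = "\<beta> / \<beta>'" and ?s = "\<beta>' / \<beta> - 1"
  have p: "0 < ?p" and p': "0 < pot (W \<beta>') xs" by (rule attractive.pot_pos[OF att(1)], rule attractive.pot_pos[OF att(2)])
  have s: "0 \<le> ?s" using assms by simp
  have L: "0 < laplace M V \<beta>" using assms by (intro laplace_pos) auto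
  have "laplace M V \<beta> ^ N \<le> ?p"
    using attractive.pot_ge_power[OF att(1), of xs] xs by (simp add: upaths_def site_weight_def)
  then have "(laplace M V \<beta> ^ N) powr ?s \<le> ?p powr ?s"
    using s L by (intro powr_mono2) auto
  then have Ls: "exp (?s * ln (laplace M V \<beta>) * real N) \<le> ?p powr ?s"
    using L by (simp add: powr_def ln_realpow mult_ac)
  have "?p = pot (W (?t * \<beta>')) xs" using assms by simp
  also have "\<dots> \<le> pot (W \<beta>') xs powr ?t" using assms by (intro pot_power) auto
  finally have "?p powr (\<beta>' / \<beta>) \<le> (pot (W \<beta>') xs powr ?t) powr (\<beta>' / \<beta>)"
    using assms p by (intro powr_mono2) auto
  also have "\<dots> = pot (W \<beta>') xs" using assms p' by (simp add: powr_powr)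
  finally have "?p * ?p powr ?s \<le> pot (W \<beta>') xs"
    using p powr_add[of ?p 1 ?s] by simp
  then have "?p * exp (?s * ln (laplace M V \<beta>) * real N) \<le> pot (W \<beta>') xs"
    using mult_left_mono[OF Ls less_imp_le[OF p]] by linarith
  then have "(?p * exp (?s * ln (laplace M V \<beta>) * real N)) * exp (- (?s * ln (laplace M V \<beta>) * real N))
      \<le> pot (W \<beta>') xs * exp (- (?s * ln (laplace M V \<beta>) * real N))"
    by (rule mult_right_mono) simp
  also have "(?p * exp (?s * ln (laplace M V \<beta>) * real N)) * exp (- (?s * ln (laplace M V \<beta>) * real N)) = ?p"
    by (simp only: mult.assoc exp_minus_inverse mult_1_right)
  finally have "?p \<le> exp (?s * (- ln (laplace M V \<beta>)) * real N) * pot (W \<beta>') xs"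
    by (simp add: mult.commute)
  then have "(kap 1 xs * exp (h * of_int (lev i0 xs))) * ?p
      \<le> (kap 1 xs * exp (h * of_int (lev i0 xs))) * (exp (?s * (- ln (laplace M V \<beta>)) * real N) * pot (W \<beta>') xs)"
    by (intro mult_left_mono mult_nonneg_nonneg kap_nonneg) auto
  then show "wt i0 (W \<beta>) 1 h xs \<le> exp (?s * (- ln (laplace M V \<beta>)) * real N) * wt i0 (W \<beta>') 1 h xs"
    by (simp add: wt_def mult_ac)
qed

lemma pot_W0: "pot (W 0) xs = 1"
  by (simp add: pot_def potl_def site_weight_0)

text \<open>The ratio of parameters used in \<open>g_beta_diff\<close> degenerates at 0. There the
  potential is identically 1 and is compared with the bound of one factor
  \<open>laplace M V \<beta>\<close> per step.\<close>

lemma g_beta_diff_0: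
  assumes "0 \<le> \<beta>" shows "g h 0 \<le> - ln (laplace M V \<beta>) + g h \<beta>"
proof (rule zrate_leI1)
  show att: "attractive (W 0)" "attractive (W \<beta>)" using assms by (auto intro: attractive_site_weight)
  fix N and xs :: "(int ^ 'd) list" assume xs: "xs \<in> upaths N"
  have L: "0 < laplace M V \<beta>" using assms by (rule laplace_pos)
  have "laplace M V \<beta> ^ N \<le> pot (W \<beta>) xs"
    using attractive.pot_ge_power[OF att(2), of xs] xs by (simp add: upaths_def site_weight_def)
  moreover have "laplace M V \<beta> ^ N = exp (ln (laplace M V \<beta>) * real N)"
    using L by (simp add: exp_of_nat2_mult)
  ultimately have "exp (- (ln (laplace M V \<beta>) * real N)) * exp (ln (laplace M V \<beta>) * real N)
      \<le> exp (- (ln (laplace M V \<beta>) * real N)) * pot (W \<beta>) xs"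
    by (intro mult_left_mono) auto
  then have "1 \<le> exp (- ln (laplace M V \<beta>) * real N) * pot (W \<beta>) xs"
    by (simp add: exp_add[symmetric])
  then have "(kap 1 xs * exp (h * of_int (lev i0 xs))) * 1
      \<le> (kap 1 xs * exp (h * of_int (lev i0 xs))) * (exp (- ln (laplace M V \<beta>) * real N) * pot (W \<beta>) xs)"
    by (intro mult_left_mono mult_nonneg_nonneg kap_nonneg) auto
  then show "wt i0 (W 0) 1 h xs \<le> exp (- ln (laplace M V \<beta>) * real N) * wt i0 (W \<beta>) 1 h xs"
    by (simp add: wt_def pot_W0 mult_ac)
qed

text \<open>Without potential the partition function of the drifted walk is a total probability, so
  \<open>zhat\<close> is exactly the inverse of its normalization.\<close>

lemma g_0: "g h 0 = - ln (fug TYPE('d) h)"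
proof -
  have att: "attractive (W 0)" by (rule attractive_site_weight) simp
  interpret weighted_walk "W 0" i0 1 by (rule weighted_walkI[OF att]) auto
  interpret W: prob_space "walk_measure i0 h" by (rule prob_space_walk)
  have z: "fug TYPE('d) h ^ N * zhat i0 (W 0) N h = 1" for N
  proof -
    have "(1 :: real) = (\<integral>\<xi>. (\<lambda>_. 1) (map \<xi> [0..<N]) \<partial>walk_measure i0 h)"
      by (simp add: W.prob_space)
    also have "\<dots> = (\<Sum>xs\<in>upaths N. kap (fug TYPE('d) h) xs * exp (h * of_int (lev i0 xs)) * 1)"
      by (rule walk_expectation)
    also have "\<dots> = (\<Sum>xs\<in>upaths N. fug TYPE('d) h ^ N * wt i0 (W 0) 1 h xs)"
      by (intro sum.cong refl) (simp add: wt_def kap_def upaths_def power_divide pot_W0)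
    finally show ?thesis by (simp add: zhat_def sum_distrib_left)
  qed
  have "(\<lambda>N. ln (zhat i0 (W 0) N h) / real N) \<longlonglongrightarrow> - ln (fug TYPE('d) h)"
  proof (rule Lim_transform_eventually[OF tendsto_const])
    show "\<forall>\<^sub>F N in sequentially. - ln (fug TYPE('d) h) = ln (zhat i0 (W 0) N h) / real N"
      using eventually_ge_at_top[of 1]
    proof eventually_elim
      case (elim N)
      have "ln (fug TYPE('d) h ^ N * zhat i0 (W 0) N h) = 0" unfolding z by simp
      then have "real N * ln (fug TYPE('d) h) + ln (zhat i0 (W 0) N h) = 0"
        using fug_pos[where 'd = 'd, of h] zhat_pos[of N h] by (simp add: ln_mult_pos ln_realpow)
      then have "ln (zhat i0 (W 0) N h) = real N * (- ln (fug TYPE('d) h))" by simp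
      then show ?case using elim by simp
    qed
  qed
  then show ?thesis using LIMSEQ_unique zrate_limit by blast
qed

lemma g_cont_beta: "continuous_on {0..} (\<lambda>\<beta>. g h \<beta>)"
  unfolding continuous_on_def
proof
  fix b :: real assume b: "b \<in> {0..}"
  let ?F = "at b within {0..}"
  have "((\<lambda>\<beta>. g h \<beta> - g h b) \<longlongrightarrow> 0) ?F"
  proof (cases "b = 0")
    case True
    show ?thesis
    proof (rule tendstoI)
      fix e :: real assume e: "0 < e"
      have "0 < 1 - exp (- e)" using e by simp
      then obtain \<delta> where \<delta>: "0 < \<delta>" "\<And>s. 0 \<le> s \<Longrightarrow> s \<le> \<delta> \<Longrightarrow> 1 - (1 - exp (- e)) < laplace M V s"
        using laplace_tendsto_1 by blast
      have "dist (g h \<beta> - g h b) 0 < e" if \<beta>: "0 \<le> \<beta>" "\<beta> < \<delta>" for \<beta>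
      proof -
        have "ln (exp (- e)) < ln (laplace M V \<beta>)"
          using \<delta>(2)[of \<beta>] \<beta> laplace_pos[of \<beta>] by (subst ln_less_cancel_iff) auto
        then have "- ln (laplace M V \<beta>) < e" by simp
        then show ?thesis
          using g_beta_diff_0[OF \<beta>(1), of h] g_antimono[of 0 \<beta> h] \<beta> True by (simp add: dist_real_def)
      qed
      then show "\<forall>\<^sub>F \<beta> in ?F. dist (g h \<beta> - g h b) 0 < e"
        unfolding eventually_at using True \<delta>(1) by (intro exI[of _ \<delta>]) (auto simp: dist_real_def)
    qed
  next
    case False
    with b have b0: "0 < b" by simp
    let ?K = "- ln (laplace M V b)"
    have K: "0 \<le> ?K" using b0 by (simp add: laplace_le_1 laplace_pos)
    show ?thesis
    proof (rule Lim_null_comparison)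
      show "((\<lambda>\<beta>. \<bar>\<beta> / b - 1\<bar> * ?K + \<bar>b / \<beta> - 1\<bar> * ?K) \<longlongrightarrow> 0) ?F"
      proof -
        have "((\<lambda>\<beta>. \<bar>\<beta> / b - 1\<bar> * ?K + \<bar>b / \<beta> - 1\<bar> * ?K) \<longlongrightarrow> \<bar>b / b - 1\<bar> * ?K + \<bar>b / b - 1\<bar> * ?K) ?F"
          using b0 by (intro tendsto_intros) auto
        then show ?thesis using b0 by simp
      qed
      have "norm (g h \<beta> - g h b) \<le> \<bar>\<beta> / b - 1\<bar> * ?K + \<bar>b / \<beta> - 1\<bar> * ?K" if "0 < \<beta>" for \<beta>
      proof (cases "b \<le> \<beta>")
        case True
        have "(\<beta> / b - 1) * ?K \<le> \<bar>\<beta> / b - 1\<bar> * ?K" using K by (intro mult_right_mono) auto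
        moreover have "0 \<le> \<bar>b / \<beta> - 1\<bar> * ?K" by (rule mult_nonneg_nonneg[OF abs_ge_zero K])
        ultimately show ?thesis
          using g_beta_diff[OF b0 True, of h] g_antimono[of b \<beta> h] b0 True unfolding real_norm_def by linarith
      next
        case F: False
        have "ln (laplace M V b) \<le> ln (laplace M V \<beta>)"
          using that F b0 laplace_antimono[of \<beta> b] laplace_pos[of b] by (intro ln_mono) auto
        then have "(b / \<beta> - 1) * (- ln (laplace M V \<beta>)) \<le> \<bar>b / \<beta> - 1\<bar> * ?K"
          using that F by (intro mult_mono) (auto simp: laplace_le_1 laplace_pos less_imp_le)
        moreover have "0 \<le> \<bar>\<beta> / b - 1\<bar> * ?K" by (rule mult_nonneg_nonneg[OF abs_ge_zero K])
        ultimately show ?thesis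
          using g_beta_diff[OF that, of b h] g_antimono[of \<beta> b h] that F unfolding real_norm_def by linarith
      qed
      then show "\<forall>\<^sub>F \<beta> in ?F. norm (g h \<beta> - g h b) \<le> \<bar>\<beta> / b - 1\<bar> * ?K + \<bar>b / \<beta> - 1\<bar> * ?K"
        unfolding eventually_at using b0 by (intro exI[of _ b]) (auto simp: dist_real_def)
    qed
  qed
  then show "((\<lambda>\<beta>. g h \<beta>) \<longlongrightarrow> g h b) ?F"
    by (simp add: LIM_zero_iff)
qed

text \<open>Continuity in each variable is enough, because the Lipschitz bound in \<open>h\<close>
  is uniform in \<open>\<beta>\<close>.\<close>

lemma g_cont: "continuous_on (UNIV \<times> {0..}) (\<lambda>(h, \<beta>). g h \<beta>)"
  unfolding continuous_on_def
proof (safe)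
  fix h b :: real assume b: "0 \<le> b"
  let ?F = "at (h, b) within UNIV \<times> {0..}"
  have "((\<lambda>p. g (fst p) (snd p) - g h b) \<longlongrightarrow> 0) ?F"
  proof (rule Lim_null_comparison)
    have "((\<lambda>\<beta>. g h \<beta>) \<longlongrightarrow> g h b) (at b within {0..})"
      using g_cont_beta[of h] b by (auto simp: continuous_on_def)
    moreover have "continuous_on (UNIV \<times> {0..}) (\<lambda>p :: real \<times> real. g h (snd p))"
      by (rule continuous_on_compose2[OF g_cont_beta]) (auto intro: continuous_intros)
    then have "((\<lambda>p. g h (snd p)) \<longlongrightarrow> g h b) ?F"
      using b by (auto simp: continuous_on_def)
    moreover have "((\<lambda>p. fst p) \<longlongrightarrow> h) ?F"
      by (auto intro!: tendsto_eq_intros)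
    ultimately have "((\<lambda>p. \<bar>fst p - h\<bar> + \<bar>g h (snd p) - g h b\<bar>) \<longlongrightarrow> \<bar>h - h\<bar> + \<bar>g h b - g h b\<bar>) ?F"
      by (intro tendsto_intros)
    then show "((\<lambda>p. \<bar>fst p - h\<bar> + \<bar>g h (snd p) - g h b\<bar>) \<longlongrightarrow> 0) ?F" by simp
    have "norm (g (fst p) (snd p) - g h b) \<le> \<bar>fst p - h\<bar> + \<bar>g h (snd p) - g h b\<bar>" if "0 \<le> snd p" for p
      using g_lipschitz[OF that, of "fst p" h] unfolding real_norm_def by linarith
    then show "\<forall>\<^sub>F p in ?F. norm (g (fst p) (snd p) - g h b) \<le> \<bar>fst p - h\<bar> + \<bar>g h (snd p) - g h b\<bar>"
      unfolding eventually_at by (intro exI[of _ 1]) auto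
  qed
  then show "((\<lambda>(h, \<beta>). g h \<beta>) \<longlongrightarrow> g h b) ?F"
    by (simp add: LIM_zero_iff case_prod_unfold)
qed

section \<open>The critical curve\<close>

lemma g_pos: "0 \<le> \<beta> \<Longrightarrow> a \<beta> < h \<Longrightarrow> 0 < g h \<beta>"
  by (rule zrate_pos[OF attractive_site_weight])

lemma g_eq_0: "0 \<le> \<beta> \<Longrightarrow> 0 \<le> h \<Longrightarrow> h < a \<beta> \<Longrightarrow> g h \<beta> = 0"
  using zrate_nonpos[OF attractive_site_weight, of \<beta> h i0] g_nonneg[of \<beta> h] by simp

lemma a_nonneg: "0 \<le> \<beta> \<Longrightarrow> 0 \<le> a \<beta>"
  using g_pos[of \<beta> 0] g_le[of \<beta> 0] by (cases "0 \<le> a \<beta>") auto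

lemma a_mono: "0 \<le> \<beta> \<Longrightarrow> \<beta> \<le> \<beta>' \<Longrightarrow> a \<beta> \<le> a \<beta>'"
  by (intro alpha_antimono attractive_site_weight site_weight_antimono) auto

text \<open>If it failed, some \<open>h\<close> would have \<open>g h \<beta> = 0\<close> but
  \<open>g (t * h) (t * \<beta>) > 0\<close>, against \<open>g_scale\<close>.\<close>

lemma a_scale:
  assumes "0 \<le> \<beta>" "0 < t" "t \<le> 1" shows "t * a \<beta> \<le> a (t * \<beta>)"
proof (rule ccontr)
  assume "\<not> t * a \<beta> \<le> a (t * \<beta>)"
  then have "a (t * \<beta>) / t < a \<beta>" using assms by (simp add: divide_less_eq mult.commute)
  then obtain h where h: "a (t * \<beta>) / t < h" "h < a \<beta>" using dense by blast
  have "0 \<le> a (t * \<beta>) / t" using assms a_nonneg[of "t * \<beta>"] by simp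
  then have "g h \<beta> = 0" using h assms by (intro g_eq_0) auto
  moreover have "0 < g (t * h) (t * \<beta>)" using h assms by (intro g_pos) (auto simp: divide_less_eq mult.commute)
  ultimately show False using g_scale[of \<beta> t h] assms by simp
qed

text \<open>Monotonicity and \<open>a_scale\<close> squeeze \<open>a \<beta>\<close> between
  multiples of \<open>a b\<close> with factors tending to 1.\<close>

lemma a_cont: "continuous_on {0<..} a"
  unfolding continuous_on_def
proof
  fix b :: real assume "b \<in> {0<..}"
  then have b: "0 < b" by simp
  let ?F = "at b within {0<..}"
  show "(a \<longlongrightarrow> a b) ?F"
  proof (rule tendsto_sandwich)
    have "((\<lambda>\<beta>. min 1 (\<beta> / b) * a b) \<longlongrightarrow> min 1 (b / b) * a b) ?F"
      using b by (intro tendsto_intros) auto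
    then show "((\<lambda>\<beta>. min 1 (\<beta> / b) * a b) \<longlongrightarrow> a b) ?F" using b by simp
    have "((\<lambda>\<beta>. max 1 (\<beta> / b) * a b) \<longlongrightarrow> max 1 (b / b) * a b) ?F"
      using b by (intro tendsto_intros) auto
    then show "((\<lambda>\<beta>. max 1 (\<beta> / b) * a b) \<longlongrightarrow> a b) ?F" using b by simp
    have *: "min 1 (\<beta> / b) * a b \<le> a \<beta> \<and> a \<beta> \<le> max 1 (\<beta> / b) * a b" if "0 < \<beta>" for \<beta>
    proof (cases "\<beta> \<le> b")
      case True
      then have "(\<beta> / b) * a b \<le> a \<beta>" using a_scale[of b "\<beta> / b"] b that by simp
      then show ?thesis using True a_mono[of \<beta> b] b that by (simp add: min_def max_def)
    next
      case False
      then have "(b / \<beta>) * a \<beta> \<le> a b" using a_scale[of \<beta> "b / \<beta>"] b that by simp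
      then have "a \<beta> \<le> (\<beta> / b) * a b" using b that by (simp add: field_simps)
      then show ?thesis using False a_mono[of b \<beta>] b that by (simp add: min_def max_def)
    qed
    show "\<forall>\<^sub>F \<beta> in ?F. min 1 (\<beta> / b) * a b \<le> a \<beta>" "\<forall>\<^sub>F \<beta> in ?F. a \<beta> \<le> max 1 (\<beta> / b) * a b"
      unfolding eventually_at using * by (auto intro!: exI[of _ 1])
  qed
qed

text \<open>At \<open>\<beta> = 0\<close> the rate at \<open>h / 2\<close> is positive by the
  explicit formula \<open>g_0\<close>. Continuity preserves this for small \<open>\<beta>\<close>,
  and a positive rate excludes \<open>h / 2 < a \<beta>\<close>.\<close>

lemma a_small:
  assumes "0 < h" obtains \<beta> where "0 < \<beta>" "a \<beta> < h"
proof -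
  have "0 < g (h / 2) 0"
    using assms fug_less_1[where 'd = 'd, of "h / 2"] fug_pos[where 'd = 'd, of "h / 2"] by (simp add: g_0)
  moreover have "((\<lambda>\<beta>. g (h / 2) \<beta>) \<longlongrightarrow> g (h / 2) 0) (at 0 within {0..})"
    using g_cont_beta[of "h / 2"] by (auto simp: continuous_on_def)
  ultimately have "\<forall>\<^sub>F \<beta> in at 0 within {0..}. 0 < g (h / 2) \<beta>"
    using order_tendstoD(1) by blast
  then obtain d where d: "0 < d" "\<And>\<beta>. 0 < \<beta> \<Longrightarrow> \<beta> < d \<Longrightarrow> 0 < g (h / 2) \<beta>"
    unfolding eventually_at by (auto simp: dist_real_def)
  have "0 < g (h / 2) (d / 2)" using d by simp
  then have "a (d / 2) \<le> h / 2" using g_eq_0[of "d / 2" "h / 2"] d(1) assms by (cases "h / 2 < a (d / 2)") auto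
  then show thesis using that[of "d / 2"] d(1) assms by simp
qed

text \<open>With equal values of \<open>a\<close>, both irreducible masses would be one at the same
  tilt; but the single upward step loses weight strictly when \<open>\<beta>\<close> grows, because
  the Laplace transform is strictly decreasing.\<close>

lemma a_strict_mono:
  assumes "0 \<le> \<beta>" "\<beta> < \<beta>'" shows "a \<beta> < a \<beta>'"
proof (rule ccontr)
  assume "\<not> a \<beta> < a \<beta>'"
  then have eq: "a \<beta>' = a \<beta>" using a_mono[of \<beta> \<beta>'] assms by simp
  have att: "attractive (W \<beta>)" "attractive (W \<beta>')" using assms by (auto intro: attractive_site_weight)
  interpret A: weighted_walk "W \<beta>" i0 1 by (rule weighted_walkI[OF att(1)]) auto
  interpret B: weighted_walk "W \<beta>'" i0 1 by (rule weighted_walkI[OF att(2)]) auto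
  let ?e = "[axis i0 1] :: (int ^ 'd) list" and ?h = "a \<beta>"
  let ?d = "wt i0 (W \<beta>) 1 ?h ?e - wt i0 (W \<beta>') 1 ?h ?e"
  have "W \<beta>' 1 < W \<beta> 1"
    unfolding site_weight_def using assms by (intro laplace_strict_antimono) auto
  then have d: "0 < ?d"
    by (simp add: wt_def kap_def divide_strict_right_mono)
  let ?R = "irreducible_bridges i0 - {?e}"
  have split: "mass w (irreducible_bridges i0) = ennreal (w ?e) + mass w ?R" if "0 \<le> w ?e" for w
    using mass_insert[of ?e ?R w] that axis_irreducible[of i0] by (simp add: insert_absorb)
  have "irr_mass i0 (W \<beta>') 1 ?h + ennreal ?d \<le> irr_mass i0 (W \<beta>) 1 ?h"
  proof -
    have "irr_mass i0 (W \<beta>') 1 ?h + ennreal ?d = ennreal (wt i0 (W \<beta>') 1 ?h ?e) + ennreal ?d + mass (wt i0 (W \<beta>') 1 ?h) ?R"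
      unfolding irr_mass_def split[OF B.wt_nonneg] by (simp add: add_ac)
    also have "ennreal (wt i0 (W \<beta>') 1 ?h ?e) + ennreal ?d = ennreal (wt i0 (W \<beta>) 1 ?h ?e)"
      using d B.wt_nonneg[of ?h ?e] by (simp add: ennreal_plus[symmetric] del: ennreal_plus)
    also have "mass (wt i0 (W \<beta>') 1 ?h) ?R \<le> mass (wt i0 (W \<beta>) 1 ?h) ?R"
      using assms by (intro mass_mono wt_antimono) auto
    finally show ?thesis
      unfolding irr_mass_def split[OF A.wt_nonneg] by (simp add: add_left_mono)
  qed
  then have "1 + ennreal ?d \<le> 1"
    using A.irr_mass_alpha B.irr_mass_alpha unfolding eq by simp
  moreover have "1 + ennreal ?d = ennreal (1 + ?d)" using d by (subst ennreal_plus) auto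
  ultimately have "ennreal (1 + ?d) \<le> 1" by (simp only:)
  then have "1 + ?d \<le> 1" by (simp only: ennreal_le_1)
  then show False using d by linarith
qed

lemma mbar0: "0 \<le> \<beta> \<Longrightarrow> mbar_an0 M V i0 \<beta> = a \<beta>"
  by (rule mbar_an0_eq[OF attractive_site_weight])

lemma beta_crit_eq:
  assumes "0 < \<beta>" shows "beta_crit M V i0 (a \<beta>) = ereal \<beta>"
proof -
  have "(THE b. b > 0 \<and> mbar_an0 M V i0 b = a \<beta>) = \<beta>"
  proof (rule the_equality)
    show "b = \<beta>" if "b > 0 \<and> mbar_an0 M V i0 b = a \<beta>" for b
    proof -
      have "0 < b" "a b = a \<beta>" using that mbar0[of b] by simp_all
      then show ?thesis
        using a_strict_mono[of b \<beta>] a_strict_mono[of \<beta> b] assms by (cases b \<beta> rule: linorder_cases) simp_all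
    qed
  qed (use assms mbar0[of \<beta>] in auto)
  moreover have "\<exists>b>0. mbar_an0 M V i0 b = a \<beta>" using assms mbar0[of \<beta>] by auto
  ultimately show ?thesis by (simp add: beta_crit_def)
qed

text \<open>If \<open>a \<beta>\<close> were at least \<open>h\<close>, the intermediate value
  theorem, started from \<open>a_small\<close>, would give a finite critical value not exceeding
  \<open>\<beta>\<close>. The argument covers an infinite \<open>beta_crit\<close> as well.\<close>

lemma beta_crit_less:
  assumes "0 < h" "0 \<le> \<beta>" "ereal \<beta> < beta_crit M V i0 h" shows "a \<beta> < h"
proof (rule ccontr)
  assume "\<not> a \<beta> < h"
  then have h: "h \<le> a \<beta>" by simp
  obtain b where b: "0 < b" "a b < h" using a_small[OF assms(1)] by blast
  have "b < \<beta>" using a_mono[of \<beta> b] assms b h by (cases "b < \<beta>") auto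
  moreover have "continuous_on {b..\<beta>} a"
    by (rule continuous_on_subset[OF a_cont]) (use b in auto)
  ultimately obtain c where c: "b \<le> c" "c \<le> \<beta>" "a c = h"
    using IVT'[of a b h \<beta>] b h by auto
  then have "beta_crit M V i0 h = ereal c" using beta_crit_eq[of c] b by auto
  then show False using assms c by simp
qed

lemma beta_crit_iff:
  assumes "0 < h" "0 < \<beta>" shows "ereal \<beta> = beta_crit M V i0 h \<longleftrightarrow> a \<beta> = h"
proof
  assume eq: "ereal \<beta> = beta_crit M V i0 h"
  then have ex: "\<exists>b>0. mbar_an0 M V i0 b = h" by (auto simp: beta_crit_def split: if_splits)
  then obtain b where b: "0 < b" "a b = h" using mbar0 by auto
  then have "beta_crit M V i0 h = ereal b" using beta_crit_eq[of b] by auto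
  then show "a \<beta> = h" using eq b by simp
qed (use beta_crit_eq[OF assms(2)] in auto)

lemma regime_set: "{(h, \<beta>). h > 0 \<and> \<beta> > 0 \<and> ereal \<beta> \<noteq> beta_crit M V i0 h} = {(h, \<beta>). h > 0 \<and> \<beta> > 0 \<and> a \<beta> \<noteq> h}"
  using beta_crit_iff by auto

lemma open_regimes: "open {(h, \<beta>). h > 0 \<and> \<beta> > 0 \<and> a \<beta> \<noteq> h}"
proof -
  have "continuous_on ({0<..} \<times> {0<..}) (\<lambda>p :: real \<times> real. a (snd p))"
    by (rule continuous_on_compose2[OF a_cont]) (auto intro: continuous_intros)
  then have "continuous_on ({0<..} \<times> {0<..}) (\<lambda>p :: real \<times> real. a (snd p) - fst p)"
    by (intro continuous_intros)
  then have "open (({0<..} \<times> {0<..}) \<inter> (\<lambda>p. a (snd p) - fst p) -` (- {0}))"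
    by (intro continuous_open_preimage open_Times) auto
  moreover have "({0<..} \<times> {0<..}) \<inter> (\<lambda>p. a (snd p) - fst p) -` (- {0}) = {(h, \<beta>). h > 0 \<and> \<beta> > 0 \<and> a \<beta> \<noteq> h}"
    by auto
  ultimately show ?thesis by simp
qed

end

section \<open>Renewal in time and the lower bound\<close>

definition bridges_of_length :: "'d \<Rightarrow> nat \<Rightarrow> (int ^ 'd) list set" where
  "bridges_of_length i0 n = {xs \<in> bridges i0. length xs = n}"

definition irreducibles_of_length :: "'d \<Rightarrow> nat \<Rightarrow> (int ^ 'd) list set" where
  "irreducibles_of_length i0 n = {xs \<in> irreducible_bridges i0. length xs = n}"

definition bridge_coeff :: "'d::finite \<Rightarrow> (nat \<Rightarrow> real) \<Rightarrow> real \<Rightarrow> nat \<Rightarrow> real" where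
  "bridge_coeff i0 \<psi> h n = (\<Sum>xs\<in>bridges_of_length i0 n. wt i0 \<psi> 1 h xs)"

definition irr_coeff :: "'d::finite \<Rightarrow> (nat \<Rightarrow> real) \<Rightarrow> real \<Rightarrow> nat \<Rightarrow> real" where
  "irr_coeff i0 \<psi> h n = (\<Sum>xs\<in>irreducibles_of_length i0 n. wt i0 \<psi> 1 h xs)"

lemma bridges_of_length_upaths: "bridges_of_length i0 n \<subseteq> upaths n"
  and irreducibles_of_length_bridges: "irreducibles_of_length i0 n \<subseteq> bridges_of_length i0 n"
  by (auto simp: bridges_of_length_def irreducibles_of_length_def upaths_def irreducible_bridgesD bridges_lists
      intro: bridges_lists[THEN in_listsD, rule_format])

lemma finite_bridges_of_length [simp]: "finite (bridges_of_length (i0 :: 'd::finite) n)"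
  by (rule finite_subset[OF bridges_of_length_upaths finite_upaths])

lemma finite_irreducibles_of_length [simp]: "finite (irreducibles_of_length (i0 :: 'd::finite) n)"
  by (rule finite_subset[OF irreducibles_of_length_bridges finite_bridges_of_length])

context weighted_walk
begin

lemma irr_coeff_nonneg: "0 \<le> irr_coeff i0 \<psi> h n"
  unfolding irr_coeff_def by (intro sum_nonneg weighted_walk.wt_nonneg[OF ww1])

lemma irr_mass_series: "irr_mass i0 \<psi> z h = (\<Sum>n. ennreal (irr_coeff i0 \<psi> h n * z ^ n))"
proof -
  have "irr_mass i0 \<psi> z h = (\<Sum>n. mass (wt i0 \<psi> z h) (irreducibles_of_length i0 n))"
    unfolding irr_mass_def irreducibles_of_length_def by (rule mass_split)
  also have "\<dots> = (\<Sum>n. ennreal (irr_coeff i0 \<psi> h n * z ^ n))"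
  proof (rule suminf_cong)
    fix n
    have "mass (wt i0 \<psi> z h) (irreducibles_of_length i0 n) = ennreal (\<Sum>xs\<in>irreducibles_of_length i0 n. wt i0 \<psi> z h xs)"
      by (intro mass_finite wt_nonneg) simp
    also have "(\<Sum>xs\<in>irreducibles_of_length i0 n. wt i0 \<psi> z h xs) = (\<Sum>xs\<in>irreducibles_of_length i0 n. wt i0 \<psi> 1 h xs * z ^ n)"
      by (rule sum.cong[OF refl], subst wt_scale) (simp add: irreducibles_of_length_def)
    finally show "mass (wt i0 \<psi> z h) (irreducibles_of_length i0 n) = ennreal (irr_coeff i0 \<psi> h n * z ^ n)"
      by (simp add: irr_coeff_def sum_distrib_right)
  qed
  finally show ?thesis .
qed

lemma irr_coeff_summable:
  assumes "irr_mass i0 \<psi> z h < \<infinity>"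
  shows "summable (\<lambda>n. irr_coeff i0 \<psi> h n * z ^ n)"
    and "irr_mass i0 \<psi> z h = ennreal (\<Sum>n. irr_coeff i0 \<psi> h n * z ^ n)"
proof -
  have nn: "0 \<le> irr_coeff i0 \<psi> h n * z ^ n" for n
    using irr_coeff_nonneg z_pos by simp
  show s: "summable (\<lambda>n. irr_coeff i0 \<psi> h n * z ^ n)"
    using assms nn unfolding irr_mass_series by (intro summable_suminf_not_top) (auto simp: less_top)
  show "irr_mass i0 \<psi> z h = ennreal (\<Sum>n. irr_coeff i0 \<psi> h n * z ^ n)"
    unfolding irr_mass_series using s nn by (intro suminf_ennreal2) auto
qed

lemma irr_coeff_partial_sum:
  assumes "irr_mass i0 \<psi> z h \<le> ennreal A" "0 \<le> A"
  shows "(\<Sum>n\<le>N. irr_coeff i0 \<psi> h n * z ^ n) \<le> A"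
proof -
  have nn: "0 \<le> irr_coeff i0 \<psi> h n * z ^ n" for n
    using irr_coeff_nonneg z_pos by simp
  have fin: "irr_mass i0 \<psi> z h < \<infinity>" using assms by (auto intro: le_less_trans)
  have "(\<Sum>n\<le>N. irr_coeff i0 \<psi> h n * z ^ n) \<le> (\<Sum>n. irr_coeff i0 \<psi> h n * z ^ n)"
    using irr_coeff_summable(1)[OF fin] nn by (intro sum_le_suminf) auto
  also have "\<dots> \<le> A"
    using assms unfolding irr_coeff_summable(2)[OF fin] by (simp add: ennreal_le_iff)
  finally show ?thesis .
qed

lemma bridge_coeff_0: "bridge_coeff i0 \<psi> h 0 = 1" and irr_coeff_0: "irr_coeff i0 \<psi> h 0 = 0"
proof -
  have "bridges_of_length i0 0 = {[]}" by (auto simp: bridges_of_length_def)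
  then show "bridge_coeff i0 \<psi> h 0 = 1" by (simp add: bridge_coeff_def wt_def)
  have "irreducibles_of_length i0 0 = {}" by (auto simp: irreducibles_of_length_def dest: irreducible_bridgesD)
  then show "irr_coeff i0 \<psi> h 0 = 0" by (simp add: irr_coeff_def)
qed

lemma bridge_coeff_renewal:
  assumes n: "1 \<le> n"
  shows "bridge_coeff i0 \<psi> h n = (\<Sum>k=1..n. irr_coeff i0 \<psi> h k * bridge_coeff i0 \<psi> h (n - k))"
proof -
  interpret U: weighted_walk \<psi> i0 1 by (rule ww1)
  let ?app = "\<lambda>p :: (int ^ 'd) list \<times> (int ^ 'd) list. fst p @ snd p"
  let ?P = "\<lambda>k. irreducibles_of_length i0 k \<times> bridges_of_length i0 (n - k)"
  have sub: "(\<Union>k\<in>{1..n}. ?P k) \<subseteq> irreducible_bridges i0 \<times> bridges i0"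
    by (auto simp: irreducibles_of_length_def bridges_of_length_def)
  have img: "bridges_of_length i0 n = ?app ` (\<Union>k\<in>{1..n}. ?P k)"
  proof (intro equalityI subsetI)
    fix xs assume xs: "xs \<in> bridges_of_length i0 n"
    then have "xs \<in> bridges i0" "xs \<noteq> []" "length xs = n" using n by (auto simp: bridges_of_length_def)
    then obtain b c where bc: "b \<in> irreducible_bridges i0" "c \<in> bridges i0" "xs = b @ c"
      using irreducible_decomp by blast
    have "b \<noteq> []" using bc(1) by (rule irreducible_bridgesD)
    then have "1 \<le> length b" by (cases b) auto
    moreover have "length b \<le> n" "length c = n - length b" using \<open>length xs = n\<close> bc(3) by auto
    ultimately have "(b, c) \<in> (\<Union>k\<in>{1..n}. ?P k)"
      using bc by (intro UN_I[of "length b"]) (auto simp: irreducibles_of_length_def bridges_of_length_def)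
    then show "xs \<in> ?app ` (\<Union>k\<in>{1..n}. ?P k)"
      using bc(3) by (intro image_eqI[of _ _ "(b, c)"]) simp_all
  next
    fix xs assume "xs \<in> ?app ` (\<Union>k\<in>{1..n}. ?P k)"
    then obtain k b c where k: "k \<in> {1..n}" "b \<in> irreducibles_of_length i0 k" "c \<in> bridges_of_length i0 (n - k)" "xs = b @ c"
      by auto
    then have "b @ c \<in> bridges i0"
      by (intro bridge_append) (auto simp: irreducibles_of_length_def bridges_of_length_def dest: irreducible_bridgesD)
    then show "xs \<in> bridges_of_length i0 n"
      using k by (auto simp: irreducibles_of_length_def bridges_of_length_def)
  qed
  have "bridge_coeff i0 \<psi> h n = (\<Sum>p\<in>(\<Union>k\<in>{1..n}. ?P k). wt i0 \<psi> 1 h (?app p))"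
    unfolding bridge_coeff_def img
    by (subst sum.reindex[OF inj_on_subset[OF inj_on_irreducible_append sub]]) simp
  also have "\<dots> = (\<Sum>k=1..n. \<Sum>p\<in>?P k. wt i0 \<psi> 1 h (?app p))"
  proof (rule sum.UNION_disjoint)
    show "\<forall>k\<in>{1..n}. finite (?P k)" by (intro ballI finite_cartesian_product) simp_all
  qed (auto simp: irreducibles_of_length_def)
  also have "\<dots> = (\<Sum>k=1..n. irr_coeff i0 \<psi> h k * bridge_coeff i0 \<psi> h (n - k))"
  proof (rule sum.cong[OF refl])
    fix k
    have "(\<Sum>p\<in>?P k. wt i0 \<psi> 1 h (?app p)) = (\<Sum>p\<in>?P k. wt i0 \<psi> 1 h (fst p) * wt i0 \<psi> 1 h (snd p))"
      by (intro sum.cong refl U.wt_bridge_append)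
        (auto simp: irreducibles_of_length_def bridges_of_length_def dest: irreducible_bridgesD)
    also have "\<dots> = irr_coeff i0 \<psi> h k * bridge_coeff i0 \<psi> h (n - k)"
      unfolding irr_coeff_def bridge_coeff_def sum_product
      by (simp add: sum.cartesian_product case_prod_unfold)
    finally show "(\<Sum>p\<in>?P k. wt i0 \<psi> 1 h (?app p)) = irr_coeff i0 \<psi> h k * bridge_coeff i0 \<psi> h (n - k)" .
  qed
  finally show ?thesis .
qed

lemma bridge_coeff_nonneg: "0 \<le> bridge_coeff i0 \<psi> h n"
  unfolding bridge_coeff_def by (intro sum_nonneg weighted_walk.wt_nonneg[OF ww1])

lemma bridge_coeff_le_zhat: "bridge_coeff i0 \<psi> h n \<le> zhat i0 \<psi> n h"
  unfolding bridge_coeff_def zhat_def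
  by (intro sum_mono2 finite_upaths bridges_of_length_upaths weighted_walk.wt_nonneg[OF ww1])

lemma irr_coeff_1: "1 / (2 * real CARD('d)) * exp h * \<psi> 1 \<le> irr_coeff i0 \<psi> h 1"
proof -
  have "wt i0 \<psi> 1 h [axis i0 1] \<le> irr_coeff i0 \<psi> h 1"
    unfolding irr_coeff_def
    by (rule member_le_sum[OF _ _ finite_irreducibles_of_length])
      (auto simp: irreducibles_of_length_def axis_irreducible intro!: weighted_walk.wt_nonneg[OF ww1])
  then show ?thesis by (simp add: wt_def kap_def)
qed

end

text \<open>Below \<open>exp (- zrate)\<close> the irreducible bridges have mass at most one and above it at least one.\<close>

lemma irr_coeff_sums_1:
  fixes i0 :: "'d::finite"
  assumes att: "attractive \<psi>" and h: "0 \<le> h" and rate: "zrate i0 \<psi> h = - ln z"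
    and z: "0 < z" "z < z1" "z1 \<le> 1" and fin: "irr_mass i0 \<psi> z1 h < \<infinity>"
  shows "(\<lambda>n. irr_coeff i0 \<psi> h n * z ^ n) sums 1"
proof -
  interpret Z: weighted_walk \<psi> i0 z1 by (rule weighted_walkI[OF att]) (use z in auto)
  let ?F = "\<lambda>x. \<Sum>n. irr_coeff i0 \<psi> h n * x ^ n"
  note summ1 = Z.irr_coeff_summable(1)[OF fin]
  have real: "irr_mass i0 \<psi> x h = ennreal (?F x)" and nn: "0 \<le> ?F x" and summ: "summable (\<lambda>n. irr_coeff i0 \<psi> h n * x ^ n)"
    if x: "0 < x" "x < z1" for x
  proof -
    interpret X: weighted_walk \<psi> i0 x by (rule weighted_walkI[OF att]) (use x z in auto)
    show s: "summable (\<lambda>n. irr_coeff i0 \<psi> h n * x ^ n)"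
      using powser_inside[OF summ1, of x] x by simp
    show "0 \<le> ?F x" using s x X.irr_coeff_nonneg by (intro suminf_nonneg) auto
    show "irr_mass i0 \<psi> x h = ennreal (?F x)"
      unfolding X.irr_mass_series using s x X.irr_coeff_nonneg by (intro suminf_ennreal2) auto
  qed
  have below: "?F x \<le> 1" if x: "0 < x" "x < z" for x
  proof -
    interpret X: weighted_walk \<psi> i0 x by (rule weighted_walkI[OF att]) (use x z in auto)
    have "ln x < ln z" using x by simp
    then have "h < alpha i0 \<psi> x"
      using X.zrate_ge[of h] rate by (cases "h < alpha i0 \<psi> x") auto
    then have "irr_mass i0 \<psi> x h \<le> 1"
      using X.irr_mass_mono[of h "alpha i0 \<psi> x"] X.irr_mass_alpha by simp
    then show ?thesis using real[of x] x z by (simp add: ennreal_le_1)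
  qed
  have above: "1 \<le> ?F x" if x: "z < x" "x < z1" for x
  proof -
    interpret X: weighted_walk \<psi> i0 x by (rule weighted_walkI[OF att]) (use x z in auto)
    have "ln z < ln x" using x z by simp
    then have "alpha i0 \<psi> x \<le> h"
      using X.zrate_le[OF _ h] rate x z by (cases "h < alpha i0 \<psi> x") auto
    then have "1 \<le> irr_mass i0 \<psi> x h"
      using X.irr_mass_mono[of "alpha i0 \<psi> x" h] X.irr_mass_alpha by simp
    then show ?thesis using real[of x] x z by (simp add: ennreal_ge_1)
  qed
  \<comment> \<open>\<open>z\<close> lies strictly inside the disc of convergence, so the one-sided
    bounds close up to an equality.\<close>
  have "isCont ?F z" by (rule isCont_powser[OF summ1]) (use z in simp)
  then have lim: "(?F \<longlongrightarrow> ?F z) (at_left z)" "(?F \<longlongrightarrow> ?F z) (at_right z)"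
    unfolding isCont_def filterlim_at_split by auto
  have "?F z \<le> 1"
    by (rule tendsto_upperbound[OF lim(1)]) (use below z in \<open>auto intro!: eventually_at_leftI[of 0]\<close>)
  moreover have "1 \<le> ?F z"
    by (rule tendsto_lowerbound[OF lim(2)]) (use above z in \<open>auto intro!: eventually_at_rightI[of _ z1]\<close>)
  ultimately have "?F z = 1" by simp
  then show ?thesis using summ[of z] z by (simp add: sums_iff)
qed

context drifted_potential
begin

text \<open>Room beyond the critical fugacity, uniform in \<beta>. By \<open>g_scale_h\<close>,
  lowering \<open>h\<close> by \<open>\<delta>'\<close> lowers the rate by at least the fraction
  \<open>\<delta>' / h\<close> of itself, and the rate is at least \<open>g0\<close> for all
  \<open>\<beta> \<le> \<beta>0\<close>.\<close>

lemma ballistic_gap: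
  assumes b: "0 \<le> \<beta>0" "a \<beta>0 < h"
  obtains q A where "1 < q" "0 < A"
    "\<And>\<beta>. 0 \<le> \<beta> \<Longrightarrow> \<beta> \<le> \<beta>0 \<Longrightarrow> q * exp (- g h \<beta>) < 1 \<and> irr_mass i0 (W \<beta>) (q * exp (- g h \<beta>)) h \<le> ennreal A"
proof -
  have h: "0 < h" using a_nonneg[OF b(1)] b(2) by simp
  define g0 where "g0 = g h \<beta>0"
  have g0: "0 < g0" unfolding g0_def by (rule g_pos[OF b])
  have "0 < exp (- g0 / 2)" "exp (- g0 / 2) < 1" using g0 by simp_all
  then obtain \<delta> A where \<delta>: "0 < \<delta>" "0 < A"
    and gap: "\<And>\<psi> z h. attractive \<psi> \<Longrightarrow> 0 < z \<Longrightarrow> z \<le> exp (- g0 / 2) \<Longrightarrow> zrate i0 \<psi> (h - \<delta>) < - ln z \<Longrightarrow> irr_mass i0 \<psi> z h \<le> ennreal A"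
    using irr_mass_gap[where ?i0.0 = i0] by metis
  \<comment> \<open>The bound \<open>h / 2\<close> keeps the scaling factor
    \<open>1 - \<delta>' / h\<close> in the unit interval.\<close>
  define \<delta>' where "\<delta>' = min \<delta> (h / 2)"
  have \<delta>': "0 < \<delta>'" "\<delta>' \<le> \<delta>" "\<delta>' \<le> h / 2" using \<delta> h by (auto simp: \<delta>'_def)
  \<comment> \<open>Less than the guaranteed drop of the rate, and small enough for the enlarged
    fugacity to remain below \<open>exp (- g0 / 2)\<close>.\<close>
  define l where "l = min (g0 * \<delta>' / (2 * h)) (g0 / 2)"
  have l: "0 < l" "l \<le> g0 / 2" "l < g0 * \<delta>' / h"
  proof -
    have "0 < g0 * \<delta>' / h" using g0 \<delta>' h by simp
    then have "g0 * \<delta>' / (2 * h) < g0 * \<delta>' / h" by (simp add: field_simps)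
    then show "0 < l" "l \<le> g0 / 2" "l < g0 * \<delta>' / h" using g0 \<delta>' h by (auto simp: l_def min_less_iff_disj)
  qed
  show thesis
  proof (rule that[of "exp l" A])
    show "1 < exp l" "0 < A" using l \<delta> by simp_all
    fix \<beta> assume \<beta>: "0 \<le> \<beta>" "\<beta> \<le> \<beta>0"
    let ?z = "exp l * exp (- g h \<beta>)"
    have att: "attractive (W \<beta>)" by (rule attractive_site_weight[OF \<beta>(1)])
    have zeq: "?z = exp (- (g h \<beta> - l))" by (simp add: exp_add[symmetric])
    have gg: "g0 \<le> g h \<beta>" unfolding g0_def by (rule g_antimono[OF \<beta>])
    have z1: "?z \<le> exp (- g0 / 2)" unfolding zeq using gg l by simp
    have z2: "?z < 1" unfolding zeq using gg l g0 by simp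
    have "g (h - \<delta>') \<beta> = g ((1 - \<delta>' / h) * h) \<beta>" using h by (simp add: algebra_simps)
    also have "\<dots> \<le> (1 - \<delta>' / h) * g h \<beta>"
      using \<delta>' h \<beta> by (intro g_scale_h) auto
    also have "\<dots> = g h \<beta> - g h \<beta> * \<delta>' / h" by (simp add: algebra_simps)
    also have "\<dots> < g h \<beta> - l"
    proof -
      have "g0 * \<delta>' / h \<le> g h \<beta> * \<delta>' / h" using gg \<delta>' h by (intro divide_right_mono mult_right_mono) auto
      then show ?thesis using l by linarith
    qed
    \<comment> \<open>The gap is applied at the larger tilt
      \<open>h + (\<delta> - \<delta>')\<close>, whose shift by \<open>\<delta>\<close> is
      \<open>h - \<delta>'\<close>; monotonicity in the tilt returns to \<open>h\<close>.\<close>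
    finally have "zrate i0 (W \<beta>) ((h + (\<delta> - \<delta>')) - \<delta>) < - ln ?z" unfolding zeq by simp
    then have "irr_mass i0 (W \<beta>) ?z (h + (\<delta> - \<delta>')) \<le> ennreal A"
      using z1 by (intro gap att) auto
    moreover have "irr_mass i0 (W \<beta>) ?z h \<le> irr_mass i0 (W \<beta>) ?z (h + (\<delta> - \<delta>'))"
      by (rule weighted_walk.irr_mass_mono[OF weighted_walkI[OF att]]) (use z2 \<delta>' in auto)
    ultimately show "?z < 1 \<and> irr_mass i0 (W \<beta>) ?z h \<le> ennreal A" using z2 by (auto intro: order_trans)
  qed
qed

text \<open>At fugacity \<open>exp (- g h \<beta>)\<close> the irreducible bridges form a
  probability distribution of lengths with uniform exponential tails, and the bridges are its
  renewal sequence. As bridges are paths, a lower bound for the renewal sequence is one for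
  \<open>zhat\<close>.\<close>

lemma zhat_lower_bound:
  assumes b: "0 \<le> \<beta>0" "a \<beta>0 < h"
  obtains \<kappa> where "0 < \<kappa>" "\<And>\<beta> N. 0 \<le> \<beta> \<Longrightarrow> \<beta> \<le> \<beta>0 \<Longrightarrow> \<kappa> * exp (g h \<beta> * real N) \<le> zhat i0 (W \<beta>) N h"
proof -
  have h: "0 < h" using a_nonneg[OF b(1)] b(2) by simp
  obtain q A where q: "1 < q" "0 < A"
    and gap: "\<And>\<beta>. 0 \<le> \<beta> \<Longrightarrow> \<beta> \<le> \<beta>0 \<Longrightarrow> q * exp (- g h \<beta>) < 1 \<and> irr_mass i0 (W \<beta>) (q * exp (- g h \<beta>)) h \<le> ennreal A"
    using ballistic_gap[OF b] by metis
  \<comment> \<open>Bounds the weight of the single upward step for every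
    \<open>\<beta> \<le> \<beta>0\<close>: by \<open>g_le\<close> the tilt \<open>exp h\<close>
    compensates the fugacity \<open>exp (- g h \<beta>)\<close>.\<close>
  define c where "c = W \<beta>0 1 / (2 * real CARD('d))"
  have att0: "attractive (W \<beta>0)" by (rule attractive_site_weight[OF b(1)])
  have c: "0 < c" "c \<le> 1"
  proof -
    have "1 \<le> real CARD('d)" by (simp add: Suc_le_eq)
    then have D: "0 < 2 * real CARD('d)" "1 \<le> 2 * real CARD('d)" by linarith+
    show "0 < c" unfolding c_def by (rule divide_pos_pos[OF attractive.psi_pos[OF att0] D(1)])
    show "c \<le> 1"
      unfolding c_def pos_divide_le_eq[OF D(1)] using attractive.psi_le_1[OF att0, of 1] D(2) by linarith
  qed
  obtain \<kappa> where \<kappa>: "0 < \<kappa>"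
    "\<And>u f n. \<lbrakk>u 0 = 1; \<And>n. 1 \<le> n \<Longrightarrow> u n = (\<Sum>k=1..n. f k * u (n - k)); \<And>n. 0 \<le> u n \<and> u n \<le> (1::real);
       \<And>n. 0 \<le> f n; c \<le> f 1; f 0 = 0; f sums 1; \<And>N. (\<Sum>k\<le>N. f k * q ^ k) \<le> A\<rbrakk> \<Longrightarrow> \<kappa> \<le> u n"
    using renewal_lower_bound[OF c q] by blast
  show thesis
  proof (rule that[OF \<kappa>(1)])
    fix \<beta> N assume \<beta>: "0 \<le> \<beta>" "\<beta> \<le> \<beta>0"
    let ?z = "exp (- g h \<beta>)"
    have att: "attractive (W \<beta>)" by (rule attractive_site_weight[OF \<beta>(1)])
    have gpos: "0 < g h \<beta>" using a_mono[OF \<beta>] b by (intro g_pos \<beta>) auto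
    interpret weighted_walk "W \<beta>" i0 "q * ?z" by (rule weighted_walkI[OF att]) (use q gap[OF \<beta>] in auto)
    let ?u = "\<lambda>n. bridge_coeff i0 (W \<beta>) h n * ?z ^ n" and ?f = "\<lambda>n. irr_coeff i0 (W \<beta>) h n * ?z ^ n"
    have "\<kappa> \<le> ?u N"
    proof (rule \<kappa>(2)[of ?u ?f N])
      show "?u 0 = 1" by (simp add: bridge_coeff_0)
      show "?u n = (\<Sum>k=1..n. ?f k * ?u (n - k))" if n: "1 \<le> n" for n
      proof -
        have "?u n = (\<Sum>k=1..n. (irr_coeff i0 (W \<beta>) h k * bridge_coeff i0 (W \<beta>) h (n - k)) * ?z ^ n)"
          unfolding bridge_coeff_renewal[OF n] by (rule sum_distrib_right)
        also have "\<dots> = (\<Sum>k=1..n. ?f k * ?u (n - k))"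
        proof (rule sum.cong[OF refl])
          fix k assume "k \<in> {1..n}"
          then have "?z ^ n = ?z ^ k * ?z ^ (n - k)" by (simp add: power_add[symmetric])
          then show "irr_coeff i0 (W \<beta>) h k * bridge_coeff i0 (W \<beta>) h (n - k) * ?z ^ n = ?f k * ?u (n - k)"
            by (simp only: mult_ac)
        qed
        finally show ?thesis .
      qed
      show "0 \<le> ?u n \<and> ?u n \<le> 1" for n
      proof (cases "n = 0")
        case False
        then have "bridge_coeff i0 (W \<beta>) h n \<le> exp (g h \<beta> * real n)"
          using bridge_coeff_le_zhat[of h n] zhat_le_zrate[of n h] by simp
        then have "?u n \<le> exp (g h \<beta> * real n) * ?z ^ n" by (rule mult_right_mono) simp
        also have "\<dots> = 1" by (simp add: exp_of_nat_mult[symmetric] exp_add[symmetric] mult.commute)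
        finally show ?thesis using bridge_coeff_nonneg by simp
      qed (simp add: bridge_coeff_0)
      show "0 \<le> ?f n" for n using irr_coeff_nonneg by simp
      show "c \<le> ?f 1"
      proof -
        have "c * 1 \<le> (1 / (2 * real CARD('d)) * W \<beta> 1) * (exp h * ?z)"
        proof (rule mult_mono)
          show "c \<le> 1 / (2 * real CARD('d)) * W \<beta> 1"
            using site_weight_antimono[OF \<beta>, of 1] by (simp add: c_def divide_right_mono)
          show "1 \<le> exp h * ?z" using g_le[OF \<beta>(1), of h] h by (simp add: exp_add[symmetric])
          show "0 \<le> 1 / (2 * real CARD('d)) * W \<beta> 1" using W_nonneg[OF \<beta>(1)] by simp
        qed simp
        also have "\<dots> = (1 / (2 * real CARD('d)) * exp h * W \<beta> 1) * ?z" by simp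
        also have "\<dots> \<le> irr_coeff i0 (W \<beta>) h 1 * ?z" by (rule mult_right_mono[OF irr_coeff_1]) simp
        finally show ?thesis by simp
      qed
      show "?f 0 = 0" by (simp add: irr_coeff_0)
      show "?f sums 1"
      proof (rule irr_coeff_sums_1[OF att, where ?z1.0 = "q * ?z"])
        show "irr_mass i0 (W \<beta>) (q * ?z) h < \<infinity>" using gap[OF \<beta>] by (auto intro: le_less_trans)
      qed (use h q gap[OF \<beta>] in auto)
      show "(\<Sum>k\<le>n. ?f k * q ^ k) \<le> A" for n
        using irr_coeff_partial_sum[of h A n] gap[OF \<beta>] q by (simp add: power_mult_distrib mult_ac)
    qed
    then have "\<kappa> * exp (g h \<beta> * real N) \<le> ?u N * exp (g h \<beta> * real N)" by (rule mult_right_mono) simp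
    also have "\<dots> = bridge_coeff i0 (W \<beta>) h N"
      by (simp add: exp_of_nat_mult[symmetric] mult.assoc exp_add[symmetric] mult.commute)
    also have "\<dots> \<le> zhat i0 (W \<beta>) N h" by (rule bridge_coeff_le_zhat)
    finally show "\<kappa> * exp (g h \<beta> * real N) \<le> zhat i0 (W \<beta>) N h" .
  qed
qed

end

section \<open>Analyticity\<close>

lemma holomorphic_bounded_near:
  fixes f :: "complex \<Rightarrow> complex"
  assumes f: "f holomorphic_on S" and S: "open S" "p \<in> S"
  obtains r M where "0 < r" "ball p r \<subseteq> S" "\<And>x. x \<in> ball p r \<Longrightarrow> norm (f x) \<le> M"
proof -
  obtain r where r: "0 < r" "cball p r \<subseteq> S" using S open_contains_cball by blast
  have "continuous_on (cball p r) f"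
    using holomorphic_on_imp_continuous_on[OF f] r(2) by (rule continuous_on_subset)
  then have "bounded (f ` cball p r)"
    by (intro compact_imp_bounded compact_continuous_image) auto
  then obtain M where "\<forall>y\<in>f ` cball p r. norm y \<le> M"
    unfolding bounded_iff by blast
  then show thesis using r by (intro that[of r M]) (auto simp: subset_iff)
qed

text \<open>The reciprocal of \<open>fug\<close> extends to an entire function that is positive on
  the real axis, so the principal logarithm is holomorphic near each real point.\<close>

lemma ln_fug_holomorphic:
  obtains F r M where "0 < r" "F holomorphic_on ball (of_real h) r"
    "\<And>x. x \<in> ball (of_real h) r \<Longrightarrow> norm (F x) \<le> M"
    "\<And>x. F (of_real x) = of_real (- ln (fug TYPE('d::finite) x))"
proof -
  let ?d = "real CARD('d)"
  have d: "1 \<le> ?d" by (simp add: Suc_le_eq)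
  define E :: "complex \<Rightarrow> complex" where "E = (\<lambda>x. ((exp x + exp (- x)) / 2 + of_real ?d - 1) / of_real ?d)"
  have E_real: "E (of_real x) = of_real (1 / fug TYPE('d) x)" for x
  proof -
    have "(exp (of_real x) + exp (- of_real x)) / 2 = (of_real (cosh x) :: complex)"
      by (simp add: cosh_field_def exp_of_real[symmetric])
    then show ?thesis by (simp add: E_def fug_def)
  qed
  have E_holo: "E holomorphic_on UNIV"
    unfolding E_def using d by (intro holomorphic_intros) auto
  let ?S = "E -` (- \<real>\<^sub>\<le>\<^sub>0)"
  have S: "open ?S"
    using holomorphic_on_imp_continuous_on[OF E_holo] by (intro open_vimage) auto
  have h: "of_real x \<in> ?S" for x
    using fug_pos[where 'd = 'd, of x] by (simp add: E_real complex_nonpos_Reals_iff)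
  have L: "(\<lambda>x. Ln (E x)) holomorphic_on ?S"
    by (intro holomorphic_on_Ln' holomorphic_on_subset[OF E_holo]) auto
  obtain r M where r: "0 < r" "ball (of_real h) r \<subseteq> ?S" "\<And>x. x \<in> ball (of_real h) r \<Longrightarrow> norm (Ln (E x)) \<le> M"
    using holomorphic_bounded_near[OF L S h] by blast
  show thesis
  proof (rule that[OF r(1) holomorphic_on_subset[OF L r(2)] r(3)])
    show "Ln (E (of_real x)) = of_real (- ln (fug TYPE('d) x))" for x
    proof -
      have "Ln (of_real (1 / fug TYPE('d) x)) = of_real (ln (1 / fug TYPE('d) x))"
        by (rule Ln_of_real) (simp add: fug_pos)
      also have "ln (1 / fug TYPE('d) x) = - ln (fug TYPE('d) x)"
        using fug_pos[where 'd = 'd, of x] by (simp add: ln_div)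
      finally show ?thesis unfolding E_real .
    qed
  qed
qed

context drifted_potential
begin

text \<open>The continuation of \<open>irr_coeff\<close> to complex drift and complex \<beta>. As a
  sum over the finitely many irreducible bridges of length \<open>n\<close>, it is holomorphic
  wherever the site weights are.\<close>

definition ccoeff :: "nat \<Rightarrow> complex \<Rightarrow> complex \<Rightarrow> complex" where
  "ccoeff n x y = (\<Sum>xs\<in>irreducibles_of_length i0 n.
     of_real (kap 1 xs) * exp (x * of_int (lev i0 xs)) * pot (\<lambda>k. claplace M V (of_nat k * y)) xs)"

lemma cpot_eq: "pot (\<lambda>k. claplace M V (of_nat k * y)) xs =
    (\<Prod>s\<in>set (sites 0 xs). claplace M V (of_nat (count_list (sites 0 xs) s) * y))"
  by (simp add: pot_def potl_def)

lemma count_list_pos: "s \<in> set l \<Longrightarrow> 0 < count_list l s"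
  using count_list_0_iff[of l s] by (cases "count_list l s") auto

lemma ccoeff_holomorphic_x: "(\<lambda>x. ccoeff n x y) holomorphic_on UNIV"
  unfolding ccoeff_def by (intro holomorphic_intros)

lemma ccoeff_holomorphic_y: "ccoeff n x holomorphic_on {y. 0 < Re y}"
  unfolding ccoeff_def cpot_eq
proof (intro holomorphic_on_sum holomorphic_on_mult holomorphic_on_const holomorphic_on_prod)
  fix s xs assume "s \<in> set (sites 0 xs)"
  then have c: "0 < count_list (sites 0 xs) s" by (rule count_list_pos)
  show "(\<lambda>y. claplace M V (of_nat (count_list (sites 0 xs) s) * y)) holomorphic_on {y. 0 < Re y}"
    by (rule holomorphic_on_compose_gen[OF _ claplace_holomorphic, unfolded o_def])
      (use c in \<open>auto intro!: holomorphic_intros\<close>)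
qed

lemma ccoeff_continuous: "continuous_on (UNIV \<times> {y. 0 < Re y}) (\<lambda>p. ccoeff n (fst p) (snd p))"
  unfolding ccoeff_def cpot_eq
proof (intro continuous_on_sum continuous_on_mult continuous_on_const continuous_on_prod)
  fix xs
  show "continuous_on (UNIV \<times> {y. 0 < Re y}) (\<lambda>p :: complex \<times> complex. exp (fst p * of_int (lev i0 xs)))"
    by (intro continuous_intros)
next
  fix s xs assume "s \<in> set (sites 0 xs)"
  then have c: "0 < count_list (sites 0 xs) s" by (rule count_list_pos)
  show "continuous_on (UNIV \<times> {y. 0 < Re y}) (\<lambda>p. claplace M V (of_nat (count_list (sites 0 xs) s) * snd p))"
    by (rule continuous_on_compose2[OF holomorphic_on_imp_continuous_on[OF claplace_holomorphic]])
      (use c in \<open>auto intro!: continuous_intros\<close>)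
qed

text \<open>Irreducible bridges have nonnegative level, so a larger real drift and a smaller real
  \<beta> only increase the weights. One real series at a corner thus dominates a whole complex
  neighbourhood.\<close>

lemma norm_ccoeff_le:
  assumes x: "Re x \<le> h" and y: "0 \<le> \<beta>" "\<beta> \<le> Re y"
  shows "norm (ccoeff n x y) \<le> irr_coeff i0 (W \<beta>) h n"
  unfolding ccoeff_def irr_coeff_def
proof (rule sum_norm_le)
  fix xs assume "xs \<in> irreducibles_of_length i0 n"
  then have l: "0 \<le> lev i0 xs"
    by (auto simp: irreducibles_of_length_def intro: bridge_lev_nonneg dest: irreducible_bridgesD)
  have "norm (pot (\<lambda>k. claplace M V (of_nat k * y)) xs) \<le> pot (W \<beta>) xs"
    unfolding cpot_eq unfolding pot_def potl_def
  proof (rule order_trans[OF norm_prod_le], rule prod_mono)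
    fix s
    let ?k = "count_list (sites 0 xs) s"
    have "norm (claplace M V (of_nat ?k * y)) \<le> laplace M V (Re (of_nat ?k * y))"
      using y by (intro norm_claplace_le) auto
    also have "\<dots> \<le> laplace M V (real ?k * \<beta>)"
      using y by (intro laplace_antimono) (auto intro: mult_left_mono)
    finally show "0 \<le> norm (claplace M V (of_nat ?k * y)) \<and> norm (claplace M V (of_nat ?k * y)) \<le> W \<beta> ?k"
      by (simp add: site_weight_def)
  qed
  moreover have "norm (exp (x * of_int (lev i0 xs))) \<le> exp (h * of_int (lev i0 xs))"
    using x l by (simp add: norm_exp_eq_Re mult_right_mono)
  ultimately have "norm (of_real (kap 1 xs) * exp (x * of_int (lev i0 xs)) * pot (\<lambda>k. claplace M V (of_nat k * y)) xs)
      \<le> kap 1 xs * exp (h * of_int (lev i0 xs)) * pot (W \<beta>) xs"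
    unfolding norm_mult by (intro mult_mono) (auto simp: kap_nonneg)
  then show "norm (of_real (kap 1 xs) * exp (x * of_int (lev i0 xs)) * pot (\<lambda>k. claplace M V (of_nat k * y)) xs)
      \<le> wt i0 (W \<beta>) 1 h xs"
    by (simp only: wt_def)
qed

lemma ccoeff_of_real: "ccoeff n (of_real h) (of_real \<beta>) = of_real (irr_coeff i0 (W \<beta>) h n)"
proof -
  have "claplace M V (of_nat k * of_real \<beta>) = of_real (W \<beta> k)" for k
    using claplace_of_real[of "real k * \<beta>"] by (simp add: site_weight_def)
  moreover have "exp (complex_of_real h * of_int l) = of_real (exp (h * of_int l))" for l
    by (simp add: exp_of_real[symmetric])
  ultimately show ?thesis
    by (simp add: ccoeff_def irr_coeff_def wt_def cpot_eq) (simp add: pot_def potl_def)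
qed

text \<open>A variant of \<open>ballistic_gap\<close> at the corner
  \<open>(h + \<epsilon>, b - \<epsilon>)\<close>, the worst point of a neighbourhood according to
  \<open>norm_ccoeff_le\<close>, with a radius \<open>z1\<close> beyond the fugacity of the
  centre.\<close>

lemma ballistic_gap_local:
  assumes b: "0 < b" "a b < h"
  obtains \<epsilon> z1 where "0 < \<epsilon>" "\<epsilon> < b" "\<epsilon> < h" "exp (- g h b) < z1" "z1 < 1" "irr_mass i0 (W (b - \<epsilon>)) z1 (h + \<epsilon>) < \<infinity>"
proof -
  have h: "0 < h" using a_nonneg[of b] b by simp
  define g0 where "g0 = g h b"
  have g0: "0 < g0" unfolding g0_def using b by (intro g_pos) auto
  have "0 < exp (- g0 / 2)" "exp (- g0 / 2) < 1" using g0 by simp_all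
  then obtain \<delta> A where \<delta>: "0 < \<delta>" "0 < A"
    and gap: "\<And>\<psi> z h. attractive \<psi> \<Longrightarrow> 0 < z \<Longrightarrow> z \<le> exp (- g0 / 2) \<Longrightarrow> zrate i0 \<psi> (h - \<delta>) < - ln z \<Longrightarrow> irr_mass i0 \<psi> z h \<le> ennreal A"
    using irr_mass_gap[where ?i0.0 = i0] by metis
  define \<delta>' where "\<delta>' = min \<delta> (h / 2)"
  have \<delta>': "0 < \<delta>'" "\<delta>' \<le> \<delta>" "\<delta>' \<le> h / 2" using \<delta> h by (auto simp: \<delta>'_def)
  have "g (h - \<delta>') b = g ((1 - \<delta>' / h) * h) b" using h by (simp add: algebra_simps)
  also have "\<dots> \<le> (1 - \<delta>' / h) * g0"
    unfolding g0_def using \<delta>' h b by (intro g_scale_h) auto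
  also have "\<dots> < 1 * g0" using \<delta>' h g0 by (intro mult_strict_right_mono) auto
  finally obtain s where s: "max (g (h - \<delta>') b) (g0 / 2) < s" "s < g0"
    using dense[of "max (g (h - \<delta>') b) (g0 / 2)" g0] g0 by auto
  have "((\<lambda>(x, y). g x y) \<longlongrightarrow> g (h - \<delta>') b) (at (h - \<delta>', b) within UNIV \<times> {0..})"
    using g_cont b by (auto simp: continuous_on_def)
  then have "\<forall>\<^sub>F p in at (h - \<delta>', b) within UNIV \<times> {0..}. (case p of (x, y) \<Rightarrow> g x y) < s"
    using s by (intro order_tendstoD) auto
  then obtain e where e: "0 < e"
    "\<And>x y. 0 \<le> y \<Longrightarrow> (x, y) \<noteq> (h - \<delta>', b) \<Longrightarrow> dist (x, y) (h - \<delta>', b) < e \<Longrightarrow> g x y < s"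
    unfolding eventually_at by auto
  \<comment> \<open>Both coordinates move by \<open>\<epsilon>\<close>, so the total distance is at
    most two thirds of \<open>e\<close>.\<close>
  define \<epsilon> where "\<epsilon> = min (e / 3) (min (b / 2) (h / 2))"
  have \<epsilon>: "0 < \<epsilon>" "\<epsilon> \<le> e / 3" "\<epsilon> < b" "\<epsilon> < h" using e b h by (auto simp: \<epsilon>_def)
  have "dist (h - \<delta>' + \<epsilon>, b - \<epsilon>) (h - \<delta>', b) \<le> dist (h - \<delta>' + \<epsilon>) (h - \<delta>') + dist (b - \<epsilon>) b"
    unfolding dist_prod_def by (rule order_trans[OF sqrt_sum_squares_le_sum]) auto
  also have "\<dots> < e" using \<epsilon> by (simp add: dist_real_def)
  finally have gs: "g (h - \<delta>' + \<epsilon>) (b - \<epsilon>) < s" using \<epsilon> by (intro e(2)) auto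
  have att: "attractive (W (b - \<epsilon>))" using \<epsilon> by (intro attractive_site_weight) auto
  have "irr_mass i0 (W (b - \<epsilon>)) (exp (- s)) (h + \<epsilon> + (\<delta> - \<delta>')) \<le> ennreal A"
    using s gs by (intro gap att) (auto simp: algebra_simps)
  moreover have "irr_mass i0 (W (b - \<epsilon>)) (exp (- s)) (h + \<epsilon>) \<le> irr_mass i0 (W (b - \<epsilon>)) (exp (- s)) (h + \<epsilon> + (\<delta> - \<delta>'))"
    by (rule weighted_walk.irr_mass_mono[OF weighted_walkI[OF att]]) (use s g0 \<delta>' in auto)
  ultimately have "irr_mass i0 (W (b - \<epsilon>)) (exp (- s)) (h + \<epsilon>) < \<infinity>"
    by (auto intro: le_less_trans order_trans)
  then show thesis
    using \<epsilon> s g0 by (intro that[of \<epsilon> "exp (- s)"]) (auto simp: g0_def)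
qed

text \<open>For real parameters \<open>exp (- g x y)\<close> solves the equation that irreducible
  bridges have mass one; local uniqueness of the root identifies it with the holomorphic branch
  \<open>\<zeta>\<close>. The radius \<open>\<rho>0\<close> keeps the values of
  \<open>\<zeta>\<close> where the logarithm will be taken.\<close>

lemma ballistic_root:
  assumes b: "0 < b" "a b < h" and \<rho>0: "0 < \<rho>0"
  obtains r \<zeta> where "0 < r"
    "\<And>x y. x \<in> ball (of_real h) r \<Longrightarrow> y \<in> ball (of_real b) r \<Longrightarrow> \<zeta> x y \<in> ball (of_real (exp (- g h b))) \<rho>0"
    "\<And>y. y \<in> ball (of_real b) r \<Longrightarrow> (\<lambda>x. \<zeta> x y) holomorphic_on ball (of_real h) r"
    "\<And>x. x \<in> ball (of_real h) r \<Longrightarrow> \<zeta> x holomorphic_on ball (of_real b) r"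
    "\<And>x y. \<bar>x - h\<bar> < r \<Longrightarrow> \<bar>y - b\<bar> < r \<Longrightarrow> \<zeta> (of_real x) (of_real y) = of_real (exp (- g x y))"
proof -
  obtain \<epsilon> z1 where \<epsilon>: "0 < \<epsilon>" "\<epsilon> < b" "\<epsilon> < h" and z1: "exp (- g h b) < z1" "z1 < 1"
    and fin: "irr_mass i0 (W (b - \<epsilon>)) z1 (h + \<epsilon>) < \<infinity>"
    by (rule ballistic_gap_local[OF b])
  let ?z0 = "exp (- g h b)"
  let ?C = "irr_coeff i0 (W (b - \<epsilon>)) (h + \<epsilon>)"
  have z1_pos: "0 < z1" using z1(1) exp_gt_zero less_trans by blast
  interpret C: weighted_walk "W (b - \<epsilon>)" i0 z1
    by (rule weighted_walkI[OF attractive_site_weight]) (use \<epsilon> z1 z1_pos in auto)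
  have C_summ: "summable (\<lambda>n. ?C n * z1 ^ n)" by (rule C.irr_coeff_summable(1)[OF fin])
  have re: "Re x \<le> h + \<epsilon>" "b - \<epsilon> \<le> Re y" "0 < Re y"
    if "x \<in> ball (of_real h) \<epsilon>" "y \<in> ball (of_real b) \<epsilon>" for x y
  proof -
    have "\<bar>Re (x - of_real h)\<bar> < \<epsilon>" "\<bar>Re (y - of_real b)\<bar> < \<epsilon>"
      using that abs_Re_le_cmod[of "x - of_real h"] abs_Re_le_cmod[of "y - of_real b"]
      by (auto simp: dist_norm norm_minus_commute)
    then show "Re x \<le> h + \<epsilon>" "b - \<epsilon> \<le> Re y" "0 < Re y" using \<epsilon> by auto
  qed
  have root: "(\<Sum>n. ccoeff n (of_real x) (of_real y) * of_real (exp (- g x y)) ^ n) = 1"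
    if xy: "\<bar>x - h\<bar> < \<epsilon>" "\<bar>y - b\<bar> < \<epsilon>" "exp (- g x y) < z1" for x y
  proof -
    have "0 \<le> x" "0 < y" "x \<le> h + \<epsilon>" "b - \<epsilon> \<le> y" using xy \<epsilon> by auto
    have att: "attractive (W y)" using \<open>0 < y\<close> by (intro attractive_site_weight) auto
    have "irr_mass i0 (W y) z1 x \<le> irr_mass i0 (W y) z1 (h + \<epsilon>)"
      by (rule weighted_walk.irr_mass_mono[OF weighted_walkI[OF att]]) (use z1 z1_pos \<open>x \<le> h + \<epsilon>\<close> in auto)
    also have "\<dots> \<le> irr_mass i0 (W (b - \<epsilon>)) z1 (h + \<epsilon>)"
      unfolding irr_mass_def by (intro mass_mono wt_antimono) (use \<epsilon> z1_pos \<open>b - \<epsilon> \<le> y\<close> in auto)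
    finally have "irr_mass i0 (W y) z1 x < \<infinity>" using fin by (rule le_less_trans)
    then have "(\<lambda>n. irr_coeff i0 (W y) x n * exp (- g x y) ^ n) sums 1"
      by (intro irr_coeff_sums_1[OF att \<open>0 \<le> x\<close>, where ?z1.0 = z1]) (use xy z1 in auto)
    then have "(\<lambda>n. complex_of_real (irr_coeff i0 (W y) x n * exp (- g x y) ^ n)) sums of_real 1"
      by (subst sums_of_real_iff)
    then show ?thesis by (simp add: ccoeff_of_real sums_iff)
  qed
  \<comment> \<open>All coefficients are nonnegative at the real base point, and the one of the
    single upward step is positive.\<close>
  have der: "(\<Sum>n. ccoeff n (of_real h) (of_real b) * (of_nat n * of_real ?z0 ^ (n - 1))) \<noteq> 0"
  proof -
    interpret B: weighted_walk "W b" i0 1 by (rule weighted_walkI[OF attractive_site_weight]) (use b in auto)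
    let ?c = "irr_coeff i0 (W b) h"
    let ?t = "\<lambda>n. ?c n * (real n * ?z0 ^ (n - 1))"
    have t_nonneg: "0 \<le> ?t n" for n using B.irr_coeff_nonneg[of h n] by simp
    have "summable ?t"
    proof (rule summable_comparison_test'[where N = 0])
      show "summable (\<lambda>n. ?C n * z1 ^ n / (z1 - ?z0))" by (rule summable_divide[OF C_summ])
      fix n
      have "?c n \<le> ?C n"
        using norm_ccoeff_le[of "of_real h" "h + \<epsilon>" "b - \<epsilon>" "of_real b" n] B.irr_coeff_nonneg[of h n] \<epsilon>
        by (simp add: ccoeff_of_real)
      \<comment> \<open>A divided difference between \<open>?z0\<close> and \<open>z1\<close> bounds
        the derivative, so the series already known to converge at \<open>z1\<close> is a
        majorant.\<close>
      moreover have "real n * ?z0 ^ (n - 1) \<le> z1 ^ n / (z1 - ?z0)"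
      proof -
        have "real n * ?z0 ^ (n - 1) = (\<Sum>i<n. ?z0 ^ (n - Suc i) * ?z0 ^ i)"
        proof -
          have "?z0 ^ (n - Suc i) * ?z0 ^ i = ?z0 ^ (n - 1)" if "i < n" for i
            using that by (simp add: power_add[symmetric])
          then show ?thesis by simp
        qed
        also have "\<dots> \<le> (\<Sum>i<n. ?z0 ^ (n - Suc i) * z1 ^ i)"
          using z1 by (intro sum_mono mult_left_mono power_mono) auto
        finally have "(z1 - ?z0) * (real n * ?z0 ^ (n - 1)) \<le> (z1 - ?z0) * (\<Sum>i<n. ?z0 ^ (n - Suc i) * z1 ^ i)"
          using z1 by (intro mult_left_mono) auto
        also have "\<dots> = z1 ^ n - ?z0 ^ n" by (simp add: power_diff_sumr2)
        also have "\<dots> \<le> z1 ^ n" by simp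
        finally show ?thesis using z1 by (simp add: pos_le_divide_eq mult.commute)
      qed
      ultimately have "?t n \<le> ?C n * (z1 ^ n / (z1 - ?z0))"
        using C.irr_coeff_nonneg by (intro mult_mono) auto
      then show "norm (?t n) \<le> ?C n * z1 ^ n / (z1 - ?z0)" using t_nonneg[of n] by simp
    qed
    then have "?t 1 \<le> (\<Sum>n. ?t n)"
      using sum_le_suminf[of ?t "{1}"] t_nonneg by simp
    moreover have "0 < ?t 1"
    proof -
      have "0 < 1 / (2 * real CARD('d)) * exp h * W b 1" using B.psi_pos[of 1] by simp
      then show ?thesis using B.irr_coeff_1[of h] by simp
    qed
    ultimately have "0 < (\<Sum>n. ?t n)" by linarith
    moreover have "(\<Sum>n. ccoeff n (of_real h) (of_real b) * (of_nat n * of_real ?z0 ^ (n - 1))) = of_real (\<Sum>n. ?t n)"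
      using suminf_of_real[OF \<open>summable ?t\<close>, where 'a = complex] by (simp add: ccoeff_of_real)
    ultimately show ?thesis by (metis less_irrefl of_real_eq_0_iff)
  qed
  obtain r \<rho> \<zeta> where r: "0 < r" "r \<le> \<epsilon>" and \<rho>: "0 < \<rho>" "\<rho> \<le> \<rho>0"
    and \<zeta>_ball: "\<And>x y. x \<in> ball (of_real h) r \<Longrightarrow> y \<in> ball (of_real b) r \<Longrightarrow> \<zeta> x y \<in> ball (of_real ?z0) \<rho>"
    and \<zeta>_unique: "\<And>x y w. x \<in> ball (of_real h) r \<Longrightarrow> y \<in> ball (of_real b) r \<Longrightarrow> w \<in> ball (of_real ?z0) \<rho> \<Longrightarrow> (\<Sum>n. ccoeff n x y * w ^ n) = 1 \<Longrightarrow> w = \<zeta> x y"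
    and \<zeta>_x: "\<And>y. y \<in> ball (of_real b) r \<Longrightarrow> (\<lambda>x. \<zeta> x y) holomorphic_on ball (of_real h) r"
    and \<zeta>_y: "\<And>x. x \<in> ball (of_real h) r \<Longrightarrow> \<zeta> x holomorphic_on ball (of_real b) r"
  proof (rule power_series_implicit[of \<epsilon> "of_real h" "of_real b" ccoeff ?C z1 "of_real ?z0" \<rho>0])
    show "norm (ccoeff n x y) \<le> ?C n" if "x \<in> ball (of_real h) \<epsilon>" "y \<in> ball (of_real b) \<epsilon>" for n x y
      using re[OF that] \<epsilon> by (intro norm_ccoeff_le) auto
    show "continuous_on (ball (of_real h) \<epsilon> \<times> ball (of_real b) \<epsilon>) (\<lambda>p. ccoeff n (fst p) (snd p))" for n
      by (rule continuous_on_subset[OF ccoeff_continuous]) (use re \<epsilon> in \<open>auto intro: centre_in_ball\<close>)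
    show "(\<lambda>x. ccoeff n x y) holomorphic_on ball (of_real h) \<epsilon>" for n y
      by (rule holomorphic_on_subset[OF ccoeff_holomorphic_x]) simp
    show "ccoeff n x holomorphic_on ball (of_real b) \<epsilon>" if "x \<in> ball (of_real h) \<epsilon>" for n x
      by (rule holomorphic_on_subset[OF ccoeff_holomorphic_y]) (use re[OF that] in auto)
    show "(\<Sum>n. ccoeff n (of_real h) (of_real b) * of_real ?z0 ^ n) = 1"
      by (rule root) (use \<epsilon> z1 in auto)
  qed (use \<epsilon> z1 C_summ der \<rho>0 in auto)
  \<comment> \<open>By continuity of \<open>g\<close>, the real solution remains in the ball of
    uniqueness and below \<open>z1\<close>, where \<open>root\<close> is available.\<close>
  have "((\<lambda>(x, y). exp (- g x y)) \<longlongrightarrow> ?z0) (at (h, b) within UNIV \<times> {0..})"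
    using g_cont b by (auto simp: continuous_on_def case_prod_unfold intro!: tendsto_intros)
  then have "\<forall>\<^sub>F p in at (h, b) within UNIV \<times> {0..}. dist (case p of (x, y) \<Rightarrow> exp (- g x y)) ?z0 < min \<rho> (z1 - ?z0)"
    using \<rho> z1 by (intro tendstoD) auto
  then obtain e where e: "0 < e"
    "\<And>x y. 0 \<le> y \<Longrightarrow> (x, y) \<noteq> (h, b) \<Longrightarrow> dist (x, y) (h, b) < e \<Longrightarrow> dist (exp (- g x y)) ?z0 < min \<rho> (z1 - ?z0)"
    unfolding eventually_at by auto
  define r' where "r' = min r (e / 2)"
  have r': "0 < r'" "r' \<le> r" "r' \<le> e / 2" using r e by (auto simp: r'_def)
  have sub: "ball p r' \<subseteq> ball p r" for p :: complex using r' by (simp add: subset_ball)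
  show thesis
  proof (rule that[OF r'(1)])
    show "\<zeta> x y \<in> ball (of_real ?z0) \<rho>0" if "x \<in> ball (of_real h) r'" "y \<in> ball (of_real b) r'" for x y
      using \<zeta>_ball[of x y] that sub \<rho> by (auto simp: subset_iff)
    show "(\<lambda>x. \<zeta> x y) holomorphic_on ball (of_real h) r'" if "y \<in> ball (of_real b) r'" for y
      by (rule holomorphic_on_subset[OF \<zeta>_x sub]) (use that sub in blast)
    show "\<zeta> x holomorphic_on ball (of_real b) r'" if "x \<in> ball (of_real h) r'" for x
      by (rule holomorphic_on_subset[OF \<zeta>_y sub]) (use that sub in blast)
    show "\<zeta> (of_real x) (of_real y) = of_real (exp (- g x y))" if xy: "\<bar>x - h\<bar> < r'" "\<bar>y - b\<bar> < r'" for x y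
    proof -
      have "dist (exp (- g x y)) ?z0 < min \<rho> (z1 - ?z0)"
      proof (cases "(x, y) = (h, b)")
        case False
        have "dist (x, y) (h, b) \<le> dist x h + dist y b"
          unfolding dist_prod_def by (rule order_trans[OF sqrt_sum_squares_le_sum]) auto
        also have "\<dots> < e" using xy r' by (simp add: dist_real_def)
        finally show ?thesis using False xy r' r \<epsilon> by (intro e(2)) auto
      qed (use \<rho> z1 in simp)
      then have d: "dist (exp (- g x y)) ?z0 < \<rho>" "exp (- g x y) < z1" by (auto simp: dist_real_def)
      have "of_real (exp (- g x y)) = \<zeta> (of_real x) (of_real y)"
      proof (rule \<zeta>_unique)
        show "complex_of_real x \<in> ball (of_real h) r" "complex_of_real y \<in> ball (of_real b) r"
          using xy r' by (auto simp: dist_of_real dist_real_def abs_minus_commute)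
        show "complex_of_real (exp (- g x y)) \<in> ball (of_real ?z0) \<rho>"
          using d(1) by (simp only: mem_ball dist_of_real dist_commute)
        show "(\<Sum>n. ccoeff n (of_real x) (of_real y) * of_real (exp (- g x y)) ^ n) = 1"
          using xy r' r d(2) by (intro root) auto
      qed
      then show ?thesis by simp
    qed
  qed
qed

lemma m_an_formula: "0 \<le> \<beta> \<Longrightarrow> m_an M V i0 h \<beta> = - ln (fug TYPE('d) h) - g h \<beta>"
  by (rule m_an_eq[OF attractive_site_weight])

text \<open>If \<open>a b < h\<close>, then \<open>m_an\<close> is locally the real trace of
  \<open>F x + Ln (\<zeta> x y)\<close>; if \<open>h < a b\<close>, the rate vanishes on a
  neighbourhood and only \<open>F\<close> is left.\<close>

lemma m_an_analytic_at:
  assumes h: "0 < h" and b: "0 < b" and ne: "a b \<noteq> h"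
  shows "\<exists>r>0. \<exists>c :: nat \<Rightarrow> nat \<Rightarrow> real. \<forall>x y. \<bar>x - h\<bar> < r \<longrightarrow> \<bar>y - b\<bar> < r \<longrightarrow>
        ((\<lambda>(i, j). c i j * (x - h) ^ i * (y - b) ^ j) has_sum (case (x, y) of (h, \<beta>) \<Rightarrow> m_an M V i0 h \<beta>)) UNIV"
proof -
  obtain F rF BF where F: "0 < rF" "F holomorphic_on ball (of_real h) rF"
    "\<And>x. x \<in> ball (of_real h) rF \<Longrightarrow> norm (F x) \<le> BF"
    "\<And>x. F (of_real x) = of_real (- ln (fug TYPE('d) x))"
    using ln_fug_holomorphic[where 'd = 'd and h = h] by metis
  show "\<exists>r>0. \<exists>c :: nat \<Rightarrow> nat \<Rightarrow> real. \<forall>x y. \<bar>x - h\<bar> < r \<longrightarrow> \<bar>y - b\<bar> < r \<longrightarrow>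
        ((\<lambda>(i, j). c i j * (x - h) ^ i * (y - b) ^ j) has_sum (case (x, y) of (h, \<beta>) \<Rightarrow> m_an M V i0 h \<beta>)) UNIV"
  proof (cases "a b < h")
    case True
    have Ln: "Ln holomorphic_on - \<real>\<^sub>\<le>\<^sub>0" by (rule holomorphic_on_Ln) auto
    have opn: "open (- \<real>\<^sub>\<le>\<^sub>0 :: complex set)" by auto
    have "complex_of_real (exp (- g h b)) \<in> - \<real>\<^sub>\<le>\<^sub>0" by (simp add: complex_nonpos_Reals_iff)
    from holomorphic_bounded_near[OF Ln opn this] obtain \<rho>0 BL where \<rho>0: "0 < \<rho>0" "ball (complex_of_real (exp (- g h b))) \<rho>0 \<subseteq> - \<real>\<^sub>\<le>\<^sub>0"
      "\<And>w. w \<in> ball (of_real (exp (- g h b))) \<rho>0 \<Longrightarrow> norm (Ln w) \<le> BL"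
      by blast
    obtain r \<zeta> where r: "0 < r"
      and \<zeta>: "\<And>x y. x \<in> ball (of_real h) r \<Longrightarrow> y \<in> ball (of_real b) r \<Longrightarrow> \<zeta> x y \<in> ball (of_real (exp (- g h b))) \<rho>0"
      "\<And>y. y \<in> ball (of_real b) r \<Longrightarrow> (\<lambda>x. \<zeta> x y) holomorphic_on ball (of_real h) r"
      "\<And>x. x \<in> ball (of_real h) r \<Longrightarrow> \<zeta> x holomorphic_on ball (of_real b) r"
      "\<And>x y. \<bar>x - h\<bar> < r \<Longrightarrow> \<bar>y - b\<bar> < r \<Longrightarrow> \<zeta> (of_real x) (of_real y) = of_real (exp (- g x y))"
      by (rule ballistic_root[OF b True \<rho>0(1)]) (rule that; assumption)
    define R where "R = min (min r rF) b"
    have R: "0 < R" "R \<le> r" "R \<le> rF" "R \<le> b" using r F(1) b by (auto simp: R_def)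
    have sub: "ball p R \<subseteq> ball p r" "ball p R \<subseteq> ball p rF" for p :: complex
      using R by (simp_all add: subset_ball)
    have inS: "\<zeta> x y \<notin> \<real>\<^sub>\<le>\<^sub>0" if "x \<in> ball (of_real h) R" "y \<in> ball (of_real b) R" for x y
      using \<zeta>(1)[of x y] that sub \<rho>0(2) by blast
    show ?thesis
    proof (rule real_double_power_series[OF R(1), where H = "\<lambda>x y. F x + Ln (\<zeta> x y)" and M = "BF + BL"])
      show "(\<lambda>x. F x + Ln (\<zeta> x y)) holomorphic_on ball (of_real h) R" if "y \<in> ball (of_real b) R" for y
        using that inS sub by (intro holomorphic_on_add holomorphic_on_Ln' holomorphic_on_subset[OF F(2)] holomorphic_on_subset[OF \<zeta>(2)]) blast+
      show "(\<lambda>y. F x + Ln (\<zeta> x y)) holomorphic_on ball (of_real b) R" if "x \<in> ball (of_real h) R" for x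
        using that inS sub by (intro holomorphic_on_add holomorphic_on_const holomorphic_on_Ln' holomorphic_on_subset[OF \<zeta>(3)]) blast+
      show "norm (F x + Ln (\<zeta> x y)) \<le> BF + BL" if "x \<in> ball (of_real h) R" "y \<in> ball (of_real b) R" for x y
        by (intro norm_triangle_mono F(3) \<rho>0(3) \<zeta>(1)) (use that sub in blast)+
      show "Re (F (of_real x) + Ln (\<zeta> (of_real x) (of_real y))) = (case (x, y) of (h, \<beta>) \<Rightarrow> m_an M V i0 h \<beta>)"
        if "\<bar>x - h\<bar> < R" "\<bar>y - b\<bar> < R" for x y
      proof -
        have "Ln (complex_of_real (exp (- g x y))) = of_real (ln (exp (- g x y)))" by (rule Ln_of_real) simp
        moreover have "0 \<le> y" using that R by linarith
        ultimately show ?thesis using that R F(4)[of x] \<zeta>(4)[of x y] by (simp add: m_an_formula)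
      qed
    qed
  next
    case False
    have "((\<lambda>p. a (snd p) - fst p) \<longlongrightarrow> a b - h) (at (h, b))"
    proof -
      have "isCont a b" using a_cont b by (simp add: continuous_on_eq_continuous_at)
      then show ?thesis by (intro tendsto_diff isCont_tendsto_compose[where g = a]) (auto intro!: tendsto_eq_intros)
    qed
    then have "\<forall>\<^sub>F p in at (h, b). 0 < a (snd p) - fst p"
      using False ne by (intro order_tendstoD) auto
    then obtain e where e: "0 < e" "\<And>x y. (x, y) \<noteq> (h, b) \<Longrightarrow> dist (x, y) (h, b) < e \<Longrightarrow> x < a y"
      unfolding eventually_at by auto
    define R where "R = min (min (e / 2) rF) (min h b)"
    have R: "0 < R" "R \<le> e / 2" "R \<le> rF" "R \<le> h" "R \<le> b" using e h b F(1) by (auto simp: R_def)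
    have sub: "ball p R \<subseteq> ball p rF" for p :: complex using R by (simp add: subset_ball)
    show ?thesis
    proof (rule real_double_power_series[OF R(1), where H = "\<lambda>x y. F x" and M = BF])
      show "(\<lambda>x. F x) holomorphic_on ball (of_real h) R" by (rule holomorphic_on_subset[OF F(2) sub])
      show "(\<lambda>y. F x) holomorphic_on ball (of_real b) R" for x by (rule holomorphic_on_const)
      show "norm (F x) \<le> BF" if "x \<in> ball (of_real h) R" for x
        using that sub by (intro F(3)) blast
      show "Re (F (of_real x)) = (case (x, y) of (h, \<beta>) \<Rightarrow> m_an M V i0 h \<beta>)"
        if xy: "\<bar>x - h\<bar> < R" "\<bar>y - b\<bar> < R" for x y
      proof -
        have "x < a y"
        proof (cases "(x, y) = (h, b)")
          case F: False
          have "dist (x, y) (h, b) \<le> dist x h + dist y b"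
            unfolding dist_prod_def by (rule order_trans[OF sqrt_sum_squares_le_sum]) auto
          also have "\<dots> < e" using xy R by (simp add: dist_real_def)
          finally show ?thesis by (rule e(2)[OF F])
        qed (use False ne in auto)
        moreover have "0 \<le> x" "0 \<le> y" using xy R by linarith+
        ultimately show ?thesis using F(4)[of x] by (simp add: m_an_formula g_eq_0)
      qed
    qed
  qed
qed

lemma m_an_analytic:
  "real_analytic2_on (\<lambda>(h, \<beta>). m_an M V i0 h \<beta>) {(h, \<beta>). h > 0 \<and> \<beta> > 0 \<and> a \<beta> \<noteq> h}"
  unfolding real_analytic2_on_def
proof (rule ballI)
  fix p assume "p \<in> {(h, \<beta>). h > 0 \<and> \<beta> > 0 \<and> a \<beta> \<noteq> h}"
  then obtain h b where p: "p = (h, b)" and hb: "0 < h" "0 < b" "a b \<noteq> h" by auto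
  show "case p of (h, b) \<Rightarrow> \<exists>r>0. \<exists>c :: nat \<Rightarrow> nat \<Rightarrow> real. \<forall>x y. \<bar>x - h\<bar> < r \<longrightarrow> \<bar>y - b\<bar> < r \<longrightarrow>
        ((\<lambda>(i, j). c i j * (x - h) ^ i * (y - b) ^ j) has_sum (case (x, y) of (h, \<beta>) \<Rightarrow> m_an M V i0 h \<beta>)) UNIV"
    unfolding p prod.case[of _ h b] by (rule m_an_analytic_at[OF hb])
qed

end

section \<open>The annealed partition function\<close>

context drifted_potential
begin

lemma Z_an_formula: "0 \<le> \<beta> \<Longrightarrow> Z_an M V i0 h \<beta> N = fug TYPE('d) h ^ N * zhat i0 (W \<beta>) N h"
  by (rule Z_an_eq[OF attractive_site_weight])

lemma exp_m_an:
  assumes "0 \<le> \<beta>"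
  shows "exp (- m_an M V i0 h \<beta> * real N) = fug TYPE('d) h ^ N * exp (g h \<beta> * real N)"
proof -
  have "exp (- m_an M V i0 h \<beta> * real N) = exp (real N * ln (fug TYPE('d) h)) * exp (g h \<beta> * real N)"
    unfolding m_an_formula[OF assms] by (simp add: exp_add[symmetric] algebra_simps)
  also have "exp (real N * ln (fug TYPE('d) h)) = fug TYPE('d) h ^ N"
    using fug_pos[where 'd = 'd, of h] by (simp add: exp_of_nat_mult)
  finally show ?thesis .
qed

lemma Z_an_upper:
  assumes "0 \<le> \<beta>" "1 \<le> N"
  shows "Z_an M V i0 h \<beta> N \<le> exp (- m_an M V i0 h \<beta> * real N)"
proof -
  interpret weighted_walk "W \<beta>" i0 1 by (rule weighted_walkI[OF attractive_site_weight]) (use assms in auto)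
  show ?thesis
    unfolding exp_m_an[OF assms(1)] Z_an_formula[OF assms(1)]
    using fug_pos[where 'd = 'd, of h] by (intro mult_left_mono zhat_le_zrate assms) simp
qed

lemma Z_an_lower:
  assumes "0 < h" "0 \<le> \<beta>0" "ereal \<beta>0 < beta_crit M V i0 h"
  shows "\<exists>K>0. \<forall>\<beta>\<in>{0..\<beta>0}. \<forall>N\<ge>1. exp (- m_an M V i0 h \<beta> * real N) / K \<le> Z_an M V i0 h \<beta> N"
proof -
  obtain \<kappa> where \<kappa>: "0 < \<kappa>"
    "\<And>\<beta> N. 0 \<le> \<beta> \<Longrightarrow> \<beta> \<le> \<beta>0 \<Longrightarrow> \<kappa> * exp (g h \<beta> * real N) \<le> zhat i0 (W \<beta>) N h"
    by (rule zhat_lower_bound[OF assms(2) beta_crit_less[OF assms]]) (rule that; assumption)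
  have "exp (- m_an M V i0 h \<beta> * real N) / (1 / \<kappa>) \<le> Z_an M V i0 h \<beta> N" if "\<beta> \<in> {0..\<beta>0}" for \<beta> N
  proof -
    have \<beta>: "0 \<le> \<beta>" "\<beta> \<le> \<beta>0" using that by auto
    have "fug TYPE('d) h ^ N * (\<kappa> * exp (g h \<beta> * real N)) \<le> fug TYPE('d) h ^ N * zhat i0 (W \<beta>) N h"
      using fug_pos[where 'd = 'd, of h] by (intro mult_left_mono \<kappa>(2) \<beta>) simp
    then show ?thesis unfolding exp_m_an[OF \<beta>(1)] Z_an_formula[OF \<beta>(1)] by (simp add: mult_ac)
  qed
  then show ?thesis using \<kappa>(1) by (intro exI[of _ "1 / \<kappa>"]) simp
qed

lemma m_an_continuous: "continuous_on ({0..} \<times> {0..}) (\<lambda>(h, \<beta>). m_an M V i0 h \<beta>)"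
proof -
  have fug: "continuous_on S (\<lambda>p. fug TYPE('d) (fst p))" for S :: "(real \<times> real) set"
  proof -
    have "cosh x + real CARD('d) - 1 \<noteq> 0" for x :: real
      using cosh_real_pos[of x] zero_less_card_finite[where 'a = 'd] by linarith
    then show ?thesis unfolding fug_def by (intro continuous_intros) auto
  qed
  have "continuous_on ({0..} \<times> {0..}) (\<lambda>p. - ln (fug TYPE('d) (fst p)) - (case p of (h, \<beta>) \<Rightarrow> g h \<beta>))"
    by (intro continuous_on_diff continuous_on_minus continuous_on_ln fug continuous_on_subset[OF g_cont])
      (use fug_pos[where 'd = 'd] in \<open>auto simp: less_imp_neq[symmetric]\<close>)
  then show ?thesis
    by (rule continuous_on_eq) (auto simp: m_an_formula)
qed

end

theorem theoremB:
  fixes M :: "'w measure"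
    and V :: "int ^ 'd::finite \<Rightarrow> 'w \<Rightarrow> real"
    and i0 :: 'd
  assumes "prob_space M"
    and "prob_space.indep_vars M (\<lambda>_. borel) V UNIV"
    and "\<And>x. distr M borel (V x) = distr M borel (V 0)"
    and "\<And>x. essinf M (V x) = 0"
    and "\<And>x. integrable M (\<lambda>\<omega>. V x \<omega> ^ CARD('d))"
    and "\<And>x. measure M {\<omega> \<in> space M. V x \<omega> = 0} < 1"
  shows "(\<forall>h\<ge>0. \<forall>\<beta>\<ge>0. \<forall>N\<ge>1. Z_an M V i0 h \<beta> N \<le> exp (- m_an M V i0 h \<beta> * real N))
    \<and> continuous_on ({0..} \<times> {0..}) (\<lambda>(h, \<beta>). m_an M V i0 h \<beta>)
    \<and> (\<forall>h>0. \<forall>\<beta>\<^sub>0\<ge>0. ereal \<beta>\<^sub>0 < beta_crit M V i0 h \<longrightarrow>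
         (\<exists>K>0. \<forall>\<beta>\<in>{0..\<beta>\<^sub>0}. \<forall>N\<ge>1.
            Z_an M V i0 h \<beta> N \<ge> exp (- m_an M V i0 h \<beta> * real N) / K))
    \<and> open {(h, \<beta>). h > 0 \<and> \<beta> > 0 \<and> ereal \<beta> \<noteq> beta_crit M V i0 h}
    \<and> real_analytic2_on (\<lambda>(h, \<beta>). m_an M V i0 h \<beta>)
         {(h, \<beta>). h > 0 \<and> \<beta> > 0 \<and> ereal \<beta> \<noteq> beta_crit M V i0 h}"
proof -
  interpret prob_space M by (rule assms(1))
  have "V 0 \<in> borel_measurable M"
    using assms(2) by (auto simp: indep_vars_def)
  then interpret potential_law M V
    by (intro potential_lawI assms)
  interpret drifted_potential M V i0
    by unfold_locales
  show ?thesis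
    unfolding regime_set using Z_an_upper Z_an_lower m_an_continuous open_regimes m_an_analytic by blast
qed

end
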